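(* Let $s\ge0$ be an integer. Suppose $(\omega,\bar\epsilon)\in\mathcal P$ and $\mathcal E\in C^{s+2}(S_v)$. Let $(E_\ell)_{\ell\ge0}$ (with $E_{-1}:=0$) be the solutions of $$\mathrm{curl}\,\mathrm{curl}\,E_\ell-\bar\epsilon k_0^2E_\ell=\bar\epsilon k_0^2\,\mathcal E\,E_{\ell-1}\ \text{ in } S_v,\qquad -\partial_zE_\ell-T_u[E_\ell]=\delta_{\ell,0}\,\phi\ \text{ at }\Gamma_h,$$ $$\partial_zE_\ell-T_w[E_\ell]=0\ \text{ at }\Gamma_{-h},\qquad E_\ell(x+d_x,y+d_y,z)=e^{i\alpha d_x+i\beta d_y}E_\ell(x,y,z),$$ where $\delta_{\ell,0}$ is the Kronecker delta. Then the series $\sum_{\ell=0}^\infty E_\ell(x,y,z)\,\delta^\ell$ converges strongly (for $\delta$ sufficiently small). More precisely, $$\|E_\ell\|_{H^{s+2}}\le K B^\ell\qquad\text{for all }\ell\ge0,$$ for some constants $K,B>0$ independent of $\ell$.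
   Context: Parameters: $d_x,d_y,h>0$; frequency $\omega$; vacuum permittivity and permeability $\epsilon_0,\mu_0>0$; $k_0^2=\omega^2\epsilon_0\mu_0$; constants $\epsilon^{(u)},\epsilon^{(w)},\bar\epsilon\in\mathbf R^+$; incidence angles $(\theta_0,\phi_0)$, $(k^{(u)})^2=\epsilon^{(u)}k_0^2$, and $\kappa=(\alpha,\beta,-\gamma^{(u)})^T=k^{(u)}(\sin\theta_0\cos\phi_0,\ \sin\theta_0\sin\phi_0,\ -\cos\theta_0)^T$. $A$ is a constant vector with $A\cdot\kappa=0$, $|A|=|B_0|=1$, where $B_0=\frac1{\omega\mu_0}\kappa\times A$. The incident data is $$\phi(x,y)=\left(2i\gamma^{(u)}e^{-i\gamma^{(u)}h}\right)A\,e^{i\alpha x+i\beta y}.$$ Domains: $\Gamma=(0,d_x)\times(0,d_y)$, $S_v=\Gamma\times(-h,h)$, $\Gamma_{\pm h}=\Gamma\times\{z=\pm h\}$. For $p,q\in\mathbf Z$: $\alpha_p=\alpha+(2\pi/d_x)p$, $\beta_q=\beta+(2\pi/d_y)q$, and for $m\in\{u,w\}$, $\gamma^{(m)}_{p,q}=\sqrt{\epsilon^{(m)}k_0^2-\alpha_p^2-\beta_q^2}$ if $\alpha_p^2+\beta_q^2\le\epsilon^{(m)}k_0^2$, and $\gamma^{(m)}_{p,q}=i\sqrt{\alpha_p^2+\beta_q^2-\epsilon^{(m)}k_0^2}$ otherwise. All fields are $\mathbf C^3$-valued and laterally quasiperiodic, i.e. they have Fourier expansions $v(x,y,z)=\sum_{p,q\in\mathbf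 Z}\hat v_{p,q}(z)e^{i\alpha_px+i\beta_qy}$ (and $\psi(x,y)=\sum_{p,q}\hat\psi_{p,q}e^{i\alpha_px+i\beta_qy}$ on $\Gamma$). $T_u[\psi]=\sum_{p,q}(-i\gamma^{(u)}_{p,q})\hat\psi_{p,q}e^{i\alpha_px+i\beta_qy}$, $T_w[\psi]=\sum_{p,q}(-i\gamma^{(w)}_{p,q})\hat\psi_{p,q}e^{i\alpha_px+i\beta_qy}$ (applied to traces at $z=h$, $z=-h$), and $\mathcal L_0=\mathrm{curl}\,\mathrm{curl}-k_0^2\bar\epsilon$. The envelope $\mathcal E=\mathcal E(x,y,z)$ is a scalar function, biperiodic in $(x,y)$ with periods $d_x,d_y$; it describes the permittivity $\bar\epsilon(1-\delta\mathcal E(x,y,z))$ of the layer $|z|<h$, with perturbation parameter $\delta$. $C^{s}(S_v)$ is the space of $s$ times continuously differentiable functions with norm $|\cdot|_{C^s}$ equal to the maximum of the sup norms of all partial derivatives of order at most $s$. Norm on $S_v$: with $\langle(p,q)\rangle^2=1+|p|^2+|q|^2$, for integer $s\ge0$, $\|u\|_{H^s}^2=\sum_{j=0}^s\sum_{p,q}\langle(p,q)\rangle^{2(s-j)}\int_{-h}^h|\partial_z^j\hat u_{p,q}(z)|^2dz$. $\mathcal P$ is the set of pairs $(\omega,\bar\epsilon)$ for which $V\equiv0$ is the unique solution of: $\mathcal L_0V=0$ in $S_v$, $-\partial_zV-T_u[V]=0$ at $\Gamma_h$, $\partial_zV-T_w[V]=0$ at $\Gamma_{-h}$, $V(x+d_x,y+d_y,z)=e^{i\alpha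 d_x+i\beta d_y}V(x,y,z)$. *)

theory Defs
  imports "HOL-Analysis.Analysis"
begin

section \<open>Continuously differentiable functions and test functions\<close>

type_synonym space = "real \<times> real \<times> real"

text \<open>\<open>partials [d1, ..., dk] f\<close> is the iterated directional derivative \<open>D_d1 ... D_dk f\<close>;
  it is used only along directions in \<^const>\<open>Basis\<close>.\<close>

primrec partials ::
  "'a::euclidean_space list \<Rightarrow> ('a \<Rightarrow> 'b::real_normed_vector) \<Rightarrow> 'a \<Rightarrow> 'b" where
  "partials [] f = f"
| "partials (d # ds) f = (\<lambda>x. frechet_derivative (partials ds f) (at x) d)"

definition C_k :: "'a::euclidean_space set \<Rightarrow> nat \<Rightarrow> ('a \<Rightarrow> 'b::real_normed_vector) \<Rightarrow> bool" where
  "C_k U k f \<longleftrightarrow> (\<forall>ds. set ds \<subseteq> Basis \<and> length ds \<le> k \<longrightarrow>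
     continuous_on U (partials ds f) \<and>
     (length ds < k \<longrightarrow> (\<forall>x\<in>U. partials ds f differentiable at x)))"

text \<open>The functions for which the \<open>C^k\<close> norm (maximum of the sup norms of the partial
  derivatives of order at most \<open>k\<close>) is defined and finite.\<close>

definition C_k_bounded ::
  "'a::euclidean_space set \<Rightarrow> nat \<Rightarrow> ('a \<Rightarrow> 'b::real_normed_vector) \<Rightarrow> bool" where
  "C_k_bounded U k f \<longleftrightarrow> C_k U k f \<and>
     (\<forall>ds. set ds \<subseteq> Basis \<and> length ds \<le> k \<longrightarrow> bounded (partials ds f ` U))"

definition test_function :: "'a::euclidean_space set \<Rightarrow> ('a \<Rightarrow> 'b::real_normed_vector) \<Rightarrow> bool" where
  "test_function U \<psi> \<longleftrightarrow> (\<forall>k. C_k UNIV k \<psi>) \<and>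
     (\<exists>K. compact K \<and> K \<subseteq> U \<and> (\<forall>x. x \<notin> K \<longrightarrow> \<psi> x = 0))"


section \<open>Weak curl\<close>

definition ccross :: "complex^3 \<Rightarrow> complex^3 \<Rightarrow> complex^3" where
  "ccross a b = vector [a$2 * b$3 - a$3 * b$2, a$3 * b$1 - a$1 * b$3, a$1 * b$2 - a$2 * b$1]"

text \<open>The bilinear (unconjugated) product on \<open>C^3\<close>.\<close>

definition cdot :: "complex^3 \<Rightarrow> complex^3 \<Rightarrow> complex" where
  "cdot a b = (\<Sum>i\<in>UNIV. a$i * b$i)"

definition curl :: "(space \<Rightarrow> complex^3) \<Rightarrow> space \<Rightarrow> complex^3" where
  "curl \<Psi> x = (let Dx = frechet_derivative \<Psi> (at x) (1, 0, 0);
                   Dy = frechet_derivative \<Psi> (at x) (0, 1, 0);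
                   Dz = frechet_derivative \<Psi> (at x) (0, 0, 1)
               in vector [Dy$3 - Dz$2, Dz$1 - Dx$3, Dx$2 - Dy$1])"

definition weak_curl :: "space set \<Rightarrow> (space \<Rightarrow> complex^3) \<Rightarrow> (space \<Rightarrow> complex^3) \<Rightarrow> bool" where
  "weak_curl U V W \<longleftrightarrow> set_integrable lborel U V \<and> set_integrable lborel U W \<and>
     (\<forall>\<Psi>. test_function U \<Psi> \<longrightarrow>
        set_lebesgue_integral lborel U (\<lambda>x. cdot (W x) (\<Psi> x)) =
        set_lebesgue_integral lborel U (\<lambda>x. cdot (V x) (curl \<Psi> x)))"


section \<open>Parameters of the problem\<close>

record grating =
  per_x :: real      (* d_x *)
  per_y :: real      (* d_y *)
  hgt :: real        (* h *)
  freq :: real       (* omega *)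
  eps0 :: real
  mu0 :: real
  eps_u :: real
  eps_w :: real
  eps_bar :: real
  theta0 :: real
  phi0 :: real

definition k0 :: "grating \<Rightarrow> real" where
  "k0 D = freq D * sqrt (eps0 D * mu0 D)"

definition k_u :: "grating \<Rightarrow> real" where
  "k_u D = sqrt (eps_u D) * k0 D"

definition alpha :: "grating \<Rightarrow> real" where
  "alpha D = k_u D * (sin (theta0 D) * cos (phi0 D))"

definition beta :: "grating \<Rightarrow> real" where
  "beta D = k_u D * (sin (theta0 D) * sin (phi0 D))"

definition gamma_u :: "grating \<Rightarrow> real" where
  "gamma_u D = k_u D * cos (theta0 D)"

definition kappa :: "grating \<Rightarrow> complex^3" where
  "kappa D = vector [of_real (alpha D), of_real (beta D), - of_real (gamma_u D)]"

definition B0 :: "grating \<Rightarrow> complex^3 \<Rightarrow> complex^3" where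
  "B0 D A = of_real (1 / (freq D * mu0 D)) *s ccross (kappa D) A"

definition phi_inc :: "grating \<Rightarrow> complex^3 \<Rightarrow> real \<times> real \<Rightarrow> complex^3" where
  "phi_inc D A = (\<lambda>(x, y).
     (2 * \<i> * of_real (gamma_u D) * exp (- \<i> * of_real (gamma_u D * hgt D)) *
      exp (\<i> * of_real (alpha D * x + beta D * y))) *s A)"

definition alpha_p :: "grating \<Rightarrow> int \<Rightarrow> real" where
  "alpha_p D p = alpha D + 2 * pi / per_x D * of_int p"

definition beta_q :: "grating \<Rightarrow> int \<Rightarrow> real" where
  "beta_q D q = beta D + 2 * pi / per_y D * of_int q"

definition gamma_pq :: "grating \<Rightarrow> real \<Rightarrow> int \<Rightarrow> int \<Rightarrow> complex" where
  "gamma_pq D e p q =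
     (if (alpha_p D p)\<^sup>2 + (beta_q D q)\<^sup>2 \<le> e * (k0 D)\<^sup>2
      then of_real (sqrt (e * (k0 D)\<^sup>2 - (alpha_p D p)\<^sup>2 - (beta_q D q)\<^sup>2))
      else \<i> * of_real (sqrt ((alpha_p D p)\<^sup>2 + (beta_q D q)\<^sup>2 - e * (k0 D)\<^sup>2)))"

definition Gam :: "grating \<Rightarrow> (real \<times> real) set" where
  "Gam D = {0<..<per_x D} \<times> {0<..<per_y D}"

definition S_v :: "grating \<Rightarrow> space set" where
  "S_v D = {0<..<per_x D} \<times> {0<..<per_y D} \<times> {- hgt D<..<hgt D}"

text \<open>Quasiperiodic and biperiodic fields are functions on the full slab, of which \<^const>\<open>S_v\<close>
  is one period cell; their values outside the slab are irrelevant.\<close>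

definition slab :: "grating \<Rightarrow> space set" where
  "slab D = UNIV \<times> UNIV \<times> {- hgt D<..<hgt D}"

definition biperiodic :: "grating \<Rightarrow> (space \<Rightarrow> complex) \<Rightarrow> bool" where
  "biperiodic D f \<longleftrightarrow> (\<forall>x y z. \<bar>z\<bar> < hgt D \<longrightarrow>
     f (x + per_x D, y, z) = f (x, y, z) \<and> f (x, y + per_y D, z) = f (x, y, z))"

text \<open>Quasiperiodicity in each lateral variable is what a Fourier expansion in
  \<open>exp (i alpha_p x + i beta_q y)\<close> amounts to. It implies the joint condition
  \<open>u (x + d_x, y + d_y, z) = exp (i alpha d_x + i beta d_y) u (x, y, z)\<close>.\<close>

definition quasiperiodic :: "grating \<Rightarrow> (space \<Rightarrow> complex^3) \<Rightarrow> bool" where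
  "quasiperiodic D u \<longleftrightarrow> (\<forall>x y z. \<bar>z\<bar> < hgt D \<longrightarrow>
     u (x + per_x D, y, z) = exp (\<i> * of_real (alpha D * per_x D)) *s u (x, y, z) \<and>
     u (x, y + per_y D, z) = exp (\<i> * of_real (beta D * per_y D)) *s u (x, y, z))"


section \<open>Fourier coefficients and Sobolev norms\<close>

definition fcoeff :: "grating \<Rightarrow> (real \<times> real \<Rightarrow> complex^3) \<Rightarrow> int \<Rightarrow> int \<Rightarrow> complex^3" where
  "fcoeff D \<psi> p q = (1 / (per_x D * per_y D)) *\<^sub>R
     set_lebesgue_integral lborel (Gam D)
       (\<lambda>(x, y). exp (- \<i> * of_real (alpha_p D p * x + beta_q D q * y)) *s \<psi> (x, y))"

definition hat :: "grating \<Rightarrow> (space \<Rightarrow> complex^3) \<Rightarrow> int \<Rightarrow> int \<Rightarrow> real \<Rightarrow> complex^3" where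
  "hat D u p q z = fcoeff D (\<lambda>(x, y). u (x, y, z)) p q"

text \<open>\<open>g\<close> is the weak derivative of \<open>f\<close> of order \<open>j\<close> on the interval \<open>(-h, h)\<close>.\<close>

definition has_wderiv :: "real \<Rightarrow> nat \<Rightarrow> (real \<Rightarrow> complex^3) \<Rightarrow> (real \<Rightarrow> complex^3) \<Rightarrow> bool" where
  "has_wderiv h j f g \<longleftrightarrow>
     set_integrable lborel {-h<..<h} f \<and> set_integrable lborel {-h<..<h} g \<and>
     (\<forall>\<psi> :: real \<Rightarrow> real. test_function {-h<..<h} \<psi> \<longrightarrow>
        set_lebesgue_integral lborel {-h<..<h} (\<lambda>z. (deriv ^^ j) \<psi> z *\<^sub>R f z) =
        (-1) ^ j *\<^sub>R set_lebesgue_integral lborel {-h<..<h} (\<lambda>z. \<psi> z *\<^sub>R g z))"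

text \<open>Determined up to a null set whenever a weak derivative exists.\<close>

definition wderiv :: "real \<Rightarrow> nat \<Rightarrow> (real \<Rightarrow> complex^3) \<Rightarrow> real \<Rightarrow> complex^3" where
  "wderiv h j f = (SOME g. has_wderiv h j f g)"

text \<open>Value at \<open>a\<close> in \<open>[-h, h]\<close> of the continuous representative of \<open>f\<close>. It exists when \<open>f\<close> has an
  integrable first weak derivative on \<open>(-h, h)\<close>.\<close>

definition trace_at :: "real \<Rightarrow> (real \<Rightarrow> complex^3) \<Rightarrow> real \<Rightarrow> complex^3" where
  "trace_at h f a = (THE c. \<exists>F. continuous_on {-h..h} F \<and>
     (AE z in lborel. z \<in> {-h<..<h} \<longrightarrow> F z = f z) \<and> F a = c)"

definition Hnorm_sq :: "grating \<Rightarrow> nat \<Rightarrow> (space \<Rightarrow> complex^3) \<Rightarrow> ennreal" where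
  "Hnorm_sq D s u = (\<Sum>j\<le>s. \<Sum>\<^sub>\<infinity>(p, q)\<in>UNIV.
     ennreal ((1 + (of_int p)\<^sup>2 + (of_int q)\<^sup>2) ^ (s - j)) *
     set_nn_integral lborel {- hgt D<..<hgt D}
       (\<lambda>z. ennreal ((norm (wderiv (hgt D) j (hat D u p q) z))\<^sup>2)))"

definition Hnorm :: "grating \<Rightarrow> nat \<Rightarrow> (space \<Rightarrow> complex^3) \<Rightarrow> real" where
  "Hnorm D s u = sqrt (enn2real (Hnorm_sq D s u))"

text \<open>The laterally quasiperiodic Sobolev space; elements are functions rather than classes
  modulo null sets.\<close>

definition Hspace :: "grating \<Rightarrow> nat \<Rightarrow> (space \<Rightarrow> complex^3) set" where
  "Hspace D s = {u. quasiperiodic D u \<and>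
     set_borel_measurable lborel (slab D) u \<and>
     set_integrable lborel (S_v D) (\<lambda>x. (norm (u x))\<^sup>2) \<and>
     (\<forall>p q. \<forall>j\<le>s. \<exists>g. has_wderiv (hgt D) j (hat D u p q) g) \<and>
     Hnorm_sq D s u < \<infinity>}"


section \<open>The boundary value problem\<close>

text \<open>\<open>L0_eq D V F\<close>: the equation \<open>L_0 V = curl curl V - k_0^2 eps_bar V = F\<close> in \<^const>\<open>S_v\<close>.\<close>

definition L0_eq :: "grating \<Rightarrow> (space \<Rightarrow> complex^3) \<Rightarrow> (space \<Rightarrow> complex^3) \<Rightarrow> bool" where
  "L0_eq D V F \<longleftrightarrow> (\<exists>W. weak_curl (S_v D) V W \<and>
     weak_curl (S_v D) W (\<lambda>x. F x + of_real ((k0 D)\<^sup>2 * eps_bar D) *s V x))"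

text \<open>Quasiperiodic functions on \<open>Gamma\<close> are identified with their Fourier coefficients;
  \<open>T_u\<close> and \<open>T_w\<close> are Fourier multipliers.\<close>

definition T_u :: "grating \<Rightarrow> (int \<Rightarrow> int \<Rightarrow> complex^3) \<Rightarrow> int \<Rightarrow> int \<Rightarrow> complex^3" where
  "T_u D \<psi> p q = (- \<i> * gamma_pq D (eps_u D) p q) *s \<psi> p q"

definition T_w :: "grating \<Rightarrow> (int \<Rightarrow> int \<Rightarrow> complex^3) \<Rightarrow> int \<Rightarrow> int \<Rightarrow> complex^3" where
  "T_w D \<psi> p q = (- \<i> * gamma_pq D (eps_w D) p q) *s \<psi> p q"

text \<open>Fourier coefficients of the traces of \<open>V\<close> and of its \<open>z\<close>-derivative at height \<open>a\<close>.\<close>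

definition tr :: "grating \<Rightarrow> (space \<Rightarrow> complex^3) \<Rightarrow> real \<Rightarrow> int \<Rightarrow> int \<Rightarrow> complex^3" where
  "tr D V a p q = trace_at (hgt D) (hat D V p q) a"

definition tr_dz :: "grating \<Rightarrow> (space \<Rightarrow> complex^3) \<Rightarrow> real \<Rightarrow> int \<Rightarrow> int \<Rightarrow> complex^3" where
  "tr_dz D V a p q = trace_at (hgt D) (wderiv (hgt D) 1 (hat D V p q)) a"

definition solves ::
  "grating \<Rightarrow> (space \<Rightarrow> complex^3) \<Rightarrow> (real \<times> real \<Rightarrow> complex^3) \<Rightarrow> (space \<Rightarrow> complex^3) \<Rightarrow> bool" where
  "solves D F Q V \<longleftrightarrow> V \<in> Hspace D 2 \<and> L0_eq D V F \<and>
     (\<forall>p q. - tr_dz D V (hgt D) p q - T_u D (tr D V (hgt D)) p q = fcoeff D Q p q) \<and>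
     (\<forall>p q. tr_dz D V (- hgt D) p q - T_w D (tr D V (- hgt D)) p q = 0)"

text \<open>The pairs (frequency, \<open>eps_bar\<close>) of unique solvability, for given values of the remaining
  parameters of \<open>D\<close>. The wave numbers, \<open>alpha\<close> and \<open>beta\<close> vary with the frequency.\<close>

definition P_set :: "grating \<Rightarrow> (real \<times> real) set" where
  "P_set D = {(w, e). let D' = D\<lparr>freq := w, eps_bar := e\<rparr> in
     \<forall>V. solves D' (\<lambda>_. 0) (\<lambda>_. 0) V \<longrightarrow> (AE x in lborel. x \<in> S_v D' \<longrightarrow> V x = 0)}"

end

theory Submission
  imports Defs
begin

text \<open>The lateral Fourier coefficients of a solution satisfy ordinary differential equations in \<open>z\<close>.
 Taking the divergence decouples the three components into scalar problems \<open>w'' = \<nu> w - g\<close> with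
 impedance conditions at both ends, where \<open>g = f + grad div f / (k0^2 eps_bar)\<close>: two derivatives of the
 right-hand side are lost and two are regained. For all but finitely many modes \<open>\<nu> > 0\<close> and both
 impedances are evanescent, and an energy estimate bounds \<open>\<nu> w\<close> by \<open>g\<close>. In the remaining modes
 membership in \<^const>\<open>P_set\<close> excludes homogeneous solutions, which gives a Green's function bound.
 Multiplication by the envelope is a convolution of Fourier coefficients; the weights \<open>p\<close>, \<open>q\<close>
 obey a Leibniz rule with it, so it is bounded on \<open>H^(s+2)\<close>. Hence the norms of the \<open>E l\<close> grow at most
 geometrically, and the power series converges absolutely for small \<open>\<delta>\<close>.\<close>

section \<open>Calculus of continuously differentiable functions\<close>

text \<open>Source and solution must be measured in the same space, or each step of the recursion
  would lose regularity. With \<open>E (l - 1)\<close> in \<open>H^(s+2)\<close> the source stays in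
  \<open>H^(s+2)\<close>, because the envelope is \<open>C^(s+2)\<close>; the loss and the gain of
  two derivatives balance, and one constant serves all \<open>l\<close>. The solutions are given, so
  a priori bounds suffice. They are proved coefficient by coefficient: a trace condition becomes a
  relation between numbers, and a constant independent of the mode sums to a Sobolev bound.
  \<open>E 0\<close> stands apart, since its datum lives in mode (0, 0); there only finiteness is at
  stake. \<open>P_set\<close> concerns the vector problem while the estimates need scalar
  uniqueness; the gap is closed by lifting a scalar solution to a divergence-free field with
  constant polarisation. Squared norms in \<open>ennreal\<close> are used throughout, so adding two
  terms costs a factor 2, whence constants such as 5 and 20. For
  \<open>norm \<delta> < 1 / (2 * B)\<close> the squared norms of the terms decay like
  \<open>4^(-l)\<close>, which beats the weights \<open>2^l\<close> of a Cauchy-Schwarz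
  summation.\<close>

lemma partials_append: "partials (ds @ [d]) f = partials ds (partials [d] f)"
 by (induction ds) auto

lemma partials_1: "partials [d] f = (%x. frechet_derivative f (at x) d)"
 by simp

lemma C_k_0: "C_k U 0 f \<longleftrightarrow> continuous_on U f"
 by (simp add: C_k_def)

lemma all_lists_Suc: "(\<forall>ds. set ds \<subseteq> B \<and> length ds <= Suc k --> P ds) \<longleftrightarrow>
  P [] \<and> (\<forall>d\<in>B. \<forall>ds. set ds \<subseteq> B \<and> length ds <= k --> P (ds @ [d]))"
proof (intro iffI allI impI conjI)
 fix ds assume "P [] \<and> (\<forall>d\<in>B. \<forall>ds. set ds \<subseteq> B \<and> length ds <= k --> P (ds @ [d]))"
  and "set ds \<subseteq> B \<and> length ds <= Suc k"
 then show "P ds" by (cases ds rule: rev_cases) auto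
qed auto

text \<open>\<open>partials\<close> applies the head of the list last, so the recursion peels the
  end of the list instead: a partial derivative of \<open>f\<close> takes the place of
  \<open>f\<close>, and inductions on \<open>k\<close> generalise over the function.\<close>

lemma C_k_Suc: "C_k U (Suc k) f \<longleftrightarrow>
  continuous_on U f \<and> (\<forall>x\<in>U. f differentiable at x) \<and> (\<forall>d\<in>Basis. C_k U k (partials [d] f))"
 unfolding C_k_def all_lists_Suc partials_append by auto

lemma C_k_bounded_0: "C_k_bounded U 0 f \<longleftrightarrow> continuous_on U f \<and> bounded (f ` U)"
 by (simp add: C_k_bounded_def C_k_0)

lemma C_k_bounded_Suc: "C_k_bounded U (Suc k) f \<longleftrightarrow>
  continuous_on U f \<and> bounded (f ` U) \<and> (\<forall>x\<in>U. f differentiable at x) \<and>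
  (\<forall>d\<in>Basis. C_k_bounded U k (partials [d] f))"
 unfolding C_k_bounded_def C_k_Suc all_lists_Suc partials_append by auto

lemma C_k_mono: "C_k U k f ==> j <= k ==> C_k U j f"
 unfolding C_k_def by (meson le_trans less_le_trans)

lemma C_k_bounded_mono: "C_k_bounded U k f ==> j <= k ==> C_k_bounded U j f"
 unfolding C_k_bounded_def by (meson C_k_mono le_trans)

text \<open>With the derivative given explicitly, the product and chain rules can be inserted as
  they stand, without computing \<open>frechet_derivative\<close>.\<close>

lemma C_k_SucI:
 assumes "!!x. (f has_derivative f' x) (at x)"
  and "!!d. d \<in> Basis ==> C_k UNIV k (%x. f' x d)"
 shows "C_k UNIV (Suc k) f"
proof -
 have "partials [d] f = (%x. f' x d)" for d
  using frechet_derivative_at[OF assms(1)] by (simp add: fun_eq_iff)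
 moreover have "f differentiable at x" for x
  using assms(1) by (auto simp: differentiable_def)
 ultimately show ?thesis
  using assms(2) unfolding C_k_Suc
  by (auto intro: continuous_at_imp_continuous_on differentiable_imp_continuous_within)
qed

lemma C_k_SucD:
 assumes "C_k UNIV (Suc k) f"
 shows "(f has_derivative frechet_derivative f (at x)) (at x)"
  and "d \<in> Basis ==> C_k UNIV k (%x. frechet_derivative f (at x) d)"
  and "C_k UNIV k f"
 using assms C_k_mono[OF assms, of k] unfolding C_k_Suc by (auto simp: frechet_derivative_works)

lemma C_k_const: "C_k UNIV k (%x. c)"
proof (induction k arbitrary: c)
 case (Suc k)
 show ?case by (rule C_k_SucI[where f' = "%x d. 0"]) (auto intro: Suc)
qed (simp add: C_k_0)

lemma C_k_add: "C_k UNIV k f ==> C_k UNIV k g ==> C_k UNIV k (%x. f x + g x)"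
proof (induction k arbitrary: f g)
 case (Suc k)
 note D = C_k_SucD[OF Suc.prems(1)] C_k_SucD[OF Suc.prems(2)]
 show ?case by (rule C_k_SucI[OF has_derivative_add[OF D(1,4)]]) (intro Suc.IH D)
qed (simp add: C_k_0 continuous_on_add)

lemma C_k_bilinear:
 fixes prod :: "'b::real_normed_vector => 'c::real_normed_vector => 'd::real_normed_vector"
 assumes "bounded_bilinear prod"
 shows "C_k UNIV k f ==> C_k UNIV k g ==> C_k UNIV k (%x. prod (f x) (g x))"
proof (induction k arbitrary: f g)
 case 0
 then show ?case by (simp add: C_k_0 bounded_bilinear.continuous_on[OF assms])
next
 case (Suc k)
 note D = C_k_SucD[OF Suc.prems(1)] C_k_SucD[OF Suc.prems(2)]
 show ?case
  by (rule C_k_SucI[OF bounded_bilinear.FDERIV[OF assms D(1,4)]]) (intro C_k_add Suc.IH D)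
qed

lemmas C_k_mult = C_k_bilinear[OF bounded_bilinear_mult]

lemma C_k_linear:
 assumes "bounded_linear L"
 shows "C_k UNIV k f ==> C_k UNIV k (%x. L (f x))"
proof (induction k arbitrary: f)
 case 0
 then show ?case by (simp add: C_k_0 bounded_linear.continuous_on[OF assms])
next
 case (Suc k)
 note D = C_k_SucD[OF Suc.prems(1)]
 show ?case
  by (rule C_k_SucI[OF bounded_linear.has_derivative[OF assms D(1)]]) (intro Suc.IH D)
qed

text \<open>A coordinate projection sends each basis vector to a basis vector or to zero, so that
 precomposing with it commutes with taking partial derivatives.\<close>

lemma C_k_compose_proj:
 assumes L: "bounded_linear L" and B: "!!d. d \<in> Basis ==> L d = 0 \<or> L d \<in> Basis"
 shows "C_k UNIV k f ==> C_k UNIV k (%x. f (L x))"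
proof (induction k arbitrary: f)
 case 0
 then show ?case
  using continuous_on_compose2[of UNIV f UNIV L] bounded_linear.continuous_on[OF L continuous_on_id]
  by (auto simp: C_k_0)
next
 case (Suc k)
 note D = C_k_SucD[OF Suc.prems(1)]
 have der: "((%x. f (L x)) has_derivative (%d. frechet_derivative f (at (L x)) (L d))) (at x)" for x
  using diff_chain_at[OF bounded_linear.has_derivative[OF L has_derivative_ident] D(1), of x]
  by (simp add: o_def)
 have 0: "frechet_derivative f (at x) 0 = 0" for x
  using has_derivative_bounded_linear[OF D(1)] by (simp add: bounded_linear.linear linear_0)
 show ?case
 proof (rule C_k_SucI[OF der])
  fix d :: 'a assume "d \<in> Basis"
  then consider "L d = 0" | "L d \<in> Basis" using B by blast
  then show "C_k UNIV k (%x. frechet_derivative f (at (L x)) (L d))"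
   by cases (auto simp: 0 intro: C_k_const Suc.IH[OF D(2)])
 qed
qed

lemma C_k_Suc_real:
 fixes f :: "real => 'b::real_normed_vector"
 assumes "!!x. (f has_vector_derivative f' x) (at x)" and "C_k UNIV k f'"
 shows "C_k UNIV (Suc k) f"
 by (rule C_k_SucI[OF assms(1)[unfolded has_vector_derivative_def]]) (use assms(2) in auto)

lemma C_k_Suc_realD:
 fixes f :: "real => 'b::real_normed_vector"
 assumes "C_k UNIV (Suc k) f"
 shows "(f has_vector_derivative vector_derivative f (at x)) (at x)"
  and "C_k UNIV k (%x. vector_derivative f (at x))"
proof -
 show d: "(f has_vector_derivative vector_derivative f (at x)) (at x)" for x
  using C_k_SucD(1)[OF assms] by (meson differentiable_def vector_derivative_works)
 have "vector_derivative f (at x) = frechet_derivative f (at x) 1" for x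
  using d[of x] by (metis frechet_derivative_at has_vector_derivative_def scaleR_one)
 then show "C_k UNIV k (%x. vector_derivative f (at x))"
  using C_k_SucD(2)[OF assms, of 1] by auto
qed

definition smooth :: "('a::euclidean_space => 'b::real_normed_vector) => bool" where
 "smooth f \<longleftrightarrow> (\<forall>k. C_k UNIV k f)"

lemma smooth_const: "smooth (%x. c)"
 and smooth_add: "smooth f ==> smooth g ==> smooth (%x. f x + g x)"
 and smooth_linear: "bounded_linear L ==> smooth f ==> smooth (%x. L (f x))"
 by (auto simp: smooth_def C_k_const C_k_add C_k_linear)

lemma smooth_mult:
 fixes f g :: "'a::euclidean_space => 'b::real_normed_algebra"
 shows "smooth f ==> smooth g ==> smooth (%x. f x * g x)"
 by (simp add: smooth_def C_k_mult)

lemma smooth_diff: "smooth f ==> smooth g ==> smooth (%x. f x - g x)"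
 using smooth_add[OF _ smooth_linear[OF bounded_linear_minus[OF bounded_linear_ident]], of f g] by simp

lemma smooth_power:
 fixes f :: "'a::euclidean_space => 'b::real_normed_algebra_1"
 shows "smooth f ==> smooth (%x. f x ^ n)"
 by (induction n) (auto intro: smooth_const smooth_mult)

lemma smoothD:
 assumes "smooth f"
 shows "(f has_derivative frechet_derivative f (at x)) (at x)"
  and "d \<in> Basis ==> smooth (%x. frechet_derivative f (at x) d)"
  and "continuous_on S f"
 using assms C_k_SucD[of _ f] continuous_on_subset[of UNIV f S] unfolding smooth_def
 by (auto simp flip: C_k_0)

lemma smooth_realD:
 fixes f :: "real => 'b::real_normed_vector"
 assumes "smooth f"
 shows "(f has_vector_derivative vector_derivative f (at x)) (at x)"
  and "smooth (%x. vector_derivative f (at x))"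
 using assms C_k_Suc_realD[of _ f] unfolding smooth_def by auto

lemma smooth_realI:
 fixes f :: "real => 'b::real_normed_vector"
 assumes "!!x. (f has_vector_derivative f' x) (at x)" and "smooth f'"
 shows "smooth f"
 using assms C_k_Suc_real[OF assms(1)] unfolding smooth_def by (metis C_k_0 C_k_mono le_SucI le_refl)

lemma C_k_exp: "C_k UNIV k (%x::real. exp (of_real x * c :: complex))"
proof (induction k)
 case 0
 show ?case by (auto simp: C_k_0 intro!: continuous_intros)
next
 case (Suc k)
 show ?case
  by (rule C_k_Suc_real[where f' = "%x. exp (of_real x * c) * c"])
   (auto intro!: derivative_eq_intros has_vector_derivative_real_field C_k_mult Suc C_k_const)
qed

lemma smooth_exp: "smooth (%x::real. exp (of_real x * c :: complex))"
 by (simp add: smooth_def C_k_exp)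

lemma test_function_iff: "test_function U ps \<longleftrightarrow> smooth ps \<and>
  (\<exists>K. compact K \<and> K \<subseteq> U \<and> (\<forall>x. x \<notin> K --> ps x = 0))"
 by (simp add: test_function_def smooth_def)

text \<open>The complement of the closed set is open, so near \<open>x\<close> the function
  coincides with the constant 0.\<close>

lemma deriv_zero_outside:
 fixes f :: "'a::real_normed_vector => 'b::real_normed_vector"
 assumes "(f has_derivative f') (at x)" "closed K" "!!x. x \<notin> K ==> f x = 0" "x \<notin> K"
 shows "f' = (%_. 0)"
proof (rule has_derivative_unique[OF assms(1)])
 show "(f has_derivative (%_. 0)) (at x)"
  by (rule has_derivative_transform_within_open[where f = "%_. 0" and s = "- K"])
   (use assms in \<open>auto simp: open_Compl\<close>)
qed

section \<open>Bump functions\<close>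

text \<open>Powers of \<open>1 / x\<close> are built into the flat function
  \<open>exp (- 1 / x)\<close> because differentiation produces exactly these: the span of the
  family is closed under derivatives, and smoothness is an induction over all \<open>n\<close> at
  once.\<close>

definition bump0 :: "nat => real => real" where
 "bump0 n x = (if x > 0 then (1 / x) ^ n * exp (- (1 / x)) else 0)"

text \<open>The substitution \<open>t = 1 / x\<close> turns the limit from the right into that of
  \<open>t ^ n * exp (- t)\<close> at infinity.\<close>

lemma bump0_tendsto: "((%x. bump0 n x) \<longlongrightarrow> 0) (at 0)"
proof -
 have "((%x::real. (1 / x) ^ n * exp (- (1 / x))) \<longlongrightarrow> 0) (at_right 0)"
 proof -
  have "((%x::real. x ^ n * exp (- x)) \<longlongrightarrow> 0) at_top"
   using tendsto_power_div_exp_0[of n] by (simp add: exp_minus field_simps)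
  then show ?thesis
   using filterlim_compose[OF _ filterlim_inverse_at_top_right, of "%x. x ^ n * exp (- x)" "nhds 0"]
   by (simp add: inverse_eq_divide)
 qed
 then have "((%x. bump0 n x) \<longlongrightarrow> 0) (at_right 0)"
  by (rule Lim_transform_eventually) (auto simp: bump0_def eventually_at_filter)
 moreover have "((%x. bump0 n x) \<longlongrightarrow> 0) (at_left 0)"
  by (rule Lim_transform_eventually[OF tendsto_const]) (auto simp: bump0_def eventually_at_filter)
 ultimately show ?thesis by (simp add: filterlim_split_at)
qed

lemma bump0_deriv:
 "(bump0 n has_vector_derivative bump0 (n + 2) x - real n * bump0 (n + 1) x) (at x)"
proof -
 consider "x > 0" | "x < 0" | "x = 0" by linarith
 then show ?thesis
 proof cases
  case 1
  have "((%x. (1 / x) ^ n * exp (- (1 / x))) has_real_derivative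
    (bump0 (n + 2) x - real n * bump0 (n + 1) x)) (at x)"
  proof -
   have D1: "((%x. (1 / x) ^ n * exp (- (1 / x))) has_real_derivative
    real n * (1 / x) ^ (n - 1) * (- (1 / x) * (1 / x)) * exp (- (1 / x)) +
    (1 / x) ^ n * (exp (- (1 / x)) * ((1 / x) * (1 / x)))) (at x)"
   proof -
    have "((%x. u x ^ n * exp (- u x)) has_real_derivative
     real n * u x ^ (n - 1) * u' * exp (- u x) + u x ^ n * (exp (- u x) * (- u'))) (at x)"
     if "(u has_real_derivative u') (at x)" for u u'
     using that by (auto intro!: derivative_eq_intros)
    moreover have "((%x. 1 / x) has_real_derivative - (1 / x) * (1 / x)) (at x)"
     using 1 by (auto intro!: derivative_eq_intros)
    ultimately show ?thesis by fastforce
   qed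
   \<comment> \<open>At \<open>n = 0\<close> the exponent \<open>n - 1\<close> is truncated, but the
     factor \<open>real n\<close> removes the term.\<close>
   have eq: "real n * (1 / x) ^ (n - 1) * (- (1 / x) * (1 / x)) = - (real n * (1 / x) ^ (n + 1))"
    by (cases n) (auto simp: algebra_simps add_divide_distrib)
   show ?thesis using D1[unfolded eq] 1 by (simp add: bump0_def algebra_simps)
  qed
  then have "(bump0 n has_real_derivative (bump0 (n + 2) x - real n * bump0 (n + 1) x)) (at x)"
   by (rule has_field_derivative_transform_within_open[where S = "{0<..}"])
    (use 1 in \<open>auto simp: bump0_def\<close>)
  then show ?thesis by (simp add: has_real_derivative_iff_has_vector_derivative)
 next
  case 2
  have "((%x. 0) has_vector_derivative 0) (at x)" by simp
  then have "(bump0 n has_vector_derivative 0) (at x)"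
   by (rule has_vector_derivative_transform_within_open[where S = "{..<0}"])
    (use 2 in \<open>auto simp: bump0_def\<close>)
  then show ?thesis using 2 by (simp add: bump0_def)
 next
  case 3
  \<comment> \<open>The difference quotient at 0 is \<open>bump0 (Suc n)\<close>, whose limit is
    already known.\<close>
  have "((%h. (bump0 n (0 + h) - bump0 n 0) / h) \<longlongrightarrow> 0) (at 0)"
   by (rule Lim_transform_eventually[OF bump0_tendsto[of "Suc n"]])
    (auto simp: bump0_def eventually_at_filter)
  then have "(bump0 n has_real_derivative 0) (at 0)"
   by (simp add: DERIV_def)
  then show ?thesis
   using 3 by (simp add: bump0_def has_real_derivative_iff_has_vector_derivative)
 qed
qed

lemma smooth_bump0: "smooth (bump0 n)"
proof -
 have "C_k UNIV k (bump0 n)" for k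
 proof (induction k arbitrary: n)
  case 0
  show ?case
   unfolding C_k_0
   by (intro continuous_at_imp_continuous_on ballI has_vector_derivative_continuous[OF bump0_deriv])
 next
  case (Suc k)
  have "C_k UNIV k (%x. bump0 (n + 2) x + (- real n) * bump0 (n + 1) x)"
   by (intro C_k_add Suc C_k_mult C_k_const)
  then show ?case by (intro C_k_Suc_real[OF bump0_deriv]) simp
 qed
 then show ?thesis by (simp add: smooth_def)
qed

lemma smooth_affine_compose:
 fixes f :: "real => real"
 assumes "smooth f"
 shows "smooth (%x. f (a * x + b))"
proof -
 have "C_k UNIV k f ==> C_k UNIV k (%x. f (a * x + b))" for k and f :: "real => real"
 proof (induction k arbitrary: f)
  case 0
  then show ?case
   by (auto simp: C_k_0 intro!: continuous_on_compose2[of UNIV f] continuous_intros)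
 next
  case (Suc k)
  note D = C_k_Suc_realD[OF Suc.prems]
  have "((%x. f (a * x + b)) has_vector_derivative a * vector_derivative f (at (a * x + b))) (at x)" for x
  proof -
   have "((%x. a * x + b) has_vector_derivative a) (at x)"
    by (auto intro!: derivative_eq_intros simp flip: has_real_derivative_iff_has_vector_derivative)
   from vector_diff_chain_at[OF this D(1)] show ?thesis by (simp add: o_def)
  qed
  then show ?case
   by (rule C_k_Suc_real) (intro C_k_mult C_k_const Suc.IH D)
 qed
 then show ?thesis using assms by (auto simp: smooth_def)
qed

text \<open>The bounds 0 and 1 and the pointwise limit are what dominated convergence asks for; no
  plateau on which a cut-off equals 1 has to be constructed.\<close>

lemma cutoff_sequence:
 fixes a b :: real
 obtains rh :: "nat => real => real" where
  "!!n. test_function {a<..<b} (rh n)"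
  "!!n x. 0 <= rh n x" "!!n x. rh n x <= 1"
  "!!x. (%n. rh n x) \<longlonglongrightarrow> indicator {a<..<b} x"
proof
 define e :: "nat => real" where "e n = inverse (real (Suc n))" for n
 define g where "g n x = bump0 0 (x - (a + e n)) * bump0 0 ((b - e n) - x)" for n x
 \<comment> \<open>Where \<open>g n x\<close> stays above a fixed positive number,
   \<open>(1 - g n x) ^ n\<close> tends to 0; where \<open>g n x = 0\<close> the cut-off vanishes
   too.\<close>
 define rh where "rh n x = 1 - (1 - g n x) ^ n" for n x
 have e0: "e n > 0" for n by (simp add: e_def)
 have b01: "0 <= bump0 0 x" "bump0 0 x <= 1" for x by (auto simp: bump0_def)
 have g01: "0 <= g n x" "g n x <= 1" for n x
  by (auto simp: g_def b01 mult_le_one)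
 have sg: "smooth (g n)" for n
  using smooth_affine_compose[OF smooth_bump0[of 0], of 1 "- (a + e n)"]
   smooth_affine_compose[OF smooth_bump0[of 0], of "-1" "b - e n"]
  unfolding g_def by (intro smooth_mult) (simp_all add: algebra_simps)
 have "smooth (rh n)" for n
  unfolding rh_def by (intro smooth_diff smooth_power smooth_const sg)
 moreover have "rh n x = 0" if "x \<notin> {a + e n..b - e n}" for n x
  using that by (auto simp: rh_def g_def bump0_def)
 moreover have "{a + e n..b - e n} \<subseteq> {a<..<b}" for n
  using e0[of n] by auto
 ultimately show "test_function {a<..<b} (rh n)" for n
  unfolding test_function_iff by (metis compact_Icc)
 show "0 <= rh n x" "rh n x <= 1" for n x
  using g01[of n x] by (auto simp: rh_def power_le_one)
 show "(%n. rh n x) \<longlonglongrightarrow> indicator {a<..<b} x" for x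
 proof (cases "x \<in> {a<..<b}")
  case False
  then have "g n x = 0" for n
   using e0[of n] by (auto simp: g_def bump0_def)
  then show ?thesis using False by (simp add: rh_def)
 next
  case True
  define c where "c = bump0 0 (x - a) * bump0 0 (b - x)"
  have cont: "isCont (bump0 0) y" for y
   using has_vector_derivative_continuous[OF bump0_deriv] by blast
  have el: "e \<longlonglongrightarrow> 0" unfolding e_def by (rule LIMSEQ_inverse_real_of_nat)
  have "(%n. g n x) \<longlonglongrightarrow> bump0 0 (x - (a + 0)) * bump0 0 ((b - 0) - x)"
   unfolding g_def by (intro tendsto_mult isCont_tendsto_compose[OF cont] tendsto_intros el)
  then have gl: "(%n. g n x) \<longlonglongrightarrow> c" by (simp add: c_def)
  have c: "c > 0" using True by (auto simp: c_def bump0_def)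
  then have "\<forall>\<^sub>F n in sequentially. c / 2 < g n x"
   using order_tendstoD(1)[OF gl, of "c / 2"] by simp
  then have ev: "\<forall>\<^sub>F n in sequentially. (1 - g n x) ^ n <= (1 - c / 2) ^ n"
   by eventually_elim (use g01 in \<open>auto intro!: power_mono\<close>)
  have "c <= 1" using g01 gl by (meson LIMSEQ_le_const2)
  then have "(%n. (1 - c / 2) ^ n) \<longlonglongrightarrow> 0"
   using c by (intro LIMSEQ_realpow_zero) auto
  from tendsto_sandwich[OF _ ev tendsto_const this] have "(%n. (1 - g n x) ^ n) \<longlonglongrightarrow> 0"
   using g01 by auto
  then have "(%n. 1 - (1 - g n x) ^ n) \<longlonglongrightarrow> 1 - 0" by (intro tendsto_intros)
  then show ?thesis using True by (simp add: rh_def)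
 qed
qed

section \<open>Weak derivatives on an interval\<close>

lemma open_space_restrict [simp]: "space (restrict_space lborel A) = A"
 by (simp add: space_restrict_space)

lemma finite_measure_restrict_bounded:
 fixes A :: "'a::euclidean_space set"
 assumes "bounded A" "A \<in> sets borel"
 shows "finite_measure (restrict_space lborel A)"
 by (rule finite_measureI)
  (use assms emeasure_bounded_finite[OF assms(1)] in \<open>auto simp: emeasure_restrict_space\<close>)

lemma sigma_finite_restrict:
 fixes A :: "'a::euclidean_space set"
 assumes "A \<in> sets borel"
 shows "sigma_finite_measure (restrict_space lborel A)"
 by (rule sigma_finite_measure_restrict_space) (use assms sigma_finite_lborel in auto)

abbreviation IM :: "real => real measure" where
 "IM h \<equiv> restrict_space lborel {-h<..<h}"

lemma finite_measure_IM: "finite_measure (IM h)"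
 by (rule finite_measure_restrict_bounded) auto

interpretation IM: finite_measure "IM h" for h
 by (rule finite_measure_IM)

interpretation IM_pair: pair_sigma_finite "IM h" "IM h" for h ..

lemma integrable_product:
 fixes f :: "'a => complex" and g :: "'b => complex"
 assumes "sigma_finite_measure M" "sigma_finite_measure N"
  and [measurable]: "integrable M f" "integrable N g"
 shows "integrable (M \<Otimes>\<^sub>M N) (%(x, y). f x * g y)"
proof -
 interpret pair_sigma_finite M N using assms by (intro pair_sigma_finite.intro)
 show ?thesis
  by (rule Fubini_integrable) (use assms(3,4) in \<open>auto simp: norm_mult\<close>)
qed

section \<open>Absolutely continuous functions as primitives\<close>

lemma AE_IM_neq: "AE t in IM h. t \<noteq> z"
 by (auto simp: AE_restrict_space_iff intro: AE_mp[OF AE_lborel_singleton[of z]])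

text \<open>The primitive starting at \<open>-h\<close>, written over the whole interval with an
  indicator so that dominated convergence and Fubini apply without a change of measure.\<close>

definition J :: "real => (real => complex) => real => complex" where
 "J h g z = (LINT t|IM h. indicator {..<z} t *\<^sub>R g t)"

lemma integrable_IM_indicator:
 fixes g :: "real => 'b::{banach, second_countable_topology}"
 shows "integrable (IM h) g ==> A \<in> sets borel ==> integrable (IM h) (%t. indicator A t *\<^sub>R g t)"
proof -
 assume g: "integrable (IM h) g" and A: "A \<in> sets borel"
 have "A \<inter> {-h<..<h} \<in> sets (IM h)" using A by (auto simp: sets_restrict_space)
 then have "integrable (IM h) (%t. indicator (A \<inter> {-h<..<h}) t *\<^sub>R g t)"
  using g by (rule integrable_mult_indicator)
 then show ?thesis
  by (rule Bochner_Integration.integrable_cong[THEN iffD1, rotated -1]) (auto simp: indicator_def)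
qed

text \<open>Absolute continuity in integrated form. \<open>F\<close> is fixed at every point of the
  closed interval, so endpoint values make sense, while \<open>g\<close> matters only up to null
  sets.\<close>

definition AC :: "real => (real => complex) => (real => complex) => bool" where
 "AC h F g \<longleftrightarrow> integrable (IM h) g \<and> (\<exists>c. \<forall>z\<in>{-h..h}. F z = c + J h g z)"

lemma ACD:
 assumes "AC h F g" "0 <= h"
 shows "integrable (IM h) g" "z \<in> {-h..h} ==> F z = F (-h) + J h g z"
proof -
 obtain c where c: "!!z. z \<in> {-h..h} ==> F z = c + J h g z" using assms(1) by (auto simp: AC_def)
 have "J h g (-h) = 0" unfolding J_def by (auto intro!: integral_eq_zero_AE)
 with c[of "-h"] assms(2) have "F (-h) = c" by simp
 with c show "z \<in> {-h..h} ==> F z = F (-h) + J h g z" by simp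
 show "integrable (IM h) g" using assms by (simp add: AC_def)
qed

lemma measurable_IM_borel [measurable (raw)]:
 "f \<in> borel_measurable borel ==> f \<in> borel_measurable (IM h)"
 by (rule measurable_restrict_space1) simp

text \<open>The indicators converge except possibly at \<open>t = z\<close>, a null set, and
  \<open>norm (g t)\<close> dominates.\<close>

lemma J_tendsto:
 assumes g: "integrable (IM h) g" and x: "x \<longlonglongrightarrow> z"
 shows "(%n. J h g (x n)) \<longlonglongrightarrow> J h g z"
 unfolding J_def
proof (rule integral_dominated_convergence[where w = "%t. norm (g t)"])
 have [measurable]: "g \<in> borel_measurable (IM h)" using g by auto
 show "AE t in IM h. (%n. indicator {..<x n} t *\<^sub>R g t) \<longlonglongrightarrow> indicator {..<z} t *\<^sub>R g t"
  using AE_IM_neq[of z h]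
 proof eventually_elim
  case (elim t)
  then consider "t < z" | "t > z" by linarith
  then have "\<forall>\<^sub>F n in sequentially. indicator {..<x n} t *\<^sub>R g t = indicator {..<z} t *\<^sub>R g t"
  proof cases
   case 1
   with order_tendstoD(1)[OF x] have "\<forall>\<^sub>F n in sequentially. t < x n" .
   then show ?thesis by eventually_elim (use 1 in auto)
  next
   case 2
   with order_tendstoD(2)[OF x] have "\<forall>\<^sub>F n in sequentially. x n < t" .
   then show ?thesis by eventually_elim (use 2 in auto)
  qed
  then show ?case by (rule tendsto_eventually)
 qed
 show "(%t. indicator {..<z} t *\<^sub>R g t) \<in> borel_measurable (IM h)"
  using integrable_IM_indicator[OF g, of "{..<z}"] by auto
 show "(%t. indicator {..<x n} t *\<^sub>R g t) \<in> borel_measurable (IM h)" for n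
  using integrable_IM_indicator[OF g, of "{..<x n}"] by auto
qed (use g in \<open>auto simp: indicator_def\<close>)

lemma continuous_on_J: "integrable (IM h) g ==> continuous_on S (J h g)"
 by (auto simp: continuous_on_sequentially o_def intro!: J_tendsto)

lemma AC_continuous: "AC h F g ==> continuous_on {-h..h} F"
 unfolding AC_def
 by (elim conjE exE, subst continuous_on_cong[OF refl], erule (1) bspec)
  (intro continuous_intros continuous_on_J)

lemma J_ends: "J h g (-h) = 0" "J h g h = (LINT t|IM h. g t)"
 unfolding J_def by (auto intro!: integral_eq_zero_AE Bochner_Integration.integral_cong)

lemma J_add: "integrable (IM h) f ==> integrable (IM h) g ==> J h (%t. f t + g t) z = J h f z + J h g z"
 unfolding J_def by (simp add: scaleR_add_right integrable_IM_indicator)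

lemma J_cmult: "J h (%t. c * g t) z = c * J h g z"
 unfolding J_def by (simp flip: mult_scaleR_right)

lemma norm_J: "integrable (IM h) g ==> norm (J h g z) <= (LINT t|IM h. norm (g t))"
 unfolding J_def
 by (rule order_trans[OF integral_norm_bound], rule integral_mono[OF integrable_norm[OF integrable_IM_indicator] integrable_norm])
  (auto simp: indicator_def)

lemma AC_integral: "AC h F g ==> h >= 0 ==> (LINT t|IM h. g t) = F h - F (-h)"
 using ACD(2)[of h F g h] by (simp add: J_ends)

lemma AC_add: "AC h F f ==> AC h G g ==> AC h (%z. F z + G z) (%z. f z + g z)"
 unfolding AC_def
proof safe
 fix c d assume "integrable (IM h) f" "integrable (IM h) g"
  "\<forall>z\<in>{-h..h}. F z = c + J h f z" "\<forall>z\<in>{-h..h}. G z = d + J h g z"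
 then show "\<exists>c. \<forall>z\<in>{-h..h}. F z + G z = c + J h (%z. f z + g z) z"
  by (intro exI[of _ "c + d"]) (simp add: J_add)
qed simp

lemma AC_cmult: "AC h F f ==> AC h (%z. c * F z) (%z. c * f z)"
 unfolding AC_def by (auto simp: J_cmult distrib_left)

lemma AC_const: "AC h (%z. c) (%z. 0)"
 unfolding AC_def by (simp add: J_def)

lemma AC_cong: "AC h F f ==> (!!z. z \<in> {-h..h} ==> F z = G z) ==> AE z in IM h. f z = g z ==>
  g \<in> borel_measurable (IM h) ==> 0 <= h ==> AC h G g"
proof -
 assume A: "AC h F f" "!!z. z \<in> {-h..h} ==> F z = G z" "AE z in IM h. f z = g z"
  "g \<in> borel_measurable (IM h)" "0 <= h"
 then have f: "integrable (IM h) f" by (simp add: AC_def)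
 have g: "integrable (IM h) g" using f A(3,4) integrable_cong_AE[of f "IM h" g] by auto
 have eq: "J h f z = J h g z" for z
  unfolding J_def
  by (rule integral_cong_AE) (use A(3) integrable_IM_indicator[OF f, of "{..<z}"]
   integrable_IM_indicator[OF g, of "{..<z}"] in auto)
 show ?thesis using A(1,2) g unfolding AC_def eq by auto
qed

text \<open>Two primitives multiply by Fubini: the two iterated integrals over \<open>s < t\<close> and \<open>s > t\<close>
 make up the product of the integrals.\<close>

lemma Fubini_triangle:
 fixes p q :: "real => complex"
 assumes p: "integrable (IM h) p" and q: "integrable (IM h) q"
 shows "(LINT t|IM h. p t * (LINT s|IM h. indicator {..<t} s *\<^sub>R q s)) +
     (LINT t|IM h. q t * (LINT s|IM h. indicator {..<t} s *\<^sub>R p s)) =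
     (LINT t|IM h. p t) * (LINT t|IM h. q t)"
proof -
 define P where "P t s = p t * q s" for t s
 have [measurable]: "p \<in> borel_measurable (IM h)" "q \<in> borel_measurable (IM h)" using p q by auto
 have iP: "integrable (IM h \<Otimes>\<^sub>M IM h) (%(t, s). P t s)"
  unfolding P_def by (rule integrable_product) (use p q sigma_finite_restrict[of "{-h<..<h}"] in auto)
 have m1: "{x \<in> space (IM h \<Otimes>\<^sub>M IM h). snd x < fst x} \<in> sets (IM h \<Otimes>\<^sub>M IM h)"
 proof -
  have [measurable]: "(%x. x) \<in> borel_measurable (IM h)" by measurable
  have [measurable]: "fst \<in> borel_measurable (IM h \<Otimes>\<^sub>M IM h)" "snd \<in> borel_measurable (IM h \<Otimes>\<^sub>M IM h)"
   using measurable_compose[OF measurable_fst[of "IM h" "IM h"], of "%x. x" borel]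
    measurable_compose[OF measurable_snd[of "IM h" "IM h"], of "%x. x" borel] by auto
  show ?thesis by measurable
 qed
 have i1: "integrable (IM h \<Otimes>\<^sub>M IM h) (%(t, s). indicator {..<t} s *\<^sub>R P t s)"
  by (rule Bochner_Integration.integrable_cong[THEN iffD1, OF refl _ integrable_mult_indicator[OF m1 iP]])
   (auto simp: indicator_def space_pair_measure split: prod.splits)
 have "(LINT t|IM h. q t * (LINT s|IM h. indicator {..<t} s *\<^sub>R p s)) =
   (LINT t|IM h. (LINT s|IM h. indicator {..<t} s *\<^sub>R P s t))"
 proof -
  have "indicator {..<t} s *\<^sub>R P s t = q t * (indicator {..<t} s *\<^sub>R p s)" for s t
   by (simp add: P_def mult.commute)
  then show ?thesis by (simp only: integral_mult_right_zero)
 qed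
 also have "... = (LINT s|IM h. (LINT t|IM h. indicator {..<t} s *\<^sub>R P s t))"
 proof (rule IM_pair.Fubini_integral)
  have "{x \<in> space (IM h \<Otimes>\<^sub>M IM h). fst x < snd x} \<in> sets (IM h \<Otimes>\<^sub>M IM h)"
  proof -
   have [measurable]: "(%x. x) \<in> borel_measurable (IM h)" by measurable
   have [measurable]: "fst \<in> borel_measurable (IM h \<Otimes>\<^sub>M IM h)" "snd \<in> borel_measurable (IM h \<Otimes>\<^sub>M IM h)"
    using measurable_compose[OF measurable_fst[of "IM h" "IM h"], of "%x. x" borel]
     measurable_compose[OF measurable_snd[of "IM h" "IM h"], of "%x. x" borel] by auto
   show ?thesis by measurable
  qed
  from integrable_mult_indicator[OF this iP]
  show "integrable (IM h \<Otimes>\<^sub>M IM h) (%(s, t). indicator {..<t} s *\<^sub>R P s t)"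
   by (rule Bochner_Integration.integrable_cong[THEN iffD1, OF refl, rotated])
    (auto simp: indicator_def space_pair_measure split: prod.splits)
 qed
 finally have 2: "(LINT t|IM h. q t * (LINT s|IM h. indicator {..<t} s *\<^sub>R p s)) =
   (LINT t|IM h. p t * (LINT s|IM h. indicator {t<..} s *\<^sub>R q s))"
  by (simp add: P_def indicator_def flip: mult_scaleR_right)
 have split: "(LINT s|IM h. q s) =
   (LINT s|IM h. indicator {..<t} s *\<^sub>R q s) + (LINT s|IM h. indicator {t<..} s *\<^sub>R q s)" for t
 proof -
  have "(LINT s|IM h. q s) = (LINT s|IM h. indicator {..<t} s *\<^sub>R q s + indicator {t<..} s *\<^sub>R q s)"
   by (rule integral_cong_AE)
    (use AE_IM_neq[of t h] in \<open>auto intro!: borel_measurable_add borel_measurable_integrable integrable_IM_indicator q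
     simp: indicator_def\<close>)
  then show ?thesis by (simp add: q integrable_IM_indicator)
 qed
 have b1: "integrable (IM h) (%t. p t * (LINT s|IM h. indicator {..<t} s *\<^sub>R q s))"
  using IM_pair.integrable_fst[OF i1] by (simp add: P_def flip: mult_scaleR_right)
 have b2: "integrable (IM h) (%t. p t * (LINT s|IM h. indicator {t<..} s *\<^sub>R q s))"
 proof -
  have "integrable (IM h) (%t. p t * (LINT s|IM h. q s) - p t * (LINT s|IM h. indicator {..<t} s *\<^sub>R q s))"
   by (intro Bochner_Integration.integrable_diff b1 integrable_mult_left p)
  moreover have "p t * (LINT s|IM h. q s) - p t * (LINT s|IM h. indicator {..<t} s *\<^sub>R q s) =
    p t * (LINT s|IM h. indicator {t<..} s *\<^sub>R q s)" for t
   using split[of t] by (simp add: algebra_simps)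
  ultimately show ?thesis by simp
 qed
 have "(LINT t|IM h. p t) * (LINT s|IM h. q s) = (LINT t|IM h. p t * (LINT s|IM h. q s))"
  by simp
 also have "... = (LINT t|IM h. p t * (LINT s|IM h. indicator {..<t} s *\<^sub>R q s) +
   p t * (LINT s|IM h. indicator {t<..} s *\<^sub>R q s))"
 proof (rule Bochner_Integration.integral_cong)
  show "p t * (LINT s|IM h. q s) = p t * (LINT s|IM h. indicator {..<t} s *\<^sub>R q s) +
   p t * (LINT s|IM h. indicator {t<..} s *\<^sub>R q s)" for t
   using split[of t] by (simp add: algebra_simps)
 qed simp
 finally show ?thesis using b1 b2 2 by simp
qed

lemma integrable_bounded_mult:
 fixes f g :: "'a => 'b::{banach, real_normed_algebra, second_countable_topology}"
 assumes f: "integrable M f" and [measurable]: "g \<in> borel_measurable M"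
  and "!!x. x \<in> space M ==> norm (g x) <= B"
 shows "integrable M (%x. f x * g x)" "integrable M (%x. g x * f x)"
proof -
 have [measurable]: "f \<in> borel_measurable M" using f by auto
 have "norm (f x) * norm (g x) <= B * norm (f x)" "norm (g x) * norm (f x) <= B * norm (f x)" if "x \<in> space M" for x
  using mult_right_mono[OF assms(3)[OF that], of "norm (f x)"] by (auto simp: mult.commute)
 then have "norm (f x * g x) <= norm (B * norm (f x))" "norm (g x * f x) <= norm (B * norm (f x))"
  if "x \<in> space M" for x
  using that norm_mult_ineq[of "f x" "g x"] norm_mult_ineq[of "g x" "f x"] by fastforce+
 then show "integrable M (%x. f x * g x)" "integrable M (%x. g x * f x)"
  by (auto intro!: Bochner_Integration.integrable_bound[where f = "%x. B * norm (f x)"]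
    integrable_mult_right integrable_norm f AE_I2)
qed

lemma AC_integrable_mult:
 assumes F: "AC h F f" and g: "integrable (IM h) g"
 shows "integrable (IM h) (%t. F t * g t)" "integrable (IM h) F"
proof -
 have "compact (F ` {-h..h})" using AC_continuous[OF F] compact_continuous_image by blast
 then obtain B where B: "!!z. z \<in> {-h..h} ==> norm (F z) <= B"
  by (meson bounded_iff compact_imp_bounded image_eqI)
 have m: "F \<in> borel_measurable (IM h)"
  using borel_measurable_continuous_on_restrict[OF continuous_on_subset[OF AC_continuous[OF F]], of "{-h<..<h}"]
   measurable_cong_sets[OF sets_restrict_space_cong[OF sets_lborel] refl] by fastforce
 show "integrable (IM h) (%t. F t * g t)"
  by (rule integrable_bounded_mult(2)[OF g m, of B]) (use B in auto)
 have "integrable (IM h) (%t. F t * 1)"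
  by (rule integrable_bounded_mult(2)[OF _ m, of _ B]) (use B in auto)
 then show "integrable (IM h) F" by simp
qed

text \<open>Each factor is its value at \<open>-h\<close> plus a primitive. Only the product of the
  two primitives needs an argument, and that is the triangle identity applied to integrands cut off
  at \<open>z\<close>.\<close>

lemma AC_mult:
 assumes F: "AC h F f" and G: "AC h G g" and h: "0 <= h"
 shows "AC h (%z. F z * G z) (%z. f z * G z + F z * g z)"
 unfolding AC_def
proof (intro conjI exI ballI)
 have f: "integrable (IM h) f" and g: "integrable (IM h) g" using F G by (auto simp: AC_def)
 have i: "integrable (IM h) (%z. f z * G z)" "integrable (IM h) (%z. F z * g z)"
  using AC_integrable_mult[OF F g] AC_integrable_mult[OF G f] by (simp_all add: mult.commute)
 then show "integrable (IM h) (%z. f z * G z + F z * g z)" by simp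
 fix z assume z: "z \<in> {-h..h}"
 define p where "p t = indicator {..<z} t *\<^sub>R f t" for t
 define q where "q t = indicator {..<z} t *\<^sub>R g t" for t
 have p: "integrable (IM h) p" and q: "integrable (IM h) q"
  unfolding p_def q_def using f g by (auto intro: integrable_IM_indicator)
 have q': "indicator {..<z} t *\<^sub>R (f t * J h g t) = p t * (LINT s|IM h. indicator {..<t} s *\<^sub>R q s)" for t
  unfolding p_def q_def J_def by (auto simp: indicator_def intro!: arg_cong[of _ _ "%x. f t * x"] Bochner_Integration.integral_cong)
 have p': "indicator {..<z} t *\<^sub>R (J h f t * g t) = q t * (LINT s|IM h. indicator {..<t} s *\<^sub>R p s)" for t
  unfolding p_def q_def J_def by (auto simp: indicator_def intro!: arg_cong[of _ _ "%x. x * g t"] Bochner_Integration.integral_cong)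
 have jj: "AC h (J h f) f" "AC h (J h g) g" using f g by (auto simp: AC_def intro: exI[of _ 0])
 have ji: "integrable (IM h) (%z. f z * J h g z)" "integrable (IM h) (%z. J h f z * g z)"
  using AC_integrable_mult[OF jj(1) g] AC_integrable_mult[OF jj(2) f] by (simp_all add: mult.commute)
 have tri: "J h (%z. f z * J h g z) z + J h (%z. J h f z * g z) z = J h f z * J h g z"
  using Fubini_triangle[OF p q] unfolding J_def[of h "%z. f z * J h g z"] J_def[of h "%z. J h f z * g z"] q' p'
  by (simp add: J_def p_def q_def)
 have "J h (%z. f z * G z + F z * g z) z =
   J h (%z. (G (-h) * f z + F (-h) * g z) + (f z * J h g z + J h f z * g z)) z"
  unfolding J_def
 proof (rule Bochner_Integration.integral_cong)
  fix t assume "t \<in> space (IM h)"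
  then have "t \<in> {-h..h}" by auto
  from ACD(2)[OF F h this] ACD(2)[OF G h this] show "indicator {..<z} t *\<^sub>R (f t * G t + F t * g t) =
    indicator {..<z} t *\<^sub>R ((G (-h) * f t + F (-h) * g t) + (f t * (LINT s|IM h. indicator {..<t} s *\<^sub>R g s) +
     (LINT s|IM h. indicator {..<t} s *\<^sub>R f s) * g t))"
   by (simp add: algebra_simps J_def)
 qed simp
 also have "... = G (-h) * J h f z + F (-h) * J h g z + J h f z * J h g z"
  using ji f g tri by (simp add: J_add J_cmult)
 finally show "F z * G z = F (-h) * G (-h) + J h (%z. f z * G z + F z * g z) z"
  unfolding ACD(2)[OF F h z] ACD(2)[OF G h z] by (simp add: algebra_simps)
qed

lemma AC_real:
 assumes "h > 0" "!!z. z \<in> {-h..h} ==> (f has_vector_derivative f' z) (at z)" "continuous_on {-h..h} f'"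
 shows "AC h f f'"
 unfolding AC_def
proof (intro conjI exI ballI)
 show i: "integrable (IM h) f'"
 proof -
  have "set_integrable lborel {-h..h} f'" by (rule borel_integrable_atLeastAtMost') fact
  then have "set_integrable lborel {-h<..<h} f'" by (rule set_integrable_subset) auto
  then show ?thesis by (simp add: integrable_restrict_space set_integrable_def)
 qed
 fix z assume z: "z \<in> {-h..h}"
 have "f z - f (-h) = (LBINT t:{-h..z}. f' t)"
 proof -
  have c: "continuous_on {-h..z} f'" using assms(3) z by (auto intro: continuous_on_subset)
  have "set_integrable lborel {-h..z} f'" by (rule borel_integrable_atLeastAtMost') fact
  then have "(LBINT t:{-h..z}. f' t) = integral {-h..z} f'" by (simp add: set_borel_integral_eq_integral)
  also have "... = f z - f (-h)"
   by (rule integral_unique, rule fundamental_theorem_of_calculus)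
    (use z assms(2) in \<open>auto intro: has_vector_derivative_at_within\<close>)
  finally show ?thesis by simp
 qed
 also have "... = (LBINT t. indicator {-h<..<h} t *\<^sub>R indicator {..<z} t *\<^sub>R f' t)"
  unfolding set_lebesgue_integral_def
 proof (rule integral_cong_AE)
  show "(%x. indicator {-h..z} x *\<^sub>R f' x) \<in> borel_measurable lborel"
   using borel_integrable_atLeastAtMost'[OF continuous_on_subset[OF assms(3)], of "-h" z] z
   by (auto simp: set_integrable_def)
  show "(%t. indicator {-h<..<h} t *\<^sub>R indicator {..<z} t *\<^sub>R f' t) \<in> borel_measurable lborel"
   using integrable_IM_indicator[OF i, of "{..<z}"] by (auto simp: integrable_restrict_space)
  show "AE x in lborel. indicator {-h..z} x *\<^sub>R f' x = indicator {-h<..<h} x *\<^sub>R indicator {..<z} x *\<^sub>R f' x"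
   using AE_lborel_singleton[of z] AE_lborel_singleton[of "-h"]
   by eventually_elim (use z in \<open>auto simp: indicator_def\<close>)
 qed
 also have "... = J h f' z"
  unfolding J_def by (simp add: integral_restrict_space)
 finally show "f z = f (-h) + J h f' z" by (simp add: algebra_simps)
qed

section \<open>Weak derivatives tested with smooth functions\<close>

text \<open>Scalar first-order case of \<open>has_wderiv\<close>; vectors and higher orders are
  reduced to it by components and by chaining.\<close>

definition wd :: "real => (real => complex) => (real => complex) => bool" where
 "wd h f g \<longleftrightarrow> integrable (IM h) f \<and> integrable (IM h) g \<and>
   (\<forall>ps :: real => real. test_function {-h<..<h} ps -->
    (LINT z|IM h. deriv ps z *\<^sub>R f z) = - (LINT z|IM h. ps z *\<^sub>R g z))"

lemma test_deriv:
 fixes ps :: "real => real"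
 assumes "test_function U ps"
 shows "(ps has_real_derivative deriv ps z) (at z)" and "test_function U (deriv ps)"
proof -
 obtain K where K: "compact K" "K \<subseteq> U" "!!x. x \<notin> K ==> ps x = 0" and s: "smooth ps"
  using assms by (auto simp: test_function_iff)
 have d: "vector_derivative ps (at z) = deriv ps z" for z
  using smooth_realD(1)[OF s, of z]
  by (metis DERIV_imp_deriv has_real_derivative_iff_has_vector_derivative)
 show dd: "(ps has_real_derivative deriv ps z) (at z)" for z
  using smooth_realD(1)[OF s, of z] unfolding d by (simp add: has_real_derivative_iff_has_vector_derivative)
 have "deriv ps x = 0" if "x \<notin> K" for x
  using deriv_zero_outside[OF dd[unfolded has_field_derivative_def] compact_imp_closed[OF K(1)] K(3) that]
  by (metis lambda_one mult_cancel_left mult_1 )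
 with K smooth_realD(2)[OF s] show "test_function U (deriv ps)"
  unfolding d test_function_iff by blast
qed

lemma test_bounded:
 fixes ps :: "'a::euclidean_space => 'b::real_normed_vector"
 assumes "test_function U ps"
 obtains B where "!!x. norm (ps x) <= B" "B > 0"
proof -
 obtain K where K: "compact K" "!!x. x \<notin> K ==> ps x = 0" and s: "smooth ps"
  using assms by (auto simp: test_function_iff)
 have "bounded (ps ` K)" by (intro compact_imp_bounded compact_continuous_image smoothD K s)
 then obtain B where B: "B > 0" "!!x. x \<in> K ==> norm (ps x) <= B" by (auto simp: bounded_pos)
 then have "norm (ps x) <= B" for x using K(2)[of x] by (cases "x \<in> K") auto
 then show thesis using that B by blast
qed

lemma test_continuous: "test_function U ps ==> continuous_on S ps"
 by (auto simp: test_function_iff smoothD)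

lemma test_measurable: "test_function U ps ==> ps \<in> borel_measurable borel"
 by (auto intro!: borel_measurable_continuous_onI test_continuous)

lemma test_integrable:
 fixes ps :: "real => real" and f :: "real => complex"
 assumes "test_function U ps" "integrable (IM h) f"
 shows "integrable (IM h) (%z. ps z *\<^sub>R f z)"
proof -
 obtain B where "!!x. norm (ps x) <= B" using test_bounded[OF assms(1)] by auto
 then have "integrable (IM h) (%z. of_real (ps z) * f z)"
  by (intro integrable_bounded_mult(2)[OF assms(2), of _ B])
   (auto intro!: measurable_IM_borel measurable_compose[OF test_measurable[OF assms(1)]])
 then show ?thesis by (simp add: scaleR_conv_of_real)
qed

lemma AC_test:
 fixes ps :: "real => real"
 assumes t: "test_function {-h<..<h} ps" and h: "h > 0"
 shows "AC h (%z. of_real (ps z)) (%z. of_real (deriv ps z))" "ps h = 0" "ps (-h) = 0"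
proof -
 show "AC h (%z. of_real (ps z)) (%z. of_real (deriv ps z))"
 proof (rule AC_real[OF h])
  show "((%z. complex_of_real (ps z)) has_vector_derivative of_real (deriv ps z)) (at z)" for z
   by (rule has_vector_derivative_of_real[OF test_deriv(1)[OF t]])
  show "continuous_on {-h..h} (%z. complex_of_real (deriv ps z))"
   by (intro continuous_intros test_continuous[OF test_deriv(2)[OF t]])
 qed
 show "ps h = 0" "ps (-h) = 0" using t unfolding test_function_def by fastforce+
qed

text \<open>Integration by parts: the product with a test function is absolutely continuous and
  vanishes at both ends.\<close>

lemma AC_imp_wd:
 assumes A: "AC h F g" and h: "h > 0" shows "wd h F g"
 unfolding wd_def
proof (intro conjI allI impI)
 show g: "integrable (IM h) g" using ACD(1)[OF A] h by auto
 show i: "integrable (IM h) F" by (rule AC_integrable_mult(2)[OF A g])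
 fix ps :: "real => real" assume t: "test_function {-h<..<h} ps"
 note m = AC_mult[OF AC_test(1)[OF t h] A]
 have "(LINT z|IM h. of_real (deriv ps z) * F z + of_real (ps z) * g z) = 0"
  using AC_integral[OF m] h AC_test(2,3)[OF t h] by auto
 moreover have "integrable (IM h) (%z. of_real (deriv ps z) * F z)" "integrable (IM h) (%z. of_real (ps z) * g z)"
  using test_integrable[OF t g] test_integrable[OF test_deriv(2)[OF t] i] by (auto simp: scaleR_conv_of_real)
 ultimately show "(LINT z|IM h. deriv ps z *\<^sub>R F z) = - (LINT z|IM h. ps z *\<^sub>R g z)"
  by (simp add: scaleR_conv_of_real add_eq_0_iff)
qed

text \<open>The positive and the negative part, used as densities, give finite measures that agree
  on all rays \<open>{x<..}\<close>. Hence the measures agree, and so do the densities almost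
  everywhere.\<close>

lemma AE_zero_real:
 fixes f :: "real => real"
 assumes f: "integrable lborel f" and 0: "!!x. (LINT t|lborel. indicator {x<..} t * f t) = 0"
 shows "AE x in lborel. f x = 0"
proof -
 have [measurable]: "f \<in> borel_measurable borel" using f by auto
 have fin: "(\<integral>\<^sup>+ t. ennreal (f t) * indicator A t \<partial>lborel) < \<infinity>"
  "(\<integral>\<^sup>+ t. ennreal (- f t) * indicator A t \<partial>lborel) < \<infinity>" for A
 proof -
  have "(\<integral>\<^sup>+ t. ennreal (norm (f t)) \<partial>lborel) < \<infinity>" using f by (simp add: integrable_iff_bounded)
  moreover have "(\<integral>\<^sup>+ t. ennreal (f t) * indicator A t \<partial>lborel) <= (\<integral>\<^sup>+ t. ennreal (norm (f t)) \<partial>lborel)"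
   "(\<integral>\<^sup>+ t. ennreal (- f t) * indicator A t \<partial>lborel) <= (\<integral>\<^sup>+ t. ennreal (norm (f t)) \<partial>lborel)"
   by (intro nn_integral_mono, auto simp: indicator_def ennreal_leI)+
  ultimately show "(\<integral>\<^sup>+ t. ennreal (f t) * indicator A t \<partial>lborel) < \<infinity>"
   "(\<integral>\<^sup>+ t. ennreal (- f t) * indicator A t \<partial>lborel) < \<infinity>"
   by (auto intro: le_less_trans)
 qed
 have "density lborel (%x. ennreal (f x)) = density lborel (%x. ennreal (- f x))"
 proof (rule measure_eqI_lessThan)
  show "emeasure (density lborel (%x. ennreal (f x))) {x<..} < \<infinity>" for x
   using fin(1) by (simp add: emeasure_density)
  fix x
  have i: "integrable lborel (%t. indicator {x<..} t * f t)"
   using integrable_mult_indicator[OF _ f, of "{x<..}"] by simp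
  have e: "ennreal (indicator {x<..} t * f t) = ennreal (f t) * indicator {x<..} t"
   "ennreal (- (indicator {x<..} t * f t)) = ennreal (- f t) * indicator {x<..} t" for t
   by (auto simp: indicator_def)
  have "enn2real (\<integral>\<^sup>+ t. ennreal (f t) * indicator {x<..} t \<partial>lborel) =
   enn2real (\<integral>\<^sup>+ t. ennreal (- f t) * indicator {x<..} t \<partial>lborel)"
   using real_lebesgue_integral_def[OF i] 0[of x] unfolding e by simp
  then show "emeasure (density lborel (%x. ennreal (f x))) {x<..} = emeasure (density lborel (%x. ennreal (- f x))) {x<..}"
   using fin by (simp add: emeasure_density) (metis ennreal_enn2real infinity_ennreal_def)
 qed auto
 then have "AE x in lborel. ennreal (f x) = ennreal (- f x)"
  using fin(1)[of UNIV] by (intro finite_density_unique[THEN iffD1]) auto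
 \<comment> \<open>\<open>ennreal\<close> sends negative numbers to 0, so one side is 0 and then
   both are.\<close>
 then show ?thesis
 proof eventually_elim
  case (elim x)
  then show ?case by (cases "f x >= 0") (auto simp: ennreal_neg dest: sym)
 qed
qed

text \<open>Fundamental lemma of the calculus of variations: cut-offs of subintervals converge to
  the ray integrals that decide whether a function is 0.\<close>

lemma AE_zero_test:
 fixes f :: "real => complex"
 assumes f: "integrable (IM h) f"
  and 0: "!!ps :: real => real. test_function {-h<..<h} ps ==> (LINT z|IM h. ps z *\<^sub>R f z) = 0"
 shows "AE z in IM h. f z = 0"
proof -
 define f0 where "f0 t = indicator {-h<..<h} t *\<^sub>R f t" for t
 have i0: "integrable lborel f0" unfolding f0_def using f by (simp add: integrable_restrict_space)
 have z: "(LINT t|lborel. indicator {x<..} t *\<^sub>R f0 t) = 0" for x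
 proof -
  \<comment> \<open>Clipping at \<open>-h\<close> keeps the cut-offs supported in the interval;
    \<open>f0\<close> is 0 to the left of it anyway.\<close>
  define a where "a = max x (-h)"
  obtain rh :: "nat => real => real" where r: "!!n. test_function {a<..<h} (rh n)" "!!n x. 0 <= rh n x" "!!n x. rh n x <= 1"
   "!!x. (%n. rh n x) \<longlonglongrightarrow> indicator {a<..<h} x" using cutoff_sequence[of a h] by blast
  have t: "test_function {-h<..<h} (rh n)" for n
   using r(1)[of n] unfolding test_function_def a_def by (force)
  have "(%n. LINT z|IM h. rh n z *\<^sub>R f z) \<longlonglongrightarrow> (LINT z|IM h. indicator {a<..<h} z *\<^sub>R f z)"
  proof (rule integral_dominated_convergence[where w = "%z. norm (f z)"])
   show "(%z. indicator {a<..<h} z *\<^sub>R f z) \<in> borel_measurable (IM h)"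
    using integrable_IM_indicator[OF f, of "{a<..<h}"] by auto
   show "(%z. rh n z *\<^sub>R f z) \<in> borel_measurable (IM h)" for n using test_integrable[OF t f] by auto
   show "AE z in IM h. norm (rh n z *\<^sub>R f z) <= norm (f z)" for n
    using r(2,3)[of n] by (auto intro!: AE_I2 mult_left_le_one_le)
  qed (use r f in \<open>auto intro!: AE_I2 tendsto_intros\<close>)
  then have "(LINT z|IM h. indicator {a<..<h} z *\<^sub>R f z) = 0"
   using 0[OF t] by (simp add: LIMSEQ_const_iff)
  moreover have "(LINT z|IM h. indicator {a<..<h} z *\<^sub>R f z) = (LINT t|lborel. indicator {x<..} t *\<^sub>R f0 t)"
   by (simp add: integral_restrict_space f0_def)
    (intro Bochner_Integration.integral_cong, auto simp: indicator_def a_def)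
  ultimately show ?thesis by simp
 qed
 have ii: "integrable lborel (%t. indicator {x<..} t *\<^sub>R f0 t)" for x
  using integrable_mult_indicator[OF _ i0, of "{x<..}"] by simp
 have "AE x in lborel. Re (f0 x) = 0"
  by (rule AE_zero_real) (use i0 arg_cong[OF z, of Re] ii in \<open>auto simp flip: integral_Re\<close>)
 moreover have "AE x in lborel. Im (f0 x) = 0"
  by (rule AE_zero_real) (use i0 arg_cong[OF z, of Im] ii in \<open>auto simp flip: integral_Im\<close>)
 ultimately have "AE x in lborel. x \<in> {-h<..<h} --> f x = 0"
  by eventually_elim (auto simp: f0_def complex_eq_iff indicator_def split: if_splits)
 then show ?thesis by (simp add: AE_restrict_space_iff)
qed

text \<open>Zero mean makes the primitive that vanishes to the left of the support vanish to the
  right of it as well.\<close>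

lemma test_primitive:
 fixes et :: "real => real"
 assumes t: "test_function {-h<..<h} et" and 0: "(LINT z|IM h. et z) = 0" and h: "h > 0"
 obtains tht where "test_function {-h<..<h} tht" "deriv tht = et"
proof -
 obtain K where K: "compact K" "K \<subseteq> {-h<..<h}" "!!x. x \<notin> K ==> et x = 0" and s: "smooth et"
  using t by (auto simp: test_function_iff)
 \<comment> \<open>A closed interval strictly inside that contains the support; its ends lie halfway
   between the extreme points of \<open>K\<close> and the points \<open>-h\<close> and
   \<open>h\<close>.\<close>
 obtain a b where ab: "-h < a" "a < b" "b < h" "K \<subseteq> {a..b}"
 proof (cases "K = {}")
  case True then show ?thesis using that[of "-h/2" "h/2"] h by auto
 next
  case False
  obtain l u where "l \<in> K" "u \<in> K" "!!x. x \<in> K ==> l <= x \<and> x <= u"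
   using compact_attains_inf[OF K(1) False] compact_attains_sup[OF K(1) False] by metis
  then show ?thesis using K(2) that[of "(l + (-h))/2" "(u + h)/2"] by (force simp: subset_iff)
 qed
 have cont: "isCont et x" for x
  using test_continuous[OF t, of UNIV] by (simp add: continuous_on_eq_continuous_at)
 obtain \<Theta> where \<Theta>: "!!x. (\<Theta> has_vector_derivative et x) (at x)"
  using einterval_antiderivative[of "-\<infinity>" "\<infinity>" et] cont by auto
 define tht where "tht x = \<Theta> x - \<Theta> (-h)" for x
 have d: "(tht has_vector_derivative et x) (at x)" for x
  unfolding tht_def by (auto intro!: derivative_eq_intros \<Theta>)
 have dr: "(tht has_real_derivative et x) (at x)" for x
  using d by (simp add: has_real_derivative_iff_has_vector_derivative)
 have zero: "et x = 0" if "x \<notin> {a..b}" for x using K(3)[of x] ab(4) that by blast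
 have "AC h (%x. of_real (tht x)) (%x. of_real (et x))"
  by (rule AC_real[OF h]) (auto intro!: has_vector_derivative_of_real dr continuous_intros test_continuous[OF t])
 from AC_integral[OF this] h have "of_real (tht h) - of_real (tht (-h)) = (LINT x|IM h. complex_of_real (et x))"
  by simp
 then have thth: "tht h = 0" "tht (-h) = 0" using 0 by (auto simp: tht_def)
 have d0: "(tht has_derivative (%y. 0)) (at x)" if "x \<notin> {a..b}" for x
  using d[of x] zero[OF that] by (simp add: has_vector_derivative_def)
 have low: "tht x = 0" if "x < a" for x
 proof -
  have "tht x = tht (-h)"
   by (rule has_derivative_zero_unique_connected[of "{..<a}" tht, OF _ _ _ _ _ ])
    (use that ab in \<open>auto intro!: d0\<close>)
  then show ?thesis using thth by simp
 qed
 have up: "tht x = 0" if "x > b" for x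
 proof -
  have "tht x = tht h"
   by (rule has_derivative_zero_unique_connected[of "{b<..}" tht, OF _ _ _ _ _ ])
    (use that ab in \<open>auto intro!: d0\<close>)
  then show ?thesis using thth by simp
 qed
 have "test_function {-h<..<h} tht"
  unfolding test_function_iff
  by (intro conjI smooth_realI[OF d s] exI[of _ "{a..b}"]) (use ab low up in \<open>auto simp: not_le\<close>)
 moreover have "deriv tht = et" using dr DERIV_imp_deriv by blast
 ultimately show thesis using that by blast
qed

lemma test_normalized:
 assumes h: "h > 0"
 obtains ps :: "real => real" where "test_function {-h<..<h} ps" "(LINT z|IM h. ps z) = 1"
proof -
 obtain rh :: "nat => real => real" where r: "!!n. test_function {-h<..<h} (rh n)" "!!n x. 0 <= rh n x" "!!n x. rh n x <= 1"
  "!!x. (%n. rh n x) \<longlonglongrightarrow> indicator {-h<..<h} x" using cutoff_sequence[of "-h" h] by blast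
 have "(%n. LINT z|IM h. rh n z) \<longlonglongrightarrow> (LINT z|IM h. indicator {-h<..<h} z)"
  by (rule integral_dominated_convergence[where w = "%z. 1"])
   (use r in \<open>auto intro!: measurable_IM_borel test_measurable\<close>)
 also have "(LINT z|IM h. indicator {-h<..<h} z) = 2 * h"
  using h by (simp add: measure_restrict_space)
 finally have "\<forall>\<^sub>F n in sequentially. 0 < (LINT z|IM h. rh n z)"
  using h by (auto dest!: order_tendstoD(1)[of _ _ _ 0])
 then obtain n where n: "0 < (LINT z|IM h. rh n z)" by (auto simp: eventually_sequentially)
 define c where "c = (LINT z|IM h. rh n z)"
 have "test_function {-h<..<h} (%z. inverse c * rh n z)"
 proof -
  obtain K where "compact K" "K \<subseteq> {-h<..<h}" "\<forall>x. x \<notin> K --> rh n x = 0" "smooth (rh n)"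
   using r(1)[of n] unfolding test_function_iff by blast
  then show ?thesis
   unfolding test_function_iff by (intro conjI smooth_mult smooth_const exI[of _ K]) auto
 qed
 moreover have "(LINT z|IM h. inverse c * rh n z) = 1" using n by (simp add: c_def)
 ultimately show thesis using that by blast
qed

lemma test_lincomb:
 fixes ps ph :: "real => real"
 assumes "test_function U ps" "test_function U ph"
 shows "test_function U (%z. ps z + c * ph z)"
proof -
 obtain K L where "compact K" "K \<subseteq> U" "!!x. x \<notin> K ==> ps x = 0" "compact L" "L \<subseteq> U" "!!x. x \<notin> L ==> ph x = 0"
  and s: "smooth ps" "smooth ph" using assms by (auto simp: test_function_iff)
 then have "\<exists>K. compact K \<and> K \<subseteq> U \<and> (\<forall>x. x \<notin> K --> ps x + c * ph x = 0)"
  by (intro exI[of _ "K \<union> L"]) auto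
 moreover have "smooth (%z. ps z + c * ph z)"
  by (intro smooth_add smooth_mult smooth_const s)
 ultimately show ?thesis by (auto simp: test_function_iff)
qed

text \<open>The lemma of du Bois-Reymond. After subtraction of a primitive of \<open>g\<close>, the
  remainder \<open>u\<close> annihilates all derivatives of test functions, and every test function
  of mean zero is such a derivative; so \<open>u\<close> is constant.\<close>

lemma wd_imp_AC:
 assumes w: "wd h f g" and h: "h > 0"
 obtains F where "AC h F g" "AE z in IM h. f z = F z"
proof -
 have f: "integrable (IM h) f" and g: "integrable (IM h) g" using w by (auto simp: wd_def)
 have A: "AC h (J h g) g" using g by (auto simp: AC_def intro: exI[of _ 0])
 note wJ = AC_imp_wd[OF A h]
 have Ji: "integrable (IM h) (J h g)" using wJ by (simp add: wd_def)
 define u where "u z = f z - J h g z" for z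
 have ui: "integrable (IM h) u" unfolding u_def using f Ji by simp
 have u0: "(LINT z|IM h. deriv ps z *\<^sub>R u z) = 0" if t: "test_function {-h<..<h} ps" for ps
  using w wJ t unfolding wd_def u_def
  by (simp add: scaleR_diff_right test_integrable[OF test_deriv(2)[OF t]])
 obtain ps0 :: "real => real" where p0: "test_function {-h<..<h} ps0" "(LINT z|IM h. ps0 z) = 1"
  using test_normalized[OF h] .
 define c where "c = (LINT z|IM h. ps0 z *\<^sub>R u z)"
 have ti: "integrable (IM h) ps" if "test_function {-h<..<h} ps" for ps :: "real => real"
 proof -
  have "integrable (IM h) (%z. ps z *\<^sub>R (1::complex))" by (rule test_integrable[OF that]) auto
  from integrable_Re[OF this] show ?thesis by simp
 qed
 have "AE z in IM h. u z - c = 0"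
 proof (rule AE_zero_test)
  show "integrable (IM h) (%z. u z - c)" using ui by simp
  fix ps :: "real => real" assume t: "test_function {-h<..<h} ps"
  define m where "m = (LINT z|IM h. ps z)"
  \<comment> \<open>Removing the multiple \<open>m\<close> of the normalised \<open>ps0\<close>
    leaves a test function of mean zero, hence a derivative.\<close>
  define et where "et z = ps z + (- m) * ps0 z" for z
  have te: "test_function {-h<..<h} et" unfolding et_def by (rule test_lincomb[OF t p0(1)])
  have "(LINT z|IM h. et z) = 0" unfolding et_def using ti[OF t] ti[OF p0(1)] p0(2) by (simp add: m_def)
  then obtain tht where th: "test_function {-h<..<h} tht" "deriv tht = et"
   using test_primitive[OF te _ h] by blast
  have "(LINT z|IM h. et z *\<^sub>R u z) = 0" using u0[OF th(1)] th(2) by simp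
  then have "(LINT z|IM h. ps z *\<^sub>R u z) = m *\<^sub>R c"
   unfolding et_def c_def using test_integrable[OF t ui] test_integrable[OF p0(1) ui]
   by (simp add: scaleR_add_left scaleR_diff_left flip: scaleR_scaleR)
  then show "(LINT z|IM h. ps z *\<^sub>R (u z - c)) = 0"
   using test_integrable[OF t ui] ti[OF t] by (simp add: scaleR_diff_right m_def)
 qed
 then have "AE z in IM h. f z = c + J h g z" by (auto simp: u_def algebra_simps)
 moreover have "AC h (%z. c + J h g z) g" using g by (auto simp: AC_def)
 ultimately show thesis using that by blast
qed

section \<open>Fourier series on the period cell\<close>

lemma restrict_pair:
 assumes A: "A \<in> sets M" and B: "B \<in> sets N"
  and M: "sigma_finite_measure M" and N: "sigma_finite_measure N"
 shows "restrict_space M A \<Otimes>\<^sub>M restrict_space N B = restrict_space (M \<Otimes>\<^sub>M N) (A \<times> B)"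
proof (rule pair_measure_eqI)
 have AB: "A \<times> B \<in> sets (M \<Otimes>\<^sub>M N)" using A B by auto
 have AB': "A \<times> B \<inter> space (M \<Otimes>\<^sub>M N) \<in> sets (M \<Otimes>\<^sub>M N)" "A \<inter> space M \<in> sets M" "B \<inter> space N \<in> sets N"
  using A B by auto
 interpret N: sigma_finite_measure N by fact
 show "sigma_finite_measure (restrict_space M A)" "sigma_finite_measure (restrict_space N B)"
  by (auto intro: sigma_finite_measure_restrict_space assms)
 have id_meas: "(%p. (fst p, snd p)) \<in> measurable (restrict_space M A \<Otimes>\<^sub>M restrict_space N B) (M \<Otimes>\<^sub>M N)"
  by (intro measurable_Pair measurable_compose[OF measurable_fst] measurable_compose[OF measurable_snd]
    measurable_restrict_space1 measurable_ident_sets refl)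
 show "sets (restrict_space M A \<Otimes>\<^sub>M restrict_space N B) = sets (restrict_space (M \<Otimes>\<^sub>M N) (A \<times> B))"
 proof
  show "sets (restrict_space M A \<Otimes>\<^sub>M restrict_space N B) \<subseteq> sets (restrict_space (M \<Otimes>\<^sub>M N) (A \<times> B))"
   by (rule sets_pair_in_sets) (use A B AB' in \<open>auto simp: sets_restrict_space_iff\<close>)
  show "sets (restrict_space (M \<Otimes>\<^sub>M N) (A \<times> B)) \<subseteq> sets (restrict_space M A \<Otimes>\<^sub>M restrict_space N B)"
  proof
   fix S assume "S \<in> sets (restrict_space (M \<Otimes>\<^sub>M N) (A \<times> B))"
   then have S: "S \<in> sets (M \<Otimes>\<^sub>M N)" "S \<subseteq> A \<times> B" using AB' by (auto simp: sets_restrict_space_iff)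
   have "(%p. (fst p, snd p)) -` S \<inter> space (restrict_space M A \<Otimes>\<^sub>M restrict_space N B) = S"
    using S sets.sets_into_space[OF A] sets.sets_into_space[OF B]
    by (auto simp: space_pair_measure space_restrict_space)
   with measurable_sets[OF id_meas S(1)] show "S \<in> sets (restrict_space M A \<Otimes>\<^sub>M restrict_space N B)" by simp
  qed
 qed
 fix X Y assume "X \<in> sets (restrict_space M A)" "Y \<in> sets (restrict_space N B)"
 then have XY: "X \<in> sets M" "X \<subseteq> A" "Y \<in> sets N" "Y \<subseteq> B" using AB' by (auto simp: sets_restrict_space_iff)
 then have "X \<times> Y \<subseteq> A \<times> B" by auto
 then show "emeasure (restrict_space M A) X * emeasure (restrict_space N B) Y =
   emeasure (restrict_space (M \<Otimes>\<^sub>M N) (A \<times> B)) (X \<times> Y)"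
  using XY AB' by (simp add: emeasure_restrict_space N.emeasure_pair_measure_Times)
qed

lemma restrict_lborel_pair:
 fixes A :: "'a::euclidean_space set" and B :: "'b::euclidean_space set"
 assumes "A \<in> sets borel" "B \<in> sets borel"
 shows "restrict_space lborel A \<Otimes>\<^sub>M restrict_space lborel B = restrict_space lborel (A \<times> B)"
 using restrict_pair[of A lborel B lborel] assms by (simp add: lborel_prod sigma_finite_lborel)

text \<open>Sums over modes are integrals over the counting measure.\<close>

definition L2 :: "'a measure => ('a => complex) => bool" where
 "L2 M f \<longleftrightarrow> f \<in> borel_measurable M \<and> (\<integral>\<^sup>+ x. ennreal ((norm (f x))\<^sup>2) \<partial>M) < \<infinity>"

definition sqn :: "'a measure => ('a => complex) => ennreal" where
 "sqn M f = (\<integral>\<^sup>+ x. ennreal ((norm (f x))\<^sup>2) \<partial>M)"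

lemma L2_sqn: "L2 M f \<longleftrightarrow> f \<in> borel_measurable M \<and> sqn M f < \<infinity>"
 by (simp add: L2_def sqn_def)

lemma L2_meas [measurable_dest]: "L2 M f ==> f \<in> borel_measurable M"
 by (simp add: L2_def)

lemma norm_add_sq: "(norm (a + b :: 'a::real_normed_vector))\<^sup>2 <= 2 * (norm a)\<^sup>2 + 2 * (norm b)\<^sup>2"
proof -
 have "(norm (a + b))\<^sup>2 <= (norm a + norm b)\<^sup>2" by (intro power_mono norm_triangle_ineq) auto
 also have "... <= 2 * (norm a)\<^sup>2 + 2 * (norm b)\<^sup>2"
  using sum_squares_ge_zero[of "norm a - norm b" 0] by (simp add: power2_eq_square algebra_simps)
 finally show ?thesis .
qed

text \<open>A factor 2 replaces the triangle inequality for the norm; roots in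
  \<open>ennreal\<close> are avoided, and later estimates add squared norms in the same way.\<close>

lemma sqn_add:
 assumes [measurable]: "f \<in> borel_measurable M" "g \<in> borel_measurable M"
 shows "sqn M (%x. f x + g x) <= 2 * sqn M f + 2 * sqn M g"
proof -
 have "sqn M (%x. f x + g x) <= (\<integral>\<^sup>+ x. 2 * ennreal ((norm (f x))\<^sup>2) + 2 * ennreal ((norm (g x))\<^sup>2) \<partial>M)"
  unfolding sqn_def
  by (intro nn_integral_mono)
   (use norm_add_sq in \<open>auto simp flip: ennreal_plus ennreal_mult' ennreal_numeral intro!: ennreal_leI\<close>)
 also have "... = 2 * sqn M f + 2 * sqn M g"
  unfolding sqn_def by (simp add: nn_integral_add nn_integral_cmult)
 finally show ?thesis .
qed

lemma sqn_cmult: "sqn M (%x. c * f x) = ennreal ((norm c)\<^sup>2) * sqn M f" if [measurable]: "f \<in> borel_measurable M"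
 unfolding sqn_def by (simp add: norm_mult power_mult_distrib ennreal_mult nn_integral_cmult)

lemma sqn_uminus [simp]: "sqn M (%x. - f x) = sqn M f"
 by (simp add: sqn_def)

lemma sqn_cong_AE: "AE x in M. f x = g x ==> sqn M f = sqn M g"
 unfolding sqn_def by (rule nn_integral_cong_AE) auto

lemma sqn_cong: "(!!x. x \<in> space M ==> f x = g x) ==> sqn M f = sqn M g"
 unfolding sqn_def by (rule nn_integral_cong) auto

lemma sqn_mono: "(!!x. x \<in> space M ==> norm (f x) <= norm (g x)) ==> sqn M f <= sqn M g"
 unfolding sqn_def by (intro nn_integral_mono ennreal_leI power_mono) auto

lemma L2_add: "L2 M f ==> L2 M g ==> L2 M (%x. f x + g x)"
 unfolding L2_sqn
 by (auto intro!: le_less_trans[OF sqn_add] simp: ennreal_mult_less_top ennreal_add_eq_top less_top)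

lemma L2_cmult: "L2 M f ==> L2 M (%x. c * f x)"
 unfolding L2_sqn by (auto simp: sqn_cmult ennreal_mult_less_top)

lemma L2_uminus: "L2 M f ==> L2 M (%x. - f x)"
 using L2_cmult[of M f "-1"] by simp

lemma L2_diff: "L2 M f ==> L2 M g ==> L2 M (%x. f x - g x)"
 using L2_add[of M f "%x. - g x"] L2_uminus[of M g] by simp

lemma borel_measurable_cnj [measurable (raw)]:
 "f \<in> borel_measurable M ==> (%x. cnj (f x)) \<in> borel_measurable M"
 by (rule measurable_compose[of f M borel]) (auto intro!: borel_measurable_continuous_onI continuous_intros)

lemma L2_cnj: "L2 M f ==> L2 M (%x. cnj (f x))"
 unfolding L2_def by auto

lemma sqn_0 [simp]: "sqn M (%x. 0) = 0" by (simp add: sqn_def)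

lemma L2_0: "L2 M (%x. 0)"
 by (simp add: L2_sqn)

lemma L2_sum: "(!!i. i \<in> I ==> L2 M (f i)) ==> L2 M (%x. \<Sum>i\<in>I. f i x)"
 by (induction I rule: infinite_finite_induct) (auto intro: L2_0 L2_add)

lemma L2_integrable_sq: "L2 M f \<longleftrightarrow> f \<in> borel_measurable M \<and> integrable M (%x. (norm (f x))\<^sup>2)"
 by (auto simp: L2_def integrable_iff_bounded)

lemma sqn_eq_integral: "L2 M f ==> sqn M f = ennreal (LINT x|M. (norm (f x))\<^sup>2)"
 unfolding sqn_def by (rule nn_integral_eq_integral) (auto simp: L2_integrable_sq)

lemma young: "norm (a * b :: complex) <= (norm a)\<^sup>2 + (norm b)\<^sup>2"
proof -
 have "0 <= (norm a - norm b)\<^sup>2 + (norm a)\<^sup>2 + (norm b)\<^sup>2" by simp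
 then show ?thesis unfolding power2_diff norm_mult by (simp add: power2_eq_square)
qed

lemma L2_mult_integrable:
 assumes f: "L2 M f" and g: "L2 M g"
 shows "integrable M (%x. f x * g x)"
 by (rule Bochner_Integration.integrable_bound[of _ "%x. (norm (f x))\<^sup>2 + (norm (g x))\<^sup>2"])
  (use f g young in \<open>auto simp: L2_integrable_sq intro!: AE_I2\<close>)

lemma (in finite_measure) L2_const: "L2 M (%x. c)"
 by (simp add: L2_integrable_sq)

lemma (in finite_measure) L2_integrable: "L2 M f ==> integrable M f"
 using L2_mult_integrable[OF _ L2_const[of 1], of f] by simp

lemma (in finite_measure) L2_bounded:
 assumes "f \<in> borel_measurable M" "!!x. x \<in> space M ==> norm (f x) <= B"
 shows "L2 M f"
 unfolding L2_integrable_sq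
proof
 show "integrable M (%x. (norm (f x))\<^sup>2)"
  by (rule integrable_const_bound[of _ "B\<^sup>2"]) (use assms in \<open>auto intro!: AE_I2 power_mono\<close>)
qed (use assms in auto)

lemma L2_bounded_mult:
 assumes f: "L2 M f" and [measurable]: "g \<in> borel_measurable M" and B: "!!x. x \<in> space M ==> norm (g x) <= B"
 shows "L2 M (%x. g x * f x)" "sqn M (%x. g x * f x) <= ennreal (B\<^sup>2) * sqn M f"
proof -
 have [measurable]: "f \<in> borel_measurable M" using f by (simp add: L2_def)
 have "sqn M (%x. g x * f x) <= (\<integral>\<^sup>+ x. ennreal (B\<^sup>2) * ennreal ((norm (f x))\<^sup>2) \<partial>M)"
  unfolding sqn_def
  by (intro nn_integral_mono)
   (auto simp: norm_mult power_mult_distrib simp flip: ennreal_mult intro!: ennreal_leI mult_right_mono power_mono B)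
 also have "... = ennreal (B\<^sup>2) * sqn M f" unfolding sqn_def by (simp add: nn_integral_cmult)
 finally show le: "sqn M (%x. g x * f x) <= ennreal (B\<^sup>2) * sqn M f" .
 show "L2 M (%x. g x * f x)"
  unfolding L2_sqn using le_less_trans[OF le] f by (auto simp: L2_sqn ennreal_mult_less_top)
qed

lemma sqn_cauchy_schwarz:
 assumes f: "L2 M f" and g: "L2 M g"
 shows "ennreal ((norm (LINT x|M. f x * g x))\<^sup>2) <= sqn M f * sqn M g"
proof -
 have [measurable]: "f \<in> borel_measurable M" "g \<in> borel_measurable M" using f g by (auto simp: L2_def)
 have "ennreal (norm (LINT x|M. f x * g x)) <= (\<integral>\<^sup>+ x. ennreal (norm (f x)) * ennreal (norm (g x)) \<partial>M)"
  using integral_norm_bound_ennreal[OF L2_mult_integrable[OF f g]] by (simp add: norm_mult ennreal_mult)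
 then have "(ennreal (norm (LINT x|M. f x * g x)))\<^sup>2 <= (\<integral>\<^sup>+ x. ennreal (norm (f x)) * ennreal (norm (g x)) \<partial>M)\<^sup>2"
  by (intro power_mono) auto
 also have "... <= (\<integral>\<^sup>+ x. (ennreal (norm (f x)))\<^sup>2 \<partial>M) * (\<integral>\<^sup>+ x. (ennreal (norm (g x)))\<^sup>2 \<partial>M)"
  by (rule Cauchy_Schwarz_nn_integral) auto
 finally show ?thesis by (simp add: sqn_def ennreal_power)
qed

section \<open>Quasiperiodic exponentials on the cell\<close>

type_synonym mode = "int \<times> int"

abbreviation modes :: "mode measure" where "modes \<equiv> count_space UNIV"

text \<open>Collects the positivity of the cell dimensions; the sign of \<open>kk\<close> and the
  unique solvability of the modes appear later as explicit premises where they matter.\<close>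

locale grid =
 fixes D :: grating
 assumes per_x: "per_x D > 0" and per_y: "per_y D > 0" and hgt: "hgt D > 0"
begin

abbreviation dx where "dx \<equiv> per_x D"
abbreviation dy where "dy \<equiv> per_y D"
abbreviation h where "h \<equiv> hgt D"
abbreviation al :: "mode => real" where "al k \<equiv> alpha_p D (fst k)"
abbreviation be :: "mode => real" where "be k \<equiv> beta_q D (snd k)"
abbreviation XM where "XM \<equiv> restrict_space lborel {0<..<dx}"
abbreviation YM where "YM \<equiv> restrict_space lborel {0<..<dy}"
abbreviation GM where "GM \<equiv> restrict_space lborel (Gam D)"
abbreviation SM where "SM \<equiv> restrict_space lborel (S_v D)"
abbreviation HM where "HM \<equiv> IM h"

definition area :: real where "area = dx * dy"

lemma area: "area > 0" using per_x per_y by (simp add: area_def)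

lemma XY_GM: "XM \<Otimes>\<^sub>M YM = GM"
 unfolding Gam_def by (rule restrict_lborel_pair) auto

lemma XYZ_SM: "XM \<Otimes>\<^sub>M (YM \<Otimes>\<^sub>M HM) = SM"
 unfolding S_v_def by (subst restrict_lborel_pair, simp, simp, subst restrict_lborel_pair) (auto intro: borel_Times)

sublocale XM: finite_measure XM by (rule finite_measure_restrict_bounded) auto
sublocale YM: finite_measure YM by (rule finite_measure_restrict_bounded) auto
sublocale XY: pair_sigma_finite XM YM ..

sublocale GM: finite_measure GM
 unfolding Gam_def
 by (rule finite_measure_restrict_bounded) (auto intro!: bounded_Times borel_Times)

sublocale GI: pair_sigma_finite GM "HM" ..
sublocale YI: pair_sigma_finite YM "HM" ..
sublocale XYI: pair_sigma_finite XM "YM \<Otimes>\<^sub>M HM" by (intro pair_sigma_finite.intro) unfold_locales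

definition ex :: "mode => real \<times> real => complex" where
 "ex k p = exp (\<i> * of_real (al k * fst p + be k * snd p))"

text \<open>Scalar counterpart of \<open>fcoeff\<close>, indexed by pairs; \<open>hat_fc\<close>
  connects the two on slices.\<close>

definition fc :: "(real \<times> real => complex) => mode => complex" where
 "fc f k = (LINT p|GM. cnj (ex k p) * f p) / of_real area"

lemma ex_cnj: "cnj (ex k p) = exp (- \<i> * of_real (al k * fst p + be k * snd p))"
 by (simp add: ex_def exp_cnj)

lemma norm_ex [simp]: "norm (ex k p) = 1"
 by (simp add: ex_def norm_exp_eq_Re)

lemma ex_cont: "continuous_on S (ex k)"
 unfolding ex_def by (intro continuous_intros)

lemma ex_meas [measurable]: "ex k \<in> borel_measurable GM"
 by (intro measurable_restrict_space1) (simp add: borel_measurable_continuous_onI ex_cont)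

lemma measurable_GM_borel [measurable (raw)]:
 "f \<in> borel_measurable borel ==> f \<in> borel_measurable GM"
 by (rule measurable_restrict_space1) simp

lemma L2_ex: "L2 GM (ex k)"
 by (rule GM.L2_bounded[of _ 1]) auto

lemma exp_integral:
 fixes d c :: real
 assumes "d > 0" "c \<noteq> 0" "exp (\<i> * of_real (c * d)) = 1"
 shows "(LINT x|restrict_space lborel {0<..<d}. exp (\<i> * of_real (c * x))) = 0"
proof -
 have "(LINT x|restrict_space lborel {0<..<d}. exp (\<i> * of_real (c * x))) =
   (LBINT x:{0<..<d}. exp (\<i> * of_real (c * x)))"
  by (simp add: integral_restrict_space set_lebesgue_integral_def)
 also have "... = (LBINT x:{0..d}. exp (\<i> * of_real (c * x)))"
  unfolding set_lebesgue_integral_def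
  by (rule integral_cong_AE)
   (use AE_lborel_singleton[of 0] AE_lborel_singleton[of d] in \<open>auto simp: indicator_def
    intro!: borel_measurable_scaleR borel_measurable_continuous_onI continuous_intros borel_measurable_indicator\<close>)
 also have "... = integral {0..d} (%x. exp (\<i> * of_real (c * x)))"
  by (intro set_borel_integral_eq_integral borel_integrable_atLeastAtMost' continuous_intros)
 also have "... = exp (\<i> * of_real (c * d)) / (\<i> * of_real c) - exp (\<i> * of_real (c * 0)) / (\<i> * of_real c)"
 proof (rule integral_unique, rule fundamental_theorem_of_calculus)
  fix x
  have "((%z. exp (\<i> * (of_real c * z)) / (\<i> * of_real c)) has_field_derivative exp (\<i> * of_real (c * x))) (at (of_real x))"
   using assms by (auto intro!: derivative_eq_intros simp: complex_eq_iff)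
  from has_vector_derivative_real_field[OF this]
  show "((%x. exp (\<i> * of_real (c * x)) / (\<i> * of_real c)) has_vector_derivative exp (\<i> * of_real (c * x))) (at x within {0..d})"
   by simp
 qed (use assms in auto)
 finally show ?thesis using assms by simp
qed

lemma exp_int_period: "d > 0 ==> exp (\<i> * of_real (2 * pi / d * of_int n * d)) = 1"
proof -
 assume "d > 0"
 then have "\<i> * of_real (2 * pi / d * of_int n * d) = of_int n * (of_real pi * 2 * \<i>)" by simp
 moreover have "exp (of_int n * (of_real pi * 2 * \<i>)) = 1"
  using exp_integer_2pi[of "of_int n"] by (simp add: mult.commute mult.left_commute)
 ultimately show ?thesis by metis
qed

lemma emeasure_GM: "measure GM (Gam D) = area"
proof -
 have "emeasure (lborel \<Otimes>\<^sub>M lborel) ({0<..<dx} \<times> {0<..<dy}) = ennreal dx * ennreal dy"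
  using per_x per_y by (subst lborel.emeasure_pair_measure_Times) auto
 then have "emeasure lborel (Gam D) = ennreal area"
  using per_x unfolding area_def Gam_def by (simp add: lborel_prod ennreal_mult')
 moreover have "Gam D \<in> sets borel" unfolding Gam_def by (rule borel_Times) auto
 ultimately show ?thesis
  using area by (simp add: measure_def emeasure_restrict_space)
qed

lemma ex_orthogonal: "(LINT p|GM. ex k p * cnj (ex l p)) = (if k = l then of_real area else 0)"
proof (cases "k = l")
 case True
 have "ex k p * cnj (ex k p) = 1" for p using complex_norm_square[of "ex k p"] by simp
 with True show ?thesis by (simp add: emeasure_GM scaleR_conv_of_real)
next
 case False
 \<comment> \<open>The shifts \<open>alpha D\<close> and \<open>beta D\<close> cancel in the
   product, leaving whole multiples of the base frequencies.\<close>
 define a where "a = 2 * pi / dx * of_int (fst k - fst l)"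
 define b where "b = 2 * pi / dy * of_int (snd k - snd l)"
 have e: "ex k p * cnj (ex l p) = exp (\<i> * of_real (a * fst p)) * exp (\<i> * of_real (b * snd p))" for p
  unfolding ex_cnj unfolding ex_def a_def b_def exp_add[symmetric] alpha_p_def beta_q_def
  by (rule arg_cong[of _ _ exp]) (simp add: algebra_simps diff_divide_distrib)
 have "(LINT p|GM. ex k p * cnj (ex l p)) =
   (LINT x|XM. LINT y|YM. exp (\<i> * of_real (a * x)) * exp (\<i> * of_real (b * y)))"
 proof -
  have i: "integrable (XM \<Otimes>\<^sub>M YM) (%p. ex k p * cnj (ex l p))"
   unfolding XY_GM by (intro L2_mult_integrable L2_cnj L2_ex)
  from XY.integral_fst'[OF this] show ?thesis unfolding XY_GM by (simp add: e)
 qed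
 also have "... = (LINT x|XM. exp (\<i> * of_real (a * x))) * (LINT y|YM. exp (\<i> * of_real (b * y)))"
  by simp
 also have "... = 0"
 proof (cases "fst k = fst l")
  case True
  with False have "b \<noteq> 0" using per_y by (auto simp: b_def prod_eq_iff)
  then show ?thesis
   using exp_integral[OF per_y, of b] exp_int_period[OF per_y, of "snd k - snd l"] by (simp add: b_def)
 next
  case False
  then have "a \<noteq> 0" using per_x by (auto simp: a_def)
  then show ?thesis
   using exp_integral[OF per_x, of a] exp_int_period[OF per_x, of "fst k - fst l"] by (simp add: a_def)
 qed
 finally show ?thesis using False by simp
qed

section \<open>Density of trigonometric polynomials in L2\<close>

definition trig :: "(real \<times> real => complex) => bool" where
 "trig t \<longleftrightarrow> (\<exists>K c. finite K \<and> t = (%p. \<Sum>k\<in>K. c k * ex k p))"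

lemma trig_L2: "trig t ==> L2 GM t"
 unfolding trig_def by (auto intro!: L2_sum L2_cmult L2_ex)

lemma trig_ex: "trig (%p. c * ex k p)"
 unfolding trig_def by (intro exI[of _ "{k}"] exI[of _ "%_. c"]) auto

lemma trig_0: "trig (%p. 0)"
 unfolding trig_def by (intro exI[of _ "{}"]) auto

lemma trig_add: "trig s ==> trig t ==> trig (%p. s p + t p)"
proof -
 assume "trig s" "trig t"
 then obtain K c L d where *: "finite K" "s = (%p. \<Sum>k\<in>K. c k * ex k p)" "finite L" "t = (%p. \<Sum>k\<in>L. d k * ex k p)"
  unfolding trig_def by blast
 define b where "b k = (if k \<in> K then c k else 0) + (if k \<in> L then d k else 0)" for k
 have "(%p. s p + t p) = (%p. \<Sum>k\<in>K \<union> L. b k * ex k p)"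
 proof
  fix p
  have "(\<Sum>k\<in>K. c k * ex k p) = (\<Sum>k\<in>K \<union> L. (if k \<in> K then c k else 0) * ex k p)"
   by (rule sum.mono_neutral_cong_left) (use * in auto)
  moreover have "(\<Sum>k\<in>L. d k * ex k p) = (\<Sum>k\<in>K \<union> L. (if k \<in> L then d k else 0) * ex k p)"
   by (rule sum.mono_neutral_cong_left) (use * in auto)
  ultimately show "s p + t p = (\<Sum>k\<in>K \<union> L. b k * ex k p)"
   unfolding * b_def distrib_right sum.distrib by simp
 qed
 then show ?thesis unfolding trig_def using * by (intro exI[of _ "K \<union> L"] exI[of _ b]) auto
qed

lemma trig_sum: "(!!i. i \<in> I ==> trig (t i)) ==> trig (%p. \<Sum>i\<in>I. t i p)"
 by (induction I rule: infinite_finite_induct) (auto intro: trig_0 trig_add)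

lemma trig_cmult: "trig t ==> trig (%p. c * t p)"
 unfolding trig_def
proof safe
 fix K :: "mode set" and b assume "finite K"
 then show "\<exists>K' b'. finite K' \<and> (%p. c * (\<Sum>k\<in>K. b k * ex k p)) = (%p. \<Sum>k\<in>K'. b' k * ex k p)"
  by (intro exI[of _ K] exI[of _ "%k. c * b k"]) (auto simp: sum_distrib_left mult.assoc)
qed

text \<open>Periodic characters: products with them permute the quasiperiodic exponentials.\<close>

definition pex :: "mode => real \<times> real => complex" where
 "pex k p = exp (\<i> * of_real (2 * pi / dx * of_int (fst k) * fst p + 2 * pi / dy * of_int (snd k) * snd p))"

lemma pex_ex: "pex k p * ex l p = ex (k + l) p"
 unfolding pex_def ex_def exp_add[symmetric] alpha_p_def beta_q_def
 by (rule arg_cong[of _ _ exp]) (simp add: algebra_simps add_divide_distrib)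

lemma trig_pex: "trig t ==> trig (%p. pex k p * t p)"
proof -
 assume "trig t"
 then obtain K c where *: "finite K" "t = (%p. \<Sum>k\<in>K. c k * ex k p)"
  unfolding trig_def by blast
 have "(%p. pex k p * t p) = (%p. \<Sum>l\<in>K. c l * ex (k + l) p)"
  unfolding * sum_distrib_left by (simp add: mult.left_commute pex_ex)
 then show ?thesis by (simp add: trig_sum trig_ex)
qed

text \<open>The cell as a subset of the torus. There Stone-Weierstrass gives uniform approximation
  by real polynomials, and \<open>trig_poly\<close> turns these into trigonometric ones.\<close>

definition cir :: "real \<times> real => complex \<times> complex" where
 "cir p = (pex (1, 0) p, pex (0, 1) p)"

lemma cir_alt: "cir p = (cis (2 * pi / dx * fst p), cis (2 * pi / dy * snd p))"
 by (simp add: cir_def pex_def cis_conv_exp)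

lemma cir_cont: "continuous_on S cir"
 unfolding cir_def pex_def by (intro continuous_intros)

text \<open>The cell is open, so the opposite faces, which the torus identifies, are absent.\<close>

lemma cir_inj: "inj_on cir (Gam D)"
proof (rule inj_onI)
 fix p q assume pq: "p \<in> Gam D" "q \<in> Gam D" and eq: "cir p = cir q"
 have *: "x = y" if "0 < x" "x < d" "0 < y" "y < d" "cis (2 * pi / d * x) = cis (2 * pi / d * y)" for x y d :: real
 proof -
  have "Arg2pi (cis (2 * pi / d * x)) = 2 * pi / d * x"
   using that Arg2pi_unique[of 1 "2 * pi / d * x"] by (simp add: cis_conv_exp field_simps)
  moreover have "Arg2pi (cis (2 * pi / d * y)) = 2 * pi / d * y"
   using that Arg2pi_unique[of 1 "2 * pi / d * y"] by (simp add: cis_conv_exp field_simps)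
  ultimately have "2 * pi / d * x = 2 * pi / d * y" using that(5) by metis
  then show ?thesis using that by simp
 qed
 have "fst p = fst q" by (rule *[of _ dx]) (use pq eq in \<open>auto simp: Gam_def cir_alt\<close>)
 moreover have "snd p = snd q" by (rule *[of _ dy]) (use pq eq in \<open>auto simp: Gam_def cir_alt\<close>)
 ultimately show "p = q" by (simp add: prod_eq_iff)
qed

text \<open>A real-linear function on the torus combines the real and imaginary parts of two
  characters, hence four characters; multiplication by a character only shifts the modes. Sums and
  products then follow by induction.\<close>

lemma trig_poly:
 assumes "real_polynomial_function g"
 shows "trig t ==> trig (%p. of_real (g (cir p)) * t p)"
 using assms
proof (induction g arbitrary: t rule: real_polynomial_function.induct)
 case (linear f)
 note tr = linear(2)
 interpret bounded_linear f by fact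
 have f: "f (z, w) = Re z * f (1, 0) + Im z * f (\<i>, 0) + Re w * f (0, 1) + Im w * f (0, \<i>)" for z w
 proof -
  have "(z, w) = Re z *\<^sub>R (1, 0) + Im z *\<^sub>R (\<i>, 0) + Re w *\<^sub>R (0, 1) + Im w *\<^sub>R (0, \<i>)"
   by (auto simp: complex_eq_iff)
  then show ?thesis by (simp only: add scaleR) simp
 qed
 have c: "cnj (pex k p) = pex (- k) p" for k p
  by (simp add: pex_def exp_cnj algebra_simps)
 have re: "complex_of_real (Re (pex k p)) = (pex k p + pex (-k) p) / 2" for k p
  unfolding c[symmetric] by (simp add: complex_eq_iff)
 have im: "complex_of_real (Im (pex k p)) = (pex k p - pex (-k) p) / (2 * \<i>)" for k p
  unfolding c[symmetric] by (simp add: complex_eq_iff)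
 obtain a b c' d where "complex_of_real (f (cir p)) =
   a * pex (1,0) p + b * pex (-(1,0)) p + c' * pex (0,1) p + d * pex (-(0,1)) p" for p
 proof
  show "complex_of_real (f (cir p)) =
   (f (1,0) / 2 + f (\<i>,0) / (2 * \<i>)) * pex (1,0) p + (f (1,0) / 2 - f (\<i>,0) / (2 * \<i>)) * pex (-(1,0)) p +
   (f (0,1) / 2 + f (0,\<i>) / (2 * \<i>)) * pex (0,1) p + (f (0,1) / 2 - f (0,\<i>) / (2 * \<i>)) * pex (-(0,1)) p" for p
   unfolding cir_def f[of "pex (1,0) p" "pex (0,1) p"] of_real_add of_real_mult re im
   by (simp add: algebra_simps add_divide_distrib diff_divide_distrib)
 qed
 then have "(%p. of_real (f (cir p)) * t p) = (%p. a * (pex (1,0) p * t p) + b * (pex (-(1,0)) p * t p) +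
   c' * (pex (0,1) p * t p) + d * (pex (-(0,1)) p * t p))"
  by (simp add: algebra_simps)
 then show ?case using tr by (auto intro!: trig_add trig_cmult trig_pex)
next
 case (const c)
 then show ?case by (auto intro: trig_cmult)
next
 case (add f g)
 show ?case using trig_add[OF add.IH(1)[OF add.prems] add.IH(2)[OF add.prems]] by (simp add: distrib_right)
next
 case (mult f g)
 show ?case using mult.IH(1)[OF mult.IH(2)[OF mult.prems]] by (simp add: mult.assoc)
qed

text \<open>Membership of a single function in the closure of the trigonometric polynomials. As a
  property of functions it can be carried from continuous functions to compact sets, Borel sets and
  simple functions.\<close>

definition dense :: "(real \<times> real => complex) => bool" where
 "dense f \<longleftrightarrow> L2 GM f \<and> (\<forall>ep::real. ep > 0 --> (\<exists>t. trig t \<and> sqn GM (%p. f p - t p) < ennreal ep))"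

lemma dense_approx:
 assumes f: "L2 GM f" and g: "!!ep::real. ep > 0 ==> \<exists>g. dense g \<and> sqn GM (%p. f p - g p) < ennreal ep"
 shows "dense f"
 unfolding dense_def
proof (intro conjI allI impI)
 fix ep :: real assume e: "ep > 0"
 obtain g where g: "dense g" "sqn GM (%p. f p - g p) < ennreal (ep / 4)"
  using g[of "ep / 4"] e by auto
 then obtain t where t: "trig t" "sqn GM (%p. g p - t p) < ennreal (ep / 4)"
  using e unfolding dense_def by (meson divide_pos_pos zero_less_numeral)
 have "sqn GM (%p. (f p - g p) + (g p - t p)) <= 2 * sqn GM (%p. f p - g p) + 2 * sqn GM (%p. g p - t p)"
  by (rule sqn_add) (use f g(1) trig_L2[OF t(1)] in \<open>auto simp: dense_def L2_def\<close>)
 also have "... < 2 * ennreal (ep / 4) + 2 * ennreal (ep / 4)"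
  using g t by (intro add_strict_mono ennreal_mult_strict_left_mono) auto
 also have "... = ennreal ep"
  using e by (simp flip: ennreal_plus ennreal_mult' ennreal_numeral)
 finally show "\<exists>t. trig t \<and> sqn GM (%p. f p - t p) < ennreal ep" using t(1) by auto
qed fact

lemma dense_add:
 assumes f: "dense f" and g: "dense g" shows "dense (%p. f p + g p)"
 unfolding dense_def
proof (intro conjI allI impI)
 show "L2 GM (%p. f p + g p)" using f g by (auto simp: dense_def intro: L2_add)
 fix ep :: real assume e: "ep > 0"
 then have e4: "ep / 4 > 0" by simp
 obtain s t where st: "trig s" "sqn GM (%p. f p - s p) < ennreal (ep / 4)" "trig t" "sqn GM (%p. g p - t p) < ennreal (ep / 4)"
  using f g e4 unfolding dense_def by metis
 have m: "(%p. f p - s p) \<in> borel_measurable GM" "(%p. g p - t p) \<in> borel_measurable GM"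
  using f g trig_L2[OF st(1)] trig_L2[OF st(3)] unfolding dense_def L2_def by auto
 have "sqn GM (%p. (f p + g p) - (s p + t p)) <= 2 * sqn GM (%p. f p - s p) + 2 * sqn GM (%p. g p - t p)"
  using sqn_add[OF m] by (simp add: algebra_simps)
 also have "... < 2 * ennreal (ep / 4) + 2 * ennreal (ep / 4)"
  using st by (intro add_strict_mono ennreal_mult_strict_left_mono) auto
 also have "... = ennreal ep"
  using e by (simp flip: ennreal_plus ennreal_mult' ennreal_numeral)
 finally show "\<exists>t. trig t \<and> sqn GM (%p. f p + g p - t p) < ennreal ep" using trig_add[OF st(1,3)] by blast
qed

lemma dense_cmult:
 assumes f: "dense f" shows "dense (%p. c * f p)"
proof (cases "c = 0")
 case True
 then show ?thesis unfolding dense_def using trig_0 by (auto simp: L2_0 intro: exI[of _ "%p. 0"])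
next
 case False
 show ?thesis unfolding dense_def
 proof (intro conjI allI impI)
  show "L2 GM (%p. c * f p)" using f by (auto simp: dense_def intro: L2_cmult)
  fix ep :: real assume e: "ep > 0"
  then have "ep / (norm c)\<^sup>2 > 0" using False by simp
  then obtain t where t: "trig t" "sqn GM (%p. f p - t p) < ennreal (ep / (norm c)\<^sup>2)"
   using f unfolding dense_def by metis
  have "sqn GM (%p. c * (f p - t p)) = ennreal ((norm c)\<^sup>2) * sqn GM (%p. f p - t p)"
   by (rule sqn_cmult) (use f trig_L2[OF t(1)] in \<open>auto simp: dense_def L2_def\<close>)
  also have "... < ennreal ((norm c)\<^sup>2) * ennreal (ep / (norm c)\<^sup>2)"
   using t False by (intro ennreal_mult_strict_left_mono) auto
  also have "... = ennreal ep" using False by (simp flip: ennreal_mult')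
  finally show "\<exists>t. trig t \<and> sqn GM (%p. c * f p - t p) < ennreal ep"
   using trig_cmult[OF t(1), of c] by (auto simp: algebra_simps)
 qed
qed

lemma dense_uminus: "dense f ==> dense (%p. - f p)"
 using dense_cmult[of f "-1"] by simp

lemma dense_diff: "dense f ==> dense g ==> dense (%p. f p - g p)"
 using dense_add[of f "%p. - g p"] dense_uminus[of g] by simp

lemma trig_dense: "trig t ==> dense t"
 unfolding dense_def using trig_L2 by (auto intro!: exI[of _ t])

text \<open>The bound \<open>w\<close> for the squared approximants also bounds the squared limit,
  hence \<open>4 * w\<close> bounds the squared differences, and dominated convergence gives
  convergence in the mean.\<close>

lemma dense_limit:
 assumes f: "!!n. dense (f n)" and g: "g \<in> borel_measurable GM"
  and w: "integrable GM w" and lim: "!!p. p \<in> Gam D ==> (%n. f n p) \<longlonglongrightarrow> g p"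
  and bound: "!!n p. p \<in> Gam D ==> (norm (f n p))\<^sup>2 <= w p"
 shows "dense g"
proof (rule dense_approx)
 have fm [measurable]: "f n \<in> borel_measurable GM" for n using f by (auto simp: dense_def L2_def)
 note [measurable] = g
 have gb: "(norm (g p))\<^sup>2 <= w p" if "p \<in> Gam D" for p
  by (rule LIMSEQ_le_const2[OF tendsto_power[OF tendsto_norm[OF lim[OF that]]]]) (use bound that in auto)
 show gL: "L2 GM g"
  unfolding L2_integrable_sq
 proof
  show "integrable GM (%p. (norm (g p))\<^sup>2)"
   by (rule Bochner_Integration.integrable_bound[OF w]) (use gb in \<open>auto intro!: AE_I2 order_trans[OF gb]\<close>)
 qed fact
 have "(%n. LINT p|GM. (norm (g p - f n p))\<^sup>2) \<longlonglongrightarrow> (LINT p|GM. 0)"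
 proof (rule integral_dominated_convergence[where w = "%p. 4 * w p"])
  show "AE p in GM. (%n. (norm (g p - f n p))\<^sup>2) \<longlonglongrightarrow> 0"
  proof (rule AE_I2)
   fix p assume "p \<in> space GM"
   then have "(%n. (norm (g p - f n p))\<^sup>2) \<longlonglongrightarrow> (norm (g p - g p))\<^sup>2" by (intro tendsto_intros lim) simp
   then show "(%n. (norm (g p - f n p))\<^sup>2) \<longlonglongrightarrow> 0" by simp
  qed
  show "AE p in GM. norm ((norm (g p - f n p))\<^sup>2) <= 4 * w p" for n
  proof (rule AE_I2)
   fix p assume "p \<in> space GM"
   then show "norm ((norm (g p - f n p))\<^sup>2) <= 4 * w p"
    using norm_add_sq[of "g p" "- f n p"] gb[of p] bound[of p n] by simp
  qed
 qed (use w in auto)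
 then have lim0: "(%n. LINT p|GM. (norm (g p - f n p))\<^sup>2) \<longlonglongrightarrow> 0" by simp
 fix ep :: real assume "ep > 0"
 from order_tendstoD(2)[OF lim0 this] obtain n where n: "(LINT p|GM. (norm (g p - f n p))\<^sup>2) < ep"
  by (auto simp: eventually_sequentially)
 have "sqn GM (%p. g p - f n p) = ennreal (LINT p|GM. (norm (g p - f n p))\<^sup>2)"
  by (rule sqn_eq_integral) (use gL f[of n] in \<open>auto simp: dense_def intro: L2_diff\<close>)
 then show "\<exists>f. dense f \<and> sqn GM (%p. g p - f p) < ennreal ep"
  using f n \<open>ep > 0\<close> by (auto simp: ennreal_less_iff intro!: exI[of _ "f n"])
qed

lemma dense_continuous:
 fixes g :: "complex \<times> complex => real"
 assumes g: "continuous_on UNIV g"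
 shows "dense (%p. of_real (g (cir p)) * ex 0 p)"
proof (rule dense_approx)
 have m: "(%p. of_real (g (cir p)) * ex 0 p) \<in> borel_measurable GM"
  by (intro measurable_GM_borel borel_measurable_continuous_onI continuous_intros ex_cont
    continuous_on_compose2[OF g] cir_cont) auto
 have c: "compact (sphere (0::complex) 1 \<times> sphere (0::complex) 1)" by (intro compact_Times) auto
 have cirS: "cir p \<in> sphere 0 1 \<times> sphere 0 1" for p by (simp add: cir_alt)
 have cg: "continuous_on (sphere (0::complex) 1 \<times> sphere (0::complex) 1) g"
  using g continuous_on_subset by blast
 then have "bounded (g ` (sphere 0 1 \<times> sphere 0 1))"
  by (intro compact_imp_bounded compact_continuous_image c)
 then obtain B where B: "!!z. z \<in> sphere 0 1 \<times> sphere 0 1 ==> norm (g z) <= B" by (auto simp: bounded_iff)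
 show "L2 GM (%p. of_real (g (cir p)) * ex 0 p)"
  by (rule GM.L2_bounded[OF m, of B]) (use B[OF cirS] in \<open>auto simp: norm_mult\<close>)
 fix ep :: real assume e: "ep > 0"
 \<comment> \<open>A uniform error \<open>et\<close> contributes
   \<open>et\<^sup>2 * area = ep / 2\<close> to the squared norm.\<close>
 define et where "et = sqrt (ep / (2 * area))"
 have eta: "et > 0" "et\<^sup>2 = ep / (2 * area)" using e area by (auto simp: et_def)
 obtain q where q: "real_polynomial_function q" "!!z. z \<in> sphere 0 1 \<times> sphere 0 1 ==> \<bar>g z - q z\<bar> < et"
  using Stone_Weierstrass_real_polynomial_function[OF c cg eta(1)] by blast
 define t where "t p = of_real (q (cir p)) * ex 0 p" for p
 have t: "trig t" unfolding t_def using trig_poly[OF q(1) trig_ex[of 1 0]] by simp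
 have "sqn GM (%p. of_real (g (cir p)) * ex 0 p - t p) <= (\<integral>\<^sup>+ p. ennreal (et\<^sup>2) \<partial>GM)"
  unfolding sqn_def
 proof (intro nn_integral_mono ennreal_leI)
  fix p
  have "norm (of_real (g (cir p)) * ex 0 p - t p) = \<bar>g (cir p) - q (cir p)\<bar>"
   unfolding t_def left_diff_distrib[symmetric] norm_mult by (simp flip: of_real_diff)
  then show "(norm (of_real (g (cir p)) * ex 0 p - t p))\<^sup>2 <= et\<^sup>2"
   using q(2)[OF cirS[of p]] by (metis abs_ge_zero less_imp_le power_mono)
 qed
 also have "... = ennreal (ep / 2)"
  using area e by (simp add: eta GM.emeasure_eq_measure emeasure_GM flip: ennreal_mult')
 also have "... < ennreal ep" using e by (simp add: ennreal_lessI)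
 finally show "\<exists>f. dense f \<and> sqn GM (%p. of_real (g (cir p)) * ex 0 p - f p) < ennreal ep"
  using trig_dense[OF t] by blast
qed

text \<open>Continuous functions of the distance to the image of \<open>K\<close> on the torus
  decrease to its indicator; injectivity on the cell keeps points outside \<open>K\<close> away from
  that image.\<close>

lemma dense_compact:
 assumes K: "compact K" "K \<subseteq> Gam D"
 shows "dense (%p. of_real (indicator K p) * ex 0 p)"
proof (cases "K = {}")
 case True
 then show ?thesis using trig_dense[OF trig_0] by simp
next
 case False
 define g where "g n z = max 0 (1 - real n * infdist z (cir ` K))" for n z
 have gc: "continuous_on UNIV (g n)" for n unfolding g_def by (intro continuous_intros)
 have gb: "0 <= g n z" "g n z <= 1" for n z by (auto simp: g_def infdist_nonneg)
 show ?thesis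
 proof (rule dense_limit[OF dense_continuous[OF gc], where w = "%_. 1"])
  show "(%p. of_real (indicator K p) * ex 0 p) \<in> borel_measurable GM"
  proof -
   have [measurable]: "K \<in> sets borel" using borel_compact[OF K(1)] .
   show ?thesis by (intro borel_measurable_times ex_meas measurable_GM_borel) measurable
  qed
  show "(norm (complex_of_real (g n (cir p)) * ex 0 p))\<^sup>2 <= 1" for n p
   using gb[of n "cir p"] by (simp add: norm_mult power_le_one)
  fix p assume p: "p \<in> Gam D"
  have "(%n. g n (cir p)) \<longlonglongrightarrow> indicator K p"
  proof (cases "p \<in> K")
   case True
   then show ?thesis by (simp add: g_def)
  next
   case False
   have cl: "closed (cir ` K)" by (intro compact_imp_closed compact_continuous_image cir_cont K)
   have "cir p \<notin> cir ` K" using cir_inj p K(2) False by (auto simp: inj_on_def)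
   then have pos: "infdist (cir p) (cir ` K) > 0"
    using in_closed_iff_infdist_zero[OF cl, of "cir p"] \<open>K \<noteq> {}\<close> infdist_nonneg[of "cir p" "cir ` K"] by auto
   obtain N where N: "1 / infdist (cir p) (cir ` K) < real N" using reals_Archimedean2 by blast
   have "\<forall>\<^sub>F n in sequentially. g n (cir p) = 0"
    unfolding eventually_sequentially
   proof (intro exI allI impI)
    fix n assume "N <= n"
    then have "1 / infdist (cir p) (cir ` K) < real n" using N by linarith
    then show "g n (cir p) = 0" using pos by (simp add: g_def field_simps)
   qed
   then show ?thesis using False by (simp add: tendsto_eventually)
  qed
  then show "(%n. complex_of_real (g n (cir p)) * ex 0 p) \<longlonglongrightarrow> of_real (indicator K p) * ex 0 p"
   by (intro tendsto_intros)
 qed auto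
qed

lemma Gam_borel [measurable]: "Gam D \<in> sets borel"
 unfolding Gam_def by (rule borel_Times) auto

text \<open>Induction over complements and disjoint unions, starting from the boxes, which are
  stable under intersection.\<close>

lemma dense_borel:
 assumes A: "A \<in> sets borel"
 shows "dense (%p. of_real (indicator (A \<inter> Gam D) p) * ex 0 p)"
proof -
 define G where "G = range (%(a, b). box a b :: (real \<times> real) set)"
 have st: "Int_stable G"
  unfolding Int_stable_def G_def by (auto simp: box_Int_box)
 have gen: "sets borel = sigma_sets UNIV G"
  unfolding G_def borel_eq_box by simp
 have full: "dense (%p. of_real (indicator (Gam D) p) * ex 0 p)"
  by (rule dense_limit[where f = "%n. ex 0" and w = "%_. 1"])
   (use trig_dense[OF trig_ex[of 1 0]] in auto)
 have A': "A \<in> sigma_sets UNIV G" using A gen by simp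
 have GP: "G \<subseteq> Pow UNIV" by simp
 from st GP A' show ?thesis
 proof (induction rule: sigma_sets_induct_disjoint)
  case (basic A)
  then obtain a b :: "real \<times> real" where A: "A = box a b" by (auto simp: G_def)
  define e where "e n = 1 / real (Suc n)" for n
  have e0: "e n > 0" for n by (simp add: e_def)
  \<comment> \<open>Closed boxes that exhaust the part of the open box inside the cell; the margin
    \<open>e n\<close> keeps them off the faces.\<close>
  define K where "K n = cbox (max (fst a) 0 + e n, max (snd a) 0 + e n)
   (min (fst b) dx - e n, min (snd b) dy - e n)" for n
  have K: "compact (K n)" for n unfolding K_def by (rule compact_cbox)
  have Apair: "(x, y) \<in> A \<longleftrightarrow> fst a < x \<and> x < fst b \<and> snd a < y \<and> y < snd b" for x y
   unfolding A mem_box Basis_prod_def by (cases a; cases b) auto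
  have KG: "K n \<subseteq> Gam D" for n
  proof
   fix p assume "p \<in> K n"
   with e0[of n] show "p \<in> Gam D"
    by (cases p) (auto simp: K_def Gam_def cbox_Pair_eq)
  qed
  show ?case
  proof (rule dense_limit[OF dense_compact[OF K KG], where w = "%_. 1"])
   show "(%p. complex_of_real (indicator (A \<inter> Gam D) p) * ex 0 p) \<in> borel_measurable GM"
    unfolding A by measurable
   fix p assume p: "p \<in> Gam D"
   obtain x y where xy: "p = (x, y)" by (cases p)
   have pos: "0 < x" "x < dx" "0 < y" "y < dy" using p by (auto simp: Gam_def xy)
   have li: "(%n. e n) \<longlonglongrightarrow> 0" unfolding e_def by (rule LIMSEQ_Suc[OF lim_1_over_n])
   have ev: "\<forall>\<^sub>F n in sequentially. e n < c" if "c > 0" for c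
    using order_tendstoD(2)[OF li that] .
   have "\<forall>\<^sub>F n in sequentially. p \<in> K n \<longleftrightarrow> p \<in> A \<inter> Gam D"
   proof (cases "p \<in> A")
    case True
    define c where "c = min (min (x - max (fst a) 0) (y - max (snd a) 0)) (min (min (fst b) dx - x) (min (snd b) dy - y))"
    have "c > 0" using True pos by (auto simp: c_def xy Apair)
    from ev[OF this] show ?thesis
     by eventually_elim (use True p in \<open>auto simp: c_def K_def xy cbox_Pair_eq\<close>)
   next
    case False
    have "p \<notin> K n" for n
    proof
     assume "p \<in> K n"
     with e0[of n] show False using False by (auto simp: K_def xy Apair cbox_Pair_eq)
    qed
    then show ?thesis using False by simp
   qed
   then have "\<forall>\<^sub>F n in sequentially. of_real (indicator (K n) p) * ex 0 p = of_real (indicator (A \<inter> Gam D) p) * ex 0 p"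
    by eventually_elim (auto simp: indicator_def)
   then show "(%n. of_real (indicator (K n) p) * ex 0 p) \<longlonglongrightarrow> of_real (indicator (A \<inter> Gam D) p) * ex 0 p"
    by (rule tendsto_eventually)
  qed (auto simp: norm_mult indicator_def)
 next
  case empty
  then show ?case using trig_dense[OF trig_0] by simp
 next
  case (compl A)
  have "dense (%p. of_real (indicator (Gam D) p) * ex 0 p - of_real (indicator (A \<inter> Gam D) p) * ex 0 p)"
   by (rule dense_diff[OF full compl.IH])
  also have "(%p. of_real (indicator (Gam D) p) * ex 0 p - of_real (indicator (A \<inter> Gam D) p) * ex 0 p) =
    (%p. of_real (indicator ((UNIV - A) \<inter> Gam D) p) * ex 0 p)"
   by (auto simp: indicator_def fun_eq_iff)
  finally show ?case .
 next
  case (union A)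
  have Am: "A i \<in> sets borel" for i using union gen by auto
  have fin: "dense (%p. \<Sum>i<n. of_real (indicator (A i \<inter> Gam D) p) * ex 0 p)" for n
   by (induction n) (auto intro: trig_dense[OF trig_0] dense_add union.IH)
  show ?case
  proof (rule dense_limit[OF fin, where w = "%_. 1"])
   show "(%p. complex_of_real (indicator (\<Union> (range A) \<inter> Gam D) p) * ex 0 p) \<in> borel_measurable GM"
    using Am by measurable
   fix p assume p: "p \<in> Gam D"
   have uniq: "i = j" if "p \<in> A i" "p \<in> A j" for i j
    using union.hyps(1) that by (auto simp: disjoint_family_on_def)
   have S: "(\<Sum>i<n. of_real (indicator (A i \<inter> Gam D) p) * ex 0 p) = (if \<exists>i<n. p \<in> A i then ex 0 p else 0)" for n
   proof (cases "\<exists>i<n. p \<in> A i")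
    case True
    then obtain j where j: "j < n" "p \<in> A j" by auto
    have "(\<Sum>i<n. of_real (indicator (A i \<inter> Gam D) p) * ex 0 p) = (\<Sum>i<n. if i = j then ex 0 p else 0)"
     by (rule sum.cong) (use j p uniq in \<open>auto simp: indicator_def\<close>)
    then show ?thesis using j by auto
   qed (auto intro!: sum.neutral simp: indicator_def)
   show "(norm (\<Sum>i<n. complex_of_real (indicator (A i \<inter> Gam D) p) * ex 0 p))\<^sup>2 <= 1" for n
    unfolding S by auto
   show "(%n. \<Sum>i<n. of_real (indicator (A i \<inter> Gam D) p) * ex 0 p) \<longlonglongrightarrow>
     of_real (indicator (\<Union> (range A) \<inter> Gam D) p) * ex 0 p"
   proof (rule tendsto_eventually, cases "\<exists>i. p \<in> A i")
    case True
    then obtain i where "p \<in> A i" by auto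
    then show "\<forall>\<^sub>F n in sequentially. (\<Sum>i<n. of_real (indicator (A i \<inter> Gam D) p) * ex 0 p) =
      of_real (indicator (\<Union> (range A) \<inter> Gam D) p) * ex 0 p"
     unfolding S eventually_sequentially using p by (intro exI[of _ "Suc i"]) (auto simp: indicator_def less_Suc_eq_le)
   next
    case False
    then show "\<forall>\<^sub>F n in sequentially. (\<Sum>i<n. of_real (indicator (A i \<inter> Gam D) p) * ex 0 p) =
      of_real (indicator (\<Union> (range A) \<inter> Gam D) p) * ex 0 p"
     unfolding S by (auto simp: indicator_def)
   qed
  qed auto
 qed
qed

lemma dense_L2:
 assumes f: "L2 GM f" shows "dense f"
proof -
 \<comment> \<open>Dividing out the phase \<open>ex 0\<close> leaves a function to be approximated
   by simple ones. The phase is restored afterwards, since the dense functions found so far carry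
   it.\<close>
 define g where "g p = cnj (ex 0 p) * f p" for p
 have g: "L2 GM g" unfolding g_def by (rule L2_bounded_mult(1)[OF f, of _ 1]) auto
 then have [measurable]: "g \<in> borel_measurable GM" by (simp add: L2_def)
 obtain s where s: "!!i. simple_function GM (s i)" "!!p. p \<in> space GM ==> (%i. s i p) \<longlonglongrightarrow> g p"
  "!!i p. p \<in> space GM ==> dist (s i p) 0 <= 2 * dist (g p) 0"
  using borel_measurable_implies_sequence_metric[of g GM 0] \<open>g \<in> borel_measurable GM\<close> by blast
 have "dense (%p. s i p * ex 0 p)" for i
 proof -
  have fin: "finite (s i ` Gam D)" using s(1)[of i] by (simp add: simple_function_def)
  have "dense (%p. \<Sum>y\<in>Y. y * (of_real (indicator ((s i -` {y} \<inter> Gam D) \<inter> Gam D) p) * ex 0 p))"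
   if "finite Y" "Y \<subseteq> s i ` Gam D" for Y using that
  proof (induction Y)
   case empty show ?case using trig_dense[OF trig_0] by simp
  next
   case (insert y Y)
   have "s i -` {y} \<inter> Gam D \<in> sets GM"
    using simple_functionD(2)[OF s(1)[of i], of "{y}"] by simp
   then have "s i -` {y} \<inter> Gam D \<in> sets borel" by (auto simp: sets_restrict_space)
   then have "dense (%p. y * (of_real (indicator ((s i -` {y} \<inter> Gam D) \<inter> Gam D) p) * ex 0 p))"
    by (intro dense_cmult dense_borel)
   from dense_add[OF this insert.IH] insert show ?case by simp
  qed
  from this[OF fin] have *: "dense (%p. \<Sum>y\<in>s i ` Gam D. y * (of_real (indicator ((s i -` {y} \<inter> Gam D) \<inter> Gam D) p) * ex 0 p))"
   by simp
  show ?thesis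
  proof (rule dense_limit[OF *])
   show "(%p. s i p * ex 0 p) \<in> borel_measurable GM"
    using borel_measurable_simple_function[OF s(1)[of i]] by measurable
   have eq: "(\<Sum>y\<in>s i ` Gam D. y * (of_real (indicator ((s i -` {y} \<inter> Gam D) \<inter> Gam D) p) * ex 0 p)) = s i p * ex 0 p"
    if "p \<in> Gam D" for p
   proof -
    have "(\<Sum>y\<in>s i ` Gam D. y * (of_real (indicator ((s i -` {y} \<inter> Gam D) \<inter> Gam D) p) * ex 0 p)) =
     (\<Sum>y\<in>s i ` Gam D. if y = s i p then s i p * ex 0 p else 0)"
     by (rule sum.cong) (use that in \<open>auto simp: indicator_def\<close>)
    then show ?thesis using fin that by simp
   qed
   show "(%n. \<Sum>y\<in>s i ` Gam D. y * (of_real (indicator ((s i -` {y} \<inter> Gam D) \<inter> Gam D) p) * ex 0 p)) \<longlonglongrightarrow> s i p * ex 0 p"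
    if "p \<in> Gam D" for p using eq[OF that] by simp
   show "integrable GM (%p. 4 * (norm (g p))\<^sup>2)" using g by (simp add: L2_integrable_sq)
   show "(norm (\<Sum>y\<in>s i ` Gam D. y * (of_real (indicator ((s i -` {y} \<inter> Gam D) \<inter> Gam D) p) * ex 0 p)))\<^sup>2 <= 4 * (norm (g p))\<^sup>2"
    if "p \<in> Gam D" for p
    unfolding eq[OF that] using power_mono[OF s(3)[of p i], of 2] that by (simp add: norm_mult power_mult_distrib)
  qed
 qed
 then have "dense (%p. g p * ex 0 p)"
 proof (rule dense_limit)
  show "(%p. g p * ex 0 p) \<in> borel_measurable GM" by measurable
  show "integrable GM (%p. 4 * (norm (g p))\<^sup>2)" using g by (simp add: L2_integrable_sq)
  show "(%i. s i p * ex 0 p) \<longlonglongrightarrow> g p * ex 0 p" if "p \<in> Gam D" for p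
   using s(2)[of p] that by (intro tendsto_intros) auto
  show "(norm (s i p * ex 0 p))\<^sup>2 <= 4 * (norm (g p))\<^sup>2" if "p \<in> Gam D" for i p
   using power_mono[OF s(3)[of p i], of 2] that by (simp add: norm_mult power_mult_distrib)
 qed
 moreover have "g p * ex 0 p = f p" for p
  using complex_norm_square[of "ex 0 p"] by (simp add: g_def mult.commute mult.left_commute)
 ultimately show ?thesis by simp
qed

end

section \<open>Unordered sums as integrals over the counting measure\<close>

lemma nn_count_bound:
 fixes f :: "'a::countable => ennreal"
 assumes "!!K. finite K ==> sum f K <= B"
 shows "(\<integral>\<^sup>+ k. f k \<partial>count_space UNIV) <= B"
proof -
 define F where "F n = {k::'a. to_nat k < n}" for n
 have fin: "finite (F n)" for n
  unfolding F_def by (rule finite_vimageI[of "{..<n}" to_nat, unfolded vimage_def lessThan_iff mem_Collect_eq]) auto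
 have "(\<integral>\<^sup>+ k. f k \<partial>count_space UNIV) = (\<integral>\<^sup>+ k. (SUP n. f k * indicator (F n) k) \<partial>count_space UNIV)"
 proof (rule nn_integral_cong)
  fix k
  have "(SUP n. f k * indicator (F n) k) = f k"
  proof (rule antisym)
   show "f k <= (SUP n. f k * indicator (F n) k)"
    by (rule SUP_upper2[of "Suc (to_nat k)"]) (auto simp: F_def)
  qed (auto intro!: SUP_least simp: indicator_def)
  then show "f k = (SUP n. f k * indicator (F n) k)" by simp
 qed
 also have "... = (SUP n. \<integral>\<^sup>+ k. f k * indicator (F n) k \<partial>count_space UNIV)"
  by (rule nn_integral_monotone_convergence_SUP) (auto simp: incseq_def le_fun_def F_def indicator_def)
 also have "... = (SUP n. sum f (F n))"
 proof (rule SUP_cong)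
  show "(\<integral>\<^sup>+ k. f k * indicator (F n) k \<partial>count_space UNIV) = sum f (F n)" for n
   by (subst nn_integral_count_space'[of "F n"]) (auto simp: fin intro!: sum.cong)
 qed simp
 also have "... <= B" using assms fin by (auto intro!: SUP_least)
 finally show ?thesis .
qed

lemma sum_le_nn_count:
 fixes f :: "'a => ennreal"
 assumes "finite K" shows "sum f K <= (\<integral>\<^sup>+ k. f k \<partial>count_space UNIV)"
proof -
 have "sum f K = (\<integral>\<^sup>+ k. f k * indicator K k \<partial>count_space UNIV)"
  using assms by (subst nn_integral_count_space'[of K]) (auto intro!: sum.cong)
 also have "... <= (\<integral>\<^sup>+ k. f k \<partial>count_space UNIV)"
  by (intro nn_integral_mono) (auto simp: indicator_def)
 finally show ?thesis .
qed

text \<open>Turns the \<open>infsum\<close> of \<open>Hnorm_sq\<close> into an integral, so that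
  Tonelli and monotone convergence become available for sums over modes.\<close>

lemma infsum_eq_nn_count:
 fixes f :: "'a::countable => ennreal"
 shows "infsum f UNIV = (\<integral>\<^sup>+ k. f k \<partial>count_space UNIV)"
proof -
 have "infsum f UNIV = (SUP F\<in>{F. finite F \<and> F \<subseteq> UNIV}. sum f F)"
  by (rule nonneg_infsum_complete) simp
 also have "... = (\<integral>\<^sup>+ k. f k \<partial>count_space UNIV)"
  by (rule antisym) (auto intro!: SUP_least sum_le_nn_count nn_count_bound SUP_upper)
 finally show ?thesis .
qed

interpretation modes: sigma_finite_measure modes by (rule sigma_finite_measure_count_space)

section \<open>Bessel, Parseval and polarisation\<close>

context grid
begin

lemma fc_int: "L2 GM f ==> integrable GM (%p. cnj (ex k p) * f p)"
 by (intro L2_mult_integrable L2_cnj L2_ex)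

lemma fc_add: "L2 GM f ==> L2 GM g ==> fc (%p. f p + g p) k = fc f k + fc g k"
 by (simp add: fc_def distrib_left fc_int add_divide_distrib)

lemma fc_cmult: "fc (%p. c * f p) k = c * fc f k"
 by (simp add: fc_def mult.left_commute)

lemma fc_sum: "finite I ==> (!!i. i \<in> I ==> L2 GM (f i)) ==> fc (%p. \<Sum>i\<in>I. f i p) k = (\<Sum>i\<in>I. fc (f i) k)"
proof (induction I rule: finite_induct)
 case empty then show ?case by (simp add: fc_def)
next
 case (insert i I)
 then show ?case using fc_add[of "f i" "%p. \<Sum>i\<in>I. f i p" k] by (simp add: L2_sum)
qed

lemma fc_ex: "fc (ex l) k = (if k = l then 1 else 0)"
 using ex_orthogonal[of l k] area unfolding fc_def by (simp add: mult.commute)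

lemma fc_trig: "finite K ==> fc (%p. \<Sum>k\<in>K. c k * ex k p) l = (if l \<in> K then c l else 0)"
 by (subst fc_sum) (auto simp: fc_cmult fc_ex L2_cmult L2_ex if_distrib cong: if_cong)

lemma norm_sq_cnj: "of_real ((norm (z::complex))\<^sup>2) = z * cnj z"
 by (rule complex_norm_square)

text \<open>Pythagoras for trigonometric approximation: the distance of \<open>f\<close> to a trigonometric polynomial
 exceeds its minimum by the distance of the coefficients.\<close>

lemma trig_distance:
 assumes f: "L2 GM f" and K: "finite K"
 shows "(LINT p|GM. (norm (f p - (\<Sum>k\<in>K. b k * ex k p)))\<^sup>2) =
   (LINT p|GM. (norm (f p))\<^sup>2) - area * (\<Sum>k\<in>K. (norm (fc f k))\<^sup>2) + area * (\<Sum>k\<in>K. (norm (b k - fc f k))\<^sup>2)"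
proof -
 define t where "t p = (\<Sum>k\<in>K. b k * ex k p)" for p
 have t: "L2 GM t" unfolding t_def by (intro L2_sum L2_cmult L2_ex)
 have ft: "(LINT p|GM. g p * cnj (t p)) = of_real area * (\<Sum>k\<in>K. cnj (b k) * fc g k)" if g: "L2 GM g" for g
 proof -
  have "(LINT p|GM. g p * cnj (t p)) = (LINT p|GM. (\<Sum>k\<in>K. cnj (b k) * (cnj (ex k p) * g p)))"
   by (simp add: t_def sum_distrib_left mult_ac)
  also have "... = (\<Sum>k\<in>K. cnj (b k) * (LINT p|GM. cnj (ex k p) * g p))"
   by (subst Bochner_Integration.integral_sum) (auto intro!: integrable_mult_right fc_int g)
  also have "... = of_real area * (\<Sum>k\<in>K. cnj (b k) * fc g k)"
   using area by (simp add: fc_def sum_distrib_left)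
  finally show ?thesis .
 qed
 have i: "integrable GM (%p. f p * cnj (f p))" "integrable GM (%p. f p * cnj (t p))"
  "integrable GM (%p. cnj (f p) * t p)" "integrable GM (%p. t p * cnj (t p))"
  by (intro L2_mult_integrable L2_cnj f t)+
 have tc: "fc t k = b k" if "k \<in> K" for k unfolding t_def using fc_trig[OF K, of b k] that by simp
 have "complex_of_real (LINT p|GM. (norm (f p - t p))\<^sup>2) = (LINT p|GM. f p * cnj (f p) - f p * cnj (t p) - cnj (f p) * t p + t p * cnj (t p))"
  unfolding integral_complex_of_real[symmetric] norm_sq_cnj by (simp add: algebra_simps)
 also have "... = (LINT p|GM. f p * cnj (f p)) - (LINT p|GM. f p * cnj (t p)) - (LINT p|GM. cnj (f p) * t p) + (LINT p|GM. t p * cnj (t p))"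
  using i by simp
 also have "(LINT p|GM. cnj (f p) * t p) = cnj (LINT p|GM. f p * cnj (t p))"
  using Bochner_Integration.integral_cnj[of GM "%p. f p * cnj (t p)"] by simp
 also have "(LINT p|GM. f p * cnj (f p)) = of_real (LINT p|GM. (norm (f p))\<^sup>2)"
  by (subst integral_complex_of_real[symmetric]) (simp only: norm_sq_cnj)
 finally have "complex_of_real (LINT p|GM. (norm (f p - t p))\<^sup>2) = of_real (LINT p|GM. (norm (f p))\<^sup>2) -
   of_real area * (\<Sum>k\<in>K. cnj (b k) * fc f k) - of_real area * (\<Sum>k\<in>K. b k * cnj (fc f k)) + of_real area * (\<Sum>k\<in>K. cnj (b k) * b k)"
  using ft[OF f] ft[OF t] tc by (simp cong: sum.cong)
 also have "... = of_real ((LINT p|GM. (norm (f p))\<^sup>2) - area * (\<Sum>k\<in>K. (norm (fc f k))\<^sup>2) + area * (\<Sum>k\<in>K. (norm (b k - fc f k))\<^sup>2))"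
  unfolding of_real_add of_real_diff of_real_mult of_real_sum norm_sq_cnj
  by (simp add: algebra_simps sum.distrib sum_subtractf)
 finally show ?thesis unfolding t_def of_real_eq_iff .
qed

text \<open>One inequality says that the squared distance of \<open>f\<close> to a partial sum is
  nonnegative. For the other, \<open>trig_distance\<close> is applied to a trigonometric polynomial
  with error below \<open>e\<close>, and the excess term is dropped.\<close>

lemma parseval:
 assumes f: "L2 GM f"
 shows "ennreal area * sqn modes (fc f) = sqn GM f"
proof (rule antisym)
 define F where "F = (LINT p|GM. (norm (f p))\<^sup>2)"
 have F: "sqn GM f = ennreal F" "F >= 0" using sqn_eq_integral[OF f] by (auto simp: F_def)
 have bes: "area * (\<Sum>k\<in>K. (norm (fc f k))\<^sup>2) <= F" if "finite K" for K
 proof -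
  have "0 <= (LINT p|GM. (norm (f p - (\<Sum>k\<in>K. fc f k * ex k p)))\<^sup>2)" by simp
  then show ?thesis unfolding trig_distance[OF f that] F_def by simp
 qed
 have "sqn modes (fc f) <= ennreal (F / area)"
  unfolding sqn_def
 proof (rule nn_count_bound)
  fix K :: "mode set" assume "finite K"
  then have "(\<Sum>k\<in>K. (norm (fc f k))\<^sup>2) <= F / area" using bes area by (simp add: field_simps)
  then show "(\<Sum>k\<in>K. ennreal ((norm (fc f k))\<^sup>2)) <= ennreal (F / area)"
   by (simp add: sum_ennreal ennreal_leI)
 qed
 then have "ennreal area * sqn modes (fc f) <= ennreal area * ennreal (F / area)" by (intro mult_left_mono) auto
 also have "... = ennreal F" using area F by (simp flip: ennreal_mult')
 finally show "ennreal area * sqn modes (fc f) <= sqn GM f" using F by simp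
 show "sqn GM f <= ennreal area * sqn modes (fc f)"
  unfolding F
 proof (rule ennreal_le_epsilon)
  fix e :: real assume e: "e > 0"
  obtain t where "trig t" and t2: "sqn GM (%p. f p - t p) < ennreal e"
   using dense_L2[OF f] e unfolding dense_def by blast
  then obtain K b where K: "finite K" "t = (%p. \<Sum>k\<in>K. b k * ex k p)" unfolding trig_def by blast
  have "sqn GM (%p. f p - t p) = ennreal (LINT p|GM. (norm (f p - t p))\<^sup>2)"
   by (rule sqn_eq_integral) (use f trig_L2[OF \<open>trig t\<close>] L2_diff in auto)
  then have "(LINT p|GM. (norm (f p - t p))\<^sup>2) < e" using t2 e by (simp add: ennreal_less_iff)
  then have "F - area * (\<Sum>k\<in>K. (norm (fc f k))\<^sup>2) + area * (\<Sum>k\<in>K. (norm (b k - fc f k))\<^sup>2) < e"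
   unfolding K(2) trig_distance[OF f K(1)] F_def .
  moreover have "area * (\<Sum>k\<in>K. (norm (b k - fc f k))\<^sup>2) >= 0" using area by (simp add: sum_nonneg)
  ultimately have "F <= area * (\<Sum>k\<in>K. (norm (fc f k))\<^sup>2) + e" by linarith
  then have "ennreal F <= ennreal (area * (\<Sum>k\<in>K. (norm (fc f k))\<^sup>2) + e)" by (rule ennreal_leI)
  also have "... = ennreal area * (\<Sum>k\<in>K. ennreal ((norm (fc f k))\<^sup>2)) + ennreal e"
   using area e by (simp add: ennreal_mult' sum_nonneg sum_ennreal)
  also have "... <= ennreal area * sqn modes (fc f) + ennreal e"
   unfolding sqn_def by (intro add_right_mono mult_left_mono sum_le_nn_count K) auto
  finally show "ennreal F <= ennreal area * sqn modes (fc f) + ennreal e" .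
 qed
qed

lemma fc_L2: "L2 GM f ==> L2 modes (fc f)"
 using parseval[of f] area unfolding L2_sqn by (auto simp: ennreal_mult_less_top less_top[symmetric] ennreal_mult_eq_top_iff)

lemma bessel_sqn: "L2 GM f ==> sqn modes (fc f) = ennreal (1 / area) * sqn GM f"
proof -
 assume f: "L2 GM f"
 have "ennreal (1 / area) * (ennreal area * sqn modes (fc f)) = sqn modes (fc f)"
  using area by (simp add: mult.assoc[symmetric] flip: ennreal_mult')
 then show ?thesis unfolding parseval[OF f] by simp
qed

text \<open>Polarisation. The defect \<open>B\<close> is sesquilinear and vanishes on the diagonal;
  the multipliers 1 and \<open>\<i>\<close> give two independent relations that force
  \<open>B f g = 0\<close>.\<close>

lemma parseval_inner:
 assumes f: "L2 GM f" and g: "L2 GM g"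
 shows "(LINT p|GM. f p * cnj (g p)) = of_real area * (LINT k|modes. fc f k * cnj (fc g k))"
proof -
 define B where "B f g = (LINT p|GM. f p * cnj (g p)) - of_real area * (LINT k|modes. fc f k * cnj (fc g k))" for f g
 have B0: "B f f = 0" if f: "L2 GM f" for f
 proof -
  have *: "(LINT x|M. u x * cnj (u x)) = of_real (LINT x|M. (norm (u x))\<^sup>2)" for M and u :: "'a => complex"
   by (subst integral_complex_of_real[symmetric]) (simp only: norm_sq_cnj)
  have "ennreal (area * (LINT k|modes. (norm (fc f k))\<^sup>2)) = ennreal (LINT p|GM. (norm (f p))\<^sup>2)"
   using parseval[OF f] sqn_eq_integral[OF f] sqn_eq_integral[OF fc_L2[OF f]] area by (simp add: ennreal_mult')
  then have "area * (LINT k|modes. (norm (fc f k))\<^sup>2) = (LINT p|GM. (norm (f p))\<^sup>2)"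
   using area by (subst (asm) ennreal_inj) auto
  then show ?thesis unfolding B_def * by (simp flip: of_real_mult)
 qed
 have BB: "B (%p. f p + c * g p) (%p. f p + c * g p) = B f f + cnj c * B f g + c * B g f + c * cnj c * B g g" for c
 proof -
  have i: "integrable GM (%p. f p * cnj (f p))" "integrable GM (%p. f p * cnj (g p))"
   "integrable GM (%p. g p * cnj (f p))" "integrable GM (%p. g p * cnj (g p))"
   "integrable modes (%p. fc f p * cnj (fc f p))" "integrable modes (%p. fc f p * cnj (fc g p))"
   "integrable modes (%p. fc g p * cnj (fc f p))" "integrable modes (%p. fc g p * cnj (fc g p))"
   by (intro L2_mult_integrable L2_cnj f g fc_L2)+
  have e: "fc (%p. f p + c * g p) k = fc f k + c * fc g k" for k
   using fc_add[OF f L2_cmult[OF g]] by (simp add: fc_cmult)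
  have m: "(u + c * v) * cnj (u + c * v) = u * cnj u + cnj c * (u * cnj v) + c * (v * cnj u) + (c * cnj c) * (v * cnj v)" for u v :: complex
   by (simp add: algebra_simps)
  show ?thesis unfolding B_def e m using i by (simp add: algebra_simps)
 qed
 have L: "L2 GM (%p. f p + c * g p)" for c by (intro L2_add L2_cmult f g)
 have "B f g + B g f = 0" using BB[of 1] B0[OF f] B0[OF g] B0[OF L, of 1] by simp
 moreover have "- \<i> * B f g + \<i> * B g f = 0" using BB[of \<i>] B0[OF f] B0[OF g] B0[OF L, of \<i>] by simp
 ultimately have "B f g = 0" by (simp add: add_eq_0_iff)
 then show ?thesis by (simp add: B_def)
qed

end

section \<open>Multiplication operators on Fourier coefficients\<close>

definition jw :: "mode => real" where
 "jw k = 1 + (of_int (fst k))\<^sup>2 + (of_int (snd k))\<^sup>2"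

lemma jw_ge_1: "jw k >= 1" by (simp add: jw_def)

definition wn :: "nat => (mode => complex) => ennreal" where
 "wn n v = (\<integral>\<^sup>+ k. ennreal (jw k ^ n * (norm (v k))\<^sup>2) \<partial>modes)"

lemma wn_0: "wn 0 v = sqn modes v" by (simp add: wn_def sqn_def)

text \<open>By the definition of \<open>jw\<close> one power of the weight is exchanged for
  multiplications by the two mode numbers. These play the role of derivatives in the inductive
  Leibniz argument.\<close>

lemma wn_Suc: "wn (Suc n) v = wn n v + wn n (%k. of_int (fst k) * v k) + wn n (%k. of_int (snd k) * v k)"
proof -
 have "ennreal (jw k ^ Suc n * (norm (v k))\<^sup>2) = ennreal (jw k ^ n * (norm (v k))\<^sup>2) +
   ennreal (jw k ^ n * (norm (of_int (fst k) * v k))\<^sup>2) + ennreal (jw k ^ n * (norm (of_int (snd k) * v k))\<^sup>2)" for k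
 proof -
  have "jw k ^ Suc n * (norm (v k))\<^sup>2 = jw k ^ n * (norm (v k))\<^sup>2 +
   jw k ^ n * (norm (of_int (fst k) * v k))\<^sup>2 + jw k ^ n * (norm (of_int (snd k) * v k))\<^sup>2"
   by (simp add: jw_def norm_mult power_mult_distrib algebra_simps)
  moreover have "jw k ^ n >= 0" using jw_ge_1[of k] by simp
  ultimately show ?thesis by simp
 qed
 then show ?thesis unfolding wn_def by (simp add: nn_integral_add)
qed

lemma wn_mono_Suc: "wn n v <= wn (Suc n) v"
 unfolding wn_Suc by (simp add: add.assoc)

lemma wn_mono: "n <= m ==> wn n v <= wn m v"
 by (rule lift_Suc_mono_le[of "%n. wn n v", OF wn_mono_Suc])

lemma wn_L2: "wn n v < \<infinity> ==> L2 modes v"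
 using wn_mono[of 0 n v] by (auto simp: wn_0 L2_sqn)

lemma wn_add: "wn n (%k. u k + v k) <= 2 * wn n u + 2 * wn n v"
proof -
 have "wn n (%k. u k + v k) <= (\<integral>\<^sup>+ k. 2 * ennreal (jw k ^ n * (norm (u k))\<^sup>2) + 2 * ennreal (jw k ^ n * (norm (v k))\<^sup>2) \<partial>modes)"
  unfolding wn_def
 proof (rule nn_integral_mono)
  fix k
  have j: "jw k ^ n >= 0" using jw_ge_1[of k] by simp
  have "jw k ^ n * (norm (u k + v k))\<^sup>2 <= jw k ^ n * (2 * (norm (u k))\<^sup>2 + 2 * (norm (v k))\<^sup>2)"
   by (rule mult_left_mono[OF norm_add_sq j])
  also have "... = 2 * (jw k ^ n * (norm (u k))\<^sup>2) + 2 * (jw k ^ n * (norm (v k))\<^sup>2)" by (simp add: algebra_simps)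
  finally have "ennreal (jw k ^ n * (norm (u k + v k))\<^sup>2) <= ennreal (2 * (jw k ^ n * (norm (u k))\<^sup>2) + 2 * (jw k ^ n * (norm (v k))\<^sup>2))"
   by (rule ennreal_leI)
  also have "... = 2 * ennreal (jw k ^ n * (norm (u k))\<^sup>2) + 2 * ennreal (jw k ^ n * (norm (v k))\<^sup>2)"
   using j by (simp add: ennreal_mult')
  finally show "ennreal (jw k ^ n * (norm (u k + v k))\<^sup>2) <= 2 * ennreal (jw k ^ n * (norm (u k))\<^sup>2) + 2 * ennreal (jw k ^ n * (norm (v k))\<^sup>2)" .
 qed
 also have "... = 2 * wn n u + 2 * wn n v" unfolding wn_def by (simp add: nn_integral_add nn_integral_cmult)
 finally show ?thesis .
qed

text \<open>Origin of the 5 in \<open>T_wn\<close>: the term \<open>A\<close> occurs 1 + 2 + 2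
  times.\<close>

lemma ennreal_five: "A + (2 * A + 2 * B) + (2 * A + 2 * C) <= 5 * (A + B + C)" for A B C :: ennreal
proof -
 have five: "5 * X = X + 2 * X + 2 * X" for X :: ennreal
 proof -
  have "(5 :: ennreal) = 1 + 2 + 2" by simp
  then show ?thesis by (simp only: distrib_right mult_1)
 qed
 have "A + (2 * A + 2 * B) + (2 * A + 2 * C) = 5 * A + 2 * B + 2 * C"
  unfolding five by (simp only: ac_simps)
 also have "... <= 5 * A + 5 * B + 5 * C" by (intro add_mono mult_right_mono) auto
 finally show ?thesis by (simp only: distrib_left)
qed

lemma FTC_open:
 fixes f f' :: "real => complex"
 assumes ab: "a <= b" and d: "!!x. x \<in> {a..b} ==> (f has_vector_derivative f' x) (at x)"
  and c: "continuous_on {a..b} f'"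
 shows "(LINT x|restrict_space lborel {a<..<b}. f' x) = f b - f a"
proof -
 have i: "set_integrable lborel {a..b} f'" by (rule borel_integrable_atLeastAtMost') fact
 have "(LINT x|restrict_space lborel {a<..<b}. f' x) = (LBINT x:{a<..<b}. f' x)"
  by (simp add: integral_restrict_space set_lebesgue_integral_def)
 also have "... = (LBINT x:{a..b}. f' x)"
  unfolding set_lebesgue_integral_def
 proof (rule integral_cong_AE)
  show "(%x. indicator {a<..<b} x *\<^sub>R f' x) \<in> borel_measurable lborel"
   using set_integrable_subset[OF i, of "{a<..<b}"] by (auto simp: set_integrable_def subset_iff)
  show "(%x. indicator {a..b} x *\<^sub>R f' x) \<in> borel_measurable lborel"
   using i by (auto simp: set_integrable_def)
  show "AE x in lborel. indicator {a<..<b} x *\<^sub>R f' x = indicator {a..b} x *\<^sub>R f' x"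
   using AE_lborel_singleton[of a] AE_lborel_singleton[of b] by eventually_elim (auto simp: indicator_def)
 qed
 also have "... = integral {a..b} f'" by (rule set_borel_integral_eq_integral(2)[OF i])
 also have "... = f b - f a"
  by (rule integral_unique, rule fundamental_theorem_of_calculus)
   (use ab d in \<open>auto intro: has_vector_derivative_at_within\<close>)
 finally show ?thesis .
qed

section \<open>Multiplication as convolution of coefficients\<close>

context grid
begin

text \<open>Coefficients of a periodic function, read off the quasiperiodic expansion of
  \<open>g * ex 0\<close>; \<open>pc_alt\<close> shows that the phase cancels.\<close>

definition pc :: "(real \<times> real => complex) => mode => complex" where
 "pc g k = fc (%p. g p * ex 0 p) k"

definition T :: "(real \<times> real => complex) => (mode => complex) => mode => complex" where
 "T g v k = (LINT l|modes. pc g (k - l) * v l)"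

definition bddm :: "real => (real \<times> real => complex) => bool" where
 "bddm M g \<longleftrightarrow> g \<in> borel_measurable GM \<and> (\<forall>p\<in>Gam D. norm (g p) <= M)"

lemma bddm_L2: "bddm M g ==> L2 GM g"
 unfolding bddm_def by (rule GM.L2_bounded) auto

lemma bddm_mult: "bddm M g ==> L2 GM f ==> L2 GM (%p. g p * f p)"
 "bddm M g ==> L2 GM f ==> sqn GM (%p. g p * f p) <= ennreal (M\<^sup>2) * sqn GM f"
 unfolding bddm_def by (auto intro!: L2_bounded_mult)

lemma pc_alt: "pc g k = (LINT p|GM. cnj (pex k p) * g p) / of_real area"
proof -
 have "cnj (ex k p) * (g p * ex 0 p) = cnj (pex k p) * g p" for p
 proof -
  have "cnj (ex k p) * ex 0 p = cnj (pex k p) * (ex 0 p * cnj (ex 0 p))"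
   using pex_ex[of k p 0] by (simp flip: complex_cnj_mult)
  also have "ex 0 p * cnj (ex 0 p) = 1" using complex_norm_square[of "ex 0 p"] by simp
  finally show ?thesis by (simp add: mult_ac)
 qed
 then show ?thesis by (simp only: pc_def fc_def)
qed

lemma pc_L2: assumes "bddm M g" shows "L2 modes (pc g)" "L2 modes (%l. pc g (k - l))" "sqn modes (%l. pc g (k - l)) <= ennreal (M\<^sup>2)"
proof -
 have e: "L2 GM (%p. g p * ex 0 p)" by (rule bddm_mult[OF assms L2_ex])
 show L: "L2 modes (pc g)" unfolding pc_def[abs_def] by (rule fc_L2[OF e])
 have eq: "sqn modes (%l. pc g (k - l)) = sqn modes (pc g)"
  unfolding sqn_def
  by (rule nn_integral_bij_count_space[of "%l. k - l" UNIV UNIV "%l. ennreal ((norm (pc g l))\<^sup>2)"])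
   (auto intro!: bij_betw_byWitness[where f' = "%l. k - l"])
 then show "L2 modes (%l. pc g (k - l))" using L by (simp add: L2_sqn)
 have one: "sqn GM (ex 0) = ennreal area"
  using parseval[OF L2_ex[of 0]] area
  by (simp add: sqn_def fc_ex if_distrib cong: if_cong) (simp add: emeasure_GM GM.emeasure_eq_measure)
 have "sqn modes (pc g) = ennreal (1 / area) * sqn GM (%p. g p * ex 0 p)"
  unfolding pc_def[abs_def] by (rule bessel_sqn[OF e])
 also have "... <= ennreal (1 / area) * (ennreal (M\<^sup>2) * ennreal area)"
  using bddm_mult(2)[OF assms L2_ex[of 0]] unfolding one by (rule mult_left_mono) simp
 also have "... = ennreal (M\<^sup>2)" using area by (simp flip: ennreal_mult' ennreal_mult'')
 finally show "sqn modes (%l. pc g (k - l)) <= ennreal (M\<^sup>2)" using eq by simp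
qed

lemma T_integrable: "bddm M g ==> L2 modes v ==> integrable modes (%l. pc g (k - l) * v l)"
 by (intro L2_mult_integrable pc_L2)

text \<open>The coefficient is the inner product of \<open>f\<close> with
  \<open>ex k * cnj g\<close>, whose own coefficients are conjugates of shifted values of
  \<open>pc g\<close>; Parseval then reads as a convolution.\<close>

lemma fc_mult:
 assumes g: "bddm M g" and f: "L2 GM f"
 shows "fc (%p. g p * f p) k = T g (fc f) k"
proof -
 have gL: "L2 GM (%p. ex k p * cnj (g p))"
  by (rule L2_bounded_mult(1)[OF L2_cnj[OF bddm_L2[OF g]], of _ 1]) auto
 have pcc: "cnj (fc (%p. ex k p * cnj (g p)) l) = pc g (k - l)" for l
 proof -
  have *: "ex l p * cnj (ex k p) = cnj (ex (k - l) p) * ex 0 p" for p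
   unfolding ex_cnj unfolding ex_def exp_add[symmetric] alpha_p_def beta_q_def
   by (rule arg_cong[of _ _ exp]) (simp add: algebra_simps diff_divide_distrib)
  have "cnj (LINT p|GM. cnj (ex l p) * (ex k p * cnj (g p))) = (LINT p|GM. ex l p * cnj (ex k p) * g p)"
   using Bochner_Integration.integral_cnj[of GM "%p. cnj (ex l p) * (ex k p * cnj (g p))"] by (simp add: mult_ac)
  then show ?thesis unfolding pc_def fc_def * by (simp add: mult_ac)
 qed
 have "(LINT p|GM. cnj (ex k p) * (g p * f p)) = (LINT p|GM. f p * cnj (ex k p * cnj (g p)))"
  by (simp add: mult_ac)
 also have "... = of_real area * T g (fc f) k"
  unfolding parseval_inner[OF f gL] pcc T_def by (simp add: mult.commute)
 finally show ?thesis using area unfolding fc_def by (simp add: fc_def[abs_def, symmetric])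
qed

text \<open>The operator bound by the sup norm is inherited from functions: a finitely supported
  \<open>v\<close> comes from a trigonometric polynomial, and Parseval applies to its product with
  \<open>g\<close>. Fatou extends the bound to every square summable \<open>v\<close>, with no
  appeal to a function having these coefficients.\<close>

lemma T_bound:
 assumes g: "bddm M g" and v: "L2 modes v"
 shows "sqn modes (T g v) <= ennreal (M\<^sup>2) * sqn modes v"
proof -
 define F where "F n = {k::mode. to_nat k < n}" for n
 have fin: "finite (F n)" for n
  unfolding F_def by (rule finite_vimageI[of "{..<n}" to_nat, unfolded vimage_def lessThan_iff mem_Collect_eq]) auto
 define vn where "vn n l = (if l \<in> F n then v l else 0)" for n l
 have bn: "sqn modes (T g (vn n)) <= ennreal (M\<^sup>2) * sqn modes v" for n
 proof -
  define f where "f p = (\<Sum>k\<in>F n. v k * ex k p)" for p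
  have f: "L2 GM f" unfolding f_def by (intro L2_sum L2_cmult L2_ex)
  have fcf: "fc f = vn n" unfolding f_def vn_def using fc_trig[OF fin, of v n] by auto
  have "sqn modes (T g (vn n)) = sqn modes (fc (%p. g p * f p))"
   using fc_mult[OF g f] by (simp add: fcf[symmetric] fun_eq_iff cong: sqn_cong)
  also have "... = ennreal (1 / area) * sqn GM (%p. g p * f p)" by (rule bessel_sqn[OF bddm_mult(1)[OF g f]])
  also have "... <= ennreal (1 / area) * (ennreal (M\<^sup>2) * sqn GM f)"
   by (intro mult_left_mono bddm_mult(2)[OF g f]) auto
  also have "... = ennreal (M\<^sup>2) * sqn modes (vn n)" using bessel_sqn[OF f] fcf by (simp add: mult_ac)
  also have "... <= ennreal (M\<^sup>2) * sqn modes v" by (intro mult_left_mono sqn_mono) (auto simp: vn_def)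
  finally show ?thesis .
 qed
 have lim: "(%n. T g (vn n) k) \<longlonglongrightarrow> T g v k" for k
  unfolding T_def
 proof (rule integral_dominated_convergence[where w = "%l. norm (pc g (k - l) * v l)"])
  show "AE l in modes. (%n. pc g (k - l) * vn n l) \<longlonglongrightarrow> pc g (k - l) * v l"
  proof (intro AE_I2 tendsto_intros tendsto_eventually)
   fix l show "\<forall>\<^sub>F n in sequentially. vn n l = v l"
    unfolding eventually_sequentially by (intro exI[of _ "Suc (to_nat l)"]) (auto simp: vn_def F_def)
  qed
 qed (use T_integrable[OF g v] in \<open>auto simp: vn_def\<close>)
 have "sqn modes (T g v) = (\<integral>\<^sup>+ k. liminf (%n. ennreal ((norm (T g (vn n) k))\<^sup>2)) \<partial>modes)"
  unfolding sqn_def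
 proof (rule nn_integral_cong)
  fix k
  have "(%n. ennreal ((norm (T g (vn n) k))\<^sup>2)) \<longlonglongrightarrow> ennreal ((norm (T g v k))\<^sup>2)"
   by (intro tendsto_intros lim)
  from lim_imp_Liminf[OF _ this] show "ennreal ((norm (T g v k))\<^sup>2) = liminf (%n. ennreal ((norm (T g (vn n) k))\<^sup>2))" by simp
 qed
 also have "... <= liminf (%n. sqn modes (T g (vn n)))"
  unfolding sqn_def by (rule nn_integral_liminf) auto
 also have "... <= ennreal (M\<^sup>2) * sqn modes v"
  by (rule Liminf_le) (auto intro!: always_eventually bn)
 finally show ?thesis .
qed

text \<open>Multipliers with \<open>n\<close> bounded periodic derivatives, described by their Fourier coefficients;
 \<open>gx\<close> and \<open>gy\<close> are the partial derivatives up to a normalising factor.\<close>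

primrec pbd :: "nat => real => (real \<times> real => complex) => bool" where
 "pbd 0 M g \<longleftrightarrow> bddm M g"
| "pbd (Suc n) M g \<longleftrightarrow> pbd n M g \<and> (\<exists>gx gy. pbd n M gx \<and> pbd n M gy \<and>
   (\<forall>k. of_int (fst k) * pc g k = pc gx k) \<and> (\<forall>k. of_int (snd k) * pc g k = pc gy k))"

lemma pbd_bddm: "pbd n M g ==> bddm M g"
 by (induction n) auto

text \<open>Writing \<open>k = (k - l) + l\<close> splits a mode number between the multiplier and
  \<open>v\<close>: the first part turns \<open>g\<close> into \<open>gx\<close> or
  \<open>gy\<close>, the second stays on \<open>v\<close>. All multipliers share the bound
  \<open>M\<close>, so each order costs a factor 5.\<close>

lemma T_wn:
 assumes "pbd n M g" "wn n v < \<infinity>"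
 shows "wn n (T g v) <= ennreal (5 ^ n * M\<^sup>2) * wn n v"
 using assms
proof (induction n arbitrary: g v)
 case 0
 then show ?case using T_bound[of M g v] by (simp add: wn_0 L2_sqn)
next
 case (Suc n)
 obtain gx gy where g: "pbd n M g" "pbd n M gx" "pbd n M gy"
  "!!k. of_int (fst k) * pc g k = pc gx k" "!!k. of_int (snd k) * pc g k = pc gy k" using Suc.prems by auto
 have fin: "wn n v < \<infinity>" "wn n (%k. of_int (fst k) * v k) < \<infinity>" "wn n (%k. of_int (snd k) * v k) < \<infinity>"
  using Suc.prems(2) unfolding wn_Suc by auto
 note L = wn_L2[OF fin(1)] wn_L2[OF fin(2)] wn_L2[OF fin(3)]
 note ti = T_integrable[OF pbd_bddm[OF g(2)] L(1)] T_integrable[OF pbd_bddm[OF g(3)] L(1)]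
  T_integrable[OF pbd_bddm[OF g(1)] L(2)] T_integrable[OF pbd_bddm[OF g(1)] L(3)]
 have X: "(%k. of_int (fst k) * T g v k) = (%k. T gx v k + T g (%k. of_int (fst k) * v k) k)"
 proof
  fix k
  have eq: "of_int (fst k) * (pc g (k - l) * v l) = pc gx (k - l) * v l + pc g (k - l) * (of_int (fst l) * v l)" for l
  proof -
   have "pc gx (k - l) = (of_int (fst k) - of_int (fst l)) * pc g (k - l)" using g(4)[of "k - l"] by simp
   from this show ?thesis by (simp only:) (simp add: algebra_simps)
  qed
  have "of_int (fst k) * T g v k = (LINT l|modes. of_int (fst k) * (pc g (k - l) * v l))" by (simp add: T_def)
  also have "... = T gx v k + T g (%k. of_int (fst k) * v k) k"
   unfolding eq T_def using ti by simp
  finally show "of_int (fst k) * T g v k = T gx v k + T g (%k. of_int (fst k) * v k) k" .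
 qed
 have Y: "(%k. of_int (snd k) * T g v k) = (%k. T gy v k + T g (%k. of_int (snd k) * v k) k)"
 proof
  fix k
  have eq: "of_int (snd k) * (pc g (k - l) * v l) = pc gy (k - l) * v l + pc g (k - l) * (of_int (snd l) * v l)" for l
  proof -
   have "pc gy (k - l) = (of_int (snd k) - of_int (snd l)) * pc g (k - l)" using g(5)[of "k - l"] by simp
   from this show ?thesis by (simp only:) (simp add: algebra_simps)
  qed
  have "of_int (snd k) * T g v k = (LINT l|modes. of_int (snd k) * (pc g (k - l) * v l))" by (simp add: T_def)
  also have "... = T gy v k + T g (%k. of_int (snd k) * v k) k"
   unfolding eq T_def using ti by simp
  finally show "of_int (snd k) * T g v k = T gy v k + T g (%k. of_int (snd k) * v k) k" .
 qed
 define C where "C = ennreal (5 ^ n * M\<^sup>2)"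
 define a b c where "a = wn n v" and "b = wn n (%k. of_int (fst k) * v k)" and "c = wn n (%k. of_int (snd k) * v k)"
 note IH = Suc.IH[folded C_def]
 have "wn (Suc n) (T g v) <= C * a + (2 * (C * a) + 2 * (C * b)) + (2 * (C * a) + 2 * (C * c))"
  unfolding wn_Suc X Y a_def b_def c_def
  by (intro add_mono order_trans[OF wn_add] mult_left_mono IH g fin) auto
 also have "... <= 5 * (C * a + C * b + C * c)"
  by (rule ennreal_five)
 also have "... = ennreal (5 ^ Suc n * M\<^sup>2) * wn (Suc n) v"
 proof -
  have "ennreal (5 ^ Suc n * M\<^sup>2) = 5 * C" by (simp add: C_def mult.assoc ennreal_mult'')
  then show ?thesis
   unfolding wn_Suc a_def[symmetric] b_def[symmetric] c_def[symmetric]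
   by (simp only: distrib_left mult.assoc)
 qed
 finally show ?case .
qed

end

lemma wd_cong_AE:
 assumes w: "wd h f g" and "AE z in IM h. f z = f' z" "AE z in IM h. g z = g' z"
  and [measurable]: "f' \<in> borel_measurable (IM h)" "g' \<in> borel_measurable (IM h)"
 shows "wd h f' g'"
 unfolding wd_def
proof (intro conjI allI impI)
 have [measurable]: "f \<in> borel_measurable (IM h)" "g \<in> borel_measurable (IM h)" using w by (auto simp: wd_def)
 show "integrable (IM h) f'" "integrable (IM h) g'"
  using w assms(2,3) integrable_cong_AE[of f "IM h" f'] integrable_cong_AE[of g "IM h" g'] by (auto simp: wd_def)
 fix ps :: "real => real" assume t: "test_function {-h<..<h} ps"
 have [measurable]: "ps \<in> borel_measurable (IM h)" "deriv ps \<in> borel_measurable (IM h)"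
  using test_measurable[OF t] test_measurable[OF test_deriv(2)[OF t]] by (auto intro: measurable_IM_borel)
 have "(LINT z|IM h. deriv ps z *\<^sub>R f' z) = (LINT z|IM h. deriv ps z *\<^sub>R f z)"
  by (rule integral_cong_AE) (use assms(2) in auto)
 moreover have "(LINT z|IM h. ps z *\<^sub>R g' z) = (LINT z|IM h. ps z *\<^sub>R g z)"
  by (rule integral_cong_AE) (use assms(3) in auto)
 ultimately show "(LINT z|IM h. deriv ps z *\<^sub>R f' z) = - (LINT z|IM h. ps z *\<^sub>R g' z)"
  using w t by (simp add: wd_def)
qed

section \<open>Slices of the envelope and their derivatives\<close>

context grid
begin

definition slice :: "(space => 'a) => real => real \<times> real => 'a" where
 "slice u z p = u (fst p, snd p, z)"

abbreviation "dX \<equiv> (1, 0, 0) :: space"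
abbreviation "dY \<equiv> (0, 1, 0) :: space"
abbreviation "dZ \<equiv> (0, 0, 1) :: space"

lemma Basis_space: "(Basis :: space set) = {dX, dY, dZ}"
 by (auto simp: Basis_prod_def zero_prod_def)

lemma open_slab: "open (slab D)"
 unfolding slab_def by (intro open_Times) auto

lemma slab_iff [simp]: "(x, y, z) \<in> slab D \<longleftrightarrow> \<bar>z\<bar> < h"
 by (auto simp: slab_def)

definition good :: "nat => (space => complex) => bool" where
 "good m E \<longleftrightarrow> C_k_bounded (slab D) m E \<and> biperiodic D E"

text \<open>Translation by a period maps the open slab to itself and leaves the function unchanged,
  hence also its derivative.\<close>

lemma good_SucD:
 assumes g: "good (Suc m) E" and d: "d \<in> Basis"
 shows "good m (partials [d] E)"
proof -
 have dif: "E differentiable at p" if "p \<in> slab D" for p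
  using g that by (simp add: good_def C_k_bounded_Suc)
 have shift: "frechet_derivative E (at p) = frechet_derivative E (at (p + t))"
  if "p \<in> slab D" "!!q. q \<in> slab D ==> q + t \<in> slab D \<and> E (q + t) = E q" for p t
 proof -
  have "(E has_derivative frechet_derivative E (at (p + t))) (at (p + t))"
   using dif[of "p + t"] that frechet_derivative_works by blast
  then have "((%q. E (q + t)) has_derivative frechet_derivative E (at (p + t))) (at p)"
  proof -
   have "((%q. q + t) has_derivative (%x. x)) (at p)" by (auto intro!: derivative_eq_intros)
   moreover assume "(E has_derivative frechet_derivative E (at (p + t))) (at (p + t))"
   ultimately show ?thesis using diff_chain_at[of "%q. q + t" "%x. x" p E] by (simp add: o_def)
  qed
  then have "(E has_derivative frechet_derivative E (at (p + t))) (at p)"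
   by (rule has_derivative_transform_within_open[OF _ open_slab that(1)]) (use that(2) in auto)
  then show ?thesis using frechet_derivative_at by metis
 qed
 have "biperiodic D (partials [d] E)"
  unfolding biperiodic_def
 proof (intro allI impI)
  fix x y z assume z: "\<bar>z\<bar> < h"
  have "frechet_derivative E (at (x, y, z)) = frechet_derivative E (at ((x, y, z) + (dx, 0, 0)))"
   "frechet_derivative E (at (x, y, z)) = frechet_derivative E (at ((x, y, z) + (0, dy, 0)))"
   by (rule shift; use g z in \<open>auto simp: good_def biperiodic_def slab_def\<close>)+
  then show "partials [d] E (x + dx, y, z) = partials [d] E (x, y, z) \<and>
    partials [d] E (x, y + dy, z) = partials [d] E (x, y, z)" by simp
 qed
 with g d show ?thesis unfolding good_def C_k_bounded_Suc by blast
qed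

lemma good_mono: "good m E ==> j <= m ==> good j E"
 unfolding good_def using C_k_bounded_mono by blast

lemma good_bound:
 assumes "good m E"
 obtains M where "!!p. p \<in> slab D ==> norm (E p) <= M" "M >= 0"
proof -
 have "bounded (E ` slab D)" using good_mono[OF assms, of 0] by (simp add: good_def C_k_bounded_0)
 then obtain M where "!!p. p \<in> slab D ==> norm (E p) <= M" by (auto simp: bounded_iff)
 then show thesis using that[of "max M 0"] by (metis max.coboundedI1 max.cobounded2)
qed

lemma good_cont: "good m E ==> continuous_on (slab D) E"
 using good_mono[of m E 0] by (simp add: good_def C_k_bounded_0)

lemma good_slice_cont: "good m E ==> \<bar>z\<bar> < h ==> continuous_on S (slice E z)"
 unfolding slice_def by (rule continuous_on_compose2[OF good_cont]) (auto intro!: continuous_intros)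

lemma good_slice_bddm:
 assumes "good m E" "!!p. p \<in> slab D ==> norm (E p) <= M" "\<bar>z\<bar> < h"
 shows "bddm M (slice E z)"
 unfolding bddm_def using assms(2,3)
 by (auto simp: slice_def[abs_def] intro!: measurable_GM_borel borel_measurable_continuous_onI good_slice_cont[OF assms(1,3), unfolded slice_def[abs_def]])

lemma good_derivs:
 assumes g: "good (Suc m) E" and z: "\<bar>z\<bar> < h"
 shows "((%x. E (x, y, z)) has_vector_derivative partials [dX] E (x, y, z)) (at x)"
  "((%y. E (x, y, z)) has_vector_derivative partials [dY] E (x, y, z)) (at y)"
  "((%z. E (x, y, z)) has_vector_derivative partials [dZ] E (x, y, z)) (at z)"
proof -
 have "E differentiable at (x, y, z)"
  using g z by (simp add: good_def C_k_bounded_Suc)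
 then have d: "(E has_derivative frechet_derivative E (at (x, y, z))) (at (x, y, z))"
  by (simp add: frechet_derivative_works)
 note sc = linear_scale[OF has_derivative_linear[OF d]]
 have *: "((%t. E (c t)) has_vector_derivative frechet_derivative E (at (x, y, z)) e) (at t)"
  if "c t = (x, y, z)" "(c has_derivative (%s. s *\<^sub>R e)) (at t)" for c :: "real => space" and t e
  using diff_chain_at[OF that(2) d[folded that(1)]] that(1) by (simp add: o_def has_vector_derivative_def sc)
 show "((%x. E (x, y, z)) has_vector_derivative partials [dX] E (x, y, z)) (at x)"
  unfolding partials_1 by (rule *) (auto intro!: derivative_eq_intros simp: zero_prod_def)
 show "((%y. E (x, y, z)) has_vector_derivative partials [dY] E (x, y, z)) (at y)"
  unfolding partials_1 by (rule *) (auto intro!: derivative_eq_intros simp: zero_prod_def)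
 show "((%z. E (x, y, z)) has_vector_derivative partials [dZ] E (x, y, z)) (at z)"
  unfolding partials_1 by (rule *) (auto intro!: derivative_eq_intros simp: zero_prod_def)
qed

lemma integrable_GM_cont:
 fixes f :: "real \<times> real => complex"
 assumes "continuous_on UNIV f"
 shows "integrable GM f"
proof -
 have "bounded (f ` cbox (0, 0) (dx, dy))"
  by (intro compact_imp_bounded compact_continuous_image compact_cbox continuous_on_subset[OF assms]) auto
 then obtain B where B: "!!p. p \<in> cbox (0, 0) (dx, dy) ==> norm (f p) <= B" by (auto simp: bounded_iff)
 show ?thesis
 proof (rule GM.integrable_const_bound[of _ B])
  show "AE p in GM. norm (f p) <= B"
   by (rule AE_I2, rule B) (auto simp: Gam_def cbox_Pair_eq)
 qed (intro measurable_GM_borel borel_measurable_continuous_onI assms)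
qed

lemma cnj_pex: "cnj (pex k p) = exp (- (\<i> * of_real (2 * pi / dx * of_int (fst k) * fst p + 2 * pi / dy * of_int (snd k) * snd p)))"
 by (simp add: pex_def exp_cnj)

lemma norm_pex [simp]: "norm (pex k p) = 1"
 by (simp add: pex_def norm_exp_eq_Re)

lemma pex_cont: "continuous_on S (%p. cnj (pex k p))"
 unfolding cnj_pex by (intro continuous_intros)

text \<open>Integration by parts over one period; the boundary terms cancel by periodicity, and
  \<open>dx / (2 * pi * \<i>)\<close> undoes the factor that a derivative in \<open>x\<close> puts
  in front of the mode number.\<close>

lemma pc_dx:
 assumes g: "good (Suc m) E" and z: "\<bar>z\<bar> < h"
 shows "of_int (fst k) * pc (slice E z) k = pc (%p. of_real dx / (2 * of_real pi * \<i>) * slice (partials [dX] E) z p) k"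
proof -
 define c where "c = \<i> * of_real (2 * pi / dx * of_int (fst k))"
 \<comment> \<open>\<open>F\<close> is the complete \<open>x\<close>-derivative of
   \<open>cnj (pex k) * E\<close>, so its integral over a period is a difference of equal end
   values.\<close>
 define F where "F p = cnj (pex k p) * slice (partials [dX] E) z p - c * (cnj (pex k p) * slice E z p)" for p
 have c1: "continuous_on UNIV (%p. cnj (pex k p) * slice (partials [dX] E) z p)"
  by (intro continuous_intros pex_cont good_slice_cont[OF good_SucD[OF g] z]) (simp add: Basis_space)
 have c2: "continuous_on UNIV (%p. cnj (pex k p) * slice E z p)"
  by (intro continuous_intros pex_cont good_slice_cont[OF g z])
 have cF: "continuous_on UNIV F" unfolding F_def by (intro continuous_intros c1 c2)
 have inner: "(LINT x|XM. F (x, y)) = 0" for y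
 proof -
  define f where "f x = cnj (pex k (x, y)) * E (x, y, z)" for x
  have "(LINT x|XM. F (x, y)) = f dx - f 0"
  proof (rule FTC_open)
   show "(f has_vector_derivative F (x, y)) (at x)" for x
   proof -
    have "((%x. exp (- (\<i> * (of_real (2 * pi / dx * of_int (fst k)) * x + of_real (2 * pi / dy * of_int (snd k) * y)))))
     has_field_derivative (cnj (pex k (x, y)) * (- c))) (at (of_real x))"
     using per_x per_y unfolding cnj_pex c_def by (auto intro!: derivative_eq_intros)
    from has_vector_derivative_real_field[OF this]
    have "((%x. cnj (pex k (x, y))) has_vector_derivative cnj (pex k (x, y)) * (- c)) (at x)"
     unfolding cnj_pex by simp
    from has_vector_derivative_mult[OF this good_derivs(1)[OF g z, of y x]]
    show ?thesis unfolding f_def F_def slice_def by (simp add: algebra_simps)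
   qed
   show "continuous_on {0..dx} (%x. F (x, y))"
    by (rule continuous_on_compose2[OF cF]) (auto intro!: continuous_intros)
  qed (use per_x in auto)
  also have "f dx = f 0"
  proof -
   have "E (0 + dx, y, z) = E (0, y, z)" using g z unfolding good_def biperiodic_def by blast
   moreover have "cnj (pex k (dx, y)) = cnj (pex k (0, y))"
   proof -
    have "pex k (dx, y) = exp (\<i> * of_real (2 * pi / dx * of_int (fst k) * dx)) * pex k (0, y)"
     unfolding pex_def exp_add[symmetric] by (rule arg_cong[of _ _ exp]) (simp add: algebra_simps)
    then show ?thesis using exp_int_period[OF per_x, of "fst k"] by simp
   qed
   ultimately show ?thesis by (simp add: f_def)
  qed
  finally show ?thesis by simp
 qed
 have "(LINT p|GM. F p) = 0"
  using XY.integral_snd[of "%x y. F (x, y)"] integrable_GM_cont[OF cF] inner by (simp add: XY_GM)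
 then have "(LINT p|GM. cnj (pex k p) * slice (partials [dX] E) z p) = c * (LINT p|GM. cnj (pex k p) * slice E z p)"
  using integrable_GM_cont[OF c1] integrable_GM_cont[OF c2] by (simp add: F_def)
 then show ?thesis
  using less_imp_neq[OF per_x, symmetric] by (simp add: pc_alt mult.left_commute[of "cnj _"] c_def)
qed

lemma pc_dy:
 assumes g: "good (Suc m) E" and z: "\<bar>z\<bar> < h"
 shows "of_int (snd k) * pc (slice E z) k = pc (%p. of_real dy / (2 * of_real pi * \<i>) * slice (partials [dY] E) z p) k"
proof -
 define c where "c = \<i> * of_real (2 * pi / dy * of_int (snd k))"
 define F where "F p = cnj (pex k p) * slice (partials [dY] E) z p - c * (cnj (pex k p) * slice E z p)" for p
 have c1: "continuous_on UNIV (%p. cnj (pex k p) * slice (partials [dY] E) z p)"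
  by (intro continuous_intros pex_cont good_slice_cont[OF good_SucD[OF g] z]) (simp add: Basis_space)
 have c2: "continuous_on UNIV (%p. cnj (pex k p) * slice E z p)"
  by (intro continuous_intros pex_cont good_slice_cont[OF g z])
 have cF: "continuous_on UNIV F" unfolding F_def by (intro continuous_intros c1 c2)
 have inner: "(LINT y|YM. F (x, y)) = 0" for x
 proof -
  define f where "f y = cnj (pex k (x, y)) * E (x, y, z)" for y
  have "(LINT y|YM. F (x, y)) = f dy - f 0"
  proof (rule FTC_open)
   show "(f has_vector_derivative F (x, y)) (at y)" for y
   proof -
    have "((%y. exp (- (\<i> * (of_real (2 * pi / dx * of_int (fst k) * x) + of_real (2 * pi / dy * of_int (snd k)) * y))))
     has_field_derivative (cnj (pex k (x, y)) * (- c))) (at (of_real y))"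
     using per_x per_y unfolding cnj_pex c_def by (auto intro!: derivative_eq_intros)
    from has_vector_derivative_real_field[OF this]
    have "((%y. cnj (pex k (x, y))) has_vector_derivative cnj (pex k (x, y)) * (- c)) (at y)"
     unfolding cnj_pex by simp
    from has_vector_derivative_mult[OF this good_derivs(2)[OF g z, of x y]]
    show ?thesis unfolding f_def F_def slice_def by (simp add: algebra_simps)
   qed
   show "continuous_on {0..dy} (%y. F (x, y))"
    by (rule continuous_on_compose2[OF cF]) (auto intro!: continuous_intros)
  qed (use per_y in auto)
  also have "f dy = f 0"
  proof -
   have "E (x, 0 + dy, z) = E (x, 0, z)" using g z unfolding good_def biperiodic_def by blast
   moreover have "cnj (pex k (x, dy)) = cnj (pex k (x, 0))"
   proof -
    have "pex k (x, dy) = exp (\<i> * of_real (2 * pi / dy * of_int (snd k) * dy)) * pex k (x, 0)"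
     unfolding pex_def exp_add[symmetric] by (rule arg_cong[of _ _ exp]) (simp add: algebra_simps)
    then show ?thesis using exp_int_period[OF per_y, of "snd k"] by simp
   qed
   ultimately show ?thesis by (simp add: f_def)
  qed
  finally show ?thesis by simp
 qed
 have "(LINT p|GM. F p) = 0"
  using XY.integral_fst[of "%x y. F (x, y)"] integrable_GM_cont[OF cF] inner by (simp add: XY_GM)
 then have "(LINT p|GM. cnj (pex k p) * slice (partials [dY] E) z p) = c * (LINT p|GM. cnj (pex k p) * slice E z p)"
  using integrable_GM_cont[OF c1] integrable_GM_cont[OF c2] by (simp add: F_def)
 then show ?thesis
  using less_imp_neq[OF per_y, symmetric] by (simp add: pc_alt mult.left_commute[of "cnj _"] c_def)
qed

lemma pc_cmult: "pc (%p. c * g p) k = c * pc g k"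
 by (simp add: pc_alt mult.left_commute)

lemma pbd_scale: "pbd n M g ==> pbd n (norm c * M) (%p. c * g p)"
proof (induction n arbitrary: g)
 case 0
 then show ?case by (auto simp: bddm_def norm_mult intro!: mult_left_mono)
next
 case (Suc n)
 then obtain gx gy where g: "pbd n M g" "pbd n M gx" "pbd n M gy"
  "!!k. of_int (fst k) * pc g k = pc gx k" "!!k. of_int (snd k) * pc g k = pc gy k" by auto
 show ?case unfolding pbd.simps
 proof (intro conjI exI allI)
  fix k
  show "of_int (fst k) * pc (%p. c * g p) k = pc (%p. c * gx p) k"
   "of_int (snd k) * pc (%p. c * g p) k = pc (%p. c * gy p) k"
   unfolding pc_cmult g(4,5)[symmetric] by simp_all
 qed (intro Suc.IH g)+
qed

lemma pbd_M: "pbd n M g ==> M <= M' ==> pbd n M' g"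
proof (induction n arbitrary: g)
 case 0
 then show ?case by (auto simp: bddm_def intro: order_trans)
next
 case (Suc n)
 then show ?case unfolding pbd.simps by blast
qed

text \<open>Each order uses up one lateral derivative of the envelope; boundedness on the whole slab
  makes \<open>M\<close> the same for all heights.\<close>

lemma good_pbd:
 assumes "good m E"
 shows "\<exists>M\<ge>0. \<forall>z. \<bar>z\<bar> < h --> pbd m M (slice E z)"
 using assms
proof (induction m arbitrary: E)
 case 0
 obtain M where "!!p. p \<in> slab D ==> norm (E p) <= M" "M >= 0" using good_bound[OF 0] by blast
 then show ?case using good_slice_bddm[OF 0] by auto
next
 case (Suc m)
 define a where "a = complex_of_real dx / (2 * of_real pi * \<i>)"
 define b where "b = complex_of_real dy / (2 * of_real pi * \<i>)"
 obtain M0 M1 M2 where M: "M0 >= 0" "!!z. \<bar>z\<bar> < h ==> pbd m M0 (slice E z)"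
  "M1 >= 0" "!!z. \<bar>z\<bar> < h ==> pbd m M1 (slice (partials [dX] E) z)"
  "M2 >= 0" "!!z. \<bar>z\<bar> < h ==> pbd m M2 (slice (partials [dY] E) z)"
  using Suc.IH[OF good_mono[OF Suc.prems, of m]] Suc.IH[OF good_SucD[OF Suc.prems, of dX]]
   Suc.IH[OF good_SucD[OF Suc.prems, of dY]] by (auto simp: Basis_space)
 define M where "M = M0 + norm a * M1 + norm b * M2"
 have le: "M0 <= M" "norm a * M1 <= M" "norm b * M2 <= M" "0 <= M"
  using M(1,3,5) by (auto simp: M_def add_increasing add_increasing2)
 show ?case
 proof (intro exI[of _ M] conjI allI impI le)
  fix z assume z: "\<bar>z\<bar> < h"
  show "pbd (Suc m) M (slice E z)"
   unfolding pbd.simps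
  proof (intro conjI exI allI)
   show "of_int (fst k) * pc (slice E z) k = pc (%p. a * slice (partials [dX] E) z p) k" for k
    unfolding a_def by (rule pc_dx[OF Suc.prems z])
   show "of_int (snd k) * pc (slice E z) k = pc (%p. b * slice (partials [dY] E) z p) k" for k
    unfolding b_def by (rule pc_dy[OF Suc.prems z])
   show "pbd m M (slice E z)" by (rule pbd_M[OF M(2)[OF z] le(1)])
   show "pbd m M (%p. a * slice (partials [dX] E) z p)" by (rule pbd_M[OF pbd_scale[OF M(4)[OF z]] le(2)])
   show "pbd m M (%p. b * slice (partials [dY] E) z p)" by (rule pbd_M[OF pbd_scale[OF M(6)[OF z]] le(3)])
  qed
 qed
qed

subsection \<open>Weak derivatives of products\<close>

text \<open>Continuity is known only on the open slab, so measurability passes through the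
  restricted Borel space.\<close>

lemma measurable_slab:
 fixes E :: "space => complex"
 assumes "continuous_on (slab D) E"
 shows "(%(p, z). slice E z p) \<in> borel_measurable (GM \<Otimes>\<^sub>M HM)"
proof -
 have 1: "E \<in> borel_measurable (restrict_space borel (slab D))"
  by (rule borel_measurable_continuous_on_restrict) fact
 have id: "(%x. x) \<in> measurable GM borel" "(%x. x) \<in> measurable HM borel"
  by (auto intro: measurable_GM_borel measurable_IM_borel)
 have [measurable]: "(%q. fst q) \<in> measurable (GM \<Otimes>\<^sub>M HM) borel" "(%q. snd q) \<in> measurable (GM \<Otimes>\<^sub>M HM) borel"
  using measurable_compose[OF measurable_fst id(1)] measurable_compose[OF measurable_snd id(2)] by auto
 have "(%q. (fst (fst q), snd (fst q), snd q)) \<in> measurable (GM \<Otimes>\<^sub>M HM) (restrict_space borel (slab D))"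
 proof (rule measurable_restrict_space2)
  have c: "continuous_on UNIV (%q::(real \<times> real) \<times> real. (fst (fst q), snd (fst q), snd q))" by (intro continuous_intros)
  have "(%q. (fst q, snd q)) \<in> measurable (GM \<Otimes>\<^sub>M HM) borel"
   by (rule borel_measurable_Pair) measurable
  from measurable_compose[OF this borel_measurable_continuous_onI[OF c]]
  show "(%q. (fst (fst q), snd (fst q), snd q)) \<in> borel_measurable (GM \<Otimes>\<^sub>M HM)" by simp
 qed (auto simp: space_pair_measure)
 from measurable_compose[OF this 1] show ?thesis by (simp add: slice_def case_prod_unfold)
qed

lemma GI_fin: "finite_measure (GM \<Otimes>\<^sub>M HM)"
 by (rule finite_measure_pair_measure) unfold_locales

lemma good_integrable:
 assumes g: "good m E" and u: "u \<in> borel_measurable GM" "!!p. norm (u p) <= 1"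
  and w: "w \<in> borel_measurable HM" "!!z. norm (w z) <= B"
 shows "integrable (GM \<Otimes>\<^sub>M HM) (%(p, z). u p * (w z * slice E z p))"
proof -
 interpret P: finite_measure "GM \<Otimes>\<^sub>M HM" by (rule GI_fin)
 obtain M where M: "!!p. p \<in> slab D ==> norm (E p) <= M" "M >= 0" using good_bound[OF g] by blast
 note [measurable] = measurable_slab[OF good_cont[OF g]] u(1) w(1)
 have [measurable]: "(%q. slice E (snd q) (fst q)) \<in> borel_measurable (GM \<Otimes>\<^sub>M HM)"
  using measurable_slab[OF good_cont[OF g]] by (simp add: case_prod_unfold)
 show ?thesis
 proof (rule P.integrable_const_bound[of _ "B * M"])
  show "AE q in GM \<Otimes>\<^sub>M HM. norm (case q of (p, z) => u p * (w z * slice E z p)) <= B * M"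
  proof (rule AE_I2, clarify)
   fix x y z assume "((x, y), z) \<in> space (GM \<Otimes>\<^sub>M HM)"
   then have "norm (slice E z (x, y)) <= M" by (auto simp: space_pair_measure slice_def intro!: M)
   moreover have "0 <= B" using w(2)[of 0] norm_ge_zero order_trans by blast
   ultimately have "norm (w z) * norm (slice E z (x, y)) <= B * M" using w(2)[of z] by (intro mult_mono) auto
   moreover have "norm (u (x, y)) * (norm (w z) * norm (slice E z (x, y))) <= 1 * (norm (w z) * norm (slice E z (x, y)))"
    by (rule mult_right_mono[OF u(2)]) simp
   ultimately show "norm (u (x, y) * (w z * slice E z (x, y))) <= B * M" by (simp add: norm_mult)
  qed
 qed (simp add: case_prod_unfold)
qed

lemma pc_measurable:
 assumes g: "good m E" shows "integrable HM (%z. pc (slice E z) k)"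
proof -
 have "integrable (GM \<Otimes>\<^sub>M HM) (%(p, z). cnj (pex k p) * (1 * slice E z p))"
  by (rule good_integrable[OF g, where B = 1])
   (auto intro!: measurable_GM_borel borel_measurable_continuous_onI pex_cont)
 from GI.integrable_snd[OF this] show ?thesis
  unfolding pc_alt by (intro integrable_divide) simp
qed

lemma integral_deriv_test:
 assumes g: "good (Suc m) E" and t: "test_function {-h<..<h} ps"
 shows "(LINT z|HM. of_real (deriv ps z) * E (x, y, z)) = - (LINT z|HM. of_real (ps z) * partials [dZ] E (x, y, z))"
proof -
 obtain K where K: "compact K" "K \<subseteq> {-h<..<h}" "!!x. x \<notin> K ==> ps x = 0"
  using t by (auto simp: test_function_iff)
 have K': "closed K" "-h \<notin> K" "h \<notin> K" using K by (auto intro: compact_imp_closed)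
 have dz: "deriv ps z = 0" if "z \<notin> K" for z
 proof -
  have "(ps has_derivative (%s. deriv ps z * s)) (at z)"
   using test_deriv(1)[OF t] by (simp add: has_field_derivative_def)
  from deriv_zero_outside[OF this K'(1) K(3) that] have "deriv ps z * 1 = 0" by metis
  then show ?thesis by simp
 qed
 define u where "u z = of_real (ps z) * E (x, y, z)" for z
 define u' where "u' z = of_real (deriv ps z) * E (x, y, z) + of_real (ps z) * partials [dZ] E (x, y, z)" for z
 \<comment> \<open>\<open>E\<close> is differentiable only for \<open>\<bar>z\<bar> < h\<close>; off
   the support of \<open>ps\<close> the product is locally 0, so \<open>u\<close> has a derivative
   on the whole line and the fundamental theorem applies up to the ends.\<close>
 have der: "(u has_vector_derivative u' z) (at z)" for z
 proof (cases "z \<in> K")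
  case True
  then have "z \<in> {-h<..<h}" using K(2) by blast
  then have "\<bar>z\<bar> < h" by auto
  have "((%z. complex_of_real (ps z)) has_vector_derivative of_real (deriv ps z)) (at z)"
   by (rule has_vector_derivative_of_real[OF test_deriv(1)[OF t]])
  from has_vector_derivative_mult[OF this good_derivs(3)[OF g \<open>\<bar>z\<bar> < h\<close>, of x y]]
  show ?thesis by (simp add: u_def[abs_def] u'_def algebra_simps)
 next
  case False
  have "((%z. 0) has_vector_derivative 0) (at z)" by simp
  then have "(u has_vector_derivative 0) (at z)"
   by (rule has_vector_derivative_transform_within_open[of _ _ _ "- K"])
    (use False K' K(3) in \<open>auto simp: u_def open_Compl\<close>)
  then show ?thesis using dz[OF False] K(3)[OF False] by (simp add: u'_def)
 qed
 have cE: "continuous_on {-h<..<h} (%z. F (x, y, z))" if "good j F" for j F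
  by (rule continuous_on_compose2[OF good_cont[OF that]]) (auto intro!: continuous_intros)
 have c1: "continuous_on {-h<..<h} u'"
  unfolding u'_def
  by (intro continuous_intros cE[OF g] cE[OF good_SucD[OF g]] test_continuous[OF t] test_continuous[OF test_deriv(2)[OF t]])
   (simp add: Basis_space)
 have c2: "continuous_on (- K) u'"
  by (rule continuous_on_eq[OF continuous_on_const[of _ 0]]) (auto simp: u'_def dz K(3))
 have "continuous_on ({-h<..<h} \<union> - K) u'"
  by (rule continuous_on_open_Un) (use K' c1 c2 in \<open>auto simp: open_Compl\<close>)
 then have cu: "continuous_on {-h..h} u'"
  by (rule continuous_on_subset) (use K(2) in auto)
 have "(LINT z|HM. u' z) = u h - u (-h)"
  by (rule FTC_open) (use hgt der cu in auto)
 also have "... = 0" using K(3) K' by (simp add: u_def)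
 finally have "(LINT z|HM. u' z) = 0" .
 moreover have "integrable HM (%z. of_real (w z) * F (x, y, z))" if F: "good j F" and w: "test_function {-h<..<h} w" for j F and w :: "real => real"
 proof -
  obtain M where M: "!!p. p \<in> slab D ==> norm (F p) <= M" "M >= 0" using good_bound[OF F] by blast
  have m: "(%z. F (x, y, z)) \<in> borel_measurable HM"
   using borel_measurable_continuous_on_restrict[OF cE[OF F]]
    measurable_cong_sets[OF sets_restrict_space_cong[OF sets_lborel] refl] by fastforce
  have "integrable HM (%z. F (x, y, z))"
   by (rule IM.integrable_const_bound[of _ M]) (use m M in \<open>auto intro!: AE_I2\<close>)
  from test_integrable[OF w this] show ?thesis by (simp add: scaleR_conv_of_real)
 qed
 from this[OF g test_deriv(2)[OF t]] this[OF good_SucD[OF g] t, of dZ] have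
  "(LINT z|HM. u' z) = (LINT z|HM. of_real (deriv ps z) * E (x, y, z)) + (LINT z|HM. of_real (ps z) * partials [dZ] E (x, y, z))"
  unfolding u'_def by (intro Bochner_Integration.integral_add) (auto simp: Basis_space)
 ultimately show ?thesis by (simp add: add_eq_0_iff)
qed

text \<open>Fubini moves the \<open>z\<close>-integration inside the lateral one, where
  \<open>integral_deriv_test\<close> applies for each lateral point.\<close>

lemma wd_pc:
 assumes g: "good (Suc m) E"
 shows "wd h (%z. pc (slice E z) k) (%z. pc (slice (partials [dZ] E) z) k)"
 unfolding wd_def
proof (intro conjI allI impI)
 have gz: "good m (partials [dZ] E)" by (rule good_SucD[OF g]) (simp add: Basis_space)
 show "integrable HM (%z. pc (slice E z) k)" "integrable HM (%z. pc (slice (partials [dZ] E) z) k)"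
  by (rule pc_measurable[OF g], rule pc_measurable[OF gz])
 fix ps :: "real => real" assume t: "test_function {-h<..<h} ps"
 have swap: "(LINT z|HM. w z *\<^sub>R pc (slice F z) k) =
   (LINT p|GM. cnj (pex k p) * (LINT z|HM. of_real (w z) * F (fst p, snd p, z))) / of_real area"
  if F: "good j F" and w: "test_function {-h<..<h} w" for F j and w :: "real => real"
 proof -
  obtain B where B: "!!x. norm (w x) <= B" using test_bounded[OF w] by blast
  have i: "integrable (GM \<Otimes>\<^sub>M HM) (%(p, z). cnj (pex k p) * (of_real (w z) * slice F z p))"
   by (rule good_integrable[OF F, where B = B])
    (use B test_measurable[OF w] in \<open>auto intro!: measurable_GM_borel measurable_IM_borel borel_measurable_continuous_onI pex_cont
     measurable_compose[OF test_measurable[OF w]]\<close>)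
  have "(LINT z|HM. w z *\<^sub>R pc (slice F z) k) = (LINT z|HM. (LINT p|GM. cnj (pex k p) * (of_real (w z) * slice F z p))) / of_real area"
   by (simp add: pc_alt scaleR_conv_of_real mult.left_commute[of "cnj _"])
  also have "(LINT z|HM. (LINT p|GM. cnj (pex k p) * (of_real (w z) * slice F z p))) =
    (LINT p|GM. (LINT z|HM. cnj (pex k p) * (of_real (w z) * slice F z p)))"
   by (rule GI.Fubini_integral[OF i])
  finally show ?thesis by (simp add: slice_def[abs_def])
 qed
 show "(LINT z|HM. deriv ps z *\<^sub>R pc (slice E z) k) = - (LINT z|HM. ps z *\<^sub>R pc (slice (partials [dZ] E) z) k)"
  unfolding swap[OF g test_deriv(2)[OF t]] swap[OF gz t] integral_deriv_test[OF g t] by simp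
qed

text \<open>Both factors agree almost everywhere with absolutely continuous ones, for which the
  product rule is known.\<close>

lemma wd_mult:
 assumes a: "wd h f f'" and b: "wd h g g'"
 shows "wd h (%z. f z * g z) (%z. f' z * g z + f z * g' z)"
proof -
 obtain F where F: "AC h F f'" "AE z in HM. f z = F z" using wd_imp_AC[OF a hgt] .
 obtain G where G: "AC h G g'" "AE z in HM. g z = G z" using wd_imp_AC[OF b hgt] .
 have [measurable]: "f \<in> borel_measurable HM" "g \<in> borel_measurable HM" "f' \<in> borel_measurable HM" "g' \<in> borel_measurable HM"
  using a b by (auto simp: wd_def)
 have w: "wd h (%z. F z * G z) (%z. f' z * G z + F z * g' z)"
  by (intro AC_imp_wd AC_mult F G hgt) (use hgt in simp)
 show ?thesis
 proof (rule wd_cong_AE[OF w])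
  show "AE z in HM. F z * G z = f z * g z" using F(2) G(2) by eventually_elim simp
  show "AE z in HM. f' z * G z + F z * g' z = f' z * g z + f z * g' z" using F(2) G(2) by eventually_elim simp
 qed measurable
qed

end

section \<open>Multiplication in Sobolev spaces\<close>

lemma meas_count_pair:
 fixes f :: "'i::countable => 'a => 'b::topological_space"
 assumes "!!k. f k \<in> borel_measurable M"
 shows "(%(k, z). f k z) \<in> borel_measurable (count_space UNIV \<Otimes>\<^sub>M M)"
  "(%(z, k). f k z) \<in> borel_measurable (M \<Otimes>\<^sub>M count_space UNIV)"
proof -
 show 1: "(%(k, z). f k z) \<in> borel_measurable (count_space UNIV \<Otimes>\<^sub>M M)"
  by (rule measurable_pair_measure_countable1) (use assms in auto)
 from measurable_compose[OF measurable_pair_swap' this]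
 show "(%(z, k). f k z) \<in> borel_measurable (M \<Otimes>\<^sub>M count_space UNIV)" by (simp add: case_prod_unfold)
qed

lemma meas_count:
 fixes f :: "'i::countable => 'a => ennreal"
 assumes "!!k. f k \<in> borel_measurable M"
 shows "(%z. \<integral>\<^sup>+ k. f k z \<partial>count_space UNIV) \<in> borel_measurable M"
 by (rule sigma_finite_measure.borel_measurable_nn_integral[OF sigma_finite_measure_count_space meas_count_pair(2)]) fact

lemma meas_count_integral:
 fixes f :: "'i::countable => 'a => complex"
 assumes "!!k. f k \<in> borel_measurable M"
 shows "(%z. LINT k|count_space UNIV. f k z) \<in> borel_measurable M"
 by (rule sigma_finite_measure.borel_measurable_lebesgue_integral[OF sigma_finite_measure_count_space meas_count_pair(2)]) fact

lemma nn_count_swap: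
 fixes f :: "'i::countable => 'a => ennreal"
 assumes "sigma_finite_measure M" "!!k. f k \<in> borel_measurable M"
 shows "(\<integral>\<^sup>+ z. \<integral>\<^sup>+ k. f k z \<partial>count_space UNIV \<partial>M) = (\<integral>\<^sup>+ k. \<integral>\<^sup>+ z. f k z \<partial>M \<partial>count_space UNIV)"
proof -
 interpret pair_sigma_finite "count_space (UNIV :: 'i set)" M
  using assms(1) sigma_finite_measure_count_space by (intro pair_sigma_finite.intro)
 show ?thesis using Fubini'[OF meas_count_pair(1)[OF assms(2)]] by simp
qed

lemma wd_meas:
 assumes "wd h f g" shows "f \<in> borel_measurable (IM h)" "g \<in> borel_measurable (IM h)"
 using assms by (auto simp: wd_def)

lemma wd_cmult: "wd h f f' ==> wd h (%z. c * f z) (%z. c * f' z)"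
 unfolding wd_def by (simp flip: mult_scaleR_right)

lemma wd_add:
 assumes a: "wd h f f'" and b: "wd h g g'" shows "wd h (%z. f z + g z) (%z. f' z + g' z)"
 unfolding wd_def
proof (intro conjI allI impI)
 fix ps :: "real => real" assume t: "test_function {-h<..<h} ps"
 have i: "integrable (IM h) f" "integrable (IM h) f'" "integrable (IM h) g" "integrable (IM h) g'" using a b by (auto simp: wd_def)
 then show "(LINT z|IM h. deriv ps z *\<^sub>R (f z + g z)) = - (LINT z|IM h. ps z *\<^sub>R (f' z + g' z))"
  using a b t test_integrable[OF t i(2)] test_integrable[OF t i(4)]
   test_integrable[OF test_deriv(2)[OF t] i(1)] test_integrable[OF test_deriv(2)[OF t] i(3)]
  by (simp add: wd_def scaleR_add_right)
qed (use a b in \<open>auto simp: wd_def\<close>)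

text \<open>Absolute integrability of both double families lets Fubini pull the sum out of the weak
  formulation, where the identity holds term by term.\<close>

lemma wd_sum:
 fixes q q' :: "'i::countable => real => complex"
 assumes w: "!!l. wd h (q l) (q' l)"
  and q: "(\<integral>\<^sup>+ z. \<integral>\<^sup>+ l. ennreal (norm (q l z)) \<partial>count_space UNIV \<partial>IM h) < \<infinity>"
  and q': "(\<integral>\<^sup>+ z. \<integral>\<^sup>+ l. ennreal (norm (q' l z)) \<partial>count_space UNIV \<partial>IM h) < \<infinity>"
 shows "wd h (%z. LINT l|count_space UNIV. q l z) (%z. LINT l|count_space UNIV. q' l z)"
proof -
 interpret P: pair_sigma_finite "count_space (UNIV :: 'i set)" "IM h"
  by (intro pair_sigma_finite.intro sigma_finite_measure_count_space IM.sigma_finite_measure_axioms)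
 have int: "integrable (count_space UNIV \<Otimes>\<^sub>M IM h) (%(l, z). of_real (ps z) * q l z)"
  if m: "!!l. q l \<in> borel_measurable (IM h)" and fin: "(\<integral>\<^sup>+ z. \<integral>\<^sup>+ l. ennreal (norm (q l z)) \<partial>count_space UNIV \<partial>IM h) < \<infinity>"
   and p: "ps \<in> borel_measurable borel" "!!z. norm (ps z) <= B"
  for q :: "'i => real => complex" and ps :: "real => real" and B
 proof (rule integrableI_bounded)
  have [measurable]: "ps \<in> borel_measurable (IM h)" by (rule measurable_IM_borel[OF p(1)])
  note [measurable] = m
  have [measurable]: "(%z. of_real (ps z) * q l z) \<in> borel_measurable (IM h)" for l by measurable
  show "(%(l, z). of_real (ps z) * q l z) \<in> borel_measurable (count_space UNIV \<Otimes>\<^sub>M IM h)"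
   by (rule meas_count_pair) measurable
  have "(%(l, z). ennreal (norm (of_real (ps z) * q l z))) \<in> borel_measurable (count_space UNIV \<Otimes>\<^sub>M IM h)"
   by (rule meas_count_pair) measurable
  from P.nn_integral_snd[OF this]
  have "(\<integral>\<^sup>+ x. ennreal (norm (case x of (l, z) => of_real (ps z) * q l z)) \<partial>(count_space UNIV \<Otimes>\<^sub>M IM h)) =
    (\<integral>\<^sup>+ z. \<integral>\<^sup>+ l. ennreal (norm (of_real (ps z) * q l z)) \<partial>count_space UNIV \<partial>IM h)" by (simp add: case_prod_unfold)
  also have "... <= (\<integral>\<^sup>+ z. ennreal \<bar>B\<bar> * (\<integral>\<^sup>+ l. ennreal (norm (q l z)) \<partial>count_space UNIV) \<partial>IM h)"
  proof (intro nn_integral_mono)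
   fix z
   have "(\<integral>\<^sup>+ l. ennreal (norm (of_real (ps z) * q l z)) \<partial>count_space UNIV) \<le>
     (\<integral>\<^sup>+ l. ennreal \<bar>B\<bar> * ennreal (norm (q l z)) \<partial>count_space UNIV)"
    using p(2)[of z] by (intro nn_integral_mono) (auto simp: norm_mult intro!: ennreal_leI mult_right_mono simp flip: ennreal_mult)
   then show "(\<integral>\<^sup>+ l. ennreal (norm (of_real (ps z) * q l z)) \<partial>count_space UNIV) \<le>
     ennreal \<bar>B\<bar> * (\<integral>\<^sup>+ l. ennreal (norm (q l z)) \<partial>count_space UNIV)" by (simp add: nn_integral_cmult)
  qed
  also have "... = ennreal \<bar>B\<bar> * (\<integral>\<^sup>+ z. \<integral>\<^sup>+ l. ennreal (norm (q l z)) \<partial>count_space UNIV \<partial>IM h)"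
   by (intro nn_integral_cmult meas_count) measurable
  also have "... < \<infinity>" using fin by (simp add: ennreal_mult_less_top)
  finally show "(\<integral>\<^sup>+ x. ennreal (norm (case x of (l, z) => of_real (ps z) * q l z)) \<partial>(count_space UNIV \<Otimes>\<^sub>M IM h)) < \<infinity>" .
 qed
 have swap: "(LINT z|IM h. ps z *\<^sub>R (LINT l|count_space UNIV. q l z)) = (LINT l|count_space UNIV. LINT z|IM h. ps z *\<^sub>R q l z)"
  if "!!l. q l \<in> borel_measurable (IM h)" "(\<integral>\<^sup>+ z. \<integral>\<^sup>+ l. ennreal (norm (q l z)) \<partial>count_space UNIV \<partial>IM h) < \<infinity>"
    "test_function U ps" for q :: "'i => real => complex" and ps :: "real => real" and U
 proof -
  obtain B where "!!z. norm (ps z) <= B" using test_bounded[OF \<open>test_function U ps\<close>] by blast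
  from P.Fubini_integral[OF int[OF that(1,2) test_measurable[OF that(3)] this]]
  show ?thesis by (simp add: scaleR_conv_of_real)
 qed
 have qm: "!!l. q l \<in> borel_measurable (IM h)" "!!l. q' l \<in> borel_measurable (IM h)" using wd_meas[OF w] by auto
 have ii: "integrable (IM h) (%z. LINT l|count_space UNIV. q l z)"
  if "!!l. q l \<in> borel_measurable (IM h)" "(\<integral>\<^sup>+ z. \<integral>\<^sup>+ l. ennreal (norm (q l z)) \<partial>count_space UNIV \<partial>IM h) < \<infinity>" for q :: "'i => real => complex"
 proof -
  have "integrable (count_space UNIV \<Otimes>\<^sub>M IM h) (%(l, z). of_real 1 * q l z)"
   by (rule int[OF that, of "%_. 1" 1]) auto
  from P.integrable_snd[OF this] show ?thesis by simp
 qed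
 show ?thesis
  unfolding wd_def
 proof (intro conjI allI impI ii qm q q')
  fix ps :: "real => real" assume t: "test_function {-h<..<h} ps"
  show "(LINT z|IM h. deriv ps z *\<^sub>R (LINT l|count_space UNIV. q l z)) = - (LINT z|IM h. ps z *\<^sub>R (LINT l|count_space UNIV. q' l z))"
   unfolding swap[OF qm(1) q test_deriv(2)[OF t]] swap[OF qm(2) q' t]
   using w t by (simp add: wd_def)
 qed
qed

section \<open>Jets of coefficients and their products with the envelope\<close>

context grid
begin

definition NN :: "nat => (mode => real => complex) => ennreal" where
 "NN n v = (\<integral>\<^sup>+ z. wn n (%k. v k z) \<partial>HM)"

definition mmeas :: "(mode => real => complex) => bool" where
 "mmeas v \<longleftrightarrow> (\<forall>k. v k \<in> borel_measurable HM)"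

lemma mmeasD: "mmeas v ==> v k \<in> borel_measurable HM"
 unfolding mmeas_def by blast

lemma mmeasI: "(!!k. v k \<in> borel_measurable HM) ==> mmeas v"
 unfolding mmeas_def by blast

lemma wn_meas: "mmeas v ==> (%z. wn n (%k. v k z)) \<in> borel_measurable HM"
 unfolding wn_def
proof (rule meas_count)
 fix k assume "mmeas v"
 then have [measurable]: "v k \<in> borel_measurable HM" by (rule mmeasD)
 show "(%z. ennreal (jw k ^ n * (norm (v k z))\<^sup>2)) \<in> borel_measurable HM" by measurable
qed

lemma mmeas_add:
 assumes "mmeas u" "mmeas v" shows "mmeas (%k z. u k z + v k z)"
 by (rule mmeasI) (rule borel_measurable_add[OF assms(1)[THEN mmeasD] assms(2)[THEN mmeasD]])

lemma mmeas_mult: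
 assumes "mmeas u" shows "mmeas (%k z. c k * u k z)"
 by (rule mmeasI) (rule borel_measurable_times[OF borel_measurable_const assms[THEN mmeasD]])

lemma NN_add: "mmeas u ==> mmeas v ==> NN n (%k z. u k z + v k z) <= 2 * NN n u + 2 * NN n v"
proof -
 assume [THEN wn_meas, measurable]: "mmeas u" "mmeas v"
 have "NN n (%k z. u k z + v k z) <= (\<integral>\<^sup>+ z. 2 * wn n (%k. u k z) + 2 * wn n (%k. v k z) \<partial>HM)"
  unfolding NN_def by (intro nn_integral_mono wn_add)
 also have "... = 2 * NN n u + 2 * NN n v" unfolding NN_def by (simp add: nn_integral_add nn_integral_cmult)
 finally show ?thesis .
qed

lemma NN_mono: "n <= m ==> NN n v <= NN m v"
 unfolding NN_def by (intro nn_integral_mono wn_mono)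

lemma NN_AE: "mmeas v ==> NN n v < \<infinity> ==> AE z in HM. wn n (%k. v k z) < \<infinity>"
 unfolding NN_def using nn_integral_PInf_AE[OF wn_meas, of v n] by (auto simp: less_top)

text \<open>Weak derivatives carried along as data, so that those of sums, products and series are
  built explicitly rather than through the choice in \<open>wderiv\<close>.\<close>

definition jet :: "nat => (nat => mode => real => complex) => bool" where
 "jet m w \<longleftrightarrow> (\<forall>j\<le>m. mmeas (w j)) \<and> (\<forall>j<m. \<forall>k. wd h (w j k) (w (Suc j) k))"

text \<open>The contribution of one component to \<open>Hnorm_sq\<close> when \<open>w\<close> lists
  the derivatives of its coefficients, as \<open>Hnorm_sq_rep\<close> confirms.\<close>

definition Nj :: "nat => (nat => mode => real => complex) => ennreal" where
 "Nj m w = (\<Sum>j\<le>m. NN (m - j) (w j))"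

definition TE :: "(space => complex) => (mode => real => complex) => mode => real => complex" where
 "TE E v k z = T (slice E z) (%l. v l z) k"

lemma mmeas_TE:
 assumes g: "good m E" and v: "mmeas v" shows "mmeas (TE E v)"
 unfolding mmeas_def TE_def[abs_def] T_def
proof (intro allI meas_count_integral)
 fix k l
 have [measurable]: "(%z. pc (slice E z) (k - l)) \<in> borel_measurable HM" "v l \<in> borel_measurable HM"
  using pc_measurable[OF g, of "k - l"] mmeasD[OF v] by auto
 show "(%z. pc (slice E z) (k - l) * v l z) \<in> borel_measurable HM" by measurable
qed

text \<open>\<open>T_wn\<close> applied at almost every height, where the weighted sum is finite;
  \<open>good_pbd\<close> makes the constant independent of the height.\<close>

lemma TE_NN:
 assumes g: "good n E"
 obtains C where "C >= 0" "!!v. mmeas v ==> NN n v < \<infinity> ==> NN n (TE E v) <= ennreal C * NN n v"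
proof -
 obtain M where M: "M >= 0" "!!z. \<bar>z\<bar> < h ==> pbd n M (slice E z)" using good_pbd[OF g] by blast
 show thesis
 proof (rule that[of "5 ^ n * M\<^sup>2"])
  fix v assume v: "mmeas v" "NN n v < \<infinity>"
  have "AE z in HM. wn n (%k. TE E v k z) <= ennreal (5 ^ n * M\<^sup>2) * wn n (%k. v k z)"
   using NN_AE[OF v] AE_space
  proof eventually_elim
   case (elim z)
   then have "\<bar>z\<bar> < h" by auto
   from T_wn[OF M(2)[OF this] elim(1)] show ?case by (simp add: TE_def[abs_def] del: ennreal_mult)
  qed
  then have "NN n (TE E v) <= (\<integral>\<^sup>+ z. ennreal (5 ^ n * M\<^sup>2) * wn n (%k. v k z) \<partial>HM)"
   unfolding NN_def by (rule nn_integral_mono_AE)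
  also have "... = ennreal (5 ^ n * M\<^sup>2) * NN n v"
   unfolding NN_def by (rule nn_integral_cmult[OF wn_meas[OF v(1)]])
  finally show "NN n (TE E v) <= ennreal (5 ^ n * M\<^sup>2) * NN n v" .
 qed simp
qed

text \<open>Young's inequality splits each term into squares; those of \<open>pc\<close> sum to at
  most \<open>M\<^sup>2\<close> at every height, those of \<open>v\<close> to an integrable function
  of \<open>z\<close>.\<close>

lemma TE_abs_finite:
 assumes g: "good m E" and v: "mmeas v" "NN 0 v < \<infinity>"
 shows "(\<integral>\<^sup>+ z. \<integral>\<^sup>+ l. ennreal (norm (pc (slice E z) (k - l) * v l z)) \<partial>modes \<partial>HM) < \<infinity>"
  "AE z in HM. integrable modes (%l. pc (slice E z) (k - l) * v l z)"
proof -
 obtain M where M: "!!p. p \<in> slab D ==> norm (E p) <= M" "M >= 0" using good_bound[OF g] by blast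
 have b: "bddm M (slice E z)" if "z \<in> {-h<..<h}" for z
  by (rule good_slice_bddm[OF g M(1)]) (use that in auto)
 have "(\<integral>\<^sup>+ z. \<integral>\<^sup>+ l. ennreal (norm (pc (slice E z) (k - l) * v l z)) \<partial>modes \<partial>HM) \<le>
   (\<integral>\<^sup>+ z. ennreal (M\<^sup>2) + wn 0 (%l. v l z) \<partial>HM)"
 proof (rule nn_integral_mono)
  fix z assume "z \<in> space HM"
  then have z: "z \<in> {-h<..<h}" by simp
  have "(\<integral>\<^sup>+ l. ennreal (norm (pc (slice E z) (k - l) * v l z)) \<partial>modes) \<le>
    (\<integral>\<^sup>+ l. ennreal ((norm (pc (slice E z) (k - l)))\<^sup>2) + ennreal ((norm (v l z))\<^sup>2) \<partial>modes)"
   by (intro nn_integral_mono) (auto simp flip: ennreal_plus intro!: ennreal_leI young)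
  also have "... = sqn modes (%l. pc (slice E z) (k - l)) + sqn modes (%l. v l z)"
   unfolding sqn_def by (simp add: nn_integral_add)
  also have "... <= ennreal (M\<^sup>2) + wn 0 (%l. v l z)"
   unfolding wn_0 by (intro add_right_mono pc_L2(3) b z)
  finally show "(\<integral>\<^sup>+ l. ennreal (norm (pc (slice E z) (k - l) * v l z)) \<partial>modes) <= ennreal (M\<^sup>2) + wn 0 (%l. v l z)" .
 qed
 also have "... = (\<integral>\<^sup>+ z. ennreal (M\<^sup>2) \<partial>HM) + NN 0 v"
  unfolding NN_def by (rule nn_integral_add) (use wn_meas[OF v(1)] in auto)
 also have "... < \<infinity>" using v(2) by (simp add: ennreal_mult_less_top IM.emeasure_eq_measure)
 finally show "(\<integral>\<^sup>+ z. \<integral>\<^sup>+ l. ennreal (norm (pc (slice E z) (k - l) * v l z)) \<partial>modes \<partial>HM) < \<infinity>" .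
 show "AE z in HM. integrable modes (%l. pc (slice E z) (k - l) * v l z)"
  using NN_AE[OF v] AE_space
 proof eventually_elim
  case (elim z)
  then show ?case using T_integrable[OF b wn_L2] by auto
 qed
qed

text \<open>Leibniz rule in \<open>z\<close> for each term of the convolution, summed by
  \<open>wd_sum\<close>; the two halves of the derivative are separated again almost
  everywhere.\<close>

lemma TE_wd:
 assumes g: "good (Suc m) E" and w: "!!l. wd h (v l) (v' l)" and v: "NN 0 v < \<infinity>" and v': "NN 0 v' < \<infinity>"
 shows "wd h (TE E v k) (%z. TE (partials [dZ] E) v k z + TE E v' k z)"
proof -
 define E' where "E' = partials [dZ] E"
 have g': "good m E'" unfolding E'_def by (rule good_SucD[OF g]) (simp add: Basis_space)
 have mm: "mmeas v" "mmeas v'" using wd_meas[OF w] by (auto intro: mmeasI)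
 define q where "q l z = pc (slice E z) (k - l) * v l z" for l z
 define q' where "q' l z = pc (slice E' z) (k - l) * v l z + pc (slice E z) (k - l) * v' l z" for l z
 have qw: "wd h (q l) (q' l)" for l
  unfolding q_def q'_def E'_def by (rule wd_mult[OF wd_pc[OF g] w])
 have qm: "(%z. \<integral>\<^sup>+ l. ennreal (norm (pc (slice F z) (k - l) * u l z)) \<partial>modes) \<in> borel_measurable HM"
  if "good j F" "mmeas u" for F j u
 proof (rule meas_count)
  fix l
  have [measurable]: "(%z. pc (slice F z) (k - l)) \<in> borel_measurable HM" "u l \<in> borel_measurable HM"
   using pc_measurable[OF that(1), of "k - l"] mmeasD[OF that(2)] by auto
  show "(%z. ennreal (norm (pc (slice F z) (k - l) * u l z))) \<in> borel_measurable HM" by measurable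
 qed
 have "wd h (%z. LINT l|modes. q l z) (%z. LINT l|modes. q' l z)"
 proof (rule wd_sum[OF qw])
  show "(\<integral>\<^sup>+ z. \<integral>\<^sup>+ l. ennreal (norm (q l z)) \<partial>modes \<partial>HM) < \<infinity>"
   unfolding q_def by (rule TE_abs_finite[OF g mm(1) v])
  have "(\<integral>\<^sup>+ z. \<integral>\<^sup>+ l. ennreal (norm (q' l z)) \<partial>modes \<partial>HM) \<le>
    (\<integral>\<^sup>+ z. (\<integral>\<^sup>+ l. ennreal (norm (pc (slice E' z) (k - l) * v l z)) \<partial>modes) +
    (\<integral>\<^sup>+ l. ennreal (norm (pc (slice E z) (k - l) * v' l z)) \<partial>modes) \<partial>HM)"
   unfolding q'_def
   by (intro nn_integral_mono, subst nn_integral_add[symmetric])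
    (auto intro!: nn_integral_mono norm_triangle_ineq simp flip: ennreal_plus)
  also have "... < \<infinity>"
   by (subst nn_integral_add) (use TE_abs_finite(1)[OF g' mm(1) v] TE_abs_finite(1)[OF g mm(2) v'] qm[OF g' mm(1)] qm[OF g mm(2)] in auto)
  finally show "(\<integral>\<^sup>+ z. \<integral>\<^sup>+ l. ennreal (norm (q' l z)) \<partial>modes \<partial>HM) < \<infinity>" .
 qed
 then show ?thesis
 proof (rule wd_cong_AE)
  show "AE z in HM. (LINT l|modes. q l z) = TE E v k z" by (simp add: TE_def T_def q_def)
  show "AE z in HM. (LINT l|modes. q' l z) = TE (partials [dZ] E) v k z + TE E v' k z"
   using TE_abs_finite(2)[OF g' mm(1) v, of k] TE_abs_finite(2)[OF g mm(2) v', of k]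
   by eventually_elim (simp add: TE_def T_def q'_def E'_def)
  show "TE E v k \<in> borel_measurable HM" by (rule mmeasD[OF mmeas_TE[OF g mm(1)]])
  have "mmeas (TE (partials [dZ] E) v)" "mmeas (TE E v')"
   using mmeas_TE[OF g' mm(1)] mmeas_TE[OF g mm(2)] by (simp_all add: E'_def)
  from mmeasD[OF mmeas_add[OF this]]
  show "(%z. TE (partials [dZ] E) v k z + TE E v' k z) \<in> borel_measurable HM" .
 qed
qed

lemma jet_mono: "jet m w ==> n <= m ==> jet n w"
 by (auto simp: jet_def)

lemma jet_Suc: "jet (Suc m) w \<longleftrightarrow> mmeas (w 0) \<and> (\<forall>k. wd h (w 0 k) (w 1 k)) \<and> jet m (%j. w (Suc j))"
 unfolding jet_def
 by (auto simp: less_Suc_eq_0_disj) (metis Suc_le_mono not0_implies_Suc)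

lemma Nj_Suc: "Nj (Suc m) w = NN (Suc m) (w 0) + Nj m (%j. w (Suc j))"
 unfolding Nj_def by (subst sum.atMost_Suc_shift) simp

lemma Nj_le_Suc: "Nj m w <= Nj (Suc m) w"
proof -
 have "Nj m w <= (\<Sum>j\<le>m. NN (Suc m - j) (w j))"
  unfolding Nj_def by (intro sum_mono NN_mono) auto
 also have "... <= Nj (Suc m) w" unfolding Nj_def by simp
 finally show ?thesis .
qed

lemma Nj_add:
 assumes "!!j. j <= m ==> mmeas (u j)" "!!j. j <= m ==> mmeas (v j)"
 shows "Nj m (%j k z. u j k z + v j k z) <= 2 * Nj m u + 2 * Nj m v"
proof -
 have "Nj m (%j k z. u j k z + v j k z) <= (\<Sum>j\<le>m. 2 * NN (m - j) (u j) + 2 * NN (m - j) (v j))"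
  unfolding Nj_def by (intro sum_mono NN_add assms) auto
 then show ?thesis by (simp add: Nj_def sum.distrib sum_distrib_left)
qed

lemma jet_add:
 assumes "jet m u" "jet m v" shows "jet m (%j k z. u j k z + v j k z)"
 unfolding jet_def
proof (intro conjI allI impI)
 fix j assume "j <= m"
 then show "mmeas (%k z. u j k z + v j k z)" using assms by (intro mmeas_add) (auto simp: jet_def)
next
 fix j k assume "j < m"
 then have "wd h (u j k) (u (Suc j) k)" "wd h (v j k) (v (Suc j) k)" using assms unfolding jet_def by blast+
 then show "wd h (%z. u j k z + v j k z) (%z. u (Suc j) k z + v (Suc j) k z)" by (rule wd_add)
qed

text \<open>Induction generalised over the envelope: the tail of the jet of \<open>E w\<close> is
  the sum of the jets of \<open>(d_z E) w\<close> and \<open>E w'\<close>, both of order one less,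
  and the head is bounded by \<open>TE_NN\<close>.\<close>

lemma product_jet:
 assumes "good m E"
 shows "\<exists>C\<ge>0. \<forall>w. jet m w \<and> Nj m w < \<infinity> -->
   (\<exists>w'. jet m w' \<and> w' 0 = TE E (w 0) \<and> Nj m w' <= ennreal C * Nj m w)"
 using assms
proof (induction m arbitrary: E)
 case 0
 obtain C where C: "C >= 0" "!!v. mmeas v ==> NN 0 v < \<infinity> ==> NN 0 (TE E v) <= ennreal C * NN 0 v"
  using TE_NN[OF 0] by blast
 show ?case
 proof (intro exI[of _ C] conjI allI impI C)
  fix w assume w: "jet 0 w \<and> Nj 0 w < \<infinity>"
  then have "mmeas (w 0)" "NN 0 (w 0) < \<infinity>" by (auto simp: jet_def Nj_def)
  then show "\<exists>w'. jet 0 w' \<and> w' 0 = TE E (w 0) \<and> Nj 0 w' <= ennreal C * Nj 0 w"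
   using C(2)[of "w 0"] mmeas_TE[OF 0]
   by (intro exI[of _ "%_. TE E (w 0)"]) (auto simp: jet_def Nj_def)
 qed
next
 case (Suc m)
 define E' where "E' = partials [dZ] E"
 have gE': "good m E'" unfolding E'_def by (rule good_SucD[OF Suc.prems]) (simp add: Basis_space)
 have gE: "good m E" by (rule good_mono[OF Suc.prems]) simp
 obtain C0 where C0: "C0 >= 0" "!!v. mmeas v ==> NN (Suc m) v < \<infinity> ==> NN (Suc m) (TE E v) <= ennreal C0 * NN (Suc m) v"
  using TE_NN[OF Suc.prems] by blast
 obtain C1 where C1: "C1 >= 0" "!!w. jet m w ==> Nj m w < \<infinity> ==>
   \<exists>w'. jet m w' \<and> w' 0 = TE E' (w 0) \<and> Nj m w' <= ennreal C1 * Nj m w" using Suc.IH[OF gE'] by blast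
 obtain C2 where C2: "C2 >= 0" "!!w. jet m w ==> Nj m w < \<infinity> ==>
   \<exists>w'. jet m w' \<and> w' 0 = TE E (w 0) \<and> Nj m w' <= ennreal C2 * Nj m w" using Suc.IH[OF gE] by blast
 define C where "C = C0 + 2 * C1 + 2 * C2"
 have C: "C >= 0" using C0(1) C1(1) C2(1) by (simp add: C_def)
 show ?case
 proof (intro exI[of _ C] conjI allI impI C)
  fix w assume w: "jet (Suc m) w \<and> Nj (Suc m) w < \<infinity>"
  define ws where "ws j = w (Suc j)" for j
  have w0: "mmeas (w 0)" "!!k. wd h (w 0 k) (ws 0 k)" "jet m ws" using w by (auto simp: jet_Suc ws_def[abs_def])
  have jw: "jet m w" using w jet_mono by auto
  have N: "NN (Suc m) (w 0) <= Nj (Suc m) w" "Nj m ws <= Nj (Suc m) w" "Nj m w <= Nj (Suc m) w"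
   using Nj_le_Suc[of m w] unfolding Nj_Suc ws_def[abs_def] by auto
  then have fin: "NN (Suc m) (w 0) < \<infinity>" "Nj m ws < \<infinity>" "Nj m w < \<infinity>" using w by (auto intro: le_less_trans)
  obtain wa where wa: "jet m wa" "wa 0 = TE E' (w 0)" "Nj m wa <= ennreal C1 * Nj m w" using C1(2)[OF jw fin(3)] by blast
  obtain wb where wb: "jet m wb" "wb 0 = TE E (ws 0)" "Nj m wb <= ennreal C2 * Nj m ws" using C2(2)[OF w0(3) fin(2)] by blast
  define wc where "wc j k z = wa j k z + wb j k z" for j k z
  have jc: "jet m wc" unfolding wc_def[abs_def] by (rule jet_add[OF wa(1) wb(1)])
  \<comment> \<open>Head and tail of the new jet; the link between them is
    \<open>TE_wd\<close>.\<close>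
  define w' where "w' j = (case j of 0 => TE E (w 0) | Suc j => wc j)" for j
  have z: "NN 0 (w 0) < \<infinity>" "NN 0 (ws 0) < \<infinity>"
  proof -
   show "NN 0 (w 0) < \<infinity>" using NN_mono[of 0 "Suc m" "w 0"] fin(1) by auto
   have "NN m (ws 0) <= Nj m ws" unfolding Nj_def by (rule order_trans[OF _ member_le_sum[of 0]]) auto
   then show "NN 0 (ws 0) < \<infinity>" using NN_mono[of 0 m "ws 0"] fin(2) by (auto intro: le_less_trans)
  qed
  have "wd h (w' 0 k) (w' 1 k)" for k
   using TE_wd[OF Suc.prems w0(2) z, of k] by (simp add: w'_def wc_def[abs_def] wa(2) wb(2) E'_def)
  then have "jet (Suc m) w'"
   unfolding jet_Suc using mmeas_TE[OF gE w0(1)] jc by (simp add: w'_def)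
  moreover have "w' 0 = TE E (w 0)" by (simp add: w'_def)
  moreover have "Nj (Suc m) w' <= ennreal C * Nj (Suc m) w"
  proof -
   have "Nj (Suc m) w' = NN (Suc m) (TE E (w 0)) + Nj m wc" unfolding Nj_Suc by (simp add: w'_def)
   also have "... <= NN (Suc m) (TE E (w 0)) + (2 * Nj m wa + 2 * Nj m wb)"
    unfolding wc_def[abs_def] by (intro add_left_mono Nj_add) (use wa wb in \<open>auto simp: jet_def\<close>)
   also have "... <= ennreal C0 * Nj (Suc m) w + (2 * (ennreal C1 * Nj (Suc m) w) + 2 * (ennreal C2 * Nj (Suc m) w))"
    by (intro add_mono mult_left_mono order_trans[OF C0(2)[OF w0(1) fin(1)]] order_trans[OF wa(3)] order_trans[OF wb(3)] N) auto
   also have "... = ennreal C * Nj (Suc m) w"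
    using C0(1) C1(1) C2(1) by (simp add: C_def ennreal_plus ennreal_mult' distrib_right mult.assoc add.assoc)
   finally show ?thesis .
  qed
  ultimately show "\<exists>w'. jet (Suc m) w' \<and> w' 0 = TE E (w 0) \<and> Nj (Suc m) w' <= ennreal C * Nj (Suc m) w" by blast
 qed
qed

end

section \<open>Two-point boundary value problems\<close>

lemma AC_cnj: "AC h F f ==> AC h (%z. cnj (F z)) (%z. cnj (f z))"
 unfolding AC_def
proof (elim conjE exE, intro conjI exI ballI)
 fix c z assume f: "integrable (IM h) f" and F: "\<forall>z\<in>{-h..h}. F z = c + J h f z" and z: "z \<in> {-h..h}"
 have "J h (%z. cnj (f z)) z = (LINT t|IM h. cnj (indicator {..<z} t *\<^sub>R f t))" by (simp add: J_def)
 also have "... = cnj (J h f z)" unfolding J_def by (rule Bochner_Integration.integral_cnj)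
 finally show "cnj (F z) = cnj c + J h (%z. cnj (f z)) z" using F z by simp
qed auto

lemma AC_L2:
 assumes "AC h F f" "h > 0" shows "L2 (IM h) F"
proof -
 have "compact (F ` {-h..h})" using AC_continuous[OF assms(1)] compact_continuous_image by blast
 then obtain B where B: "!!z. z \<in> {-h..h} ==> norm (F z) <= B"
  by (meson bounded_iff compact_imp_bounded image_eqI)
 have "integrable (IM h) F" using AC_integrable_mult[OF assms(1) ACD(1)[OF assms(1)]] assms(2) by auto
 then show ?thesis by (intro IM.L2_bounded[of _ _ B]) (use B in auto)
qed

lemma bvp_energy:
 assumes h: "h > 0" and V: "AC h V V1" and V1: "AC h V1 v2" and g: "L2 (IM h) g"
  and ode: "AE z in IM h. v2 z = of_real \<nu> * V z - g z"
  and l: "\<nu> > 0" and ab: "a >= 0" "b >= 0"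
  and bc: "V1 h = - of_real a * V h" "V1 (-h) = of_real b * V (-h)"
 shows "ennreal (\<nu>\<^sup>2) * sqn (IM h) V <= sqn (IM h) g" "ennreal \<nu> * sqn (IM h) V1 <= sqn (IM h) g"
proof -
 note L = AC_L2[OF V h] AC_L2[OF V1 h]
 have [measurable]: "V \<in> borel_measurable (IM h)" "V1 \<in> borel_measurable (IM h)" "g \<in> borel_measurable (IM h)" "v2 \<in> borel_measurable (IM h)"
  using L g ACD(1)[OF V1] h by (auto simp: L2_def)
 have gV: "integrable (IM h) (%z. g z * cnj (V z))" by (intro L2_mult_integrable g L2_cnj L)
 have sq: "integrable (IM h) (%z. (norm (V z))\<^sup>2)" "integrable (IM h) (%z. (norm (V1 z))\<^sup>2)" "integrable (IM h) (%z. (norm (g z))\<^sup>2)"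
  using L g by (auto simp: L2_integrable_sq)
 have "AC h (%z. V1 z * cnj (V z)) (%z. v2 z * cnj (V z) + V1 z * cnj (V1 z))"
  by (rule AC_mult[OF V1 AC_cnj[OF V]]) (use h in simp)
 from AC_integral[OF this] h
 have "(LINT z|IM h. v2 z * cnj (V z) + V1 z * cnj (V1 z)) = V1 h * cnj (V h) - V1 (-h) * cnj (V (-h))" by simp
 also have "... = - of_real (a * (norm (V h))\<^sup>2 + b * (norm (V (-h)))\<^sup>2)"
  unfolding bc of_real_add of_real_mult complex_norm_square by (simp add: algebra_simps)
 also have "(LINT z|IM h. v2 z * cnj (V z) + V1 z * cnj (V1 z)) =
   (LINT z|IM h. of_real (\<nu> * (norm (V z))\<^sup>2 + (norm (V1 z))\<^sup>2) - g z * cnj (V z))"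
 proof (rule integral_cong_AE)
  show "AE z in IM h. v2 z * cnj (V z) + V1 z * cnj (V1 z) = of_real (\<nu> * (norm (V z))\<^sup>2 + (norm (V1 z))\<^sup>2) - g z * cnj (V z)"
   using ode
  proof eventually_elim
   case (elim z)
   show ?case unfolding elim of_real_add of_real_mult complex_norm_square by (simp add: algebra_simps)
  qed
 qed measurable
 also have "... = of_real (LINT z|IM h. \<nu> * (norm (V z))\<^sup>2 + (norm (V1 z))\<^sup>2) - (LINT z|IM h. g z * cnj (V z))"
  using sq gV by (subst Bochner_Integration.integral_diff) (auto simp del: of_real_add of_real_mult of_real_power)
 finally have "Re (of_real (LINT z|IM h. \<nu> * (norm (V z))\<^sup>2 + (norm (V1 z))\<^sup>2) - (LINT z|IM h. g z * cnj (V z))) =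
   - (a * (norm (V h))\<^sup>2 + b * (norm (V (-h)))\<^sup>2)" by simp
 then have "(LINT z|IM h. \<nu> * (norm (V z))\<^sup>2 + (norm (V1 z))\<^sup>2) =
   Re (LINT z|IM h. g z * cnj (V z)) - (a * (norm (V h))\<^sup>2 + b * (norm (V (-h)))\<^sup>2)" by simp
 then have "(LINT z|IM h. \<nu> * (norm (V z))\<^sup>2 + (norm (V1 z))\<^sup>2) <= Re (LINT z|IM h. g z * cnj (V z))"
  using mult_nonneg_nonneg[OF ab(1), of "(norm (V h))\<^sup>2"] mult_nonneg_nonneg[OF ab(2), of "(norm (V (-h)))\<^sup>2"] by simp
 also have "... = (LINT z|IM h. Re (g z * cnj (V z)))" by (rule integral_Re[OF gV, symmetric])
 \<comment> \<open>The weight in Young's inequality leaves half of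
   \<open>\<nu> * (norm (V z))\<^sup>2\<close> on the left.\<close>
 also have "... <= (LINT z|IM h. \<nu> / 2 * (norm (V z))\<^sup>2 + 1 / (2 * \<nu>) * (norm (g z))\<^sup>2)"
 proof (rule integral_mono)
  fix z
  have "0 <= (\<nu> * norm (V z) - norm (g z))\<^sup>2 / (2 * \<nu>)" using l by simp
  also have "... = \<nu> / 2 * (norm (V z))\<^sup>2 + 1 / (2 * \<nu>) * (norm (g z))\<^sup>2 - norm (g z) * norm (V z)"
   using l by (simp add: power2_eq_square field_simps)
  also have "norm (g z) * norm (V z) = norm (g z * cnj (V z))" by (simp add: norm_mult)
  finally have "norm (g z * cnj (V z)) <= \<nu> / 2 * (norm (V z))\<^sup>2 + 1 / (2 * \<nu>) * (norm (g z))\<^sup>2" by simp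
  then show "Re (g z * cnj (V z)) <= \<nu> / 2 * (norm (V z))\<^sup>2 + 1 / (2 * \<nu>) * (norm (g z))\<^sup>2"
   using complex_Re_le_cmod order_trans by blast
 qed (use integrable_Re[OF gV] sq in auto)
 finally have main: "\<nu> / 2 * (LINT z|IM h. (norm (V z))\<^sup>2) + (LINT z|IM h. (norm (V1 z))\<^sup>2) <= 1 / (2 * \<nu>) * (LINT z|IM h. (norm (g z))\<^sup>2)"
  using sq by simp
 define X Y G where "X = (LINT z|IM h. (norm (V z))\<^sup>2)" and "Y = (LINT z|IM h. (norm (V1 z))\<^sup>2)" and "G = (LINT z|IM h. (norm (g z))\<^sup>2)"
 have nn: "X >= 0" "Y >= 0" "G >= 0" by (auto simp: X_def Y_def G_def)
 have "\<nu> / 2 * X + Y <= 1 / (2 * \<nu>) * G" using main by (simp add: X_def Y_def G_def)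
 then have "2 * \<nu> * (\<nu> / 2 * X + Y) <= 2 * \<nu> * (1 / (2 * \<nu>) * G)" using l by (intro mult_left_mono) auto
 then have m2: "\<nu>\<^sup>2 * X + 2 * (\<nu> * Y) <= G" using l by (simp add: power2_eq_square algebra_simps)
 have p: "0 <= \<nu>\<^sup>2 * X" "0 <= \<nu> * Y" using nn l by auto
 have "\<nu>\<^sup>2 * X <= G" "\<nu> * Y <= G" using m2 p by linarith+
 then show "ennreal (\<nu>\<^sup>2) * sqn (IM h) V <= sqn (IM h) g" "ennreal \<nu> * sqn (IM h) V1 <= sqn (IM h) g"
  unfolding sqn_eq_integral[OF L(1)] sqn_eq_integral[OF L(2)] sqn_eq_integral[OF g] X_def Y_def G_def
  using l by (auto simp flip: ennreal_mult' intro!: ennreal_leI)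
qed

text \<open>Classical solutions on the whole line: they are smooth across the faces of the slab, so
  the vector field built from them later is a classical one.\<close>

definition hsol :: "complex => (real => complex) => (real => complex) => bool" where
 "hsol \<nu> y y' \<longleftrightarrow> (\<forall>z. (y has_vector_derivative y' z) (at z)) \<and> (\<forall>z. (y' has_vector_derivative \<nu> * y z) (at z))"

lemma hsol_exists:
 obtains y y' where "hsol \<nu> y y'" "y z0 = a" "y' z0 = b"
proof (cases "\<nu> = 0")
 \<comment> \<open>For \<open>\<nu> = 0\<close> the two exponentials coincide, and affine functions
   take their place.\<close>
 case True
 have "hsol \<nu> (%z. a + of_real (z - z0) * b) (%z. b)"
  unfolding hsol_def using True by (auto intro!: derivative_eq_intros has_vector_derivative_real_field)
 then show thesis by (rule that) auto
next
 case False
 define \<mu> where "\<mu> = csqrt \<nu>"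
 have mu: "\<mu> \<noteq> 0" "\<mu> * \<mu> = \<nu>" using False by (auto simp: \<mu>_def simp flip: power2_eq_square)
 define A B where "A = (a + b / \<mu>) / 2" and "B = (a - b / \<mu>) / 2"
 define y where "y z = A * exp (\<mu> * of_real (z - z0)) + B * exp (- \<mu> * of_real (z - z0))" for z
 define y' where "y' z = \<mu> * A * exp (\<mu> * of_real (z - z0)) - \<mu> * B * exp (- \<mu> * of_real (z - z0))" for z
 have e: "((%z. C * exp (c * of_real (z - z0))) has_vector_derivative c * C * exp (c * of_real (z - z0))) (at z)" for c C :: complex and z
 proof -
  have "((%z. C * exp (c * (z - of_real z0))) has_field_derivative c * C * exp (c * of_real (z - z0))) (at (of_real z))"
   by (auto intro!: derivative_eq_intros)
  from has_vector_derivative_real_field[OF this] show ?thesis by simp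
 qed
 have "(y has_vector_derivative y' z) (at z)" for z
  unfolding y_def y'_def using has_vector_derivative_add[OF e[of A \<mu> z] e[of B "- \<mu>" z]] by simp
 moreover have "(y' has_vector_derivative \<nu> * y z) (at z)" for z
  unfolding y_def y'_def using has_vector_derivative_diff[OF e[of "\<mu> * A" \<mu> z] e[of "\<mu> * B" "- \<mu>" z]]
  by (simp add: algebra_simps flip: mu(2))
 ultimately have "hsol \<nu> y y'" by (simp add: hsol_def)
 moreover have "y z0 = a" "y' z0 = b" using mu(1) by (auto simp: y_def y'_def A_def B_def field_simps)
 ultimately show thesis by (rule that)
qed

lemma hsol_AC:
 assumes "hsol \<nu> y y'" "h > 0"
 shows "AC h y y'" "AC h y' (%z. \<nu> * y z)"
proof -
 have "continuous_on S y" "continuous_on S y'" for S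
  using assms(1) unfolding hsol_def by (auto intro!: continuous_at_imp_continuous_on has_vector_derivative_continuous)
 then show "AC h y y'" "AC h y' (%z. \<nu> * y z)"
  using assms by (auto simp: hsol_def intro!: AC_real continuous_intros)
qed

lemma hsol_smooth:
 assumes "hsol \<nu> y y'" shows "smooth y" "smooth y'"
proof -
 have "C_k UNIV k y \<and> C_k UNIV k y'" for k
 proof (induction k)
  case 0
  show ?case
   using assms unfolding hsol_def C_k_0
   by (auto intro!: continuous_at_imp_continuous_on has_vector_derivative_continuous)
 next
  case (Suc k)
  then show ?case
   using assms C_k_Suc_real[of y y' k] C_k_Suc_real[of y' "%z. \<nu> * y z" k] C_k_mult[OF C_k_const, of k y \<nu>]
   by (auto simp: hsol_def)
 qed
 then show "smooth y" "smooth y'" by (auto simp: smooth_def)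
qed

text \<open>Lagrange's identity: in the derivative of the Wronskian the products of first
  derivatives cancel.\<close>

lemma AC_mult_diff:
 assumes h: "h > 0" and "AC h V V1" "AC h V1 v2" "AC h y y'" "AC h y' y2"
 shows "AC h (%z. V1 z * y z - V z * y' z) (%z. v2 z * y z - V z * y2 z)"
proof -
 have h0: "0 <= h" using h by simp
 have "AC h (%z. V1 z * y z + (-1) * (V z * y' z)) (%z. (v2 z * y z + V1 z * y' z) + (-1) * (V1 z * y' z + V z * y2 z))"
  by (intro AC_add AC_cmult AC_mult assms h0)
 then show ?thesis by (simp add: algebra_simps)
qed

text \<open>If \<open>F\<close> vanishes at the right end, its value is a difference of two
  primitives started at \<open>-h\<close>; hence the factor 2.\<close>

lemma AC_ends_bound:
 assumes F: "AC h F f" and h: "h > 0" and z: "z \<in> {-h..h}"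
 shows "F (-h) = 0 ==> norm (F z) <= (LINT t|IM h. norm (f t))"
  "F h = 0 ==> norm (F z) <= 2 * (LINT t|IM h. norm (f t))"
proof -
 have f: "integrable (IM h) f" using ACD(1)[OF F] h by simp
 have e: "F z = F (-h) + J h f z" "F h = F (-h) + J h f h"
  by (rule ACD(2)[OF F]; use h z in simp)+
 have n: "norm (J h f z) <= (LINT t|IM h. norm (f t))" "norm (J h f h) <= (LINT t|IM h. norm (f t))"
  using norm_J[OF f] by auto
 show "F (-h) = 0 ==> norm (F z) <= (LINT t|IM h. norm (f t))" using e n by simp
 show "F h = 0 ==> norm (F z) <= 2 * (LINT t|IM h. norm (f t))"
 proof -
  assume "F h = 0"
  then have "F z = J h f z - J h f h" using e by (simp add: add_eq_0_iff)
  then show ?thesis using n norm_triangle_ineq4[of "J h f z" "J h f h"] by simp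
 qed
qed

lemma L1_le_L2:
 assumes g: "L2 (IM h) g" and h: "h > 0"
 shows "ennreal ((LINT z|IM h. norm (g z))\<^sup>2) <= ennreal (2 * h) * sqn (IM h) g"
proof -
 have c: "L2 (IM h) (%z. of_real (norm (g z)))" using g by (auto simp: L2_def)
 have "ennreal ((norm (LINT z|IM h. 1 * complex_of_real (norm (g z))))\<^sup>2) <= sqn (IM h) (%z. 1) * sqn (IM h) (%z. of_real (norm (g z)))"
  by (rule sqn_cauchy_schwarz[OF IM.L2_const c])
 moreover have "sqn (IM h) (%z. 1) = ennreal (2 * h)"
  using h by (simp add: sqn_def emeasure_restrict_space)
 moreover have "sqn (IM h) (%z. of_real (norm (g z))) = sqn (IM h) g" by (simp add: sqn_def)
 ultimately show ?thesis by simp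
qed

text \<open>Either the homogeneous problem has a nonzero solution, or Green's representation bounds every
 solution by the right-hand side.\<close>

lemma bvp_green:
 fixes \<nu> :: complex
 assumes h: "h > 0"
  and uniq: "!!y y'. hsol \<nu> y y' ==> y' h = a * y h ==> y' (-h) = b * y (-h) ==> y (-h) = 0"
 obtains C where "C >= 0" "!!V V1 v2 g. AC h V V1 ==> AC h V1 v2 ==> L2 (IM h) g ==>
   AE z in IM h. v2 z = \<nu> * V z - g z ==> V1 h = a * V h ==> V1 (-h) = b * V (-h) ==>
   sqn (IM h) V <= ennreal C * sqn (IM h) g \<and> sqn (IM h) V1 <= ennreal C * sqn (IM h) g"
proof -
 \<comment> \<open>\<open>p\<close> satisfies the condition at the left end, \<open>q\<close> the
   one at the right end; the uniqueness premise makes them independent, that is, their Wronskian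
   \<open>w\<close> is nonzero.\<close>
 obtain p p' where p: "hsol \<nu> p p'" "p (-h) = 1" "p' (-h) = b" by (rule hsol_exists[of \<nu> "-h" 1 b])
 obtain q q' where q: "hsol \<nu> q q'" "q h = 1" "q' h = a" by (rule hsol_exists[of \<nu> h 1 a])
 note pA = hsol_AC[OF p(1) h] and qA = hsol_AC[OF q(1) h]
 define w where "w = p' h - a * p h"
 have w0: "w \<noteq> 0"
 proof
  assume "w = 0"
  then have "p (-h) = 0" using uniq[OF p(1)] p by (simp add: w_def)
  then show False using p by simp
 qed
 have wr: "p' z * q z - p z * q' z = w" if z: "z \<in> {-h..h}" for z
 proof -
  have "AC h (%z. p' z * q z - p z * q' z) (%z. \<nu> * p z * q z - p z * (\<nu> * q z))"
   by (rule AC_mult_diff[OF h pA qA])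
  then have A: "AC h (%z. p' z * q z - p z * q' z) (%z. 0)" by (simp add: mult_ac)
  have J0: "J h (%z. 0) z = 0" for z by (simp add: J_def)
  have "p' z * q z - p z * q' z = p' h * q h - p h * q' h"
   using ACD(2)[OF A less_imp_le[OF h] z] ACD(2)[OF A less_imp_le[OF h], of h] h unfolding J0 by simp
  then show ?thesis using q by (simp add: w_def mult.commute)
 qed
 have bd: "bounded (f ` {-h..h})" if "AC h f f'" for f f'
  by (intro compact_imp_bounded compact_continuous_image AC_continuous[OF that]) auto
 have "bounded (p ` {-h..h} \<union> p' ` {-h..h} \<union> q ` {-h..h} \<union> q' ` {-h..h})"
  unfolding bounded_Un using bd[OF pA(1)] bd[OF pA(2)] bd[OF qA(1)] bd[OF qA(2)] by blast
 then obtain B where "\<forall>x\<in>p ` {-h..h} \<union> p' ` {-h..h} \<union> q ` {-h..h} \<union> q' ` {-h..h}. norm x <= B" by (auto simp: bounded_iff)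
 then have B: "!!z. z \<in> {-h..h} ==> norm (p z) <= B \<and> norm (p' z) <= B \<and> norm (q z) <= B \<and> norm (q' z) <= B" by blast
 have B0: "B >= 0" using order_trans[OF norm_ge_zero conjunct1[OF B[of h]]] h by simp
 \<comment> \<open>The 3 is 1 for \<open>P\<close> plus 2 for \<open>Q\<close>;
   \<open>norm w\<close> is divided out when the two Wronskians are solved for \<open>V\<close> and
   \<open>V1\<close>.\<close>
 define c where "c = 3 * B\<^sup>2 / norm w"
 have c0: "c >= 0" by (simp add: c_def)
 show thesis
 proof (rule that[of "(2 * h * c)\<^sup>2"])
  fix V V1 v2 g
  assume V: "AC h V V1" "AC h V1 v2" and g: "L2 (IM h) g" and ode: "AE z in IM h. v2 z = \<nu> * V z - g z"
   and bc: "V1 h = a * V h" "V1 (-h) = b * V (-h)"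
  have [measurable]: "g \<in> borel_measurable (IM h)" using g by (simp add: L2_def)
  have gi: "integrable (IM h) (%z. norm (g z))" using IM.L2_integrable[OF g] by simp
  define G where "G = (LINT z|IM h. norm (g z))"
  have G0: "G >= 0" by (simp add: G_def)
  have wron: "AC h (%z. V1 z * y z - V z * y' z) (%z. - (g z * y z))" if y: "AC h y y'" "AC h y' (%z. \<nu> * y z)" for y y'
  proof (rule AC_cong[OF AC_mult_diff[OF h V y]])
   show "AE z in IM h. v2 z * y z - V z * (\<nu> * y z) = - (g z * y z)"
    using ode
   proof eventually_elim
    case (elim z)
    show ?case unfolding elim by (simp add: algebra_simps)
   qed
   have "y \<in> borel_measurable (IM h)" using AC_L2[OF y(1) h] by (simp add: L2_def)
   then show "(%z. - (g z * y z)) \<in> borel_measurable (IM h)" by measurable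
  qed (use h in auto)
  have nb: "(LINT z|IM h. norm (- (g z * y z))) <= B * G" if y: "AC h y y'" "!!z. z \<in> {-h..h} ==> norm (y z) <= B" for y y'
  proof -
   have i: "integrable (IM h) (%z. g z * y z)" by (intro L2_mult_integrable g AC_L2[OF y(1) h])
   have "(LINT z|IM h. norm (- (g z * y z))) <= (LINT z|IM h. B * norm (g z))"
   proof (rule integral_mono)
    fix z assume "z \<in> space (IM h)"
    then have "z \<in> {-h..h}" by auto
    then have "norm (g z) * norm (y z) <= norm (g z) * B" by (intro mult_left_mono y) auto
    then show "norm (- (g z * y z)) <= B * norm (g z)" by (simp add: norm_mult mult.commute)
   qed (use i gi in auto)
   then show ?thesis by (simp add: G_def)
  qed
  \<comment> \<open>Wronskians of \<open>V\<close> with \<open>p\<close> and \<open>q\<close>.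
    \<open>V\<close> shares the left condition with \<open>p\<close> and the right one with
    \<open>q\<close>, so \<open>P\<close> vanishes at \<open>-h\<close> and \<open>Q\<close> at
    \<open>h\<close>, and both are controlled by the integral of \<open>norm (g z)\<close>.\<close>
  define P Q where "P z = V1 z * p z - V z * p' z" and "Q z = V1 z * q z - V z * q' z" for z
  have PA: "AC h P (%z. - (g z * p z))" and QA: "AC h Q (%z. - (g z * q z))"
   unfolding P_def[abs_def] Q_def[abs_def] by (rule wron[OF pA], rule wron[OF qA])
  have Pb: "norm (P z) <= B * G" and Qb: "norm (Q z) <= 2 * (B * G)" if z: "z \<in> {-h..h}" for z
   using AC_ends_bound(1)[OF PA h z] AC_ends_bound(2)[OF QA h z] nb[OF pA(1)] nb[OF qA(1)] B p q bc
   by (auto simp: P_def Q_def intro: order_trans)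
  have comb: "norm (x * P z - y * Q z) <= 3 * B\<^sup>2 * G" if z: "z \<in> {-h..h}" and xy: "norm x <= B" "norm y <= B" for x y z
  proof -
   have "norm (x * P z - y * Q z) <= norm x * norm (P z) + norm y * norm (Q z)"
    using norm_triangle_ineq4[of "x * P z" "y * Q z"] by (simp add: norm_mult)
   also have "... <= B * (B * G) + B * (2 * (B * G))"
    by (intro add_mono mult_mono xy Pb Qb z) (use B0 in auto)
   also have "... = 3 * B\<^sup>2 * G" by (simp add: power2_eq_square)
   finally show ?thesis .
  qed
  have Vb: "norm (V z) <= c * G" and V1b: "norm (V1 z) <= c * G" if z: "z \<in> {-h..h}" for z
  proof -
   have "w * V z = - (q z * P z - p z * Q z)" "w * V1 z = - (q' z * P z - p' z * Q z)"
    unfolding P_def Q_def wr[OF z, symmetric] by (simp_all add: algebra_simps)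
   then have "norm w * norm (V z) <= 3 * B\<^sup>2 * G" "norm w * norm (V1 z) <= 3 * B\<^sup>2 * G"
    using comb[OF z] B[OF z] by (metis norm_minus_cancel norm_mult)+
   then show "norm (V z) <= c * G" "norm (V1 z) <= c * G"
    using w0 unfolding c_def by (simp_all add: field_simps)
  qed
  have "sqn (IM h) F <= ennreal ((2 * h * c)\<^sup>2) * sqn (IM h) g" if F: "!!z. z \<in> {-h..h} ==> norm (F z) <= c * G" for F
  proof -
   have "sqn (IM h) F <= (\<integral>\<^sup>+ z. ennreal ((c * G)\<^sup>2) \<partial>IM h)"
    unfolding sqn_def by (intro nn_integral_mono ennreal_leI power_mono F) auto
   also have "... = ennreal (2 * h * c\<^sup>2) * ennreal (G\<^sup>2)"
    using h by (simp add: emeasure_restrict_space power_mult_distrib mult_ac flip: ennreal_mult')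
   also have "... <= ennreal (2 * h * c\<^sup>2) * (ennreal (2 * h) * sqn (IM h) g)"
    unfolding G_def by (intro mult_left_mono L1_le_L2[OF g h]) auto
   also have "... = ennreal ((2 * h * c)\<^sup>2) * sqn (IM h) g"
   proof -
    have "2 * h * c\<^sup>2 * (2 * h) = (2 * h * c)\<^sup>2" by (simp add: power2_eq_square)
    then have "ennreal (2 * h * c\<^sup>2) * ennreal (2 * h) = ennreal ((2 * h * c)\<^sup>2)"
     using h by (metis ennreal_mult'' less_imp_le mult_nonneg_nonneg zero_le_numeral)
    then show ?thesis by (simp only: mult.assoc[symmetric])
   qed
   finally show ?thesis .
  qed
  then show "sqn (IM h) V <= ennreal ((2 * h * c)\<^sup>2) * sqn (IM h) g \<and> sqn (IM h) V1 <= ennreal ((2 * h * c)\<^sup>2) * sqn (IM h) g"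
   using Vb V1b by blast
 qed simp
qed

section \<open>Sobolev spaces in terms of Fourier coefficients\<close>

lemma vec_integrable_iff:
 fixes f :: "'a => complex^3"
 shows "integrable M f \<longleftrightarrow> (\<forall>i. integrable M (%x. f x $ i))"
proof
 assume "integrable M f"
 then show "\<forall>i. integrable M (%x. f x $ i)"
  using integrable_bounded_linear[OF bounded_linear_vec_nth] by blast
next
 assume *: "\<forall>i. integrable M (%x. f x $ i)"
 have "bounded_linear (%c. axis i c :: complex^3)" for i
  unfolding linear_conv_bounded_linear[symmetric] by (rule linearI) (auto simp: vec_eq_iff axis_def)
 then have "integrable M (%x. \<Sum>i\<in>UNIV. axis i (f x $ i) :: complex^3)"
  by (intro Bochner_Integration.integrable_sum integrable_bounded_linear[where T = "axis _"]) (use * in auto)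
 moreover have "(\<Sum>i\<in>UNIV. axis i (f x $ i)) = f x" for x
  by (simp add: vec_eq_iff axis_def sum.delta if_distrib[of "%v. v $ _"] cong: if_cong)
 ultimately show "integrable M f" by simp
qed

lemma vec_meas_iff:
 fixes f :: "'a => complex^3"
 shows "f \<in> borel_measurable M \<longleftrightarrow> (\<forall>i. (%x. f x $ i) \<in> borel_measurable M)"
proof
 assume f: "f \<in> borel_measurable M"
 show "\<forall>i. (%x. f x $ i) \<in> borel_measurable M"
  by (intro allI measurable_compose[OF f] borel_measurable_continuous_onI continuous_intros)
next
 assume *: "\<forall>i. (%x. f x $ i) \<in> borel_measurable M"
 have "continuous_on UNIV (%c. axis i c :: complex^3)" for i
  by (rule linear_continuous_on) (simp add: linear_conv_bounded_linear[symmetric] linear_iff vec_eq_iff axis_def)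
 then have "(%x. \<Sum>i\<in>UNIV. axis i (f x $ i) :: complex^3) \<in> borel_measurable M"
  by (intro borel_measurable_sum measurable_compose[OF *[rule_format] borel_measurable_continuous_onI])
 moreover have "(\<Sum>i\<in>UNIV. axis i (f x $ i)) = f x" for x
  by (simp add: vec_eq_iff axis_def sum.delta if_distrib[of "%v. v $ _"] cong: if_cong)
 ultimately show "f \<in> borel_measurable M" by simp
qed

lemma vec_integral: "integrable M f ==> (LINT x|M. f x) $ i = (LINT x|M. f x $ i)" for f :: "'a => complex^3"
 using integral_bounded_linear[OF bounded_linear_vec_nth, of M f i] by simp

lemma norm_vec_sq: "(norm (v :: complex^3))\<^sup>2 = (\<Sum>i\<in>UNIV. (norm (v $ i))\<^sup>2)"
 unfolding norm_vec_def L2_set_def by (simp add: sum_nonneg)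

lemma has_wderiv_alt: "has_wderiv h j f g \<longleftrightarrow> integrable (IM h) f \<and> integrable (IM h) g \<and>
  (\<forall>ps :: real => real. test_function {-h<..<h} ps -->
   (LINT z|IM h. (deriv ^^ j) ps z *\<^sub>R f z) = (-1) ^ j *\<^sub>R (LINT z|IM h. ps z *\<^sub>R g z))"
 unfolding has_wderiv_def by (simp add: set_integrable_def integrable_restrict_space set_lebesgue_integral_def integral_restrict_space)

lemma test_integrable_vec:
 fixes f :: "real => complex^3" and ps :: "real => real"
 assumes "test_function U ps" "integrable (IM h) f"
 shows "integrable (IM h) (%z. ps z *\<^sub>R f z)"
 using assms test_integrable[OF assms(1)] by (simp add: vec_integrable_iff)

lemma has_wderiv_1: "has_wderiv h 1 f g \<longleftrightarrow> (\<forall>i. wd h (%z. f z $ i) (%z. g z $ i))"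
proof -
 have eq: "(LINT z|IM h. deriv ps z *\<^sub>R f z) = - (LINT z|IM h. ps z *\<^sub>R g z) \<longleftrightarrow>
   (\<forall>i. (LINT z|IM h. deriv ps z *\<^sub>R f z $ i) = - (LINT z|IM h. ps z *\<^sub>R g z $ i))"
  if "integrable (IM h) f" "integrable (IM h) g" and t: "test_function {-h<..<h} ps" for ps
  using vec_integral[OF test_integrable_vec[OF test_deriv(2)[OF t] that(1)]] vec_integral[OF test_integrable_vec[OF t that(2)]]
  by (simp add: vec_eq_iff)
 show ?thesis
  unfolding has_wderiv_alt wd_def vec_integrable_iff using eq by (auto simp: vec_integrable_iff)
qed

text \<open>A derivative of a test function is a test function, so the defining identities of orders
  \<open>j\<close> and \<open>Suc j\<close> can be compared.\<close>

lemma has_wderiv_chain: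
 assumes "has_wderiv h j f g" "has_wderiv h (Suc j) f g'" shows "has_wderiv h 1 g g'"
 unfolding has_wderiv_alt
proof (intro conjI allI impI)
 show "integrable (IM h) g" "integrable (IM h) g'" using assms by (auto simp: has_wderiv_alt)
 fix ps :: "real => real" assume t: "test_function {-h<..<h} ps"
 have "(-1) ^ j *\<^sub>R (LINT z|IM h. deriv ps z *\<^sub>R g z) = (LINT z|IM h. (deriv ^^ Suc j) ps z *\<^sub>R f z)"
  using assms(1) test_deriv(2)[OF t] by (simp add: has_wderiv_alt funpow_swap1)
 also have "... = (-1) ^ Suc j *\<^sub>R (LINT z|IM h. ps z *\<^sub>R g' z)" using assms(2) t unfolding has_wderiv_alt by blast
 finally have "(-1) ^ j *\<^sub>R ((-1) ^ j *\<^sub>R (LINT z|IM h. deriv ps z *\<^sub>R g z)) = (-1) ^ j *\<^sub>R ((-1) ^ Suc j *\<^sub>R (LINT z|IM h. ps z *\<^sub>R g' z))"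
  by simp
 then show "(LINT z|IM h. (deriv ^^ 1) ps z *\<^sub>R g z) = (-1) ^ 1 *\<^sub>R (LINT z|IM h. ps z *\<^sub>R g' z)"
  by (simp flip: power_add mult_2 power_mult)
qed

lemma has_wderiv_Suc:
 assumes "has_wderiv h j f g" "has_wderiv h 1 g g'" shows "has_wderiv h (Suc j) f g'"
 unfolding has_wderiv_alt
proof (intro conjI allI impI)
 show "integrable (IM h) f" "integrable (IM h) g'" using assms by (auto simp: has_wderiv_alt)
 fix ps :: "real => real" assume t: "test_function {-h<..<h} ps"
 have "(LINT z|IM h. (deriv ^^ Suc j) ps z *\<^sub>R f z) = (-1) ^ j *\<^sub>R (LINT z|IM h. deriv ps z *\<^sub>R g z)"
  using assms(1) test_deriv(2)[OF t] by (simp add: has_wderiv_alt funpow_swap1)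
 also have "(LINT z|IM h. deriv ps z *\<^sub>R g z) = - (LINT z|IM h. ps z *\<^sub>R g' z)"
  using assms(2) t by (auto simp: has_wderiv_alt)
 finally show "(LINT z|IM h. (deriv ^^ Suc j) ps z *\<^sub>R f z) = (-1) ^ Suc j *\<^sub>R (LINT z|IM h. ps z *\<^sub>R g' z)" by simp
qed

lemma has_wderiv_0: "integrable (IM h) f ==> has_wderiv h 0 f f"
 by (simp add: has_wderiv_alt)

lemma has_wderiv_unique:
 assumes "has_wderiv h j f g" "has_wderiv h j f g'" shows "AE z in IM h. g z = g' z"
proof -
 have i: "integrable (IM h) g" "integrable (IM h) g'" using assms by (auto simp: has_wderiv_alt)
 have "AE z in IM h. g z $ k - g' z $ k = 0" for k
 proof (rule AE_zero_test)
  show "integrable (IM h) (%z. g z $ k - g' z $ k)" using i by (simp add: vec_integrable_iff)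
  fix ps :: "real => real" assume t: "test_function {-h<..<h} ps"
  have "(LINT z|IM h. (deriv ^^ j) ps z *\<^sub>R f z) = (-1) ^ j *\<^sub>R (LINT z|IM h. ps z *\<^sub>R g z)"
   "(LINT z|IM h. (deriv ^^ j) ps z *\<^sub>R f z) = (-1) ^ j *\<^sub>R (LINT z|IM h. ps z *\<^sub>R g' z)"
   using assms t unfolding has_wderiv_alt by blast+
  then have "(-1) ^ j *\<^sub>R (LINT z|IM h. ps z *\<^sub>R g z) = (-1) ^ j *\<^sub>R (LINT z|IM h. ps z *\<^sub>R g' z)"
   by simp
  then have "(LINT z|IM h. ps z *\<^sub>R g z) $ k = (LINT z|IM h. ps z *\<^sub>R g' z) $ k" by simp
  then have "(LINT z|IM h. ps z *\<^sub>R g z $ k) = (LINT z|IM h. ps z *\<^sub>R g' z $ k)"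
   using vec_integral[OF test_integrable_vec[OF t i(1)]] vec_integral[OF test_integrable_vec[OF t i(2)]] by simp
  moreover have "integrable (IM h) (%z. ps z *\<^sub>R g z $ k)" "integrable (IM h) (%z. ps z *\<^sub>R g' z $ k)"
   using i by (auto intro!: test_integrable[OF t] simp: vec_integrable_iff)
  ultimately show "(LINT z|IM h. ps z *\<^sub>R (g z $ k - g' z $ k)) = 0" by (simp add: scaleR_diff_right)
 qed
 then have "AE z in IM h. \<forall>k\<in>UNIV. g z $ k - g' z $ k = 0" by (intro AE_finite_allI) auto
 then show ?thesis by eventually_elim (simp add: vec_eq_iff)
qed

lemma wderiv_has: "has_wderiv h j f g ==> has_wderiv h j f (wderiv h j f)"
 unfolding wderiv_def by (rule someI[of "has_wderiv h j f"])

lemma wderiv_AE: "has_wderiv h j f g ==> AE z in IM h. wderiv h j f z = g z"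
 using has_wderiv_unique wderiv_has by blast

section \<open>Tonelli on the cell and the coefficient form of the norm\<close>

context grid
begin

text \<open>\<open>space\<close> nests its factors to the right, while lateral Fourier analysis
  groups \<open>x\<close> with \<open>y\<close>; Tonelli on both groupings reconciles them.\<close>

lemma XYI_nn:
 fixes f :: "space => ennreal"
 assumes f[measurable]: "f \<in> borel_measurable SM"
 shows "(%q. f (fst (fst q), snd (fst q), snd q)) \<in> borel_measurable (GM \<Otimes>\<^sub>M HM)"
  "(\<integral>\<^sup>+ q. f (fst (fst q), snd (fst q), snd q) \<partial>(GM \<Otimes>\<^sub>M HM)) = (\<integral>\<^sup>+ x. f x \<partial>SM)"
proof -
 have fm: "f \<in> borel_measurable (XM \<Otimes>\<^sub>M (YM \<Otimes>\<^sub>M HM))" using f by (simp add: XYZ_SM)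
 have YZ: "sigma_finite_measure (YM \<Otimes>\<^sub>M HM)" by unfold_locales
 have r: "(%q. (fst (fst q), snd (fst q), snd q)) \<in> measurable ((XM \<Otimes>\<^sub>M YM) \<Otimes>\<^sub>M HM) (XM \<Otimes>\<^sub>M (YM \<Otimes>\<^sub>M HM))"
  by measurable
 show m: "(%q. f (fst (fst q), snd (fst q), snd q)) \<in> borel_measurable (GM \<Otimes>\<^sub>M HM)"
  using measurable_compose[OF r fm] by (simp add: XY_GM)
 have "(\<integral>\<^sup>+ q. f (fst (fst q), snd (fst q), snd q) \<partial>(GM \<Otimes>\<^sub>M HM)) = (\<integral>\<^sup>+ p. \<integral>\<^sup>+ z. f (fst p, snd p, z) \<partial>HM \<partial>GM)"
  using IM.nn_integral_fst[OF m] by simp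
 also have "... = (\<integral>\<^sup>+ x. \<integral>\<^sup>+ y. \<integral>\<^sup>+ z. f (x, y, z) \<partial>HM \<partial>YM \<partial>XM)"
  unfolding XY_GM[symmetric]
 proof (subst YM.nn_integral_fst[symmetric])
  have "(%p. \<integral>\<^sup>+ z. f (fst (fst (p, z)), snd (fst (p, z)), snd (p, z)) \<partial>HM) \<in> borel_measurable GM"
   using IM.borel_measurable_nn_integral_fst[OF m] by simp
  then show "(%p. \<integral>\<^sup>+ z. f (fst p, snd p, z) \<partial>HM) \<in> borel_measurable (XM \<Otimes>\<^sub>M YM)" by (simp add: XY_GM)
 qed simp
 also have "... = (\<integral>\<^sup>+ x. \<integral>\<^sup>+ q. f (x, q) \<partial>(YM \<Otimes>\<^sub>M HM) \<partial>XM)"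
 proof (rule nn_integral_cong)
  fix x assume "x \<in> space XM"
  then have "(%q. f (x, q)) \<in> borel_measurable (YM \<Otimes>\<^sub>M HM)" using fm by measurable
  from IM.nn_integral_fst[OF this] show "(\<integral>\<^sup>+ y. \<integral>\<^sup>+ z. f (x, y, z) \<partial>HM \<partial>YM) = (\<integral>\<^sup>+ q. f (x, q) \<partial>(YM \<Otimes>\<^sub>M HM))" by simp
 qed
 also have "... = (\<integral>\<^sup>+ x. f x \<partial>SM)" unfolding XYZ_SM[symmetric] by (rule sigma_finite_measure.nn_integral_fst[OF YZ fm])
 finally show "(\<integral>\<^sup>+ q. f (fst (fst q), snd (fst q), snd q) \<partial>(GM \<Otimes>\<^sub>M HM)) = (\<integral>\<^sup>+ x. f x \<partial>SM)" .
qed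

lemma SM_distr: "distr (GM \<Otimes>\<^sub>M HM) SM (%q. (fst (fst q), snd (fst q), snd q)) = SM"
 "(%q. (fst (fst q), snd (fst q), snd q)) \<in> measurable (GM \<Otimes>\<^sub>M HM) SM"
proof -
 show r: "(%q. (fst (fst q), snd (fst q), snd q)) \<in> measurable (GM \<Otimes>\<^sub>M HM) SM"
  unfolding XYZ_SM[symmetric] XY_GM[symmetric] by measurable
 show "distr (GM \<Otimes>\<^sub>M HM) SM (%q. (fst (fst q), snd (fst q), snd q)) = SM"
 proof (rule measure_eqI)
  fix A assume "A \<in> sets (distr (GM \<Otimes>\<^sub>M HM) SM (%q. (fst (fst q), snd (fst q), snd q)))"
  then have A: "A \<in> sets SM" by simp
  then have i: "indicator A \<in> borel_measurable SM" by simp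
  have "emeasure (distr (GM \<Otimes>\<^sub>M HM) SM (%q. (fst (fst q), snd (fst q), snd q))) A =
    (\<integral>\<^sup>+ x. indicator A x \<partial>distr (GM \<Otimes>\<^sub>M HM) SM (%q. (fst (fst q), snd (fst q), snd q)))"
   using A by simp
  also have "... = (\<integral>\<^sup>+ q. indicator A (fst (fst q), snd (fst q), snd q) \<partial>(GM \<Otimes>\<^sub>M HM))"
   by (subst nn_integral_distr[OF r]) (use i in auto)
  also have "... = emeasure SM A" using XYI_nn(2)[OF i] A by simp
  finally show "emeasure (distr (GM \<Otimes>\<^sub>M HM) SM (%q. (fst (fst q), snd (fst q), snd q))) A = emeasure SM A" .
 qed simp
qed

lemma SM_slice_meas:
 fixes f :: "space => 'b::topological_space"
 assumes "f \<in> borel_measurable SM"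
 shows "(%(p, z). slice f z p) \<in> borel_measurable (GM \<Otimes>\<^sub>M HM)"
 using measurable_compose[OF SM_distr(2) assms] by (simp add: slice_def case_prod_unfold)

lemma SM_integral:
 fixes f :: "space => 'b::{banach, second_countable_topology}"
 assumes f: "integrable SM f"
 shows "integrable (GM \<Otimes>\<^sub>M HM) (%(p, z). slice f z p)" "(LINT x|SM. f x) = (LINT z|HM. LINT p|GM. slice f z p)"
  "AE z in HM. integrable GM (slice f z)"
proof -
 have [measurable]: "f \<in> borel_measurable SM" using f by auto
 show i: "integrable (GM \<Otimes>\<^sub>M HM) (%(p, z). slice f z p)"
  using integrable_distr[OF SM_distr(2), of f] f by (simp add: SM_distr(1) slice_def case_prod_unfold)
 have "(LINT x|SM. f x) = (LINT q|(GM \<Otimes>\<^sub>M HM). slice f (snd q) (fst q))"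
  using integral_distr[OF SM_distr(2), of f] by (simp add: SM_distr(1) slice_def)
 also have "... = (LINT z|HM. LINT p|GM. slice f z p)"
  using GI.integral_snd[OF i] by (simp add: case_prod_unfold)
 finally show "(LINT x|SM. f x) = (LINT z|HM. LINT p|GM. slice f z p)" .
 show "AE z in HM. integrable GM (slice f z)" using GI.AE_integrable_snd[OF i] by simp
qed

lemma sqn_SM:
 assumes [measurable]: "f \<in> borel_measurable SM"
 shows "sqn SM f = (\<integral>\<^sup>+ z. sqn GM (slice f z) \<partial>HM)"
proof -
 have m: "(%x. ennreal ((norm (f x))\<^sup>2)) \<in> borel_measurable SM" by measurable
 from GI.nn_integral_snd[OF XYI_nn(1)[OF m]] XYI_nn(2)[OF m]
 show ?thesis unfolding sqn_def slice_def by simp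
qed

lemma L2_slices: "L2 SM f ==> AE z in HM. L2 GM (slice f z)"
proof -
 assume f: "L2 SM f"
 then have i: "integrable SM (%x. (norm (f x))\<^sup>2)" and fm: "f \<in> borel_measurable SM" by (auto simp: L2_integrable_sq)
 show ?thesis
  using SM_integral(3)[OF i] AE_space
 proof eventually_elim
  case (elim z)
  have "slice f z \<in> borel_measurable GM"
   using measurable_compose[OF measurable_Pair1'[of z "HM" GM] measurable_compose[OF measurable_pair_swap' SM_slice_meas[OF fm]]] elim(2)
   by simp
  then show ?case using elim(1) by (simp add: L2_integrable_sq slice_def[abs_def])
 qed
qed

lemma fc_slice_meas: "f \<in> borel_measurable SM ==> (%z. fc (slice f z) k) \<in> borel_measurable HM"
proof -
 assume "f \<in> borel_measurable SM"
 from SM_slice_meas[OF this] have [measurable]: "(%q. slice f (snd q) (fst q)) \<in> borel_measurable (GM \<Otimes>\<^sub>M HM)"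
  by (simp add: case_prod_unfold)
 have [measurable]: "(%q. cnj (ex k (fst q))) \<in> borel_measurable (GM \<Otimes>\<^sub>M HM)" by measurable
 have "(%q. cnj (ex k (fst q)) * slice f (snd q) (fst q)) \<in> borel_measurable (GM \<Otimes>\<^sub>M HM)" by measurable
 from measurable_compose[OF measurable_pair_swap' this]
 have "(%(z, p). cnj (ex k p) * slice f z p) \<in> borel_measurable (HM \<Otimes>\<^sub>M GM)" by (simp add: case_prod_unfold)
 from GM.borel_measurable_lebesgue_integral[OF this] show ?thesis unfolding fc_def by measurable
qed

lemma parseval_SM:
 assumes f: "L2 SM f" shows "sqn SM f = ennreal area * NN 0 (%k z. fc (slice f z) k)"
proof -
 have fm: "f \<in> borel_measurable SM" using f by (simp add: L2_def)
 have "sqn SM f = (\<integral>\<^sup>+ z. sqn GM (slice f z) \<partial>HM)" by (rule sqn_SM[OF fm])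
 also have "... = (\<integral>\<^sup>+ z. ennreal area * wn 0 (%k. fc (slice f z) k) \<partial>HM)"
  by (rule nn_integral_cong_AE, use L2_slices[OF f] in eventually_elim) (simp add: wn_0 parseval)
 also have "... = ennreal area * NN 0 (%k z. fc (slice f z) k)"
  unfolding NN_def by (intro nn_integral_cmult wn_meas mmeasI fc_slice_meas fm)
 finally show ?thesis .
qed

text \<open>What membership in \<open>Hspace\<close> says apart from weak derivatives and the norm.
  It is enough to form Fourier coefficients, and \<open>rep\<close> supplies the rest.\<close>

definition basic :: "(space => complex^3) => bool" where
 "basic u \<longleftrightarrow> quasiperiodic D u \<and> set_borel_measurable lborel (slab D) u \<and> set_integrable lborel (S_v D) (%x. (norm (u x))\<^sup>2)"

lemma S_v_slab: "S_v D \<subseteq> slab D"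
 by (auto simp: S_v_def slab_def)

lemma S_v_borel: "S_v D \<in> sets borel" unfolding S_v_def by (intro borel_Times) auto

lemma basic_L2: "basic u ==> L2 SM (%x. u x $ i)"
proof -
 assume u: "basic u"
 have s: "S_v D \<in> sets lborel" using S_v_borel by simp
 have "(%x. indicator (slab D) x *\<^sub>R u x) \<in> borel_measurable SM"
  using u by (intro measurable_restrict_space1) (simp add: basic_def set_borel_measurable_def)
 then have um: "u \<in> borel_measurable SM"
  by (rule measurable_cong[THEN iffD1, rotated]) (use S_v_slab in auto)
 have im: "(%x. u x $ i) \<in> borel_measurable SM"
  by (rule measurable_compose[OF um]) (intro borel_measurable_continuous_onI continuous_intros)
 have "integrable SM (%x. (norm (u x))\<^sup>2)"
  using u s by (simp add: basic_def set_integrable_def integrable_restrict_space)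
 then have "integrable SM (%x. (norm (u x $ i))\<^sup>2)"
  by (rule Bochner_Integration.integrable_bound)
   (use im in \<open>auto intro!: AE_I2 power_mono component_le_norm_cart simp: Finite_Cartesian_Product.norm_nth_le\<close>)
 then show ?thesis using im by (simp add: L2_integrable_sq)
qed

lemma hat_alt: "hat D u (fst k) (snd k) z = (1 / area) *\<^sub>R (LINT p|GM. cnj (ex k p) *s slice u z p)"
proof -
 have e: "exp (- \<i> * of_real (alpha_p D (fst k) * fst p + beta_q D (snd k) * snd p)) = cnj (ex k p)" for p
  by (simp add: ex_cnj)
 have si: "set_lebesgue_integral lborel (Gam D) F = (LINT p|GM. F p)" for F :: "real \<times> real => complex^3"
  by (simp add: set_lebesgue_integral_def integral_restrict_space)
 show ?thesis
  unfolding hat_def fcoeff_def si case_prod_unfold e area_def slice_def by simp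
qed

lemma hat_fc:
 assumes "!!i. L2 GM (slice (%x. u x $ i) z)"
 shows "hat D u (fst k) (snd k) z $ i = fc (slice (%x. u x $ i) z) k"
proof -
 have "integrable GM (%p. cnj (ex k p) *s u (fst p, snd p, z))"
  unfolding vec_integrable_iff
 proof
  fix i show "integrable GM (%p. (cnj (ex k p) *s u (fst p, snd p, z)) $ i)"
   using fc_int[OF assms[of i], of k] by (simp add: slice_def)
 qed
 from vec_integral[OF this, of i] have "(LINT p|GM. cnj (ex k p) *s slice u z p) $ i = (LINT p|GM. cnj (ex k p) * slice (%x. u x $ i) z p)"
  by (simp add: slice_def)
 moreover have "hat D u (fst k) (snd k) z $ i = (1 / area) *\<^sub>R ((LINT p|GM. cnj (ex k p) *s slice u z p) $ i)"
  unfolding hat_alt by simp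
 ultimately show ?thesis
  by (simp add: fc_def scaleR_conv_of_real)
qed

text \<open>Slices are known to be square integrable only at almost every height; one exceptional
  set serves all components and modes.\<close>

lemma hat_AE: "basic u ==> AE z in HM. \<forall>i k. hat D u (fst k) (snd k) z $ i = fc (slice (%x. u x $ i) z) k"
proof -
 assume u: "basic u"
 have "AE z in HM. \<forall>i\<in>UNIV. L2 GM (slice (%x. u x $ i) z)"
  by (intro AE_finite_allI L2_slices basic_L2 u) auto
 then show ?thesis by eventually_elim (auto simp: hat_fc)
qed

text \<open>\<open>rep m u W\<close>: the derivatives up to order \<open>m\<close> of the Fourier coefficients of the component
 \<open>u $ i\<close> are \<open>W i 0, ..., W i m\<close>.\<close>

definition rep :: "nat => (space => complex^3) => (3 => nat => mode => real => complex) => bool" where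
 "rep m u W \<longleftrightarrow> (\<forall>i. jet m (W i) \<and> Nj m (W i) < \<infinity> \<and>
   (\<forall>k. AE z in HM. W i 0 k z = hat D u (fst k) (snd k) z $ i))"

text \<open>Tonelli. The form with one norm per mode is that of \<open>Hnorm_sq\<close>, and the one
  into which modal estimates are inserted.\<close>

lemma NN_swap: "mmeas v ==> NN n v = (\<integral>\<^sup>+ k. ennreal (jw k ^ n) * sqn HM (v k) \<partial>modes)"
proof -
 assume v: "mmeas v"
 have [measurable]: "v k \<in> borel_measurable HM" for k by (rule mmeasD[OF v])
 have j: "0 <= jw k ^ n" for k using jw_ge_1[of k] by simp
 have "NN n v = (\<integral>\<^sup>+ k. \<integral>\<^sup>+ z. ennreal (jw k ^ n * (norm (v k z))\<^sup>2) \<partial>HM \<partial>modes)"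
  unfolding NN_def wn_def by (rule nn_count_swap[OF IM.sigma_finite_measure_axioms]) measurable
 also have "... = (\<integral>\<^sup>+ k. ennreal (jw k ^ n) * sqn HM (v k) \<partial>modes)"
  unfolding sqn_def using j by (simp add: ennreal_mult' nn_integral_cmult)
 finally show ?thesis .
qed

lemma NN_L2: "mmeas v ==> NN n v < \<infinity> ==> L2 HM (v k)"
proof -
 assume v: "mmeas v" "NN n v < \<infinity>"
 have "ennreal (jw k ^ 0) * sqn HM (v k) <= NN 0 v"
  unfolding NN_swap[OF v(1)] using sum_le_nn_count[of "{k}"] by simp
 also have "... <= NN n v" by (rule NN_mono) simp
 finally show ?thesis using v mmeasD[OF v(1)] by (auto simp: L2_sqn)
qed

lemma Nj_L2: "jet m w ==> Nj m w < \<infinity> ==> j <= m ==> L2 HM (w j k)"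
proof -
 assume w: "jet m w" "Nj m w < \<infinity>" "j <= m"
 have "NN (m - j) (w j) <= Nj m w" unfolding Nj_def by (rule member_le_sum) (use w in auto)
 then show ?thesis using NN_L2[of "w j" "m - j" k] w by (auto simp: jet_def intro: le_less_trans)
qed

lemma basic_meas: "basic u ==> u \<in> borel_measurable SM"
proof -
 assume u: "basic u"
 have "(%x. indicator (slab D) x *\<^sub>R u x) \<in> borel_measurable SM"
  using u by (intro measurable_restrict_space1) (simp add: basic_def set_borel_measurable_def)
 then show ?thesis
  by (rule measurable_cong[THEN iffD1, rotated]) (use S_v_slab in auto)
qed

lemma hat_meas: "basic u ==> hat D u p q \<in> borel_measurable HM"
proof -
 assume u: "basic u"
 have sm: "(%x. u x $ i) \<in> borel_measurable SM" for i using basic_meas[OF u] by (simp add: vec_meas_iff)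
 have [measurable]: "(%q. slice (%x. u x $ i) (snd q) (fst q)) \<in> borel_measurable (GM \<Otimes>\<^sub>M HM)" for i
  using SM_slice_meas[OF sm[of i]] by (simp add: case_prod_unfold)
 have [measurable]: "(%r. cnj (ex k (fst r))) \<in> borel_measurable (GM \<Otimes>\<^sub>M HM)" for k by measurable
 have "(%r. cnj (ex k (fst r)) * slice (%x. u x $ i) (snd r) (fst r)) \<in> borel_measurable (GM \<Otimes>\<^sub>M HM)" for i k by measurable
 then have "(%r. cnj (ex k (fst r)) *s slice u (snd r) (fst r)) \<in> borel_measurable (GM \<Otimes>\<^sub>M HM)" for k
  by (simp add: vec_meas_iff slice_def)
 from measurable_compose[OF measurable_pair_swap' this]
 have "(%(z, r). cnj (ex k r) *s slice u z r) \<in> borel_measurable (HM \<Otimes>\<^sub>M GM)" for k by (simp add: case_prod_unfold)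
 from GM.borel_measurable_lebesgue_integral[OF this]
 have m: "(%z. LINT r|GM. cnj (ex k r) *s slice u z r) \<in> borel_measurable HM" for k .
 have "(%z. hat D u (fst (p, q)) (snd (p, q)) z) \<in> borel_measurable HM"
  unfolding hat_alt by (intro borel_measurable_scaleR borel_measurable_const m)
 then show ?thesis by simp
qed

lemma hat_integrable: "basic u ==> integrable HM (hat D u p q)"
proof -
 assume u: "basic u"
 have m: "(%z. hat D u p q z $ i) \<in> borel_measurable HM" for i using hat_meas[OF u] by (simp add: vec_meas_iff)
 have "integrable HM (%z. hat D u p q z $ i)" for i
 proof -
  have "NN 0 (%k z. fc (slice (%x. u x $ i) z) k) < \<infinity>"
   using parseval_SM[OF basic_L2[OF u, of i]] basic_L2[OF u, of i] area
   by (auto simp: L2_sqn ennreal_mult_less_top less_top[symmetric] ennreal_mult_eq_top_iff)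
  then have "L2 HM (%z. fc (slice (%x. u x $ i) z) (p, q))"
   using NN_L2[of "%k z. fc (slice (%x. u x $ i) z) k" 0 "(p, q)"] basic_L2[OF u, of i]
   by (auto intro!: mmeasI fc_slice_meas simp: L2_def)
  then have i: "integrable HM (%z. fc (slice (%x. u x $ i) z) (p, q))" by (rule IM.L2_integrable)
  have "AE z in HM. fc (slice (%x. u x $ i) z) (p, q) = hat D u p q z $ i"
   using hat_AE[OF u] by eventually_elim (metis fst_conv snd_conv)
  then show ?thesis using i integrable_cong_AE[of "%z. fc (slice (%x. u x $ i) z) (p, q)" "HM" "%z. hat D u p q z $ i"] m by auto
 qed
 then show ?thesis by (simp add: vec_integrable_iff)
qed

lemma rep_wderiv:
 assumes u: "basic u" and r: "rep m u W" and j: "j <= m"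
 shows "has_wderiv h j (hat D u p q) (%z. \<chi> i. W i j (p, q) z)"
 using j
proof (induction j)
 case 0
 have Wi: "integrable HM (W i j (p, q))" if "j <= m" for i j
  using Nj_L2[of m "W i" j "(p, q)"] r that IM.L2_integrable unfolding rep_def by blast
 have "AE z in HM. \<forall>i\<in>UNIV. W i 0 (p, q) z = hat D u p q z $ i"
  by (intro AE_finite_allI) (use r in \<open>force simp: rep_def\<close>)+
 then have ae: "AE z in HM. (\<chi> i. W i 0 (p, q) z) = hat D u p q z"
  by eventually_elim (simp add: vec_eq_iff)
 have i: "integrable HM (%z. \<chi> i. W i 0 (p, q) z)" by (simp add: vec_integrable_iff Wi)
 show ?case
  unfolding has_wderiv_alt
 proof (intro conjI allI impI i hat_integrable[OF u])
  fix ps :: "real => real" assume t: "test_function {-h<..<h} ps"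
  have "(LINT z|HM. ps z *\<^sub>R hat D u p q z) = (LINT z|HM. ps z *\<^sub>R (\<chi> i. W i 0 (p, q) z))"
   by (rule integral_cong_AE)
    (use ae test_integrable_vec[OF t i] test_integrable_vec[OF t hat_integrable[OF u]] in auto)
  then show "(LINT z|HM. (deriv ^^ 0) ps z *\<^sub>R hat D u p q z) = (-1) ^ 0 *\<^sub>R (LINT z|HM. ps z *\<^sub>R (\<chi> i. W i 0 (p, q) z))" by simp
 qed
next
 case (Suc j)
 have "wd h (W i j (p, q)) (W i (Suc j) (p, q))" for i using r Suc.prems unfolding rep_def jet_def by (auto simp: Suc_le_eq)
 then have "has_wderiv h 1 (%z. \<chi> i. W i j (p, q) z) (%z. \<chi> i. W i (Suc j) (p, q) z)" unfolding has_wderiv_1 by simp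
 with Suc show ?case by (intro has_wderiv_Suc[of h j]) auto
qed

text \<open>Weak derivatives are unique up to null sets, so any representing jets compute the norm;
  the choice made by \<open>wderiv\<close> drops out.\<close>

lemma Hnorm_sq_rep:
 assumes u: "basic u" and r: "rep m u W"
 shows "Hnorm_sq D m u = (\<Sum>i\<in>UNIV. Nj m (W i))"
proof -
 have mm: "mmeas (W i j)" if "j <= m" for i j using r that by (auto simp: rep_def jet_def)
 have "(\<Sum>\<^sub>\<infinity>(p, q)\<in>UNIV. ennreal ((1 + (of_int p)\<^sup>2 + (of_int q)\<^sup>2) ^ (m - j)) *
   set_nn_integral lborel {- h<..<h} (%z. ennreal ((norm (wderiv h j (hat D u p q) z))\<^sup>2))) =
   (\<Sum>i\<in>UNIV. NN (m - j) (W i j))" if j: "j <= m" for j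
 proof -
  have "set_nn_integral lborel {- h<..<h} (%z. ennreal ((norm (wderiv h j (hat D u p q) z))\<^sup>2)) = (\<Sum>i\<in>UNIV. sqn HM (W i j (p, q)))" for p q
  proof -
   have "set_nn_integral lborel {- h<..<h} (%z. ennreal ((norm (wderiv h j (hat D u p q) z))\<^sup>2)) =
     (\<integral>\<^sup>+ z. ennreal ((norm (wderiv h j (hat D u p q) z))\<^sup>2) \<partial>HM)"
    by (simp add: nn_integral_restrict_space)
   also have "... = (\<integral>\<^sup>+ z. (\<Sum>i\<in>UNIV. ennreal ((norm (W i j (p, q) z))\<^sup>2)) \<partial>HM)"
    by (rule nn_integral_cong_AE, use wderiv_AE[OF rep_wderiv[OF u r j, of p q]] in eventually_elim)
     (simp add: norm_vec_sq sum_ennreal)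
   also have "... = (\<Sum>i\<in>UNIV. sqn HM (W i j (p, q)))"
    unfolding sqn_def by (rule nn_integral_sum) (use mmeasD[OF mm[OF j]] in measurable)
   finally show ?thesis .
  qed
  then have "(\<Sum>\<^sub>\<infinity>(p, q)\<in>UNIV. ennreal ((1 + (of_int p)\<^sup>2 + (of_int q)\<^sup>2) ^ (m - j)) *
   set_nn_integral lborel {- h<..<h} (%z. ennreal ((norm (wderiv h j (hat D u p q) z))\<^sup>2))) =
   (\<integral>\<^sup>+ k. (\<Sum>i\<in>UNIV. ennreal (jw k ^ (m - j)) * sqn HM (W i j k)) \<partial>modes)"
   unfolding infsum_eq_nn_count by (simp add: case_prod_unfold jw_def sum_distrib_left)
  also have "... = (\<Sum>i\<in>UNIV. NN (m - j) (W i j))"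
   by (subst nn_integral_sum) (auto simp: NN_swap[OF mm[OF j]])
  finally show ?thesis .
 qed
 then have "Hnorm_sq D m u = (\<Sum>j\<le>m. \<Sum>i\<in>UNIV. NN (m - j) (W i j))" unfolding Hnorm_sq_def by simp
 also have "... = (\<Sum>i\<in>UNIV. Nj m (W i))" unfolding Nj_def by (rule sum.swap)
 finally show ?thesis .
qed

lemma rep_Hspace:
 assumes u: "basic u" and r: "rep m u W"
 shows "u \<in> Hspace D m"
proof -
 have "Hnorm_sq D m u < \<infinity>" unfolding Hnorm_sq_rep[OF assms] using r by (simp add: rep_def less_top[symmetric])
 then show ?thesis using u rep_wderiv[OF u r] unfolding Hspace_def basic_def by blast
qed

lemma Hspace_basic: "u \<in> Hspace D m ==> basic u"
 by (simp add: Hspace_def basic_def)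

text \<open>The canonical jets: \<open>has_wderiv_chain\<close> links consecutive orders, and each
  order is bounded by its share of the norm.\<close>

lemma Hspace_rep:
 assumes u: "u \<in> Hspace D m"
 shows "rep m u (%i j k z. wderiv h j (hat D u (fst k) (snd k)) z $ i)"
proof -
 define W where "W i j k z = wderiv h j (hat D u (fst k) (snd k)) z $ i" for i j k z
 have b: "basic u" by (rule Hspace_basic[OF u])
 have w: "has_wderiv h j (hat D u p q) (wderiv h j (hat D u p q))" if "j <= m" for j p q
  using u that wderiv_has unfolding Hspace_def by blast
 have mm: "mmeas (W i j)" if "j <= m" for i j
 proof (rule mmeasI)
  fix k
  have "integrable HM (wderiv h j (hat D u (fst k) (snd k)))" using w[OF that] by (simp add: has_wderiv_alt)
  then have "integrable HM (%z. wderiv h j (hat D u (fst k) (snd k)) z $ i)" unfolding vec_integrable_iff by blast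
  then show "W i j k \<in> borel_measurable HM" unfolding W_def[abs_def] by (rule borel_measurable_integrable)
 qed
 have jet: "jet m (W i)" for i
  unfolding jet_def
 proof (intro conjI allI impI mm)
  fix j k assume "j < m"
  then have "has_wderiv h 1 (wderiv h j (hat D u (fst k) (snd k))) (wderiv h (Suc j) (hat D u (fst k) (snd k)))"
   by (intro has_wderiv_chain[OF w w]) auto
  then show "wd h (W i j k) (W i (Suc j) k)" unfolding has_wderiv_1 W_def[abs_def] by blast
 qed
 have n: "NN (m - j) (W i j) <= Hnorm_sq D m u" if j: "j <= m" for i j
 proof -
  have "NN (m - j) (W i j) = (\<integral>\<^sup>+ k. ennreal (jw k ^ (m - j)) * sqn HM (W i j k) \<partial>modes)" by (rule NN_swap[OF mm[OF j]])
  also have "... <= (\<integral>\<^sup>+ k. ennreal (jw k ^ (m - j)) * set_nn_integral lborel {- h<..<h} (%z. ennreal ((norm (wderiv h j (hat D u (fst k) (snd k)) z))\<^sup>2)) \<partial>modes)"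
   unfolding sqn_def W_def
   by (intro nn_integral_mono mult_left_mono)
    (auto simp: nn_integral_restrict_space intro!: nn_integral_mono mult_right_mono ennreal_leI power_mono Finite_Cartesian_Product.norm_nth_le)
  also have "... = (\<Sum>\<^sub>\<infinity>(p, q)\<in>UNIV. ennreal ((1 + (of_int p)\<^sup>2 + (of_int q)\<^sup>2) ^ (m - j)) *
   set_nn_integral lborel {- h<..<h} (%z. ennreal ((norm (wderiv h j (hat D u p q) z))\<^sup>2)))"
   unfolding infsum_eq_nn_count by (simp add: case_prod_unfold jw_def)
  also have "... <= Hnorm_sq D m u" unfolding Hnorm_sq_def
   by (rule member_le_sum[where f = "%j. \<Sum>\<^sub>\<infinity>(p, q)\<in>UNIV. ennreal ((1 + (of_int p)\<^sup>2 + (of_int q)\<^sup>2) ^ (m - j)) *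
   set_nn_integral lborel {- h<..<h} (%z. ennreal ((norm (wderiv h j (hat D u p q) z))\<^sup>2))"]) (use j in auto)
  finally show ?thesis .
 qed
 have "NN (m - j) (W i j) < \<infinity>" if "j <= m" for i j
  by (rule le_less_trans[OF n[OF that]]) (use u in \<open>simp add: Hspace_def\<close>)
 then have "Nj m (W i) < \<infinity>" for i
  unfolding Nj_def by (simp add: less_top[symmetric])
 moreover have "AE z in HM. W i 0 k z = hat D u (fst k) (snd k) z $ i" for i k
  using wderiv_AE[OF has_wderiv_0[OF hat_integrable[OF b, of "fst k" "snd k"]]] unfolding W_def
  by eventually_elim simp
 ultimately have "rep m u W" unfolding rep_def using jet by blast
 then show ?thesis unfolding W_def[abs_def] .
qed

end

section \<open>From the weak Maxwell equation to the modes\<close>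

lemma count_Fubini:
 fixes q :: "'i::countable => 'a => complex"
 assumes M: "sigma_finite_measure M" and m: "!!k. q k \<in> borel_measurable M"
  and fin: "(\<integral>\<^sup>+ z. \<integral>\<^sup>+ k. ennreal (norm (q k z)) \<partial>count_space UNIV \<partial>M) < \<infinity>"
 shows "(LINT z|M. LINT k|count_space UNIV. q k z) = (LINT k|count_space UNIV. LINT z|M. q k z)"
proof -
 interpret pair_sigma_finite "count_space (UNIV :: 'i set)" M
  using M sigma_finite_measure_count_space by (intro pair_sigma_finite.intro)
 have "integrable (count_space UNIV \<Otimes>\<^sub>M M) (%(k, z). q k z)"
 proof (rule integrableI_bounded)
  show "(%(k, z). q k z) \<in> borel_measurable (count_space UNIV \<Otimes>\<^sub>M M)" by (rule meas_count_pair[OF m])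
  have "(%(k, z). ennreal (norm (q k z))) \<in> borel_measurable (count_space UNIV \<Otimes>\<^sub>M M)"
   by (rule meas_count_pair) (use m in measurable)
  from nn_integral_snd[OF this] fin
  show "(\<integral>\<^sup>+ x. ennreal (norm (case x of (k, z) => q k z)) \<partial>(count_space UNIV \<Otimes>\<^sub>M M)) < \<infinity>"
   by (simp add: case_prod_unfold)
 qed
 from Fubini_integral[OF this] show ?thesis .
qed

lemma smooth_differentiable: "smooth f ==> f differentiable (at x)"
 using smoothD(1) unfolding differentiable_def by blast

lemma smooth_vec:
 fixes f :: "'a::euclidean_space => complex^3"
 assumes "!!i. smooth (%x. f x $ i)"
 shows "smooth f"
proof -
 have bl: "bounded_linear (%c. axis i c :: complex^3)" for i
  unfolding linear_conv_bounded_linear[symmetric] by (rule linearI) (auto simp: vec_eq_iff axis_def)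
 have "smooth (%x. \<Sum>i\<in>UNIV. axis i (f x $ i) :: complex^3)"
  unfolding sum_3 by (intro smooth_add smooth_linear[OF bl] assms)
 moreover have "(\<Sum>i\<in>UNIV. axis i (f x $ i)) = f x" for x
  by (simp add: vec_eq_iff axis_def sum.delta if_distrib[of "%v. v $ _"] cong: if_cong)
 ultimately show ?thesis by simp
qed

lemma smooth_nth: "smooth f ==> smooth (%x. f x $ i)" for f :: "'a::euclidean_space => complex^3"
 by (rule smooth_linear[OF bounded_linear_vec_nth])

section \<open>Curls of separable test functions\<close>

definition pd :: "'a::euclidean_space => ('a => 'b::real_normed_vector) => 'a => 'b" where
 "pd d f x = frechet_derivative f (at x) d"

lemma smooth_pd: "smooth f ==> d \<in> Basis ==> smooth (pd d f)"
 unfolding pd_def[abs_def] by (rule smoothD(2))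

lemma pd_nth:
 fixes f :: "'a::euclidean_space => complex^3"
 assumes "f differentiable (at x)"
 shows "pd d f x $ i = pd d (%x. f x $ i) x"
proof -
 have "((%x. f x $ i) has_derivative (%d. frechet_derivative f (at x) d $ i)) (at x)"
  using bounded_linear.has_derivative[OF bounded_linear_vec_nth] assms frechet_derivative_works by blast
 from frechet_derivative_at[OF this] show ?thesis by (simp add: pd_def fun_eq_iff)
qed

lemma space_Basis: "(1, 0, 0) \<in> (Basis :: space set)" "(0, 1, 0) \<in> (Basis :: space set)" "(0, 0, 1) \<in> (Basis :: space set)"
 by (auto simp: Basis_prod_def zero_prod_def)

lemma curl_alt:
 assumes "Ps differentiable (at x)"
 shows "curl Ps x = vector [pd (0,1,0) (%x. Ps x $ 3) x - pd (0,0,1) (%x. Ps x $ 2) x,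
   pd (0,0,1) (%x. Ps x $ 1) x - pd (1,0,0) (%x. Ps x $ 3) x,
   pd (1,0,0) (%x. Ps x $ 2) x - pd (0,1,0) (%x. Ps x $ 1) x]"
 unfolding curl_def Let_def pd_nth[OF assms, symmetric] by (simp add: pd_def)

lemma smooth_curl:
 assumes "smooth Ps" shows "smooth (curl Ps)"
proof (rule smooth_vec)
 fix i :: 3
 note d = smooth_differentiable[OF assms]
 have "i = 1 \<or> i = 2 \<or> i = 3" using exhaust_3 by blast
 then show "smooth (%x. curl Ps x $ i)"
  unfolding curl_alt[OF d]
  by (elim disjE; hypsubst; unfold vector_3; intro smooth_diff smooth_pd smooth_nth assms space_Basis)
qed

lemma test_curl:
 assumes "test_function U Ps" shows "test_function U (curl Ps)"
proof -
 obtain K where K: "compact K" "K \<subseteq> U" "!!x. x \<notin> K ==> Ps x = 0" and s: "smooth Ps"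
  using assms by (auto simp: test_function_iff)
 have "curl Ps x = 0" if "x \<notin> K" for x
  using deriv_zero_outside[OF smoothD(1)[OF s] compact_imp_closed[OF K(1)] K(3) that]
  by (simp add: curl_def vec_eq_iff forall_3)
 with K smooth_curl[OF s] show ?thesis by (auto simp: test_function_iff)
qed

definition sep :: "(real => complex) => (real => complex) => (real => complex) => space => complex" where
 "sep a b c p = a (fst p) * b (fst (snd p)) * c (snd (snd p))"

definition vd :: "(real => complex) => real => complex" where
 "vd a x = vector_derivative a (at x)"

lemma smooth_vd: "smooth a ==> smooth (vd a)"
 unfolding vd_def[abs_def] by (rule smooth_realD(2))

lemma smooth_sep:
 assumes "smooth a" "smooth b" "smooth c" shows "smooth (sep a b c)"
proof -
 have s: "smooth (%p::space. f (L p))" if f: "smooth f" and L: "bounded_linear L" "!!d. d \<in> Basis ==> L d = 0 \<or> L d \<in> Basis"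
  for f :: "real => complex" and L
  using f C_k_compose_proj[OF L] by (auto simp: smooth_def)
 have "smooth (%p::space. a (fst p))"
  by (rule s[OF assms(1) bounded_linear_fst]) (auto simp: Basis_prod_def)
 moreover have "smooth (%p::space. b (fst (snd p)))"
  by (rule s[OF assms(2) bounded_linear_fst_comp[OF bounded_linear_snd]]) (auto simp: Basis_prod_def)
 moreover have "smooth (%p::space. c (snd (snd p)))"
  by (rule s[OF assms(3) bounded_linear_snd_comp[OF bounded_linear_snd]]) (auto simp: Basis_prod_def)
 ultimately show ?thesis unfolding sep_def[abs_def] by (intro smooth_mult)
qed

lemma pd_sep:
 assumes "smooth a" "smooth b" "smooth c"
 shows "pd (1,0,0) (sep a b c) = sep (vd a) b c" "pd (0,1,0) (sep a b c) = sep a (vd b) c" "pd (0,0,1) (sep a b c) = sep a b (vd c)"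
proof -
 have d: "((%p. f (L p)) has_derivative (%d. L d *\<^sub>R vd f (L p))) (at p)" if "smooth f" "bounded_linear L" for f and L :: "space => real" and p
  using diff_chain_at[OF bounded_linear_imp_has_derivative[OF that(2)] smooth_realD(1)[OF that(1), unfolded has_vector_derivative_def]]
  by (simp add: o_def vd_def)
 have "(sep a b c has_derivative (%d. a (fst p) * b (fst (snd p)) * (snd (snd d) *\<^sub>R vd c (snd (snd p))) +
   (a (fst p) * (fst (snd d) *\<^sub>R vd b (fst (snd p))) + (fst d *\<^sub>R vd a (fst p)) * b (fst (snd p))) * c (snd (snd p)))) (at p)" for p
  unfolding sep_def[abs_def]
  by (intro has_derivative_mult d assms bounded_linear_fst bounded_linear_fst_comp[OF bounded_linear_snd] bounded_linear_snd_comp[OF bounded_linear_snd])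
 from frechet_derivative_at[OF this, symmetric]
 show "pd (1,0,0) (sep a b c) = sep (vd a) b c" "pd (0,1,0) (sep a b c) = sep a (vd b) c" "pd (0,0,1) (sep a b c) = sep a b (vd c)"
  by (simp_all add: fun_eq_iff pd_def sep_def)
qed

lemma test_sep:
 assumes "test_function A a" "test_function B b" "test_function C c"
 shows "test_function (A \<times> B \<times> C) (sep a b c)"
proof -
 obtain Ka Kb Kc where K: "compact Ka" "Ka \<subseteq> A" "!!x. x \<notin> Ka ==> a x = 0" "compact Kb" "Kb \<subseteq> B" "!!x. x \<notin> Kb ==> b x = 0"
  "compact Kc" "Kc \<subseteq> C" "!!x. x \<notin> Kc ==> c x = 0"
  and s: "smooth a" "smooth b" "smooth c"
  using assms unfolding test_function_iff by metis
 show ?thesis unfolding test_function_iff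
 proof (intro conjI smooth_sep s exI[of _ "Ka \<times> Kb \<times> Kc"] allI impI)
  fix x assume "x \<notin> Ka \<times> Kb \<times> Kc"
  then show "sep a b c x = 0" using K(3)[of "fst x"] K(6)[of "fst (snd x)"] K(9)[of "snd (snd x)"]
   by (cases x) (auto simp: sep_def)
 qed (use K in \<open>auto intro!: compact_Times\<close>)
qed

lemma test_axis:
 assumes "test_function U tht" shows "test_function U (%x. axis i (tht x) :: complex^3)"
proof -
 obtain K where K: "compact K" "K \<subseteq> U" "!!x. x \<notin> K ==> tht x = 0" and s: "smooth tht"
  using assms by (auto simp: test_function_iff)
 have bl: "bounded_linear (%c. axis i c :: complex^3)"
  unfolding linear_conv_bounded_linear[symmetric] by (rule linearI) (auto simp: vec_eq_iff axis_def)
 have "axis i (tht x) = (0 :: complex^3)" if "x \<notin> K" for x using K(3)[OF that] by (simp add: vec_eq_iff axis_def)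
 then show ?thesis using K smooth_linear[OF bl s] unfolding test_function_iff by blast
qed

text \<open>This is \<open>curl curl (f e\<^sub>i) = grad (d\<^sub>i f) - (Laplace f) e\<^sub>i\<close>.\<close>

lemma curl_curl_sep:
 assumes s: "smooth a" "smooth b" "smooth c"
 shows "curl (curl (%x. axis 1 (sep a b c x))) p =
   vector [- sep a (vd (vd b)) c p - sep a b (vd (vd c)) p, sep (vd a) (vd b) c p, sep (vd a) b (vd c) p]"
  "curl (curl (%x. axis 2 (sep a b c x))) p =
   vector [sep (vd a) (vd b) c p, - sep a b (vd (vd c)) p - sep (vd (vd a)) b c p, sep a (vd b) (vd c) p]"
  "curl (curl (%x. axis 3 (sep a b c x))) p =
   vector [sep (vd a) b (vd c) p, sep a (vd b) (vd c) p, - sep (vd (vd a)) b c p - sep a (vd (vd b)) c p]"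
proof -
 have ax: "smooth (%x. axis i (sep a b c x) :: complex^3)" for i
 proof (rule smooth_vec)
  show "smooth (%x. (axis i (sep a b c x) :: complex^3) $ j)" for j
   by (cases "i = j") (auto simp: axis_def intro: smooth_sep[OF s, unfolded sep_def[abs_def]] smooth_const smooth_sep[OF s])
 qed
 note d = smooth_differentiable
 have z: "pd e (%x. 0) = (%x. 0 :: complex)" for e :: space by (simp add: pd_def fun_eq_iff)
 have m: "pd e (%x. - f x) x = - pd e f x" if "smooth f" for e x and f :: "space => complex"
  using frechet_derivative_at[OF has_derivative_minus[OF smoothD(1)[OF that, of x]], symmetric] by (simp add: pd_def)
 have n: "(1::3) \<noteq> 2" "(2::3) \<noteq> 3" "(1::3) \<noteq> 3" "(2::3) \<noteq> 1" "(3::3) \<noteq> 2" "(3::3) \<noteq> 1" by auto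
 note sv = smooth_vd smooth_sep s
 note c1 = curl_alt[OF d[OF smooth_curl[OF ax]]] curl_alt[OF d[OF ax]]
 have e: "sep a b c = (%x. sep a b c x)" for a b c by simp
 show "curl (curl (%x. axis 1 (sep a b c x))) p =
   vector [- sep a (vd (vd b)) c p - sep a b (vd (vd c)) p, sep (vd a) (vd b) c p, sep (vd a) b (vd c) p]"
  "curl (curl (%x. axis 2 (sep a b c x))) p =
   vector [sep (vd a) (vd b) c p, - sep a b (vd (vd c)) p - sep (vd (vd a)) b c p, sep a (vd b) (vd c) p]"
  "curl (curl (%x. axis 3 (sep a b c x))) p =
   vector [sep (vd a) b (vd c) p, sep a (vd b) (vd c) p, - sep (vd (vd a)) b c p - sep a (vd (vd b)) c p]"
  unfolding c1 by (simp_all add: axis_def n z m pd_sep sv)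
qed

lemma cdot_axis: "cdot v (axis i c) = v $ i * c"
 by (simp add: cdot_def axis_def if_distrib cong: if_cong)

lemma cdot_3: "cdot v w = v $ 1 * w $ 1 + v $ 2 * w $ 2 + v $ 3 * w $ 3"
 by (simp add: cdot_def sum_3)

text \<open>The auxiliary field \<open>W\<close> is eliminated: the second weak curl is tested with
  \<open>Ps\<close>, the first with \<open>curl Ps\<close>, again a test function.\<close>

lemma L0_weak:
 assumes "L0_eq D V F" and t: "test_function (S_v D) Ps"
 shows "(LINT x|restrict_space lborel (S_v D). cdot (F x + of_real ((k0 D)\<^sup>2 * eps_bar D) *s V x) (Ps x)) =
  (LINT x|restrict_space lborel (S_v D). cdot (V x) (curl (curl Ps) x))"
proof -
 have sb: "S_v D \<in> sets borel" unfolding S_v_def by (intro borel_Times) auto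
 have si: "set_lebesgue_integral lborel (S_v D) G = (LINT x|restrict_space lborel (S_v D). G x)" for G :: "space => complex"
  using sb by (simp add: set_lebesgue_integral_def integral_restrict_space)
 obtain W where W: "weak_curl (S_v D) V W" "weak_curl (S_v D) W (%x. F x + of_real ((k0 D)\<^sup>2 * eps_bar D) *s V x)"
  using assms(1) by (auto simp: L0_eq_def)
 have "(LINT x|restrict_space lborel (S_v D). cdot (F x + of_real ((k0 D)\<^sup>2 * eps_bar D) *s V x) (Ps x)) =
  (LINT x|restrict_space lborel (S_v D). cdot (W x) (curl Ps x))"
  using W(2) t unfolding weak_curl_def si by blast
 also have "... = (LINT x|restrict_space lborel (S_v D). cdot (V x) (curl (curl Ps) x))"
  using W(1) test_curl[OF t] unfolding weak_curl_def si by blast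
 finally show ?thesis .
qed

lemma vd_of_real: "test_function U ps ==> vd (%z. of_real (ps z)) = (%z. of_real (deriv ps z))"
 unfolding vd_def[abs_def] by (intro ext vector_derivative_at has_vector_derivative_of_real test_deriv)

lemma test_of_real: "test_function U ps ==> test_function U (%z. of_real (ps z) :: complex)" for ps :: "real => real"
 unfolding test_function_iff using smooth_linear[OF bounded_linear_of_real] by force

lemma test_vd:
 assumes "test_function U a" shows "test_function U (vd a)"
proof -
 obtain K where K: "compact K" "K \<subseteq> U" "!!x. x \<notin> K ==> a x = 0" and s: "smooth a"
  using assms by (auto simp: test_function_iff)
 have "vd a x = 0" if "x \<notin> K" for x
 proof -
  have "(%s. s *\<^sub>R vd a x) = (%_. 0)"
   unfolding vd_def
   by (rule deriv_zero_outside[OF smooth_realD(1)[OF s, unfolded has_vector_derivative_def] compact_imp_closed[OF K(1)] K(3) that])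
  then have "1 *\<^sub>R vd a x = 0" by metis
  then show ?thesis by simp
 qed
 then show ?thesis using K smooth_vd[OF s] unfolding test_function_iff by blast
qed

section \<open>Testing the equation with separable fields\<close>

context grid
begin

text \<open>The exponential is not conjugated: by \<open>th_fc\<close> this is the conjugate
  coefficient of the conjugate test function, the factor that Parseval pairs with the coefficients
  of a field.\<close>

definition th :: "(real => complex) => (real => complex) => mode => complex" where
 "th a b k = (LINT p|GM. ex k p * (a (fst p) * b (snd p))) / of_real area"

lemma th_fc: "th a b k = cnj (fc (%p. cnj (a (fst p) * b (snd p))) k)"
proof -
 have "cnj (LINT p|GM. cnj (ex k p) * cnj (a (fst p) * b (snd p))) = (LINT p|GM. ex k p * (a (fst p) * b (snd p)))"
  using Bochner_Integration.integral_cnj[of GM "%p. cnj (ex k p) * cnj (a (fst p) * b (snd p))"] by simp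
 then show ?thesis unfolding th_def fc_def complex_cnj_divide complex_cnj_complex_of_real by (simp only:)
qed

lemma test_L2_GM:
 assumes "test_function U a" "test_function U' b"
 shows "L2 GM (%p. a (fst p) * b (snd p) :: complex)"
proof -
 obtain A B where AB: "!!x. norm (a x) <= A" "!!x. norm (b x) <= B" "A > 0" "B > 0"
  using test_bounded[OF assms(1)] test_bounded[OF assms(2)] by metis
 show ?thesis
 proof (rule GM.L2_bounded[of _ "A * B"])
  show "(%p. a (fst p) * b (snd p)) \<in> borel_measurable GM"
   by (intro measurable_GM_borel borel_measurable_continuous_onI continuous_intros
     continuous_on_compose2[OF test_continuous[OF assms(1)]] continuous_on_compose2[OF test_continuous[OF assms(2)]]) auto
  show "norm (a (fst p) * b (snd p)) <= A * B" for p
   unfolding norm_mult by (intro mult_mono AB) (use AB in \<open>auto intro: less_imp_le\<close>)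
 qed
qed

lemma th_L2: "test_function U a ==> test_function U' b ==> L2 modes (th a b)"
 unfolding th_fc[abs_def] by (intro L2_cnj fc_L2 test_L2_GM)

lemma th_prod:
 assumes "test_function U a" "test_function U' b"
 shows "th a b k = (LINT x|XM. a x * exp (\<i> * of_real (al k * x))) * (LINT y|YM. b y * exp (\<i> * of_real (be k * y))) / of_real area"
proof -
 have e: "ex k (x, y) = exp (\<i> * of_real (al k * x)) * exp (\<i> * of_real (be k * y))" for x y
  unfolding ex_def exp_add[symmetric] by (rule arg_cong[of _ _ exp]) (simp add: algebra_simps)
 have "integrable (XM \<Otimes>\<^sub>M YM) (%(x, y). ex k (x, y) * (a x * b y))"
  using L2_mult_integrable[OF L2_ex[of k] test_L2_GM[OF assms]] by (simp add: XY_GM case_prod_unfold)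
 from XY.integral_fst[OF this]
 have "(LINT p|GM. ex k p * (a (fst p) * b (snd p))) = (LINT x|XM. LINT y|YM. ex k (x, y) * (a x * b y))"
  by (simp add: XY_GM case_prod_unfold)
 also have "... = (LINT x|XM. LINT y|YM. (a x * exp (\<i> * of_real (al k * x))) * (b y * exp (\<i> * of_real (be k * y))))"
  by (simp add: e mult_ac)
 also have "... = (LINT x|XM. a x * exp (\<i> * of_real (al k * x))) * (LINT y|YM. b y * exp (\<i> * of_real (be k * y)))"
  by (simp only: integral_mult_right_zero integral_mult_left_zero)
 finally show ?thesis by (simp add: th_def)
qed

text \<open>Integration by parts; the support inside the open interval removes the boundary
  terms.\<close>

lemma vd_exp_integral:
 assumes t: "test_function {0<..<d} a" and d: "d > 0"
 shows "(LINT x|restrict_space lborel {0<..<d}. vd a x * exp (\<i> * of_real (c * x))) =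
  - \<i> * of_real c * (LINT x|restrict_space lborel {0<..<d}. a x * exp (\<i> * of_real (c * x)))"
proof -
 have s: "smooth a" using t by (simp add: test_function_iff)
 have z: "a 0 = 0" "a d = 0" using t unfolding test_function_def by fastforce+
 have ec: "continuous_on S (%x::real. exp (\<i> * complex_of_real (c * x)))" for S by (intro continuous_intros)
 have i: "integrable (restrict_space lborel {0<..<d}) (%x. f x * exp (\<i> * of_real (c * x)))" if "continuous_on UNIV f" for f
 proof -
  have "set_integrable lborel {0..d} (%x. f x * exp (\<i> * of_real (c * x)))"
   by (intro borel_integrable_atLeastAtMost' continuous_intros continuous_on_subset[OF that]) auto
  then have "set_integrable lborel {0<..<d} (%x. f x * exp (\<i> * of_real (c * x)))" by (rule set_integrable_subset) auto
  then show ?thesis by (simp add: integrable_restrict_space set_integrable_def)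
 qed
 have "(LINT x|restrict_space lborel {0<..<d}. vd a x * exp (\<i> * of_real (c * x)) + \<i> * of_real c * (a x * exp (\<i> * of_real (c * x)))) =
   a d * exp (\<i> * of_real (c * d)) - a 0 * exp (\<i> * of_real (c * 0))"
 proof (rule FTC_open)
  fix x
  have "((%z. exp (\<i> * (of_real c * z))) has_field_derivative exp (\<i> * of_real (c * x)) * (\<i> * of_real c)) (at (of_real x))"
   by (auto intro!: derivative_eq_intros)
  from has_vector_derivative_mult[OF smooth_realD(1)[OF s] has_vector_derivative_real_field[OF this]]
  show "((%x. a x * exp (\<i> * of_real (c * x))) has_vector_derivative
    vd a x * exp (\<i> * of_real (c * x)) + \<i> * of_real c * (a x * exp (\<i> * of_real (c * x)))) (at x)"
   by (simp add: vd_def algebra_simps)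
  show "continuous_on {0..d} (%x. vd a x * exp (\<i> * of_real (c * x)) + \<i> * of_real c * (a x * exp (\<i> * of_real (c * x))))"
   by (intro continuous_intros smoothD(3)[OF smooth_vd[OF s]] smoothD(3)[OF s])
 qed (use d in simp)
 then show ?thesis
  using i[OF smoothD(3)[OF smooth_vd[OF s]]] i[OF smoothD(3)[OF s]] z by (simp add: add_eq_0_iff)
qed

lemma th_vd:
 assumes a: "test_function {0<..<dx} a" and b: "test_function {0<..<dy} b"
 shows "th (vd a) b k = - \<i> * of_real (al k) * th a b k" "th a (vd b) k = - \<i> * of_real (be k) * th a b k"
 unfolding th_prod[OF a b] th_prod[OF test_vd[OF a] b] th_prod[OF a test_vd[OF b]]
  vd_exp_integral[OF a per_x] vd_exp_integral[OF b per_y] by simp_all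

text \<open>Parseval in the lateral variables on almost every slice, followed by an exchange of the
  mode sum with the \<open>z\<close>-integral; Young's inequality makes the double sum absolutely
  convergent.\<close>

lemma sep_pairing:
 assumes u: "L2 SM u" and a: "test_function U a" and b: "test_function U' b" and c: "test_function U'' c"
 shows "(LINT x|SM. u x * sep a b c x) =
  of_real area * (LINT k|modes. th a b k * (LINT z|HM. c z * fc (slice u z) k))"
  "integrable SM (%x. u x * sep a b c x)"
proof -
 obtain A B C where B: "!!x. norm (a x) <= A" "!!x. norm (b x) <= B" "!!x. norm (c x) <= C" "A > 0" "B > 0" "C > 0"
  using test_bounded[OF a] test_bounded[OF b] test_bounded[OF c] by metis
 have um: "u \<in> borel_measurable SM" using u by (simp add: L2_def)
 have "finite_measure SM" unfolding S_v_def by (rule finite_measure_restrict_bounded) (auto intro!: bounded_Times borel_Times)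
 then interpret SMf: finite_measure SM .
 have "smooth (sep a b c)" using a b c by (intro smooth_sep) (auto simp: test_function_iff)
 then have sm: "sep a b c \<in> borel_measurable SM"
  by (intro measurable_restrict_space1) (simp add: borel_measurable_continuous_onI smoothD(3))
 show i: "integrable SM (%x. u x * sep a b c x)"
 proof (rule integrable_bounded_mult(1)[OF SMf.L2_integrable[OF u] sm, of "A * B * C"])
  show "norm (sep a b c x) <= A * B * C" for x
   unfolding sep_def norm_mult by (intro mult_mono B) (use B in \<open>auto intro: less_imp_le mult_nonneg_nonneg\<close>)
 qed
 define g where "g p = cnj (a (fst p) * b (snd p))" for p
 have g: "L2 GM g" unfolding g_def by (intro L2_cnj test_L2_GM[OF a b])
 define q where "q k z = th a b k * (c z * fc (slice u z) k)" for k z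
 have cm [measurable]: "c \<in> borel_measurable HM" by (intro measurable_IM_borel test_measurable[OF c])
 have fm [measurable]: "(%z. fc (slice u z) k) \<in> borel_measurable HM" for k by (rule fc_slice_meas[OF um])
 have "(LINT x|SM. u x * sep a b c x) = (LINT z|HM. LINT p|GM. slice (%x. u x * sep a b c x) z p)"
  by (rule SM_integral(2)[OF i])
 also have "... = (LINT z|HM. of_real area * (LINT k|modes. q k z))"
 proof (rule integral_cong_AE)
  have "(%z. LINT k|modes. q k z) \<in> borel_measurable HM"
   by (rule meas_count_integral) (simp add: q_def[abs_def])
  then show "(%z. of_real area * (LINT k|modes. q k z)) \<in> borel_measurable HM" by measurable
  from GI.integrable_snd[OF SM_integral(1)[OF i]]
  show "(%z. LINT p|GM. slice (%x. u x * sep a b c x) z p) \<in> borel_measurable HM" by auto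
  show "AE z in HM. (LINT p|GM. slice (%x. u x * sep a b c x) z p) = of_real area * (LINT k|modes. q k z)"
   using L2_slices[OF u]
  proof eventually_elim
   case (elim z)
   have "(LINT p|GM. slice (%x. u x * sep a b c x) z p) = c z * (LINT p|GM. slice u z p * cnj (g p))"
    by (simp add: slice_def sep_def g_def mult_ac flip: integral_mult_right_zero)
   also have "... = c z * (of_real area * (LINT k|modes. fc (slice u z) k * th a b k))"
    unfolding parseval_inner[OF elim g] by (simp only: th_fc[of a b] g_def[abs_def])
   also have "... = of_real area * (LINT k|modes. c z * (fc (slice u z) k * th a b k))" by simp
   finally show ?case by (simp add: q_def mult_ac)
  qed
 qed
 also have "... = of_real area * (LINT k|modes. LINT z|HM. q k z)"
 proof -
  have "(\<integral>\<^sup>+ z. \<integral>\<^sup>+ k. ennreal (norm (q k z)) \<partial>modes \<partial>HM) < \<infinity>"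
  proof -
   have "(\<integral>\<^sup>+ z. \<integral>\<^sup>+ k. ennreal (norm (q k z)) \<partial>modes \<partial>HM) \<le>
     (\<integral>\<^sup>+ z. ennreal C * (sqn modes (th a b) + wn 0 (%k. fc (slice u z) k)) \<partial>HM)"
   proof (rule nn_integral_mono)
    fix z
    have "(\<integral>\<^sup>+ k. ennreal (norm (q k z)) \<partial>modes) \<le>
      (\<integral>\<^sup>+ k. ennreal C * (ennreal ((norm (th a b k))\<^sup>2) + ennreal ((norm (fc (slice u z) k))\<^sup>2)) \<partial>modes)"
    proof (rule nn_integral_mono)
     fix k
     have "norm (q k z) = norm (c z) * norm (th a b k * fc (slice u z) k)" by (simp add: q_def norm_mult)
     also have "... <= C * ((norm (th a b k))\<^sup>2 + (norm (fc (slice u z) k))\<^sup>2)"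
      by (intro mult_mono B young) (use B in auto)
     finally show "ennreal (norm (q k z)) <= ennreal C * (ennreal ((norm (th a b k))\<^sup>2) + ennreal ((norm (fc (slice u z) k))\<^sup>2))"
      using B by (simp flip: ennreal_plus ennreal_mult' add: ennreal_leI)
    qed
    then show "(\<integral>\<^sup>+ k. ennreal (norm (q k z)) \<partial>modes) <= ennreal C * (sqn modes (th a b) + wn 0 (%k. fc (slice u z) k))"
     by (simp add: sqn_def wn_0 nn_integral_cmult nn_integral_add)
   qed
   also have "... = ennreal C * ((\<integral>\<^sup>+ z. sqn modes (th a b) \<partial>HM) + NN 0 (%k z. fc (slice u z) k))"
    unfolding NN_def using wn_meas[of "%k z. fc (slice u z) k" 0] mmeasI[OF fm]
    by (simp add: nn_integral_cmult nn_integral_add)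
   also have "... < \<infinity>"
   proof -
    have "NN 0 (%k z. fc (slice u z) k) < \<infinity>"
     using parseval_SM[OF u] u area by (auto simp: L2_sqn less_top[symmetric] ennreal_mult_eq_top_iff)
    moreover have "sqn modes (th a b) < \<infinity>" using th_L2[OF a b] by (simp add: L2_sqn)
    ultimately show ?thesis by (simp add: ennreal_mult_less_top IM.emeasure_eq_measure)
   qed
   finally show ?thesis .
  qed
  from count_Fubini[OF IM.sigma_finite_measure_axioms _ this] show ?thesis by (simp add: q_def[abs_def])
 qed
 finally show "(LINT x|SM. u x * sep a b c x) = of_real area * (LINT k|modes. th a b k * (LINT z|HM. c z * fc (slice u z) k))"
  by (simp add: q_def)
qed

text \<open>\<open>modes_zero\<close> asks for square summable sequences. Cauchy-Schwarz in
  \<open>z\<close> removes the test function, and the growth of the multiplier is paid for by the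
  weight in \<open>NN n v\<close>.\<close>

lemma pairing_L2:
 assumes v: "mmeas v" "NN n v < \<infinity>" and m: "!!k. (norm (m k))\<^sup>2 <= C * jw k ^ n" and c: "test_function U c"
 shows "L2 modes (%k. m k * (LINT z|HM. c z * v k z))"
proof -
 have cL: "L2 HM c"
 proof -
  obtain B where "!!x. norm (c x) <= B" using test_bounded[OF c] by metis
  then show ?thesis by (intro IM.L2_bounded[of _ _ B] measurable_IM_borel test_measurable[OF c])
 qed
 have C: "C >= 0" using order_trans[OF zero_le_power2 m[of 0]] by (simp add: jw_def)
 have "sqn modes (%k. m k * (LINT z|HM. c z * v k z)) <= (\<integral>\<^sup>+ k. ennreal C * sqn HM c * (ennreal (jw k ^ n) * sqn HM (v k)) \<partial>modes)"
  unfolding sqn_def[of modes]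
 proof (rule nn_integral_mono)
  fix k
  have j: "jw k ^ n >= 0" using jw_ge_1[of k] by simp
  have "ennreal ((norm (m k * (LINT z|HM. c z * v k z)))\<^sup>2) = ennreal ((norm (m k))\<^sup>2) * ennreal ((norm (LINT z|HM. c z * v k z))\<^sup>2)"
   by (simp add: norm_mult power_mult_distrib ennreal_mult')
  also have "... <= ennreal (C * jw k ^ n) * (sqn HM c * sqn HM (v k))"
   by (intro mult_mono ennreal_leI m sqn_cauchy_schwarz cL NN_L2[OF v]) auto
  also have "... = ennreal C * sqn HM c * (ennreal (jw k ^ n) * sqn HM (v k))"
   using C j by (simp add: ennreal_mult' mult_ac)
  finally show "ennreal ((norm (m k * (LINT z|HM. c z * v k z)))\<^sup>2) <= ennreal C * sqn HM c * (ennreal (jw k ^ n) * sqn HM (v k))" .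
 qed
 also have "... = ennreal C * sqn HM c * NN n v" unfolding NN_swap[OF v(1)] by (rule nn_integral_cmult) simp
 also have "... < \<infinity>" using v(2) cL by (simp add: ennreal_mult_less_top L2_sqn)
 finally show ?thesis by (simp add: L2_sqn)
qed

text \<open>Separable test functions supported in the open cell still see every coefficient: cut-offs of
 the conjugate exponential converge to it in the mean.\<close>

lemma modes_zero:
 assumes t: "L2 modes t"
  and 0: "!!a b. test_function {0<..<dx} a ==> test_function {0<..<dy} b ==> (LINT k|modes. th a b k * t k) = 0"
 shows "t m0 = 0"
proof -
 obtain r1 :: "nat => real => real" where r1: "!!n. test_function {0<..<dx} (r1 n)" "!!n x. 0 <= r1 n x" "!!n x. r1 n x <= 1"
  "!!x. (%n. r1 n x) \<longlonglongrightarrow> indicator {0<..<dx} x" using cutoff_sequence[of 0 dx] by blast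
 obtain r2 :: "nat => real => real" where r2: "!!n. test_function {0<..<dy} (r2 n)" "!!n x. 0 <= r2 n x" "!!n x. r2 n x <= 1"
  "!!x. (%n. r2 n x) \<longlonglongrightarrow> indicator {0<..<dy} x" using cutoff_sequence[of 0 dy] by blast
 define a where "a n x = of_real (r1 n x) * exp (of_real x * (- \<i> * of_real (al m0)))" for n x
 define b where "b n x = of_real (r2 n x) * exp (of_real x * (- \<i> * of_real (be m0)))" for n x
 have te: "test_function U (%x. of_real (r x) * exp (of_real x * c) :: complex)" if t: "test_function U r" for U c and r :: "real => real"
 proof -
  obtain K where "compact K" "K \<subseteq> U" "!!x. x \<notin> K ==> r x = 0" "smooth r" using t by (auto simp: test_function_iff)
  then show ?thesis unfolding test_function_iff
   by (intro conjI smooth_mult smooth_linear[OF bounded_linear_of_real] smooth_exp exI[of _ K]) auto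
 qed
 have ta: "test_function {0<..<dx} (a n)" and tb: "test_function {0<..<dy} (b n)" for n
  unfolding a_def b_def by (rule te[OF r1(1)], rule te[OF r2(1)])
 have ab: "cnj (a n (fst p) * b n (snd p)) = of_real (r1 n (fst p) * r2 n (snd p)) * ex m0 p" for n p
 proof -
  have "cnj (exp (of_real (fst p) * (- \<i> * of_real (al m0))) * exp (of_real (snd p) * (- \<i> * of_real (be m0)))) = ex m0 p"
   unfolding ex_def exp_add[symmetric] exp_cnj by (rule arg_cong[of _ _ exp]) (simp add: algebra_simps)
  then show ?thesis by (simp add: a_def b_def mult_ac)
 qed
 define e where "e n p = of_real (r1 n (fst p) * r2 n (snd p)) * ex m0 p - ex m0 p" for n p
 have gL: "L2 GM (%p. of_real (r1 n (fst p) * r2 n (snd p)) * ex m0 p)" for n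
  using L2_cnj[OF test_L2_GM[OF ta tb], of n n] unfolding ab .
 have eL: "L2 GM (e n)" for n unfolding e_def[abs_def] by (intro L2_diff gL L2_ex)
 have thn: "th (a n) (b n) k = (if k = m0 then 1 else 0) + cnj (fc (e n) k)" for n k
 proof -
  have "fc (e n) k = fc (%p. of_real (r1 n (fst p) * r2 n (snd p)) * ex m0 p) k + fc (%p. (-1) * ex m0 p) k"
   using fc_add[OF gL L2_cmult[OF L2_ex], of n "-1" m0 k] by (simp add: e_def[abs_def])
  then have "fc (e n) k = fc (%p. of_real (r1 n (fst p) * r2 n (snd p)) * ex m0 p) k - (if k = m0 then 1 else 0)"
   unfolding fc_cmult fc_ex by simp
  then show ?thesis unfolding th_fc ab by simp
 qed
 have "(%n. LINT p|GM. (norm (e n p))\<^sup>2) \<longlonglongrightarrow> (LINT p|GM. 0)"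
 proof (rule integral_dominated_convergence[where w = "%p. 1"])
  have en: "norm (e n p) = \<bar>r1 n (fst p) * r2 n (snd p) - 1\<bar>" for n p
  proof -
   have "e n p = of_real (r1 n (fst p) * r2 n (snd p) - 1) * ex m0 p" by (simp add: e_def algebra_simps)
   then show ?thesis by (simp add: norm_mult del: of_real_diff of_real_mult)
  qed
  show "AE p in GM. (%n. (norm (e n p))\<^sup>2) \<longlonglongrightarrow> 0"
  proof (rule AE_I2)
   fix p assume "p \<in> space GM"
   then have p: "fst p \<in> {0<..<dx}" "snd p \<in> {0<..<dy}" by (auto simp: Gam_def)
   have "(%n. \<bar>r1 n (fst p) * r2 n (snd p) - 1\<bar>\<^sup>2) \<longlonglongrightarrow> \<bar>indicator {0<..<dx} (fst p) * indicator {0<..<dy} (snd p) - 1\<bar>\<^sup>2"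
    by (intro tendsto_intros r1(4) r2(4))
   then show "(%n. (norm (e n p))\<^sup>2) \<longlonglongrightarrow> 0" using p unfolding en by simp
  qed
  show "AE p in GM. norm ((norm (e n p))\<^sup>2) <= 1" for n
  proof (rule AE_I2)
   fix p
   have "0 <= r1 n (fst p) * r2 n (snd p)" "r1 n (fst p) * r2 n (snd p) <= 1"
    using r1(2,3)[of n "fst p"] r2(2,3)[of n "snd p"] by (auto intro: mult_le_one)
   then have "\<bar>r1 n (fst p) * r2 n (snd p) - 1\<bar> <= 1" by simp
   then show "norm ((norm (e n p))\<^sup>2) <= 1" unfolding en by (simp add: abs_square_le_1)
  qed
  show "(%p. (norm (e n p))\<^sup>2) \<in> borel_measurable GM" for n using eL[of n] by (auto simp: L2_integrable_sq)
 qed auto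
 then have lim: "(%n. LINT p|GM. (norm (e n p))\<^sup>2) \<longlonglongrightarrow> 0" by simp
 \<comment> \<open>\<open>th (a n) (b n)\<close> is the unit sequence at \<open>m0\<close> plus an
   error of small norm, so the vanishing pairing leaves \<open>t m0\<close> equal to minus the
   pairing of that error with \<open>t\<close>.\<close>
 have "ennreal ((norm (t m0))\<^sup>2) <= ennreal (1 / area * (LINT p|GM. (norm (e n p))\<^sup>2)) * sqn modes t" for n
 proof -
  have i: "integrable modes (%k. cnj (fc (e n) k) * t k)" by (intro L2_mult_integrable L2_cnj fc_L2 eL t)
  have d: "integrable modes (%k. (if k = m0 then 1 else 0) * t k)" "(LINT k|modes. (if k = m0 then 1 else 0) * t k) = t m0"
  proof -
   have *: "(%k. (if k = m0 then 1 else 0) * t k) = (%k. indicator {m0} k *\<^sub>R t m0)" by (auto simp: indicator_def)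
   show "integrable modes (%k. (if k = m0 then 1 else 0) * t k)" "(LINT k|modes. (if k = m0 then 1 else 0) * t k) = t m0"
    unfolding * by (auto simp: measure_count_space)
  qed
  have "0 = (LINT k|modes. th (a n) (b n) k * t k)" using 0[OF ta tb] by simp
  also have "... = t m0 + (LINT k|modes. cnj (fc (e n) k) * t k)"
   unfolding thn distrib_right using i d by simp
  finally have "t m0 = - (LINT k|modes. cnj (fc (e n) k) * t k)" by (simp add: add_eq_0_iff)
  then have "ennreal ((norm (t m0))\<^sup>2) <= sqn modes (%k. cnj (fc (e n) k)) * sqn modes t"
   using sqn_cauchy_schwarz[OF L2_cnj[OF fc_L2[OF eL]] t, of n] by simp
  also have "sqn modes (%k. cnj (fc (e n) k)) = ennreal (1 / area) * sqn GM (e n)"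
   using bessel_sqn[OF eL] by (simp add: sqn_def)
  also have "... = ennreal (1 / area * (LINT p|GM. (norm (e n p))\<^sup>2))"
   unfolding sqn_eq_integral[OF eL] by (rule ennreal_mult'[symmetric]) (use area in simp)
  finally show ?thesis .
 qed
 moreover define S where "S = (LINT k|modes. (norm (t k))\<^sup>2)"
 ultimately have "ennreal ((norm (t m0))\<^sup>2) <= ennreal (1 / area * (LINT p|GM. (norm (e n p))\<^sup>2) * S)" for n
  unfolding S_def sqn_eq_integral[OF t] using area by (metis divide_nonneg_pos ennreal_mult' less_imp_le mult_nonneg_nonneg
   integral_nonneg_AE AE_I2 zero_le_power2 zero_le_one)
 moreover have "(%n. ennreal (1 / area * (LINT p|GM. (norm (e n p))\<^sup>2) * S)) \<longlonglongrightarrow> ennreal (1 / area * 0 * S)"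
  by (intro tendsto_ennrealI tendsto_mult tendsto_const lim)
 ultimately have "ennreal ((norm (t m0))\<^sup>2) <= ennreal (1 / area * 0 * S)"
  by (intro LIMSEQ_le_const) auto
 then show ?thesis by simp
qed

lemma wave_bound: obtains C where "C > 0" "!!k. (al k)\<^sup>2 + (be k)\<^sup>2 <= C * jw k"
proof
 define A where "A = 2 * (alpha D)\<^sup>2 + 2 * (beta D)\<^sup>2"
 define B where "B = 2 * (2 * pi / dx)\<^sup>2 + 2 * (2 * pi / dy)\<^sup>2"
 have A: "A >= 0" and B: "B > 0" using per_x per_y by (auto simp: A_def B_def add_pos_pos)
 show "A + B > 0" using A B by simp
 fix k
 have sq: "(x + y)\<^sup>2 <= 2 * x\<^sup>2 + 2 * y\<^sup>2" for x y :: real using norm_add_sq[of x y] by simp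
 have "(al k)\<^sup>2 + (be k)\<^sup>2 <= A + 2 * (2 * pi / dx)\<^sup>2 * (of_int (fst k))\<^sup>2 + 2 * (2 * pi / dy)\<^sup>2 * (of_int (snd k))\<^sup>2"
  using sq[of "alpha D" "2 * pi / dx * of_int (fst k)"] sq[of "beta D" "2 * pi / dy * of_int (snd k)"]
  unfolding alpha_p_def beta_q_def A_def power_mult_distrib by linarith
 also have "... <= A * jw k + B * ((of_int (fst k))\<^sup>2 + (of_int (snd k))\<^sup>2)"
 proof -
  have "2 * (2 * pi / dx)\<^sup>2 * (of_int (fst k))\<^sup>2 <= B * (of_int (fst k))\<^sup>2"
   "2 * (2 * pi / dy)\<^sup>2 * (of_int (snd k))\<^sup>2 <= B * (of_int (snd k))\<^sup>2"
   by (intro mult_right_mono; simp add: B_def)+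
  moreover have "A <= A * jw k" using A jw_ge_1[of k] by (simp add: mult_le_cancel_left1)
  ultimately show ?thesis by (simp add: distrib_left)
 qed
 also have "... <= (A + B) * jw k" using A B by (simp add: jw_def algebra_simps)
 finally show "(al k)\<^sup>2 + (be k)\<^sup>2 <= (A + B) * jw k" .
qed

lemma jetD: "jet m w ==> j < m ==> wd h (w j k) (w (Suc j) k)"
 unfolding jet_def by blast

text \<open>The vector \<open>gv k\<close> with the shift \<open>sh\<close> is the symbol of the gradient.\<close>

definition gv :: "mode => 3 => complex" where
 "gv k i = (if i = 1 then \<i> * of_real (al k) else if i = 2 then \<i> * of_real (be k) else 1)"

definition sh :: "3 => nat" where "sh i = (if i = 3 then 1 else 0)"

lemma gv_bound: obtains C where "C >= 0" "!!k i. (norm (gv k i))\<^sup>2 <= C * jw k ^ (1 - sh i)"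
proof -
 obtain C where C: "C > 0" "!!k. (al k)\<^sup>2 + (be k)\<^sup>2 <= C * jw k" using wave_bound by blast
 show ?thesis
 proof (rule that[of "C + 1"])
  fix k and i :: 3
  have j: "jw k >= 1" by (rule jw_ge_1)
  have "C * jw k <= (C + 1) * jw k" using j by simp
  then have a: "(al k)\<^sup>2 <= (C + 1) * jw k" "(be k)\<^sup>2 <= (C + 1) * jw k"
   using C(2)[of k] zero_le_power2[of "al k"] zero_le_power2[of "be k"] by linarith+
  have "i = 1 \<or> i = 2 \<or> i = 3" using exhaust_3 by blast
  then show "(norm (gv k i))\<^sup>2 <= (C + 1) * jw k ^ (1 - sh i)"
   using a C(1) by (auto simp: gv_def sh_def norm_mult)
 qed (use C in simp)
qed

definition bas :: "3 => space" where
 "bas r = (if r = 1 then (1, 0, 0) else if r = 2 then (0, 1, 0) else (0, 0, 1))"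

text \<open>The truncated subtraction is exact because \<open>sh\<close> is at most 1. A factor in
  direction \<open>z\<close> contributes a derivative of the jet instead of a power of the weight,
  which matches the weight \<open>2 - n\<close> of the derivative of order \<open>n\<close> in
  \<open>Nj 2\<close>.\<close>

lemma gv_bound2: obtains C where "C >= 0" "!!k i r. (norm (gv k r * gv k i))\<^sup>2 <= C * jw k ^ (2 - (sh r + sh i))"
proof -
 obtain C where C: "C >= 0" "!!k i. (norm (gv k i))\<^sup>2 <= C * jw k ^ (1 - sh i)" using gv_bound by blast
 have "(norm (gv k r * gv k i))\<^sup>2 <= C\<^sup>2 * jw k ^ (2 - (sh r + sh i))" for k i r
 proof -
  have "2 - (sh r + sh i) = (1 - sh r) + (1 - sh i)" by (simp add: sh_def)
  moreover have "(norm (gv k r))\<^sup>2 * (norm (gv k i))\<^sup>2 <= (C * jw k ^ (1 - sh r)) * (C * jw k ^ (1 - sh i))"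
   using C jw_ge_1[of k] by (intro mult_mono) auto
  ultimately show ?thesis unfolding norm_mult power_mult_distrib by (simp add: power_add power2_eq_square mult_ac)
 qed
 then show ?thesis using that[of "C\<^sup>2"] by simp
qed

lemma curl_curl_axis:
 assumes s: "smooth a" "smooth b" "smooth c"
 shows "curl (curl (%x. axis i (sep a b c x))) p $ r = pd (bas r) (pd (bas i) (sep a b c)) p
  - (if r = i then \<Sum>m\<in>UNIV. pd (bas m) (pd (bas m) (sep a b c)) p else 0)"
proof -
 note sv = s s[THEN smooth_vd]
 show ?thesis using exhaust_3[of i] exhaust_3[of r]
  by (elim disjE) (simp_all add: curl_curl_sep[OF s] bas_def sum_3 pd_sep sv)
qed

text \<open>The symbol of \<open>grad div - Laplace\<close>, that is of \<open>curl curl\<close>, in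
  mode \<open>k\<close>; the shifts select the derivative of the jet.\<close>

definition XX :: "(3 => nat => mode => real => complex) => 3 => mode => real => complex" where
 "XX W i k z = (\<Sum>r\<in>UNIV. gv k r * gv k i * W r (sh r + sh i) k z) - (\<Sum>m\<in>UNIV. gv k m * gv k m * W i (sh m + sh m) k z)"

abbreviation kk :: real where "kk \<equiv> (k0 D)\<^sup>2 * eps_bar D"

text \<open>For a fixed test function in \<open>z\<close>, testing with all separable fields shows
  via \<open>modes_zero\<close> that the residual of every mode integrates to 0 against it; varying
  the test function then makes the residual vanish almost everywhere.\<close>

lemma modes_eq:
 assumes V: "basic V" and r: "rep 2 V W" and F: "!!i. L2 SM (%x. F x $ i)" and L0: "L0_eq D V F"
 shows "AE z in HM. XX W i k z = of_real kk * W i 0 k z + fc (slice (%x. F x $ i) z) k"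
proof -
 define f where "f k z = fc (slice (%x. F x $ i) z) k" for k z
 define v where "v j k z = fc (slice (%x. V x $ j) z) k" for j k z
 have uL: "L2 SM (%x. V x $ j)" for j by (rule basic_L2[OF V])
 have jet: "jet 2 (W j)" "Nj 2 (W j) < \<infinity>" for j using r by (auto simp: rep_def)
 have WL: "L2 HM (W j n k)" if "n <= 2" for j n k by (rule Nj_L2[OF jet that])
 have Wm: "mmeas (W j n)" if "n <= 2" for j n using jet that by (auto simp: jet_def)
 have WN: "NN (2 - n) (W j n) < \<infinity>" if "n <= 2" for j n
  using member_le_sum[of n "{..2}" "%n. NN (2 - n) (W j n)"] that jet(2)[of j] by (auto simp: Nj_def intro: le_less_trans)
 have W0: "AE z in HM. v j k z = W j 0 k z" for j k
 proof -
  have "AE z in HM. W j 0 k z = hat D V (fst k) (snd k) z $ j" using r unfolding rep_def by blast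
  then show ?thesis using hat_AE[OF V] by eventually_elim (simp add: v_def)
 qed
 have vm: "v j k \<in> borel_measurable HM" for j k
  unfolding v_def using uL by (intro fc_slice_meas) (simp add: L2_def)
 have wdW: "wd h (W j 0 k) (W j 1 k)" "wd h (W j 1 k) (W j 2 k)" for j k
  using jetD[OF jet(1)[of j], of 0 k] jetD[OF jet(1)[of j], of 1 k] by (simp_all add: numeral_2_eq_2)
 have sh2: "sh q + sh s <= 2" for q s by (simp add: sh_def)
 have fm: "mmeas f" unfolding f_def using F by (intro mmeasI fc_slice_meas) (simp add: L2_def)
 have fN: "NN 0 f < \<infinity>"
  unfolding f_def using parseval_SM[OF F[of i]] F[of i] area by (auto simp: L2_sqn less_top[symmetric] ennreal_mult_eq_top_iff)
 have fL: "L2 HM (f k)" for k by (rule NN_L2[OF fm fN])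
 have key: "(LINT z|HM. of_real (ps z) * (XX W i k z - of_real kk * W i 0 k z - f k z)) = 0"
  if t: "test_function {-h<..<h} ps" for ps :: "real => real" and k
 proof -
  define c where "c z = complex_of_real (ps z)" for z
  define I where "I j n k = (LINT z|HM. c z * W j n k z)" for j n k
  define Jf where "Jf k = (LINT z|HM. c z * f k z)" for k
  have c: "test_function {-h<..<h} c" unfolding c_def by (rule test_of_real[OF t])
  have c1: "vd c = (%z. of_real (deriv ps z))" unfolding c_def by (rule vd_of_real[OF t])
  have c2: "vd (vd c) = (%z. of_real (deriv (deriv ps) z))" unfolding c1 by (rule vd_of_real[OF test_deriv(2)[OF t]])
  have e0: "(LINT z|HM. e z * v j k z) = (LINT z|HM. e z * W j 0 k z)"
   if e: "test_function {-h<..<h} e" for e :: "real => complex" and j k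
  proof (rule integral_cong_AE)
   show "AE z in HM. e z * v j k z = e z * W j 0 k z" using W0[of j k] by eventually_elim simp
   show "(%z. e z * W j 0 k z) \<in> borel_measurable HM" "(%z. e z * v j k z) \<in> borel_measurable HM"
    using measurable_IM_borel[OF test_measurable[OF e]] vm WL[of 0 j k] by (auto simp: L2_def)
  qed
  have I: "(LINT z|HM. c z * v j k z) = I j 0 k" "(LINT z|HM. vd c z * v j k z) = - I j 1 k"
   "(LINT z|HM. vd (vd c) z * v j k z) = I j 2 k" for j k
   using e0[OF c, of j k] e0[OF test_vd[OF c], of j k] e0[OF test_vd[OF test_vd[OF c]], of j k] wdW[of j k] t test_deriv(2)[OF t]
   unfolding c2 unfolding c1 by (simp_all add: I_def wd_def c_def scaleR_conv_of_real)
  obtain B where "!!x. norm (c x) <= B" using test_bounded[OF c] by metis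
  then have ci: "integrable HM (%z. c z * g z)" if "L2 HM g" for g
   using integrable_bounded_mult(2)[OF IM.L2_integrable[OF that] measurable_IM_borel[OF test_measurable[OF c]]] by blast
  obtain C where C: "C >= 0" "!!k i r. (norm (gv k r * gv k i))\<^sup>2 <= C * jw k ^ (2 - (sh r + sh i))" using gv_bound2 by blast
  have IL: "L2 modes (%k. gv k q * gv k s * I j (sh q + sh s) k)" for q s j
   unfolding I_def by (rule pairing_L2[OF Wm[OF sh2] WN[OF sh2] C(2) c])
  have I0L: "L2 modes (%k. I j 0 k)" for j
   using pairing_L2[OF Wm[of 0 j] le_less_trans[OF NN_mono[of 0 2 "W j 0"]] _ c, of "%_. 1" 1] WN[of 0 j] unfolding I_def by simp
  have JfL: "L2 modes Jf" using pairing_L2[OF fm fN _ c, of "%_. 1" 1] by (simp add: Jf_def[abs_def])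
  \<comment> \<open>The residual of the mode equation paired with \<open>c\<close>, as the sequence
    to which \<open>modes_zero\<close> is applied.\<close>
  define tt where "tt k = (\<Sum>r\<in>UNIV. gv k r * gv k i * I r (sh r + sh i) k) - (\<Sum>m\<in>UNIV. gv k m * gv k m * I i (sh m + sh m) k)
   - of_real kk * I i 0 k - Jf k" for k
  have ttL: "L2 modes tt" unfolding tt_def[abs_def] by (intro L2_diff L2_sum IL L2_cmult I0L JfL)
  have "tt k = 0"
  proof (rule modes_zero[OF ttL])
   fix a b :: "real => complex" assume ta: "test_function {0<..<dx} a" and tb: "test_function {0<..<dy} b"
   have sm: "smooth a" "smooth b" "smooth c" using ta tb c by (auto simp: test_function_iff)
   note tv = test_vd[OF ta] test_vd[OF tb] test_vd[OF c]
   note va = th_vd[OF ta tb] th_vd[OF tv(1) tb] th_vd[OF ta tv(2)]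
   define S where "S = sep a b c"
   note pS = S_def bas_def pd_sep sm sm[THEN smooth_vd]
   \<comment> \<open>Every pairing carries two derivatives, lateral or vertical. Moving each one
     contributes a minus sign, so the signs cancel and the product of gradient symbols
     remains.\<close>
   have P: "integrable SM (%x. V x $ j * pd (bas q) (pd (bas s) S) x)"
    "(LINT x|SM. V x $ j * pd (bas q) (pd (bas s) S) x) = of_real area * (LINT k|modes. th a b k * (gv k q * gv k s * I j (sh q + sh s) k))" for j q s
   proof -
    show "integrable SM (%x. V x $ j * pd (bas q) (pd (bas s) S) x)"
     using exhaust_3[of q] exhaust_3[of s]
     by (elim disjE) (simp_all add: pS sep_pairing(2)[OF uL ta tb c] sep_pairing(2)[OF uL test_vd[OF tv(1)] tb c]
      sep_pairing(2)[OF uL ta test_vd[OF tv(2)] c] sep_pairing(2)[OF uL ta tb test_vd[OF tv(3)]]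
      sep_pairing(2)[OF uL tv(1,2) c] sep_pairing(2)[OF uL tv(1) tb tv(3)] sep_pairing(2)[OF uL ta tv(2,3)])
    show "(LINT x|SM. V x $ j * pd (bas q) (pd (bas s) S) x) = of_real area * (LINT k|modes. th a b k * (gv k q * gv k s * I j (sh q + sh s) k))"
     using exhaust_3[of q] exhaust_3[of s]
     by (elim disjE) (simp_all add: pS sep_pairing(1)[OF uL test_vd[OF tv(1)] tb c]
      sep_pairing(1)[OF uL ta test_vd[OF tv(2)] c] sep_pairing(1)[OF uL ta tb test_vd[OF tv(3)]]
      sep_pairing(1)[OF uL tv(1,2) c] sep_pairing(1)[OF uL tv(1) tb tv(3)] sep_pairing(1)[OF uL ta tv(2,3)]
      va I[unfolded v_def] gv_def sh_def numeral_2_eq_2 mult_ac)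
   qed
   have P0: "integrable SM (%x. V x $ i * S x)" "(LINT x|SM. V x $ i * S x) = of_real area * (LINT k|modes. th a b k * I i 0 k)"
    "integrable SM (%x. F x $ i * S x)" "(LINT x|SM. F x $ i * S x) = of_real area * (LINT k|modes. th a b k * Jf k)"
    unfolding S_def using sep_pairing[OF uL ta tb c, of i] sep_pairing[OF F ta tb c, of i] I(1)[unfolded v_def, of i] by (simp_all add: Jf_def f_def)
   define Ps where "Ps x = (axis i (S x) :: complex^3)" for x
   have "test_function (S_v D) Ps" unfolding Ps_def S_def S_v_def by (intro test_axis test_sep ta tb c)
   from L0_weak[OF L0 this]
   have eq: "(LINT x|SM. cdot (V x) (curl (curl Ps) x)) = (LINT x|SM. cdot (F x + of_real kk *s V x) (Ps x))" by simp
   define TI where "TI g = (LINT k|modes. th a b k * g k)" for g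
   have TIi: "integrable modes (%k. th a b k * g k)" if "L2 modes g" for g by (rule L2_mult_integrable[OF th_L2[OF ta tb] that])
   have "(LINT x|SM. cdot (F x + of_real kk *s V x) (Ps x)) = (LINT x|SM. F x $ i * S x + of_real kk * (V x $ i * S x))"
    by (simp add: Ps_def cdot_axis algebra_simps)
   also have "... = of_real area * (TI Jf + of_real kk * TI (%k. I i 0 k))"
    by (simp add: P0 TI_def distrib_left mult.left_commute[of "of_real area" "of_real kk"] del: of_real_mult of_real_power)
   finally have rhs: "(LINT x|SM. cdot (F x + of_real kk *s V x) (Ps x)) = of_real area * (TI Jf + of_real kk * TI (%k. I i 0 k))" .
   have cc: "cdot (V x) (curl (curl Ps) x) = (\<Sum>r\<in>UNIV. V x $ r * pd (bas r) (pd (bas i) S) x) - (\<Sum>m\<in>UNIV. V x $ i * pd (bas m) (pd (bas m) S) x)" for x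
    unfolding cdot_def Ps_def S_def curl_curl_axis[OF sm]
    by (simp add: right_diff_distrib sum_subtractf if_distrib[of "%w. _ * w"] sum_distrib_left cong: if_cong)
   have "(LINT x|SM. cdot (V x) (curl (curl Ps) x)) = of_real area *
    ((\<Sum>r\<in>UNIV. TI (%k. gv k r * gv k i * I r (sh r + sh i) k)) - (\<Sum>m\<in>UNIV. TI (%k. gv k m * gv k m * I i (sh m + sh m) k)))"
    unfolding cc by (simp add: P TI_def sum_distrib_left right_diff_distrib)
   moreover have "TI tt = (\<Sum>r\<in>UNIV. TI (%k. gv k r * gv k i * I r (sh r + sh i) k)) - (\<Sum>m\<in>UNIV. TI (%k. gv k m * gv k m * I i (sh m + sh m) k))
    - of_real kk * TI (%k. I i 0 k) - TI Jf"
    unfolding TI_def tt_def right_diff_distrib sum_distrib_left mult.left_commute[of "th a b _" "of_real kk"]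
    by (simp add: TIi IL I0L JfL)
   ultimately show "(LINT k|modes. th a b k * tt k) = 0"
    using eq rhs area unfolding TI_def[symmetric] by (simp del: of_real_mult) (metis add_diff_cancel_right')
  qed
  moreover have "tt k = (LINT z|HM. c z * (XX W i k z - of_real kk * W i 0 k z - f k z))"
   unfolding XX_def right_diff_distrib sum_distrib_left mult.left_commute[of "c _"]
   by (simp add: tt_def I_def Jf_def ci WL sh2 fL)
  ultimately show ?thesis by (simp add: c_def)
 qed
 have "AE z in HM. XX W i k z - of_real kk * W i 0 k z - f k z = 0"
 proof (rule AE_zero_test)
  show "integrable HM (%z. XX W i k z - of_real kk * W i 0 k z - f k z)"
   unfolding XX_def by (intro IM.L2_integrable L2_diff L2_sum L2_cmult WL sh2 fL) simp
 qed (use key in \<open>simp add: scaleR_conv_of_real\<close>)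
 then show ?thesis by eventually_elim (simp add: f_def algebra_simps)
qed

end

section \<open>The ordinary differential equations of the Fourier modes\<close>

lemma wd_AE_unique:
 assumes a: "wd h f g" and b: "wd h f' g'" and e: "AE z in IM h. f z = f' z"
 shows "AE z in IM h. g z = g' z"
proof -
 have "AE z in IM h. g z - g' z = 0"
 proof (rule AE_zero_test)
  show "integrable (IM h) (%z. g z - g' z)" using a b by (simp add: wd_def)
  fix ps :: "real => real" assume t: "test_function {-h<..<h} ps"
  have i: "integrable (IM h) f" "integrable (IM h) f'" "integrable (IM h) g" "integrable (IM h) g'"
   using a b by (auto simp: wd_def)
  have "(LINT z|IM h. deriv ps z *\<^sub>R f z) = (LINT z|IM h. deriv ps z *\<^sub>R f' z)"
  proof (rule integral_cong_AE)
   show "AE z in IM h. deriv ps z *\<^sub>R f z = deriv ps z *\<^sub>R f' z" using e by eventually_elim simp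
  qed (use test_integrable[OF test_deriv(2)[OF t]] i in auto)
  then have "(LINT z|IM h. ps z *\<^sub>R g z) = (LINT z|IM h. ps z *\<^sub>R g' z)"
   using a b t by (simp add: wd_def)
  then show "(LINT z|IM h. ps z *\<^sub>R (g z - g' z)) = 0"
   using test_integrable[OF t i(3)] test_integrable[OF t i(4)] by (simp add: scaleR_diff_right)
 qed
 then show ?thesis by eventually_elim simp
qed

text \<open>The divergence of the equation determines \<open>i a w1 + i b w2 + w3'\<close> from the right-hand side;
 eliminating it decouples the three components.\<close>

lemma ode_mode:
 fixes a b \<kappa> :: real
 assumes \<kappa>: "\<kappa> \<noteq> 0"
  and w: "wd h w1 v1" "wd h v1 u1" "wd h w2 v2" "wd h v2 u2" "wd h w3 v3" "wd h v3 u3"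
  and f: "wd h f1 g1" "wd h f2 g2" "wd h f3 g3" "wd h g3 e3"
  and eq1: "AE z in IM h. of_real (b\<^sup>2) * w1 z - of_real (a * b) * w2 z - u1 z + \<i> * of_real a * v3 z = of_real \<kappa> * w1 z + f1 z"
  and eq2: "AE z in IM h. of_real (a\<^sup>2) * w2 z - of_real (a * b) * w1 z - u2 z + \<i> * of_real b * v3 z = of_real \<kappa> * w2 z + f2 z"
  and eq3: "AE z in IM h. of_real (a\<^sup>2 + b\<^sup>2) * w3 z + \<i> * of_real a * v1 z + \<i> * of_real b * v2 z = of_real \<kappa> * w3 z + f3 z"
 shows "AE z in IM h. u1 z = of_real (a\<^sup>2 + b\<^sup>2 - \<kappa>) * w1 z - (f1 z + \<i> * of_real a / of_real \<kappa> * (\<i> * of_real a * f1 z + \<i> * of_real b * f2 z + g3 z))"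
  "AE z in IM h. u2 z = of_real (a\<^sup>2 + b\<^sup>2 - \<kappa>) * w2 z - (f2 z + \<i> * of_real b / of_real \<kappa> * (\<i> * of_real a * f1 z + \<i> * of_real b * f2 z + g3 z))"
  "AE z in IM h. u3 z = of_real (a\<^sup>2 + b\<^sup>2 - \<kappa>) * w3 z - (f3 z + 1 / of_real \<kappa> * (\<i> * of_real a * g1 z + \<i> * of_real b * g2 z + e3 z))"
proof -
 define \<alpha> \<beta> K where "\<alpha> = \<i> * complex_of_real a" and "\<beta> = \<i> * complex_of_real b" and "K = complex_of_real \<kappa>"
 have K: "K \<noteq> 0" using \<kappa> by (simp add: K_def)
 have ab: "complex_of_real (a\<^sup>2) = - \<alpha> * \<alpha>" "complex_of_real (b\<^sup>2) = - \<beta> * \<beta>" "complex_of_real (a * b) = - \<alpha> * \<beta>"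
  "complex_of_real (a\<^sup>2 + b\<^sup>2) = - \<alpha> * \<alpha> - \<beta> * \<beta>" "complex_of_real (a\<^sup>2 + b\<^sup>2 - \<kappa>) = - \<alpha> * \<alpha> - \<beta> * \<beta> - K"
  by (simp_all add: \<alpha>_def \<beta>_def K_def power2_eq_square algebra_simps)
 note eqs = eq1 eq2 eq3
 have E1: "AE z in IM h. - \<beta> * \<beta> * w1 z + \<alpha> * \<beta> * w2 z - u1 z + \<alpha> * v3 z = K * w1 z + f1 z"
  using eq1 unfolding ab by (simp add: \<alpha>_def K_def)
 have E2: "AE z in IM h. - \<alpha> * \<alpha> * w2 z + \<alpha> * \<beta> * w1 z - u2 z + \<beta> * v3 z = K * w2 z + f2 z"
  using eq2 unfolding ab by (simp add: \<beta>_def K_def)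
 have E3: "AE z in IM h. (- \<alpha> * \<alpha> - \<beta> * \<beta> - K) * w3 z + (\<alpha> * v1 z + \<beta> * v2 z) = f3 z"
  using eq3 unfolding ab by eventually_elim (simp add: \<alpha>_def \<beta>_def K_def algebra_simps)
 \<comment> \<open>The third equation contains no second derivative; differentiating it gives the
   combination of \<open>u1\<close> and \<open>u2\<close> that the divergence of the system
   requires.\<close>
 have "wd h (%z. (- \<alpha> * \<alpha> - \<beta> * \<beta> - K) * w3 z + (\<alpha> * v1 z + \<beta> * v2 z)) (%z. (- \<alpha> * \<alpha> - \<beta> * \<beta> - K) * v3 z + (\<alpha> * u1 z + \<beta> * u2 z))"
  by (intro wd_add wd_cmult w)
 from wd_AE_unique[OF this f(3) E3]
 have E3': "AE z in IM h. (- \<alpha> * \<alpha> - \<beta> * \<beta> - K) * v3 z + (\<alpha> * u1 z + \<beta> * u2 z) = g3 z" .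
 have dv: "AE z in IM h. K * (\<alpha> * w1 z + \<beta> * w2 z + v3 z) = - (\<alpha> * f1 z + \<beta> * f2 z + g3 z)"
  using E1 E2 E3'
 proof eventually_elim
  case (elim z)
  define p where "p = - \<beta> * \<beta> * w1 z + \<alpha> * \<beta> * w2 z - u1 z + \<alpha> * v3 z"
  define q where "q = - \<alpha> * \<alpha> * w2 z + \<alpha> * \<beta> * w1 z - u2 z + \<beta> * v3 z"
  have "\<alpha> * p + \<beta> * q + g3 z = - K * v3 z"
   unfolding elim(3)[symmetric] p_def q_def by (simp add: algebra_simps)
  then show ?case using elim(1,2) unfolding p_def[symmetric] q_def[symmetric] by (simp add: algebra_simps eq_neg_iff_add_eq_0)
 qed
 have dv': "AE z in IM h. \<alpha> * w1 z + \<beta> * w2 z + v3 z = (- 1 / K) * (\<alpha> * f1 z + \<beta> * f2 z + g3 z)"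
  using dv by eventually_elim (use K in \<open>simp add: field_simps\<close>)
 \<comment> \<open>Differentiating the divergence relation once more produces \<open>u3\<close>,
   which the third equation does not contain.\<close>
 have "wd h (%z. \<alpha> * w1 z + \<beta> * w2 z + v3 z) (%z. \<alpha> * v1 z + \<beta> * v2 z + u3 z)"
  "wd h (%z. (- 1 / K) * (\<alpha> * f1 z + \<beta> * f2 z + g3 z)) (%z. (- 1 / K) * (\<alpha> * g1 z + \<beta> * g2 z + e3 z))"
  by (intro wd_add wd_cmult w f)+
 from wd_AE_unique[OF this dv']
 have dv'': "AE z in IM h. \<alpha> * v1 z + \<beta> * v2 z + u3 z = (- 1 / K) * (\<alpha> * g1 z + \<beta> * g2 z + e3 z)" .
 show "AE z in IM h. u1 z = of_real (a\<^sup>2 + b\<^sup>2 - \<kappa>) * w1 z - (f1 z + \<i> * of_real a / of_real \<kappa> * (\<i> * of_real a * f1 z + \<i> * of_real b * f2 z + g3 z))"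
  unfolding ab \<alpha>_def[symmetric] \<beta>_def[symmetric] K_def[symmetric] using E1 dv'
 proof eventually_elim
  case (elim z)
  define d where "d = \<alpha> * f1 z + \<beta> * f2 z + g3 z"
  have v: "v3 z = - d / K - \<alpha> * w1 z - \<beta> * w2 z" using elim(2) unfolding d_def[symmetric] by (simp add: algebra_simps)
  have e: "u1 z = (- \<beta> * \<beta> * w1 z + \<alpha> * \<beta> * w2 z + \<alpha> * v3 z) - (K * w1 z + f1 z)" using elim(1) by (simp add: algebra_simps)
  show ?case unfolding d_def[symmetric] e v by (simp add: algebra_simps)
 qed
 show "AE z in IM h. u2 z = of_real (a\<^sup>2 + b\<^sup>2 - \<kappa>) * w2 z - (f2 z + \<i> * of_real b / of_real \<kappa> * (\<i> * of_real a * f1 z + \<i> * of_real b * f2 z + g3 z))"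
  unfolding ab \<alpha>_def[symmetric] \<beta>_def[symmetric] K_def[symmetric] using E2 dv'
 proof eventually_elim
  case (elim z)
  define d where "d = \<alpha> * f1 z + \<beta> * f2 z + g3 z"
  have v: "v3 z = - d / K - \<alpha> * w1 z - \<beta> * w2 z" using elim(2) unfolding d_def[symmetric] by (simp add: algebra_simps)
  have e: "u2 z = (- \<alpha> * \<alpha> * w2 z + \<alpha> * \<beta> * w1 z + \<beta> * v3 z) - (K * w2 z + f2 z)" using elim(1) by (simp add: algebra_simps)
  show ?case unfolding d_def[symmetric] e v by (simp add: algebra_simps)
 qed
 show "AE z in IM h. u3 z = of_real (a\<^sup>2 + b\<^sup>2 - \<kappa>) * w3 z - (f3 z + 1 / of_real \<kappa> * (\<i> * of_real a * g1 z + \<i> * of_real b * g2 z + e3 z))"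
  unfolding ab \<alpha>_def[symmetric] \<beta>_def[symmetric] K_def[symmetric] using E3 dv''
 proof eventually_elim
  case (elim z)
  define d where "d = \<alpha> * g1 z + \<beta> * g2 z + e3 z"
  have v: "u3 z = - d / K - \<alpha> * v1 z - \<beta> * v2 z" using elim(2) unfolding d_def[symmetric] by (simp add: algebra_simps)
  show ?case using elim(1) unfolding d_def[symmetric] v by (simp add: algebra_simps)
 qed
qed

text \<open>The set of disagreement in the open interval is open and null, hence empty; the ends
  follow by continuity.\<close>

lemma continuous_AE_eq:
 fixes F G :: "real => 'a::real_normed_vector"
 assumes h: "h > 0" and F: "continuous_on {-h..h} F" and G: "continuous_on {-h..h} G"
  and e: "AE z in IM h. F z = G z" and z: "z \<in> {-h..h}"
 shows "F z = G z"
proof -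
 define U where "U = {z \<in> {-h<..<h}. F z - G z \<noteq> 0}"
 have c: "continuous_on {-h<..<h} (%z. F z - G z)"
  by (rule continuous_on_subset[of "{-h..h}"]) (auto intro!: continuous_intros F G)
 have op: "open U"
  using continuous_open_preimage[OF c open_greaterThanLessThan, of "- {0}"] by (simp add: U_def vimage_def Int_def open_Compl)
 have "AE z in lborel. z \<notin> U"
  using e by (subst (asm) AE_restrict_space_iff) (auto simp: U_def elim!: eventually_mono)
 then have "U \<in> null_sets lborel" using op by (subst AE_iff_null_sets) auto
 then have "negligible U" by (simp add: negligible_iff_null_sets null_sets_completionI)
 then have U: "U = {}" using open_not_negligible[OF op] by blast
 have "continuous_on (closure {-h<..<h}) (%z. F z - G z)" using h by (simp add: F G continuous_intros)
 moreover have "F z - G z = 0" if "z \<in> {-h<..<h}" for z using U that by (auto simp: U_def)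
 moreover have "z \<in> closure {-h<..<h}" using z h by simp
 ultimately have "F z - G z = 0" by (rule continuous_constant_on_closure)
 then show ?thesis by simp
qed

text \<open>Any continuous representative, given by components, evaluates the \<open>THE\<close> in
  \<open>trace_at\<close>; uniqueness is \<open>continuous_AE_eq\<close>.\<close>

lemma trace_at_eq:
 assumes h: "h > 0" and F: "!!i. continuous_on {-h..h} (F i)" and e: "!!i. AE z in IM h. F i z = f z $ i"
  and a: "a \<in> {-h..h}"
 shows "trace_at h f a $ i = F i a"
proof -
 define G where "G z = (\<chi> i. F i z)" for z
 have G: "continuous_on {-h..h} G" unfolding G_def using F by (intro continuous_intros) auto
 have eG: "AE z in IM h. G z = f z"
 proof -
  have "AE z in IM h. \<forall>i. F i z = f z $ i" using e by (simp add: AE_all_countable)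
  then show ?thesis by eventually_elim (simp add: G_def vec_eq_iff)
 qed
 have "trace_at h f a = G a" unfolding trace_at_def
 proof (rule the_equality)
  have "AE z in lborel. z \<in> {-h<..<h} --> G z = f z"
   using eG by (subst (asm) AE_restrict_space_iff) auto
  then show "\<exists>F. continuous_on {-h..h} F \<and> (AE z in lborel. z \<in> {-h<..<h} --> F z = f z) \<and> F a = G a"
   using G by blast
  fix c assume "\<exists>F. continuous_on {-h..h} F \<and> (AE z in lborel. z \<in> {-h<..<h} --> F z = f z) \<and> F a = c"
  then obtain F' where F': "continuous_on {-h..h} F'" "AE z in lborel. z \<in> {-h<..<h} --> F' z = f z" "F' a = c" by blast
  have "AE z in IM h. F' z = f z" using F'(2) by (subst AE_restrict_space_iff) auto
  with eG have "AE z in IM h. F' z = G z" by eventually_elim simp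
  then show "c = G a" using continuous_AE_eq[OF h F'(1) G _ a] F'(3) by simp
 qed
 then show ?thesis by (simp add: G_def)
qed

section \<open>Traces, impedances and mode-independent estimates\<close>

context grid
begin

definition \<nu> :: "mode => real" where "\<nu> k = (al k)\<^sup>2 + (be k)\<^sup>2 - kk"

text \<open>With \<open>T_u\<close> and \<open>T_w\<close> moved to the other side, the conditions
  read \<open>V1 h = bu k * V h\<close>, up to the datum at the top, and
  \<open>V1 (-h) = bw k * V (-h)\<close>.\<close>

abbreviation bu :: "mode => complex" where "bu k \<equiv> \<i> * gamma_pq D (eps_u D) (fst k) (snd k)"
abbreviation bw :: "mode => complex" where "bw k \<equiv> - (\<i> * gamma_pq D (eps_w D) (fst k) (snd k))"

text \<open>Two integrable weak derivatives make the coefficient and its first derivative continuous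
  up to the faces; these representatives carry the traces.\<close>

lemma mode_traces:
 assumes V: "V \<in> Hspace D 2" and W: "W = (%i j k z. wderiv h j (hat D V (fst k) (snd k)) z $ i)"
 obtains F F' where "!!i k. AC h (F i k) (F' i k)" "!!i k. AC h (F' i k) (W i 2 k)"
  "!!i k. AE z in HM. F i k z = W i 0 k z" "!!i k. AE z in HM. F' i k z = W i 1 k z"
  "!!i k a. a \<in> {-h..h} ==> tr D V a (fst k) (snd k) $ i = F i k a"
  "!!i k a. a \<in> {-h..h} ==> tr_dz D V a (fst k) (snd k) $ i = F' i k a"
proof -
 have r: "rep 2 V W" unfolding W by (rule Hspace_rep[OF V])
 have j: "jet 2 (W i)" for i using r by (auto simp: rep_def)
 have w: "wd h (W i 0 k) (W i 1 k)" "wd h (W i 1 k) (W i 2 k)" for i k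
  using jetD[OF j[of i], of 0 k] jetD[OF j[of i], of 1 k] by (simp_all add: numeral_2_eq_2)
 define P where "P i k F F' \<longleftrightarrow> AC h F F' \<and> AC h F' (W i 2 k) \<and> (AE z in HM. F z = W i 0 k z) \<and> (AE z in HM. F' z = W i 1 k z)" for i k F F'
 have "\<exists>F F'. P i k F F'" for i k
 proof -
  obtain F where F: "AC h F (W i 1 k)" "AE z in HM. W i 0 k z = F z" by (rule wd_imp_AC[OF w(1) hgt])
  obtain F' where F': "AC h F' (W i 2 k)" "AE z in HM. W i 1 k z = F' z" by (rule wd_imp_AC[OF w(2) hgt])
  have "F' \<in> borel_measurable HM" using AC_imp_wd[OF F'(1) hgt] by (rule wd_meas)
  then have "AC h F F'" using AC_cong[OF F(1) refl F'(2)] hgt by simp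
  moreover have "AE z in HM. F z = W i 0 k z" using F(2) by eventually_elim simp
  moreover have "AE z in HM. F' z = W i 1 k z" using F'(2) by eventually_elim simp
  ultimately show ?thesis using F'(1) unfolding P_def by blast
 qed
 then obtain F F' where "!!i k. P i k (F i k) (F' i k)" by metis
 then have F: "!!i k. AC h (F i k) (F' i k)" "!!i k. AC h (F' i k) (W i 2 k)"
  "!!i k. AE z in HM. F i k z = W i 0 k z" "!!i k. AE z in HM. F' i k z = W i 1 k z" unfolding P_def by blast+
 show ?thesis
 proof (rule that[OF F])
  fix i k a assume a: "a \<in> {-h..h}"
  show "tr D V a (fst k) (snd k) $ i = F i k a" unfolding tr_def
  proof (rule trace_at_eq[OF hgt AC_continuous[OF F(1)] _ a])
   fix i
   have "AE z in HM. W i 0 k z = hat D V (fst k) (snd k) z $ i" using r unfolding rep_def by blast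
   then show "AE z in HM. F i k z = hat D V (fst k) (snd k) z $ i" using F(3)[of i k] by eventually_elim simp
  qed
  show "tr_dz D V a (fst k) (snd k) $ i = F' i k a" unfolding tr_dz_def
   by (rule trace_at_eq[OF hgt AC_continuous[OF F(2)] _ a]) (use F(4) in \<open>simp add: W\<close>)
 qed
qed

lemma solves_bc:
 assumes s: "solves D G Q V"
  and t: "!!i k a. a \<in> {-h..h} ==> tr D V a (fst k) (snd k) $ i = F i k a"
   "!!i k a. a \<in> {-h..h} ==> tr_dz D V a (fst k) (snd k) $ i = F' i k a"
 shows "F' i k h = bu k * F i k h - fcoeff D Q (fst k) (snd k) $ i" "F' i k (-h) = bw k * F i k (-h)"
proof -
 have e: "h \<in> {-h..h}" "-h \<in> {-h..h}" using hgt by auto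
 have "- tr_dz D V h (fst k) (snd k) - T_u D (tr D V h) (fst k) (snd k) = fcoeff D Q (fst k) (snd k)"
  "tr_dz D V (- h) (fst k) (snd k) - T_w D (tr D V (- h)) (fst k) (snd k) = 0"
  using s unfolding solves_def by blast+
 from this[THEN arg_cong[where f = "%v. v $ i"]]
 show "F' i k h = bu k * F i k h - fcoeff D Q (fst k) (snd k) $ i" "F' i k (-h) = bw k * F i k (-h)"
  unfolding T_u_def T_w_def by (simp_all add: t[OF e(1)] t[OF e(2)] algebra_simps eq_neg_iff_add_eq_0)
qed

text \<open>Once the lateral wave number exceeds all material constants, \<open>\<nu>\<close>
  dominates a multiple of the weight and both square roots are imaginary, so the impedances get the
  signs that \<open>bvp_energy\<close> needs.\<close>

lemma mode_bounds: obtains c R where "c > 0" "!!k. jw k >= R ==> \<nu> k >= c * jw k"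
  "!!k. jw k >= R ==> \<exists>a\<ge>0. bu k = - complex_of_real a" "!!k. jw k >= R ==> \<exists>b\<ge>0. bw k = complex_of_real b"
  "finite {k. jw k < R}"
proof -
 define c0 where "c0 = min ((2 * pi / dx)\<^sup>2 / 2) ((2 * pi / dy)\<^sup>2 / 2)"
 define A where "A = (alpha D)\<^sup>2 + (beta D)\<^sup>2"
 define M where "M = \<bar>kk\<bar> + \<bar>eps_u D * (k0 D)\<^sup>2\<bar> + \<bar>eps_w D * (k0 D)\<^sup>2\<bar>"
 \<comment> \<open>From \<open>R\<close> on, half of \<open>c0 * jw k\<close> absorbs the constants
   \<open>c0\<close>, \<open>A\<close> and \<open>M\<close>.\<close>
 define R where "R = 2 * (c0 + A + M) / c0"
 have c0: "c0 > 0" using per_x per_y by (auto simp: c0_def)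
 have sq: "y\<^sup>2 / 2 - x\<^sup>2 <= (x + y)\<^sup>2" for x y :: real
  using norm_add_sq[of "x + y" "-x"] by simp
 have low: "c0 * (jw k - 1) - A <= (al k)\<^sup>2 + (be k)\<^sup>2" for k
 proof -
  have "(2 * pi / dx * of_int (fst k))\<^sup>2 / 2 - (alpha D)\<^sup>2 <= (al k)\<^sup>2" "(2 * pi / dy * of_int (snd k))\<^sup>2 / 2 - (beta D)\<^sup>2 <= (be k)\<^sup>2"
   unfolding alpha_p_def beta_q_def by (rule sq)+
  moreover have "c0 * (of_int (fst k))\<^sup>2 <= (2 * pi / dx)\<^sup>2 / 2 * (of_int (fst k))\<^sup>2"
    "c0 * (of_int (snd k))\<^sup>2 <= (2 * pi / dy)\<^sup>2 / 2 * (of_int (snd k))\<^sup>2"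
   by (intro mult_right_mono; simp add: c0_def)+
  ultimately show ?thesis unfolding power_mult_distrib jw_def A_def by (simp add: algebra_simps)
 qed
 have big: "c0 / 2 * jw k + M <= (al k)\<^sup>2 + (be k)\<^sup>2" if "jw k >= R" for k
 proof -
  have "c0 * R <= c0 * jw k" using that c0 by simp
  then have "2 * (c0 + A + M) <= c0 * jw k" using c0 by (simp add: R_def)
  then show ?thesis using low[of k] by (simp add: algebra_simps)
 qed
 have ev: "\<exists>a\<ge>0. gamma_pq D e (fst k) (snd k) = \<i> * complex_of_real a"
  if "\<bar>e * (k0 D)\<^sup>2\<bar> <= M" "jw k >= R" for e k
 proof -
  have "0 < c0 / 2 * jw k" using c0 jw_ge_1[of k] by simp
  then have "e * (k0 D)\<^sup>2 < (al k)\<^sup>2 + (be k)\<^sup>2" using big[OF that(2)] that(1) by linarith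
  then show ?thesis unfolding gamma_pq_def by (intro exI[of _ "sqrt ((al k)\<^sup>2 + (be k)\<^sup>2 - e * (k0 D)\<^sup>2)"]) auto
 qed
 show ?thesis
 proof (rule that[of "c0 / 2" R])
  show "c0 / 2 > 0" using c0 by simp
  fix k assume R: "R <= jw k"
  show "c0 / 2 * jw k <= \<nu> k" using big[OF R] unfolding \<nu>_def M_def by (simp add: abs_le_iff)
  obtain a where "a >= 0" "gamma_pq D (eps_u D) (fst k) (snd k) = \<i> * complex_of_real a"
   using ev[OF _ R, of "eps_u D"] by (auto simp: M_def)
  then show "\<exists>a\<ge>0. bu k = - complex_of_real a" by (auto simp: mult.assoc[symmetric])
  obtain b where "b >= 0" "gamma_pq D (eps_w D) (fst k) (snd k) = \<i> * complex_of_real b"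
   using ev[OF _ R, of "eps_w D"] by (auto simp: M_def)
  then show "\<exists>b\<ge>0. bw k = complex_of_real b" by (auto simp: mult.assoc[symmetric])
 next
  have "{k. jw k < R} \<subseteq> {- \<lceil>R\<rceil>..\<lceil>R\<rceil>} \<times> {- \<lceil>R\<rceil>..\<lceil>R\<rceil>}"
  proof
   fix k assume "k \<in> {k. jw k < R}"
   then have k: "1 + (of_int (fst k))\<^sup>2 + (of_int (snd k))\<^sup>2 < R" by (simp add: jw_def)
   have b: "\<bar>n\<bar> <= \<lceil>R\<rceil>" if "(of_int n)\<^sup>2 <= R" for n :: int
   proof -
    have "\<bar>n\<bar> <= n\<^sup>2" by (metis abs_le_square_iff abs_of_nonneg power2_abs self_le_power abs_ge_zero int_one_le_iff_zero_less le_less power_zero_numeral zero_less_numeral)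
    then have "of_int \<bar>n\<bar> <= R" using that by (metis of_int_le_iff of_int_power order_trans)
    then show ?thesis by linarith
   qed
   have "\<bar>fst k\<bar> <= \<lceil>R\<rceil>" "\<bar>snd k\<bar> <= \<lceil>R\<rceil>"
    by (rule b; use k zero_le_power2[of "real_of_int (fst k)"] zero_le_power2[of "real_of_int (snd k)"] in linarith)+
   then show "k \<in> {- \<lceil>R\<rceil>..\<lceil>R\<rceil>} \<times> {- \<lceil>R\<rceil>..\<lceil>R\<rceil>}" by (cases k) (auto simp: abs_le_iff)
  qed
  then show "finite {k. jw k < R}" by (rule finite_subset) auto
 qed
qed

text \<open>\<open>y (-h) = 0\<close> expresses triviality: the left condition then gives
  \<open>y' (-h) = 0\<close> as well.\<close>

definition unique_modes :: bool where
 "unique_modes \<longleftrightarrow> (\<forall>k y y'. hsol (of_real (\<nu> k)) y y' --> y' h = bu k * y h --> y' (-h) = bw k * y (-h) --> y (-h) = 0)"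

definition bvp where
 "bvp k V V1 v2 g \<longleftrightarrow> AC h V V1 \<and> AC h V1 v2 \<and> L2 HM g \<and>
  (AE z in HM. v2 z = of_real (\<nu> k) * V z - g z) \<and> V1 h = bu k * V h \<and> V1 (-h) = bw k * V (-h)"

text \<open>\<open>jw\<close> is quadratic in the mode numbers and norms are squared, so the two
  lines say that \<open>V\<close> gains two lateral derivatives over \<open>g\<close> and
  \<open>V1\<close> gains one.\<close>

definition est where
 "est C k V V1 g \<longleftrightarrow> ennreal ((jw k)\<^sup>2) * sqn HM V <= ennreal C * sqn HM g \<and>
  ennreal (jw k) * sqn HM V1 <= ennreal C * sqn HM g"

text \<open>For large modes the energy estimate has the right powers of \<open>jw\<close>; for each
  of the finitely many others Green's bound suffices, with the powers absorbed in its
  constant.\<close>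

lemma mode_estimate:
 assumes u: unique_modes
 obtains C where "C >= 0" "!!k V V1 v2 g. bvp k V V1 v2 g ==> est C k V V1 g"
proof -
 have est_mono: "est C' k V V1 g" if "est C k V V1 g" "C <= C'" for C C' k V V1 g
 proof -
  have "ennreal C * sqn HM g <= ennreal C' * sqn HM g" using that(2) by (intro mult_right_mono ennreal_leI) auto
  then show ?thesis using that(1) unfolding est_def by (auto intro: order_trans)
 qed
 obtain c R where c: "c > 0" "!!k. jw k >= R ==> \<nu> k >= c * jw k"
  "!!k. jw k >= R ==> \<exists>a\<ge>0. bu k = - complex_of_real a" "!!k. jw k >= R ==> \<exists>b\<ge>0. bw k = complex_of_real b"
  "finite {k. jw k < R}" using mode_bounds by blast
 have large: "est (1 / c\<^sup>2 + 1 / c) k V V1 g" if k: "jw k >= R" and p: "bvp k V V1 v2 g" for k V V1 v2 g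
 proof -
  obtain a b where ab: "a >= 0" "bu k = - complex_of_real a" "b >= 0" "bw k = complex_of_real b" using c(3,4)[OF k] by blast
  have j: "jw k >= 1" "jw k > 0" using jw_ge_1[of k] by linarith+
  have \<nu>: "\<nu> k > 0" "c * jw k <= \<nu> k" using c(2)[OF k] mult_pos_pos[OF c(1) j(2)] by linarith+
  have e: "ennreal ((\<nu> k)\<^sup>2) * sqn HM V <= sqn HM g" "ennreal (\<nu> k) * sqn HM V1 <= sqn HM g"
   using bvp_energy[OF hgt, of V V1 v2 g "\<nu> k" a b] p ab \<nu> unfolding bvp_def by auto
  have "ennreal ((jw k)\<^sup>2) * sqn HM V <= ennreal (1 / c\<^sup>2 * (\<nu> k)\<^sup>2) * sqn HM V"
  proof (intro mult_right_mono ennreal_leI)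
   have "(c * jw k)\<^sup>2 <= (\<nu> k)\<^sup>2" using \<nu> c j by (intro power_mono) auto
   then show "(jw k)\<^sup>2 <= 1 / c\<^sup>2 * (\<nu> k)\<^sup>2" using c by (simp add: power_mult_distrib field_simps)
  qed simp
  also have "... = ennreal (1 / c\<^sup>2) * (ennreal ((\<nu> k)\<^sup>2) * sqn HM V)" by (subst ennreal_mult) (auto simp: mult.assoc)
  also have "... <= ennreal (1 / c\<^sup>2) * sqn HM g" by (intro mult_left_mono e) simp
  also have "... <= ennreal (1 / c\<^sup>2 + 1 / c) * sqn HM g" using c by (intro mult_right_mono ennreal_leI) auto
  finally have 1: "ennreal ((jw k)\<^sup>2) * sqn HM V <= ennreal (1 / c\<^sup>2 + 1 / c) * sqn HM g" .
  have "ennreal (jw k) * sqn HM V1 <= ennreal (1 / c * \<nu> k) * sqn HM V1"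
   using \<nu> c by (intro mult_right_mono ennreal_leI) (auto simp: field_simps)
  also have "... = ennreal (1 / c) * (ennreal (\<nu> k) * sqn HM V1)" using c \<nu> by (subst ennreal_mult) (auto simp: mult.assoc)
  also have "... <= ennreal (1 / c) * sqn HM g" by (intro mult_left_mono e) simp
  also have "... <= ennreal (1 / c\<^sup>2 + 1 / c) * sqn HM g" using c by (intro mult_right_mono ennreal_leI) auto
  finally show ?thesis using 1 by (simp add: est_def)
 qed
 have "\<exists>C\<ge>0. \<forall>V V1 v2 g. bvp k V V1 v2 g --> est C k V V1 g" for k
 proof -
  obtain C where C: "C >= 0" "!!V V1 v2 g. AC h V V1 ==> AC h V1 v2 ==> L2 HM g ==>
   AE z in HM. v2 z = of_real (\<nu> k) * V z - g z ==> V1 h = bu k * V h ==> V1 (-h) = bw k * V (-h) ==>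
   sqn HM V <= ennreal C * sqn HM g \<and> sqn HM V1 <= ennreal C * sqn HM g"
   using bvp_green[OF hgt, of "of_real (\<nu> k)" "bu k" "bw k"] u unfolding unique_modes_def by blast
  have j: "jw k >= 1" by (rule jw_ge_1)
  have "jw k ^ 1 <= jw k ^ 2" using j by (intro power_increasing) auto
  then have j2: "jw k <= (jw k)\<^sup>2" by simp
  show ?thesis
  proof (intro exI[of _ "(jw k)\<^sup>2 * C"] conjI allI impI)
   show "0 <= (jw k)\<^sup>2 * C" using C by simp
   fix V V1 v2 g assume "bvp k V V1 v2 g"
   then have s: "sqn HM V <= ennreal C * sqn HM g" "sqn HM V1 <= ennreal C * sqn HM g"
    using C(2)[of V V1 v2 g] unfolding bvp_def by auto
   have "ennreal ((jw k)\<^sup>2 * C) * sqn HM g = ennreal ((jw k)\<^sup>2) * (ennreal C * sqn HM g)"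
    using C by (subst ennreal_mult) (auto simp: mult.assoc)
   moreover have "ennreal ((jw k)\<^sup>2) * sqn HM V <= ennreal ((jw k)\<^sup>2) * (ennreal C * sqn HM g)"
    by (intro mult_left_mono s) simp
   moreover have "ennreal (jw k) * sqn HM V1 <= ennreal ((jw k)\<^sup>2) * (ennreal C * sqn HM g)"
    using j2 by (intro mult_mono s ennreal_leI) auto
   ultimately show "est ((jw k)\<^sup>2 * C) k V V1 g" by (simp add: est_def)
  qed
 qed
 then obtain Ck where Ck: "!!k. Ck k >= 0" "!!k V V1 v2 g. bvp k V V1 v2 g ==> est (Ck k) k V V1 g" by metis
 define C where "C = 1 / c\<^sup>2 + 1 / c + (\<Sum>k\<in>{k. jw k < R}. Ck k)"
 have "est C k V V1 g" if p: "bvp k V V1 v2 g" for k V V1 v2 g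
 proof (cases "jw k >= R")
  case True
  show ?thesis by (rule est_mono[OF large[OF True p]]) (simp add: C_def sum_nonneg Ck(1))
 next
  case False
  have "Ck k <= (\<Sum>k\<in>{k. jw k < R}. Ck k)" using False c(5) Ck(1) by (intro member_le_sum) auto
  then show ?thesis using c(1) by (intro est_mono[OF Ck(2)[OF p]]) (simp add: C_def add_increasing)
 qed
 moreover have "C >= 0" using c Ck(1) by (auto simp: C_def intro!: add_nonneg_nonneg sum_nonneg)
 ultimately show ?thesis using that[of C] by blast
qed

end

section \<open>Unique solvability of the modes\<close>

lemma integrable_compact_support:
 fixes f :: "'a::euclidean_space => 'b::{banach, second_countable_topology}"
 assumes c: "continuous_on UNIV f" and K: "compact K" "!!x. x \<notin> K ==> f x = 0"
 shows "integrable lborel f"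
proof -
 have "integrable lborel (%x. indicator K x *\<^sub>R f x)"
  using K(1) continuous_on_subset[OF c] by (intro borel_integrable_compact) auto
 moreover have "indicator K x *\<^sub>R f x = f x" for x using K(2) by (auto simp: indicator_def)
 ultimately show ?thesis by simp
qed

lemma lborel_translation:
 fixes f :: "'a::euclidean_space => 'b::{banach, second_countable_topology}"
 assumes f: "f \<in> borel_measurable borel"
 shows "(LINT x|lborel. f (x + c)) = (LINT x|lborel. f x)"
proof -
 have "(LINT x|lborel. f x) = (LINT x|distr lborel borel ((+) c). f x)" by (simp add: lborel_distr_plus)
 also have "... = (LINT x|lborel. f (c + x))" using f by (subst integral_distr) auto
 finally show ?thesis by (simp add: add.commute)
qed

lemma pd_along:
 fixes g :: "'a::euclidean_space => 'b::real_normed_vector"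
 assumes g: "smooth g"
 shows "((%s. g (x + s *\<^sub>R d)) has_vector_derivative pd d g (x + s *\<^sub>R d)) (at s)"
proof -
 have "((%s. x + s *\<^sub>R d) has_derivative (%t. t *\<^sub>R d)) (at s)" by (auto intro!: derivative_eq_intros)
 from has_derivative_compose[OF this smoothD(1)[OF g]]
 have "((%s. g (x + s *\<^sub>R d)) has_derivative (%t. frechet_derivative g (at (x + s *\<^sub>R d)) (t *\<^sub>R d))) (at s)" .
 moreover have "frechet_derivative g (at y) (t *\<^sub>R d) = t *\<^sub>R pd d g y" for t y
  using has_derivative_linear[OF smoothD(1)[OF g, of y]] by (simp add: pd_def linear_cmul)
 ultimately show ?thesis by (simp add: has_vector_derivative_def)
qed

lemma test_pd:
 assumes t: "test_function U g" and d: "d \<in> Basis" shows "test_function U (pd d g)"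
proof -
 obtain K where K: "compact K" "K \<subseteq> U" "!!x. x \<notin> K ==> g x = 0" and s: "smooth g"
  using t by (auto simp: test_function_iff)
 have "pd d g x = 0" if "x \<notin> K" for x
  using deriv_zero_outside[OF smoothD(1)[OF s] compact_imp_closed[OF K(1)] K(3) that] by (simp add: pd_def)
 then show ?thesis using K(1,2) smooth_pd[OF s d] by (auto simp: test_function_iff)
qed

text \<open>Difference quotients have integral 0 by translation invariance, and they converge to the
  partial derivative under a common integrable bound.\<close>

lemma test_integral_pd:
 fixes g :: "'a::euclidean_space => complex"
 assumes t: "test_function U g" and d: "d \<in> Basis"
 shows "integrable lborel (pd d g)" "(LINT x|lborel. pd d g x) = 0"
proof -
 obtain K where K: "compact K" "!!x. x \<notin> K ==> g x = 0" and s: "smooth g"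
  using t by (auto simp: test_function_iff)
 have td: "test_function U (pd d g)" by (rule test_pd[OF t d])
 obtain K' where K': "compact K'" "!!x. x \<notin> K' ==> pd d g x = 0" using td by (auto simp: test_function_iff)
 show "integrable lborel (pd d g)" by (rule integrable_compact_support[OF test_continuous[OF td] K'])
 obtain B where B: "!!x. norm (pd d g x) <= B" using test_bounded[OF td] by metis
 obtain r where r: "!!x. x \<in> K ==> norm x <= r" using compact_imp_bounded[OF K(1)] by (auto simp: bounded_iff)
 define q where "q n x = real (Suc n) *\<^sub>R (g (x + (1 / real (Suc n)) *\<^sub>R d) - g x)" for n x
 have gi: "integrable lborel g" by (rule integrable_compact_support[OF test_continuous[OF t] K])
 have gm: "g \<in> borel_measurable borel" by (rule test_measurable[OF t])
 have ti: "integrable lborel (%x. g (x + c))" for c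
 proof -
  have "integrable (distr lborel borel ((+) c)) g" using gi by (simp add: lborel_distr_plus)
  then have "integrable lborel (%x. g (c + x))" by (subst (asm) integrable_distr_eq) (use gm in auto)
  then show ?thesis by (simp add: add.commute)
 qed
 have q0: "(LINT x|lborel. q n x) = 0" for n
  unfolding q_def using ti gi by (simp add: lborel_translation[OF gm])
 have "(%n. LINT x|lborel. q n x) \<longlonglongrightarrow> (LINT x|lborel. pd d g x)"
 proof (rule integral_dominated_convergence)
  show "pd d g \<in> borel_measurable lborel" using test_measurable[OF td] by simp
  show "q n \<in> borel_measurable lborel" for n unfolding q_def using ti[of "(1 / real (Suc n)) *\<^sub>R d"] gi by auto
  \<comment> \<open>Increments are at most 1, so all difference quotients vanish outside the ball of
    radius \<open>r + 1\<close>; inside it the mean value inequality bounds them by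
    \<open>B\<close>.\<close>
  show "integrable lborel (%x::'a. B * indicator (cball 0 (r + 1)) x :: real)"
   using emeasure_lborel_cball_finite[of "0 :: 'a" "r + 1"] by (intro integrable_mult_right integrable_real_indicator) simp_all
  show "AE x in lborel. (%n. q n x) \<longlonglongrightarrow> pd d g x"
  proof (rule AE_I2)
   fix x
   have "((%s. g (x + s *\<^sub>R d)) has_vector_derivative pd d g x) (at 0)"
    using pd_along[OF s, of x d 0] by simp
   then have "((%s. norm (g (x + s *\<^sub>R d) - g x - s *\<^sub>R pd d g x) / norm s) \<longlongrightarrow> 0) (at 0)"
    by (simp add: has_vector_derivative_def has_derivative_at)
   then have "((%s. norm ((g (x + s *\<^sub>R d) - g x) /\<^sub>R s - pd d g x)) \<longlongrightarrow> 0) (at 0)"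
   proof (rule Lim_transform_eventually)
    have "norm (v - s *\<^sub>R w) / norm s = norm (v /\<^sub>R s - w)" if "s \<noteq> 0" for s :: real and v w :: complex
    proof -
     have "v /\<^sub>R s - w = (v - s *\<^sub>R w) /\<^sub>R s" using that by (simp add: scaleR_diff_right)
     then show ?thesis by (simp add: divide_inverse mult.commute)
    qed
    then show "\<forall>\<^sub>F s in at 0. norm (g (x + s *\<^sub>R d) - g x - s *\<^sub>R pd d g x) / norm s = norm ((g (x + s *\<^sub>R d) - g x) /\<^sub>R s - pd d g x)"
     by (auto simp: eventually_at_filter)
   qed
   then have "((%s. (g (x + s *\<^sub>R d) - g x) /\<^sub>R s) \<longlongrightarrow> pd d g x) (at 0)"
    by (subst (asm) tendsto_norm_zero_iff) (rule LIM_zero_cancel)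
   moreover have "filterlim (%n. 1 / real (Suc n)) (at 0) sequentially"
    using LIMSEQ_inverse_real_of_nat by (auto simp: filterlim_at inverse_eq_divide)
   ultimately have "(%n. (g (x + (1 / real (Suc n)) *\<^sub>R d) - g x) /\<^sub>R (1 / real (Suc n))) \<longlonglongrightarrow> pd d g x"
    by (rule filterlim_compose)
   then show "(%n. q n x) \<longlonglongrightarrow> pd d g x" unfolding q_def by simp
  qed
  show "AE x in lborel. norm (q n x) <= B * indicator (cball 0 (r + 1)) x" for n
  proof (rule AE_I2)
   fix x
   define \<tau> where "\<tau> = 1 / real (Suc n)"
   have \<tau>: "0 < \<tau>" "\<tau> <= 1" by (auto simp: \<tau>_def)
   show "norm (q n x) <= B * indicator (cball 0 (r + 1)) x"
   proof (cases "x \<in> cball 0 (r + 1)")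
    case True
    have "norm (g (x + \<tau> *\<^sub>R d) - g (x + 0 *\<^sub>R d)) <= B * norm (\<tau> - 0)"
     by (rule differentiable_bound[of UNIV "%s. g (x + s *\<^sub>R d)" "%s t. t *\<^sub>R pd d g (x + s *\<^sub>R d)"])
       (use pd_along[OF s, of x d] B in \<open>auto simp: has_vector_derivative_def intro!: onorm_le simp: mult.commute[of B] mult_left_mono\<close>)
    then have "norm (g (x + \<tau> *\<^sub>R d) - g x) <= B * \<tau>" using \<tau> by simp
    then have "real (Suc n) * norm (g (x + \<tau> *\<^sub>R d) - g x) <= real (Suc n) * (B * \<tau>)" by (intro mult_left_mono) auto
    also have "... = B" by (simp add: \<tau>_def)
    finally show ?thesis using True unfolding q_def \<tau>_def by simp
   next
    case False
    then have "norm x > r + 1" by simp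
    moreover have "norm x <= norm (x + \<tau> *\<^sub>R d) + norm (\<tau> *\<^sub>R d)" by (metis add_diff_cancel_right' norm_triangle_ineq4)
    moreover have "norm (\<tau> *\<^sub>R d) <= 1" using \<tau> d by simp
    ultimately have "g x = 0" "g (x + \<tau> *\<^sub>R d) = 0" using r K(2) by (meson add_increasing2 not_le zero_le_one order.strict_trans2 le_less_trans, smt (verit) r K(2))
    then show ?thesis using False unfolding q_def \<tau>_def by simp
   qed
  qed
 qed
 then show "(LINT x|lborel. pd d g x) = 0" unfolding q0 by (simp add: LIMSEQ_const_iff)
qed

lemma pd_mult:
 fixes f g :: "'a::euclidean_space => complex"
 assumes "smooth f" "smooth g"
 shows "pd d (%x. f x * g x) x = pd d f x * g x + f x * pd d g x"
proof -
 have "((%x. f x * g x) has_derivative (%t. f x * frechet_derivative g (at x) t + frechet_derivative f (at x) t * g x)) (at x)"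
  by (rule has_derivative_mult[OF smoothD(1)[OF assms(1)] smoothD(1)[OF assms(2)]])
 from frechet_derivative_at[OF this] show ?thesis unfolding pd_def by (metis add.commute)
qed

lemma pd_cmult:
 fixes f :: "'a::euclidean_space => complex"
 assumes "smooth f" shows "pd d (%x. c * f x) = (%x. c * pd d f x)"
proof
 fix x show "pd d (%x. c * f x) x = c * pd d f x"
  using pd_mult[OF smooth_const assms, of d c x] by (simp add: pd_def)
qed

lemma curl_vector3:
 assumes "smooth f" "smooth g" "smooth e"
 shows "curl (%x. vector [f x, g x, e x]) = (%x. vector [pd (0,1,0) e x - pd (0,0,1) g x, pd (0,0,1) f x - pd (1,0,0) e x, pd (1,0,0) g x - pd (0,1,0) f x])"
proof
 fix x
 have "smooth (%x. vector [f x, g x, e x] :: complex^3)"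
 proof (rule smooth_vec)
  fix i :: 3 show "smooth (%x. (vector [f x, g x, e x] :: complex^3) $ i)" using exhaust_3[of i] assms by auto
 qed
 from curl_alt[OF smooth_differentiable[OF this]]
 show "curl (%x. vector [f x, g x, e x]) x = vector [pd (0,1,0) e x - pd (0,0,1) g x, pd (0,0,1) f x - pd (1,0,0) e x, pd (1,0,0) g x - pd (0,1,0) f x]"
  by simp
qed

section \<open>From vector uniqueness to scalar uniqueness\<close>

context grid
begin

lemma set_integrable_cont:
 fixes f :: "space => 'b::{banach, second_countable_topology}"
 assumes "continuous_on UNIV f"
 shows "set_integrable lborel (S_v D) f"
proof (rule set_integrable_subset)
 show "set_integrable lborel ({0..dx} \<times> {0..dy} \<times> {-h..h}) f" unfolding set_integrable_def
  by (rule borel_integrable_compact) (auto intro!: compact_Times continuous_on_subset[OF assms])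
 show "S_v D \<in> sets lborel" using S_v_borel by simp
 show "S_v D \<subseteq> {0..dx} \<times> {0..dy} \<times> {-h..h}" by (auto simp: S_v_def)
qed

text \<open>The difference of the two integrands is a signed sum of partial derivatives of compactly
  supported products, each of which integrates to 0.\<close>

lemma weak_curl_smooth:
 assumes V: "smooth V" shows "weak_curl (S_v D) V (curl V)"
 unfolding weak_curl_def
proof (intro conjI allI impI)
 show "set_integrable lborel (S_v D) V" "set_integrable lborel (S_v D) (curl V)"
  using smoothD(3)[OF V] smoothD(3)[OF smooth_curl[OF V]] by (auto intro: set_integrable_cont)
 fix Ps :: "space => complex^3" assume t: "test_function (S_v D) Ps"
 have tc: "test_function (S_v D) (curl Ps)" by (rule test_curl[OF t])
 have ind: "set_lebesgue_integral lborel (S_v D) (%x. cdot (X x) (\<Phi> x)) = (LINT x|lborel. cdot (X x) (\<Phi> x))"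
  and int: "continuous_on UNIV X ==> integrable lborel (%x. cdot (X x) (\<Phi> x))"
  if p: "test_function (S_v D) \<Phi>" for X \<Phi> :: "space => complex^3"
 proof -
  obtain K where K: "compact K" "K \<subseteq> S_v D" "!!x. x \<notin> K ==> \<Phi> x = 0" using p by (auto simp: test_function_iff)
  have "indicator (S_v D) x *\<^sub>R cdot (X x) (\<Phi> x) = cdot (X x) (\<Phi> x)" for x
  proof -
   have "x \<in> S_v D \<or> \<Phi> x = 0" using K(2,3) by blast
   then show ?thesis by (auto simp: cdot_def)
  qed
  then show "set_lebesgue_integral lborel (S_v D) (%x. cdot (X x) (\<Phi> x)) = (LINT x|lborel. cdot (X x) (\<Phi> x))"
   by (simp add: set_lebesgue_integral_def)
  assume "continuous_on UNIV X"
  then show "integrable lborel (%x. cdot (X x) (\<Phi> x))" using K(3) test_continuous[OF p]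
   by (intro integrable_compact_support[OF _ K(1)]) (auto simp: cdot_def intro!: continuous_intros)
 qed
 have sV: "smooth (%x. V x $ i)" for i by (rule smooth_nth[OF V])
 have sP: "smooth Ps" "smooth (%x. Ps x $ i)" for i using t smooth_nth by (auto simp: test_function_iff)
 have tt: "test_function (S_v D) (%x. V x $ i * Ps x $ j)" for i j
 proof -
  obtain K where K: "compact K" "K \<subseteq> S_v D" "!!x. x \<notin> K ==> Ps x = 0" using t by (auto simp: test_function_iff)
  then show ?thesis using smooth_mult[OF sV sP(2)] by (auto simp: test_function_iff intro!: exI[of _ K])
 qed
 define Q where "Q d i j = pd d (%x. V x $ i * Ps x $ j)" for d i j
 have Q: "integrable lborel (Q d i j)" "(LINT x|lborel. Q d i j x) = 0" if "d \<in> Basis" for d i j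
  unfolding Q_def by (rule test_integral_pd[OF tt that])+
 note B = space_Basis
 have id: "cdot (curl V x) (Ps x) - cdot (V x) (curl Ps x) =
   Q (0,1,0) 3 1 x - Q (0,0,1) 2 1 x + Q (0,0,1) 1 2 x - Q (1,0,0) 3 2 x + Q (1,0,0) 2 3 x - Q (0,1,0) 1 3 x" for x
  unfolding Q_def pd_mult[OF sV sP(2)] curl_alt[OF smooth_differentiable[OF V]] curl_alt[OF smooth_differentiable[OF sP(1)]] cdot_3 vector_3
  by (simp add: algebra_simps)
 have "(LINT x|lborel. cdot (curl V x) (Ps x)) - (LINT x|lborel. cdot (V x) (curl Ps x)) =
   (LINT x|lborel. cdot (curl V x) (Ps x) - cdot (V x) (curl Ps x))"
  using int[OF t smoothD(3)[OF smooth_curl[OF V]]] int[OF tc smoothD(3)[OF V]] by simp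
 also have "... = 0" unfolding id using Q B by simp
 finally show "set_lebesgue_integral lborel (S_v D) (%x. cdot (curl V x) (Ps x)) = set_lebesgue_integral lborel (S_v D) (%x. cdot (V x) (curl Ps x))"
  unfolding ind[OF t] ind[OF tc] by simp
qed

lemma NN_single:
 assumes "f \<in> borel_measurable HM"
 shows "NN n (%l z. if l = k then f z else 0) = ennreal (jw k ^ n) * sqn HM f"
proof -
 have m: "mmeas (%l z. if l = k then f z else 0)" using assms by (auto intro!: mmeasI)
 have "NN n (%l z. if l = k then f z else 0) = (\<integral>\<^sup>+ l. (ennreal (jw k ^ n) * sqn HM f) * indicator {k} l \<partial>modes)"
  unfolding NN_swap[OF m] by (intro nn_integral_cong) (auto simp: indicator_def sqn_def)
 also have "... = ennreal (jw k ^ n) * sqn HM f" by (subst nn_integral_cmult_indicator) auto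
 finally show ?thesis .
qed

text \<open>A scalar homogeneous solution \<open>y\<close> in mode \<open>k\<close> becomes the
  field \<open>S x *s c\<close>, a lateral exponential times \<open>y\<close>. It solves the
  homogeneous vector problem, so \<open>P_set\<close> makes it vanish, and with it
  \<open>y\<close>.\<close>

lemma unique_modes_P:
 assumes P: "(freq D, eps_bar D) \<in> P_set D"
 shows unique_modes
 unfolding unique_modes_def
proof (intro allI impI)
 fix k y y' assume y: "hsol (of_real (\<nu> k)) y y'" and bc: "y' h = bu k * y h" "y' (-h) = bw k * y (-h)"
 \<comment> \<open>A horizontal polarisation orthogonal to the lateral wave vector makes the field
   divergence free, so \<open>curl curl\<close> acts as minus the Laplacian. For wave vector 0 any
   horizontal vector is orthogonal.\<close>
 define c :: "complex^3" where "c = (if al k = 0 \<and> be k = 0 then vector [1, 0, 0] else vector [of_real (be k), - of_real (al k), 0])"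
 obtain i0 where i0: "c $ i0 \<noteq> 0"
 proof (cases "be k = 0")
  case True
  then show ?thesis using that[of 1] that[of 2] by (cases "al k = 0") (simp_all add: c_def)
 qed (use that[of 1] in \<open>auto simp: c_def\<close>)
 have c3: "c $ 3 = 0" and cd: "of_real (al k) * c $ 1 + of_real (be k) * c $ 2 = 0" by (auto simp: c_def)
 define a where "a x = exp (complex_of_real x * (\<i> * of_real (al k)))" for x
 define b where "b x = exp (complex_of_real x * (\<i> * of_real (be k)))" for x
 have sm: "smooth a" "smooth b" "smooth y" "smooth y'" using smooth_exp hsol_smooth[OF y] by (auto simp: a_def[abs_def] b_def[abs_def])
 have exp_vd: "vd (%x. exp (complex_of_real x * e)) = (%x. e * exp (complex_of_real x * e))" for e
 proof
  fix x have "((%x. exp (complex_of_real x * e)) has_vector_derivative e * exp (complex_of_real x * e)) (at x)"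
   by (auto intro!: derivative_eq_intros has_vector_derivative_real_field simp: mult.commute)
  then show "vd (%x. exp (complex_of_real x * e)) x = e * exp (complex_of_real x * e)" by (simp add: vd_def vector_derivative_at)
 qed
 have vd: "vd a = (%x. \<i> * of_real (al k) * a x)" "vd b = (%x. \<i> * of_real (be k) * b x)" "vd y = y'" "vd y' = (%z. of_real (\<nu> k) * y z)"
  using y unfolding a_def b_def exp_vd by (auto simp: vd_def[abs_def] hsol_def intro!: vector_derivative_at)
 define S S' where "S = sep a b y" and "S' = sep a b y'"
 have sS: "smooth S" "smooth S'" unfolding S_def S'_def by (intro smooth_sep sm)+
 have pdS: "pd (1,0,0) S = (%x. \<i> * of_real (al k) * S x)" "pd (0,1,0) S = (%x. \<i> * of_real (be k) * S x)" "pd (0,0,1) S = S'"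
  "pd (1,0,0) S' = (%x. \<i> * of_real (al k) * S' x)" "pd (0,1,0) S' = (%x. \<i> * of_real (be k) * S' x)" "pd (0,0,1) S' = (%x. of_real (\<nu> k) * S x)"
  unfolding S_def S'_def pd_sep[OF sm(1,2,3)] pd_sep[OF sm(1,2,4)] vd by (auto simp: sep_def)
 define V where "V x = S x *s c" for x
 define e where "e = \<i> * of_real (al k) * c $ 2 - \<i> * of_real (be k) * c $ 1"
 have V_vec: "V = (%x. vector [c $ 1 * S x, c $ 2 * S x, 0 * S x])"
  by (auto simp: V_def vec_eq_iff forall_3 c3 fun_eq_iff)
 have cV: "curl V = (%x. vector [(- c $ 2) * S' x, c $ 1 * S' x, e * S x])"
 proof -
  have "curl V = (%x. vector [0 * (\<i> * of_real (be k) * S x) - c $ 2 * S' x, c $ 1 * S' x - 0 * (\<i> * of_real (al k) * S x),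
    c $ 2 * (\<i> * of_real (al k) * S x) - c $ 1 * (\<i> * of_real (be k) * S x)])"
   unfolding V_vec by (subst curl_vector3; (intro smooth_mult smooth_const sS)?) (simp only: pd_cmult[OF sS(1)] pdS)
  also have "... = (%x. vector [(- c $ 2) * S' x, c $ 1 * S' x, e * S x])"
   by (rule ext) (simp add: e_def algebra_simps)
  finally show ?thesis .
 qed
 have ccV: "curl (curl V) = (%x. of_real kk *s V x)"
 proof
  fix x
  have "curl (curl V) x = vector [e * (\<i> * of_real (be k) * S x) - c $ 1 * (of_real (\<nu> k) * S x),
    (- c $ 2) * (of_real (\<nu> k) * S x) - e * (\<i> * of_real (al k) * S x), c $ 1 * (\<i> * of_real (al k) * S' x) - (- c $ 2) * (\<i> * of_real (be k) * S' x)]"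
   unfolding cV by (subst curl_vector3; (intro smooth_mult smooth_const sS)?)
    (simp only: pd_cmult[OF sS(1)] pd_cmult[OF sS(2)] pdS)
  also have "... = of_real kk *s V x"
  proof -
   have 1: "e * (\<i> * of_real (be k)) - c $ 1 * of_real (\<nu> k) = of_real kk * c $ 1"
   proof -
    have "e * (\<i> * of_real (be k)) - c $ 1 * of_real (\<nu> k) - of_real kk * c $ 1 = - of_real (al k) * (of_real (al k) * c $ 1 + of_real (be k) * c $ 2)"
     unfolding e_def \<nu>_def by (simp add: algebra_simps power2_eq_square)
    then show ?thesis unfolding cd by simp
   qed
   have 2: "(- c $ 2) * of_real (\<nu> k) - e * (\<i> * of_real (al k)) = of_real kk * c $ 2"
   proof -
    have "(- c $ 2) * of_real (\<nu> k) - e * (\<i> * of_real (al k)) - of_real kk * c $ 2 = - of_real (be k) * (of_real (al k) * c $ 1 + of_real (be k) * c $ 2)"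
     unfolding e_def \<nu>_def by (simp add: algebra_simps power2_eq_square)
    then show ?thesis unfolding cd by simp
   qed
   have 3: "c $ 1 * (\<i> * of_real (al k) * S' x) - (- c $ 2) * (\<i> * of_real (be k) * S' x) = 0"
   proof -
    have "c $ 1 * (\<i> * of_real (al k) * S' x) - (- c $ 2) * (\<i> * of_real (be k) * S' x) = \<i> * S' x * (of_real (al k) * c $ 1 + of_real (be k) * c $ 2)"
     by (simp add: algebra_simps)
    then show ?thesis unfolding cd by simp
   qed
   have "e * (\<i> * of_real (be k) * S x) - c $ 1 * (of_real (\<nu> k) * S x) = of_real kk * c $ 1 * S x"
    unfolding 1[symmetric] by (simp add: algebra_simps)
   moreover have "(- c $ 2) * (of_real (\<nu> k) * S x) - e * (\<i> * of_real (al k) * S x) = of_real kk * c $ 2 * S x"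
    unfolding 2[symmetric] by (simp add: algebra_simps)
   ultimately show ?thesis unfolding 3 by (simp add: vec_eq_iff forall_3 V_def c3)
  qed
  finally show "curl (curl V) x = of_real kk *s V x" .
 qed
 have sV: "smooth V"
 proof (rule smooth_vec)
  fix i show "smooth (%x. V x $ i)" using smooth_mult[OF sS(1) smooth_const[of "c $ i"]] by (simp add: V_def)
 qed
 have L0: "L0_eq D V (%_. 0)" unfolding L0_eq_def
 proof (intro exI[of _ "curl V"] conjI)
  show "weak_curl (S_v D) V (curl V)" by (rule weak_curl_smooth[OF sV])
  show "weak_curl (S_v D) (curl V) (%x. 0 + of_real ((k0 D)\<^sup>2 * eps_bar D) *s V x)"
   using weak_curl_smooth[OF smooth_curl[OF sV]] unfolding ccV by simp
 qed
 have S_ex: "S (x, y0, z) = ex k (x, y0) * y z" for x y0 z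
  by (simp add: S_def sep_def a_def b_def ex_def exp_add[symmetric] algebra_simps)
 have basic: "basic V" unfolding basic_def
 proof (intro conjI)
  have per: "exp (\<i> * of_real (al k * dx)) = exp (\<i> * of_real (alpha D * dx))" "exp (\<i> * of_real (be k * dy)) = exp (\<i> * of_real (beta D * dy))"
   using exp_int_period[OF per_x, of "fst k"] exp_int_period[OF per_y, of "snd k"]
   by (simp_all add: alpha_p_def beta_q_def distrib_right distrib_left exp_add)
  have "ex k (x + dx, y0) = exp (\<i> * of_real (alpha D * dx)) * ex k (x, y0)" "ex k (x, y0 + dy) = exp (\<i> * of_real (beta D * dy)) * ex k (x, y0)" for x y0
   unfolding per[symmetric] by (simp_all add: ex_def exp_add[symmetric] algebra_simps)
  then show "quasiperiodic D V" by (simp add: quasiperiodic_def V_def S_ex vector_smult_assoc mult.assoc)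
  have "V \<in> borel_measurable borel" using smoothD(3)[OF sV] by (rule borel_measurable_continuous_onI)
  then show "set_borel_measurable lborel (slab D) V" unfolding set_borel_measurable_def
   by (intro borel_measurable_scaleR borel_measurable_indicator) (use borel_open[OF open_slab] in auto)
  show "set_integrable lborel (S_v D) (%x. (norm (V x))\<^sup>2)"
   by (rule set_integrable_cont) (intro continuous_intros smoothD(3)[OF sV])
 qed
 \<comment> \<open>The third entry is the second derivative of \<open>y\<close>, by the
   equation.\<close>
 define yy where "yy j = (if j = 0 then y else if j = 1 then y' else (%z. of_real (\<nu> k) * y z))" for j :: nat
 have yy_wd: "wd h (yy 0) (yy 1)" "wd h (yy 1) (yy 2)" using AC_imp_wd[OF hsol_AC(1)[OF y hgt] hgt] AC_imp_wd[OF hsol_AC(2)[OF y hgt] hgt] by (auto simp: yy_def)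
 have cont: "continuous_on T y" "continuous_on T y'" for T using sm by (auto intro: smoothD(3))
 have yy_cont: "continuous_on T (yy j)" for j T using cont by (auto simp: yy_def intro!: continuous_intros)
 have yy_m: "yy j \<in> borel_measurable HM" for j by (intro measurable_IM_borel borel_measurable_continuous_onI yy_cont)
 define W where "W i j l z = (if l = k then c $ i * yy j z else 0)" for i j l z
 have hatV: "fc (slice (%x. V x $ i) z) l = W i 0 l z" "L2 GM (slice (%x. V x $ i) z)" for i z l
 proof -
  have e: "slice (%x. V x $ i) z = (%p. (c $ i * y z) * ex k p)" by (auto simp: slice_def V_def S_ex)
  show "fc (slice (%x. V x $ i) z) l = W i 0 l z" unfolding e fc_cmult fc_ex by (auto simp: W_def yy_def)
  show "L2 GM (slice (%x. V x $ i) z)" unfolding e by (intro L2_cmult L2_ex)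
 qed
 have hat: "hat D V (fst l) (snd l) z $ i = W i 0 l z" for l z i using hat_fc[OF hatV(2)] hatV(1) by simp
 have sq_fin: "sqn HM (%z. c $ i * yy j z) < \<infinity>" for i j
 proof -
  have "bounded ((%z. c $ i * yy j z) ` {-h..h})"
   by (intro compact_imp_bounded compact_continuous_image continuous_intros yy_cont) auto
  then obtain M where "\<forall>z\<in>{-h..h}. norm (c $ i * yy j z) <= M" unfolding bounded_iff by blast
  then have "L2 HM (%z. c $ i * yy j z)" using yy_m by (intro IM.L2_bounded[where B = M]) auto
  then show ?thesis by (simp add: L2_sqn)
 qed
 have rep: "rep 2 V W" unfolding rep_def
 proof (intro allI conjI)
  fix i
  show "jet 2 (W i)" unfolding jet_def
  proof (intro conjI allI impI)
   show "mmeas (W i j)" for j unfolding W_def by (intro mmeasI) (use yy_m in auto)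
   fix j l assume "j < (2::nat)"
   then have "j = 0 \<or> j = 1" by auto
   then have "wd h (yy j) (yy (Suc j))" using yy_wd by (auto simp: numeral_2_eq_2)
   then have "wd h (%z. c $ i * yy j z) (%z. c $ i * yy (Suc j) z)" by (rule wd_cmult)
   moreover have "wd h (%z. 0) (%z. 0)" by (rule AC_imp_wd[OF AC_const hgt])
   ultimately show "wd h (W i j l) (W i (Suc j) l)" unfolding W_def by (cases "l = k") auto
  qed
  show "Nj 2 (W i) < \<infinity>" unfolding Nj_def W_def using yy_m sq_fin
   by (subst NN_single) (auto simp: less_top[symmetric] ennreal_mult_eq_top_iff NN_single)
  show "AE z in HM. W i 0 l z = hat D V (fst l) (snd l) z $ i" for l by (simp add: hat)
 qed
 have trV: "tr D V x p q $ i = W i 0 (p, q) x" "tr_dz D V x p q $ i = W i 1 (p, q) x" if x: "x \<in> {-h..h}" for x p q i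
 proof -
  show "tr D V x p q $ i = W i 0 (p, q) x" unfolding tr_def
  proof (rule trace_at_eq[OF hgt _ _ x])
   show "continuous_on {-h..h} (W i 0 (p, q))" for i unfolding W_def by (cases "(p, q) = k") (auto intro!: continuous_intros yy_cont)
   show "AE z in HM. W i 0 (p, q) z = hat D V p q z $ i" for i using hat[of "(p, q)"] by simp
  qed
  show "tr_dz D V x p q $ i = W i 1 (p, q) x" unfolding tr_dz_def
  proof (rule trace_at_eq[OF hgt _ _ x])
   show "continuous_on {-h..h} (W i 1 (p, q))" for i unfolding W_def by (cases "(p, q) = k") (auto intro!: continuous_intros yy_cont)
   have "AE z in HM. wderiv h 1 (hat D V p q) z = (\<chi> i. W i 1 (p, q) z)"
    by (rule wderiv_AE[OF rep_wderiv[OF basic rep]]) simp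
   then show "AE z in HM. W i 1 (p, q) z = wderiv h 1 (hat D V p q) z $ i" for i by eventually_elim simp
  qed
 qed
 have f0: "fcoeff D (%_. 0) p q = 0" for p q unfolding fcoeff_def set_lebesgue_integral_def by (simp add: case_prod_beta)
 have "solves D (%_. 0) (%_. 0) V" unfolding solves_def
 proof (intro conjI allI L0)
  show "V \<in> Hspace D 2" by (rule rep_Hspace[OF basic rep])
  have e: "h \<in> {-h..h}" "-h \<in> {-h..h}" using hgt by auto
  fix p q
  show "- tr_dz D V h p q - T_u D (tr D V h) p q = fcoeff D (%_. 0) p q" unfolding f0
   using bc(1) by (auto simp: vec_eq_iff T_u_def trV[OF e(1)] W_def yy_def)
  show "tr_dz D V (- h) p q - T_w D (tr D V (- h)) p q = 0"
   using bc(2) by (auto simp: vec_eq_iff T_w_def trV[OF e(2)] W_def yy_def)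
 qed
 moreover have "D\<lparr>freq := freq D, eps_bar := eps_bar D\<rparr> = D" by simp
 ultimately have "AE x in lborel. x \<in> S_v D --> V x = 0" using P by (auto simp: P_set_def Let_def)
 then have "AE x in SM. V x = 0" using S_v_borel by (subst AE_restrict_space_iff) auto
 then have "AE x in SM. V x $ i0 = 0" by eventually_elim simp
 then have "sqn SM (%x. V x $ i0) = sqn SM (%x. 0)" by (rule sqn_cong_AE)
 then have "sqn SM (%x. V x $ i0) = 0" by (simp add: sqn_def)
 \<comment> \<open>Parseval reduces the vanishing field to its single coefficient; a component with
   \<open>c $ i0 \<noteq> 0\<close> then exposes \<open>y\<close>.\<close>
 then have "NN 0 (%l z. W i0 0 l z) = 0" using parseval_SM[OF basic_L2[OF basic, of i0]] area unfolding hatV(1) by simp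
 then have "sqn HM (%z. c $ i0 * yy 0 z) = 0" unfolding W_def using NN_single[of "%z. c $ i0 * yy 0 z" 0 k] yy_m by simp
 then have "AE z in HM. y z = 0" using yy_m[of 0] i0 unfolding sqn_def
  by (subst (asm) nn_integral_0_iff_AE) (auto simp: yy_def)
 then show "y (-h) = 0" using hgt by (intro continuous_AE_eq[OF hgt cont(1) continuous_on_const]) auto
qed

end

section \<open>Regularity of solutions\<close>

lemma wd_diff: "wd h f f' ==> wd h g g' ==> wd h (%z. f z - g z) (%z. f' z - g' z)"
 using wd_add[of h f f' "%z. - 1 * g z" "%z. - 1 * g' z"] wd_cmult[of h g g' "- 1"] by simp

context grid
begin

lemma NN_coeff:
 assumes v: "mmeas v" and C: "C >= 0" and c: "!!k. (norm (c k))\<^sup>2 <= C * jw k ^ d"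
 shows "NN n (%k z. c k * v k z) <= ennreal C * NN (n + d) v"
proof -
 have j: "jw k >= 0" for k using jw_ge_1[of k] by simp
 have "NN n (%k z. c k * v k z) = (\<integral>\<^sup>+ k. ennreal (jw k ^ n) * (ennreal ((norm (c k))\<^sup>2) * sqn HM (v k)) \<partial>modes)"
  unfolding NN_swap[OF mmeas_mult[OF v]] by (intro nn_integral_cong) (simp add: sqn_cmult[OF mmeasD[OF v]])
 also have "... <= (\<integral>\<^sup>+ k. ennreal C * (ennreal (jw k ^ (n + d)) * sqn HM (v k)) \<partial>modes)"
 proof (intro nn_integral_mono)
  fix k
  have "ennreal (jw k ^ n) * ennreal ((norm (c k))\<^sup>2) <= ennreal (jw k ^ n) * ennreal (C * jw k ^ d)"
   by (intro mult_left_mono ennreal_leI c) simp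
  also have "... = ennreal C * ennreal (jw k ^ (n + d))"
   using j C by (simp add: ennreal_mult[symmetric] power_add mult.left_commute)
  finally show "ennreal (jw k ^ n) * (ennreal ((norm (c k))\<^sup>2) * sqn HM (v k)) <= ennreal C * (ennreal (jw k ^ (n + d)) * sqn HM (v k))"
   unfolding mult.assoc[symmetric] by (rule mult_right_mono) simp
 qed
 also have "... = ennreal C * NN (n + d) v" unfolding NN_swap[OF v] by (subst nn_integral_cmult) auto
 finally show ?thesis .
qed

lemma Nj_coeff:
 assumes v: "!!j. j <= m ==> mmeas (w j)" and C: "C >= 0" and c: "!!k. (norm (c k))\<^sup>2 <= C * jw k ^ d"
 shows "Nj m (%j k z. c k * w j k z) <= ennreal C * Nj (m + d) w"
proof -
 have "Nj m (%j k z. c k * w j k z) <= (\<Sum>j\<le>m. ennreal C * NN (m - j + d) (w j))"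
  unfolding Nj_def by (intro sum_mono NN_coeff v C c) simp
 also have "... = ennreal C * (\<Sum>j\<le>m. NN (m + d - j) (w j))" by (simp add: sum_distrib_left)
 also have "... <= ennreal C * Nj (m + d) w" unfolding Nj_def by (intro mult_left_mono sum_mono2) auto
 finally show ?thesis .
qed

lemma jet_coeff: "jet m w ==> jet m (%j k z. c k * w j k z)"
 unfolding jet_def by (blast intro: mmeas_mult wd_cmult)

lemma jet_shift: "jet (m + e) w ==> jet m (%j. w (j + e))"
 unfolding jet_def by auto

lemma Nj_shift: "Nj m (%j. w (j + e)) <= Nj (m + e) w"
proof (induction e arbitrary: w)
 case (Suc e)
 have "Nj m (%j. w (j + Suc e)) <= Nj (m + e) (%j. w (Suc j))" using Suc[of "%j. w (Suc j)"] by simp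
 also have "... <= Nj (m + Suc e) w" by (simp add: Nj_Suc)
 finally show ?case .
qed simp

text \<open>The vector \<open>g = f + grad div f / kk\<close> with all its
  \<open>z\<close>-derivatives: order \<open>j\<close> draws on orders up to \<open>j + 2\<close> of
  the source jet.\<close>

definition GG :: "(3 => nat => mode => real => complex) => 3 => nat => mode => real => complex" where
 "GG ph i j k z = ph i j k z + (\<Sum>r\<in>UNIV. gv k i * gv k r / of_real kk * ph r (j + (sh i + sh r)) k z)"

lemma GG_term:
 assumes s: "jet (s + 2) ph"
 shows "jet s (%j k z. gv k i * gv k r / of_real kk * ph (j + (sh i + sh r)) k z)"
proof -
 have "sh i + sh r <= 2" by (simp add: sh_def)
 then have "jet (s + (sh i + sh r)) ph" by (intro jet_mono[OF s]) simp
 then show ?thesis by (intro jet_coeff jet_shift)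
qed

lemma GG_jet:
 assumes "!!i. jet (s + 2) (ph i)" shows "jet s (GG ph i)"
 unfolding GG_def[abs_def] sum_3 by (intro jet_add GG_term assms jet_mono[OF assms]) simp

lemma GG_bound:
 obtains C where "C >= 0" "!!(ph :: 3 => nat => mode => real => complex) i. (!!i. jet (s + 2) (ph i)) ==> Nj s (GG ph i) <= ennreal C * (\<Sum>r\<in>UNIV. Nj (s + 2) (ph r))"
proof -
 obtain C0 where C0: "C0 >= 0" "!!k i r. (norm (gv k r * gv k i))\<^sup>2 <= C0 * jw k ^ (2 - (sh r + sh i))" using gv_bound2 by blast
 define C1 where "C1 = C0 / kk\<^sup>2"
 have C1: "C1 >= 0" using C0 by (simp add: C1_def)
 have termb: "Nj s (%j k z. gv k i * gv k r / of_real kk * ph (j + (sh i + sh r)) k z) <= ennreal C1 * Nj (s + 2) ph"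
  if p: "jet (s + 2) ph" for i r ph
 proof -
  define d where "d = 2 - (sh i + sh r)"
  have de: "d + (sh i + sh r) = 2" by (simp add: d_def sh_def)
  have "Nj s (%j k z. gv k i * gv k r / of_real kk * ph (j + (sh i + sh r)) k z) <= ennreal C1 * Nj (s + d) (%j. ph (j + (sh i + sh r)))"
  proof (rule Nj_coeff[OF _ C1])
   show "mmeas (ph (j + (sh i + sh r)))" if "j <= s" for j using p that by (auto simp: jet_def sh_def)
   fix k
   have "(norm (gv k i * gv k r))\<^sup>2 / kk\<^sup>2 <= C0 * jw k ^ d / kk\<^sup>2" unfolding d_def by (rule divide_right_mono[OF C0(2)]) simp
   then show "(norm (gv k i * gv k r / complex_of_real kk))\<^sup>2 <= C1 * jw k ^ d"
    unfolding norm_divide norm_of_real power_divide power2_abs C1_def by simp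
  qed
  also have "... <= ennreal C1 * Nj (s + d + (sh i + sh r)) ph" by (intro mult_left_mono Nj_shift) simp
  finally show ?thesis using de by (simp add: add.assoc)
 qed
 show ?thesis
 \<comment> \<open>The 2 belongs to the source itself, 20 = 2 * (2 * (2 + 2) + 2) to the three
   gradient terms added two at a time.\<close>
 proof (rule that[of "2 + 20 * C1"])
  show "0 <= 2 + 20 * C1" using C1 by simp
  fix ph :: "3 => nat => mode => real => complex" and i assume p: "!!i. jet (s + 2) (ph i)"
  define t where "t r j k z = gv k i * gv k r / of_real kk * ph r (j + (sh i + sh r)) k z" for r j k z
  have tj: "jet s (t r)" for r unfolding t_def[abs_def] by (rule GG_term[OF p])
  have tm: "mmeas (t r j)" if "j <= s" for r j using tj[of r] that by (simp add: jet_def)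
  have pm: "mmeas (ph i j)" if "j <= s" for j using p[of i] that by (simp add: jet_def)
  define X where "X = (\<Sum>r\<in>UNIV. Nj (s + 2) (ph r))"
  have X: "Nj (s + 2) (ph r) <= X" for r unfolding X_def by (rule member_le_sum) auto
  have tb: "Nj s (t r) <= ennreal C1 * X" for r
   unfolding t_def[abs_def] by (rule order_trans[OF termb[OF p] mult_left_mono[OF X]]) simp
  have pb: "Nj s (ph i) <= X" using Nj_le_Suc[of s "ph i"] Nj_le_Suc[of "Suc s" "ph i"] X[of i] by (auto intro: order_trans)
  have "GG ph i = (%j k z. ph i j k z + (t 1 j k z + t 2 j k z + t 3 j k z))"
   by (simp add: GG_def[abs_def] sum_3 t_def)
  then have b0: "Nj s (GG ph i) <= 2 * Nj s (ph i) + 2 * Nj s (%j k z. t 1 j k z + t 2 j k z + t 3 j k z)"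
   by (simp only:) (intro Nj_add pm mmeas_add tm)
  define Y where "Y = ennreal C1 * X"
  have b2: "Nj s (%j k z. t 1 j k z + t 2 j k z) <= 2 * Y + 2 * Y"
  proof (rule order_trans)
   show "Nj s (%j k z. t 1 j k z + t 2 j k z) <= 2 * Nj s (t 1) + 2 * Nj s (t 2)" by (intro Nj_add tm)
  qed (intro add_mono mult_left_mono tb[folded Y_def]; simp)
  have b3: "Nj s (%j k z. t 1 j k z + t 2 j k z + t 3 j k z) <= 2 * (2 * Y + 2 * Y) + 2 * Y"
  proof (rule order_trans)
   show "Nj s (%j k z. t 1 j k z + t 2 j k z + t 3 j k z) <= 2 * Nj s (%j k z. t 1 j k z + t 2 j k z) + 2 * Nj s (t 3)"
    by (intro Nj_add mmeas_add tm)
  qed (intro add_mono mult_left_mono tb[folded Y_def] b2; simp)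
  have "Nj s (GG ph i) <= 2 * X + 2 * (2 * (2 * Y + 2 * Y) + 2 * Y)"
   by (rule order_trans[OF b0]) (intro add_mono mult_left_mono pb b3; simp)
  also have "... = 2 * X + 20 * Y"
  proof -
   have "2 * (2 * (2 * Y + 2 * Y) + 2 * Y) = (2 * (2 * (2 + 2) + 2)) * Y" by (simp only: distrib_left distrib_right mult.assoc)
   then show ?thesis by simp
  qed
  also have "... <= ennreal (2 + 20 * C1) * X" using C1 by (simp add: Y_def ennreal_mult distrib_right mult.assoc)
  finally show "Nj s (GG ph i) <= ennreal (2 + 20 * C1) * (\<Sum>r\<in>UNIV. Nj (s + 2) (ph r))" unfolding X_def .
 qed
qed

lemma ode_GG:
 assumes kk: "kk > 0" and V: "basic V" and r: "rep 2 V W" and L0: "L0_eq D V F" and F: "!!i. L2 SM (%x. F x $ i)"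
  and p: "!!i. jet 2 (ph i)" and pF: "!!i k. AE z in HM. ph i 0 k z = fc (slice (%x. F x $ i) z) k"
 shows "AE z in HM. W i 2 k z = of_real (\<nu> k) * W i 0 k z - GG ph i 0 k z"
proof -
 have j: "jet 2 (W i)" for i using r by (auto simp: rep_def)
 have w: "wd h (W i 0 k) (W i 1 k)" "wd h (W i 1 k) (W i 2 k)" "wd h (ph i 0 k) (ph i 1 k)" "wd h (ph i 1 k) (ph i 2 k)" for i
  using jetD[OF j[of i], of 0 k] jetD[OF j[of i], of 1 k] jetD[OF p[of i], of 0 k] jetD[OF p[of i], of 1 k] by (simp_all add: numeral_2_eq_2)
 have eq: "AE z in HM. XX W i k z = of_real kk * W i 0 k z + ph i 0 k z" for i
  using modes_eq[OF V r F L0, of i k] pF[of i k] by eventually_elim simp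
 have e1: "AE z in HM. of_real ((be k)\<^sup>2) * W 1 0 k z - of_real (al k * be k) * W 2 0 k z - W 1 2 k z + \<i> * of_real (al k) * W 3 1 k z = of_real kk * W 1 0 k z + ph 1 0 k z"
  using eq[of 1] by eventually_elim (simp add: XX_def sum_3 gv_def sh_def power2_eq_square numeral_2_eq_2 algebra_simps)
 have e2: "AE z in HM. of_real ((al k)\<^sup>2) * W 2 0 k z - of_real (al k * be k) * W 1 0 k z - W 2 2 k z + \<i> * of_real (be k) * W 3 1 k z = of_real kk * W 2 0 k z + ph 2 0 k z"
  using eq[of 2] by eventually_elim (simp add: XX_def sum_3 gv_def sh_def power2_eq_square numeral_2_eq_2 algebra_simps)
 have e3: "AE z in HM. of_real ((al k)\<^sup>2 + (be k)\<^sup>2) * W 3 0 k z + \<i> * of_real (al k) * W 1 1 k z + \<i> * of_real (be k) * W 2 1 k z = of_real kk * W 3 0 k z + ph 3 0 k z"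
  using eq[of 3] by eventually_elim (simp add: XX_def sum_3 gv_def sh_def power2_eq_square numeral_2_eq_2 algebra_simps)
 note o = ode_mode[of kk h "W 1 0 k" "W 1 1 k" "W 1 2 k" "W 2 0 k" "W 2 1 k" "W 2 2 k" "W 3 0 k" "W 3 1 k" "W 3 2 k"
   "ph 1 0 k" "ph 1 1 k" "ph 2 0 k" "ph 2 1 k" "ph 3 0 k" "ph 3 1 k" "ph 3 2 k" "be k" "al k",
   OF _ w(1)[of 1] w(2)[of 1] w(1)[of 2] w(2)[of 2] w(1)[of 3] w(2)[of 3] w(3)[of 1] w(3)[of 2] w(3)[of 3] w(4)[of 3],
   OF _ e1 e2 e3, folded \<nu>_def]
 have k0: "kk \<noteq> 0" by (rule less_imp_neq[OF kk, symmetric])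
 have "i = 1 \<or> i = 2 \<or> i = 3" using exhaust_3 by blast
 then show ?thesis
 proof (elim disjE)
  assume i: "i = 1"
  show ?thesis unfolding i using o(1)[OF k0]
   by eventually_elim (simp add: GG_def sum_3 gv_def sh_def algebra_simps add_divide_distrib)
 next
  assume i: "i = 2"
  show ?thesis unfolding i using o(2)[OF k0]
   by eventually_elim (simp add: GG_def sum_3 gv_def sh_def algebra_simps add_divide_distrib)
 next
  assume i: "i = 3"
  show ?thesis unfolding i using o(3)[OF k0]
   by eventually_elim (simp add: GG_def sum_3 gv_def sh_def algebra_simps add_divide_distrib numeral_2_eq_2)
 qed
qed

text \<open>\<open>solves\<close> provides only two weak derivatives in \<open>z\<close>. Higher
  ones are generated by inserting the differential equation repeatedly, starting from the
  coefficient \<open>a\<close> and its derivative \<open>b\<close>.\<close>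

fun ext :: "(mode => real => complex) => (mode => real => complex) => (nat => mode => real => complex) => nat => mode => real => complex" where
 "ext a b G 0 = a"
| "ext a b G (Suc 0) = b"
| "ext a b G (Suc (Suc j)) = (%k z. of_real (\<nu> k) * ext a b G j k z - G j k z)"

lemma mmeas_diff: "mmeas u ==> mmeas v ==> mmeas (%k z. u k z - v k z)"
 unfolding mmeas_def by (blast intro: borel_measurable_diff)

lemma ext_mmeas:
 assumes "mmeas a" "mmeas b" "!!j. j <= s ==> mmeas (G j)"
 shows "j <= s + 2 ==> mmeas (ext a b G j)"
proof (induction j rule: induct_nat_012)
 case (ge2 j)
 then show ?case using assms(3)[of j] by (simp add: mmeas_diff mmeas_mult)
qed (use assms in auto)

text \<open>The second premise is the differential equation; the further links of the jet are its
  weak derivatives.\<close>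

lemma ext_jet:
 assumes ab: "!!k. wd h (a k) (b k)" "!!k. wd h (b k) (%z. of_real (\<nu> k) * a k z - G 0 k z)" and G: "jet s G"
 shows "jet (s + 2) (ext a b G)"
 unfolding jet_def
proof (intro conjI allI impI)
 have m: "mmeas a" "mmeas b" using wd_meas[OF ab(1)] by (auto intro!: mmeasI)
 show "mmeas (ext a b G j)" if "j <= s + 2" for j
  using ext_mmeas[OF m _ that, of G] G by (auto simp: jet_def)
 fix j k assume "j < s + 2"
 then show "wd h (ext a b G j k) (ext a b G (Suc j) k)"
 proof (induction j rule: induct_nat_012)
  case (ge2 j)
  then show ?case using jetD[OF G, of j k] by (simp add: wd_diff wd_cmult)
 qed (use ab in auto)
qed

lemma \<nu>_bound: obtains C where "C >= 0" "!!k. (norm (complex_of_real (\<nu> k)))\<^sup>2 <= C * jw k ^ 2"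
proof -
 obtain C where C: "C > 0" "!!k. (al k)\<^sup>2 + (be k)\<^sup>2 <= C * jw k" using wave_bound by blast
 have "(norm (complex_of_real (\<nu> k)))\<^sup>2 <= (C + \<bar>kk\<bar>)\<^sup>2 * jw k ^ 2" for k
 proof -
  have "\<bar>kk\<bar> <= \<bar>kk\<bar> * jw k" using jw_ge_1[of k] by (simp add: mult_le_cancel_left1)
  then have "\<bar>\<nu> k\<bar> <= (C + \<bar>kk\<bar>) * jw k"
   using C(2)[of k] zero_le_power2[of "al k"] zero_le_power2[of "be k"] unfolding \<nu>_def distrib_right by linarith
  then have "\<bar>\<nu> k\<bar>\<^sup>2 <= ((C + \<bar>kk\<bar>) * jw k)\<^sup>2" by (intro power_mono) auto
  then show ?thesis unfolding norm_of_real power_mult_distrib .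
 qed
 then show ?thesis using that[of "(C + \<bar>kk\<bar>)\<^sup>2"] by simp
qed

text \<open>Two \<open>z\<close>-derivatives are exchanged for a factor \<open>\<nu>\<close>, whose
  square costs two powers of the weight; the index \<open>s + 2 - j\<close> drops by the same
  amount. \<open>C\<close> is chosen before the data and is therefore uniform in them.\<close>

lemma ext_bound_j:
 "\<exists>C\<ge>0. \<forall>a b G M. j <= s + 2 --> mmeas a --> mmeas b --> jet s G --> NN (s + 2) a <= M --> NN (s + 1) b <= M --> Nj s G <= M
   --> NN (s + 2 - j) (ext a b G j) <= ennreal C * M"
proof (induction j rule: induct_nat_012)
 case 0 show ?case by (rule exI[of _ 1]) simp
next
 case 1 show ?case by (rule exI[of _ 1]) simp
next
 case (ge2 j)
 obtain C where C: "C >= 0" "!!a b G M. j <= s + 2 ==> mmeas a ==> mmeas b ==> jet s G ==> NN (s + 2) a <= M ==> NN (s + 1) b <= M ==> Nj s G <= M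
   ==> NN (s + 2 - j) (ext a b G j) <= ennreal C * M" using ge2(1) by blast
 obtain N where N: "N >= 0" "!!k. (norm (complex_of_real (\<nu> k)))\<^sup>2 <= N * jw k ^ 2" using \<nu>_bound by blast
 show ?case
 proof (intro exI[of _ "2 * (N * C) + 2"] conjI allI impI)
  show "0 <= 2 * (N * C) + 2" using N C by simp
  fix a b G M
  assume j: "Suc (Suc j) <= s + 2" and a: "mmeas a" and b: "mmeas b" and G: "jet s G"
   and M: "NN (s + 2) a <= M" "NN (s + 1) b <= M" "Nj s G <= M"
  have js: "j <= s" using j by simp
  have Gm: "mmeas (G j)" if "j <= s" for j using G that by (simp add: jet_def)
  have em: "mmeas (ext a b G j)" using js by (intro ext_mmeas[of a b s G] a b Gm) auto
  have 1: "NN (s - j) (%k z. of_real (\<nu> k) * ext a b G j k z) <= ennreal (N * C) * M"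
  proof -
   have "NN (s - j) (%k z. of_real (\<nu> k) * ext a b G j k z) <= ennreal N * NN (s - j + 2) (ext a b G j)"
    by (rule NN_coeff[OF em N])
   also have "s - j + 2 = s + 2 - j" using js by simp
   also have "ennreal N * NN (s + 2 - j) (ext a b G j) <= ennreal N * (ennreal C * M)"
    using js by (intro mult_left_mono C(2) a b G M) auto
   finally show ?thesis using N C by (simp add: ennreal_mult mult.assoc)
  qed
  have 2: "NN (s - j) (%k z. - 1 * G j k z) <= M"
  proof -
   have "NN (s - j) (%k z. - 1 * G j k z) <= ennreal 1 * NN (s - j + 0) (G j)"
    by (rule NN_coeff[OF Gm[OF js]]) auto
   also have "... <= Nj s G" unfolding Nj_def using member_le_sum[of j "{..s}" "%j. NN (s - j) (G j)"] js by simp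
   finally show ?thesis using M(3) by (rule order_trans)
  qed
  have "NN (s + 2 - Suc (Suc j)) (ext a b G (Suc (Suc j))) = NN (s - j) (%k z. of_real (\<nu> k) * ext a b G j k z + - 1 * G j k z)" by simp
  also have "... <= 2 * NN (s - j) (%k z. of_real (\<nu> k) * ext a b G j k z) + 2 * NN (s - j) (%k z. - 1 * G j k z)"
   by (intro NN_add mmeas_mult em Gm js)
  also have "... <= 2 * (ennreal (N * C) * M) + 2 * M" by (intro add_mono mult_left_mono 1 2) auto
  also have "... = ennreal (2 * (N * C) + 2) * M" using N C by (simp add: ennreal_mult distrib_right mult.assoc)
  finally show "NN (s + 2 - Suc (Suc j)) (ext a b G (Suc (Suc j))) <= ennreal (2 * (N * C) + 2) * M" .
 qed
qed

lemma ext_bound: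
 obtains C where "C >= 0" "!!a b G M. mmeas a ==> mmeas b ==> jet s G ==> NN (s + 2) a <= M ==> NN (s + 1) b <= M ==> Nj s G <= M
   ==> Nj (s + 2) (ext a b G) <= ennreal C * M"
proof -
 define P where "P j C \<longleftrightarrow> (\<forall>a b G M. j <= s + 2 --> mmeas a --> mmeas b --> jet s G --> NN (s + 2) a <= M --> NN (s + 1) b <= M --> Nj s G <= M
   --> NN (s + 2 - j) (ext a b G j) <= ennreal C * M)" for j C
 have "\<forall>j. \<exists>C\<ge>0. P j C" unfolding P_def using ext_bound_j by blast
 then obtain C where C: "!!j. C j >= 0" "!!j. P j (C j)" by metis
 show ?thesis
 proof (rule that[of "\<Sum>j\<le>s + 2. C j"])
  show "0 <= (\<Sum>j\<le>s + 2. C j)" using C by (simp add: sum_nonneg)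
  fix a b G M assume *: "mmeas a" "mmeas b" "jet s G" "NN (s + 2) a <= M" "NN (s + 1) b <= M" "Nj s G <= M"
  have "Nj (s + 2) (ext a b G) <= (\<Sum>j\<le>s + 2. ennreal (C j) * M)"
   unfolding Nj_def using C(2) * unfolding P_def by (intro sum_mono) auto
  also have "... = ennreal (\<Sum>j\<le>s + 2. C j) * M" using C(1) by (simp add: sum_distrib_right[symmetric] sum_ennreal del: sum.atMost_Suc)
  finally show "Nj (s + 2) (ext a b G) <= ennreal (\<Sum>j\<le>s + 2. C j) * M" .
 qed
qed

section \<open>A priori estimates for the boundary value problem\<close>

definition src :: "nat => (space => complex^3) => (3 => nat => mode => real => complex) => bool" where
 "src m F ph \<longleftrightarrow> (\<forall>i. L2 SM (%x. F x $ i)) \<and> (\<forall>i. jet m (ph i)) \<and> (\<forall>i. Nj m (ph i) < \<infinity>) \<and>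
  (\<forall>i k. AE z in HM. ph i 0 k z = fc (slice (%x. F x $ i) z) k)"

lemma srcD:
 assumes "src m F ph"
 shows "L2 SM (%x. F x $ i)" "jet m (ph i)" "Nj m (ph i) < \<infinity>" "AE z in HM. ph i 0 k z = fc (slice (%x. F x $ i) z) k"
 using assms unfolding src_def by blast+

text \<open>The modal estimate is restricted to modes without boundary datum, so that the same
  statement covers \<open>E 0\<close>, with at most one excited mode, and the later terms, with
  none.\<close>

definition modal :: "real => nat => (real \<times> real => complex^3) => (space => complex^3) =>
  (3 => nat => mode => real => complex) => (3 => nat => mode => real => complex) => bool" where
 "modal C s Q V ph W \<longleftrightarrow> basic V \<and> rep 2 V W \<and> (\<forall>i. jet (s + 2) (ext (W i 0) (W i 1) (GG ph i))) \<and>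
  (\<forall>i k. fcoeff D Q (fst k) (snd k) = 0 --> est C k (W i 0 k) (W i 1 k) (GG ph i 0 k))"

lemma NN_le_Nj: "j <= m ==> NN (m - j) (w j) <= Nj m w"
 unfolding Nj_def by (rule member_le_sum) auto

lemma solves_modal:
 assumes kk: "kk > 0" and u: unique_modes
 obtains C where "C >= 0" "!!s F Q V ph. solves D F Q V ==> src (s + 2) F ph ==> \<exists>W. modal C s Q V ph W"
proof -
 obtain C where C: "C >= 0" "!!k V V1 v2 g. bvp k V V1 v2 g ==> est C k V V1 g" using mode_estimate[OF u] by blast
 show ?thesis
 proof (rule that[OF C(1)])
  fix s F Q V ph assume s: "solves D F Q V" and src: "src (s + 2) F ph"
  define W where "W = (%i j k z. wderiv h j (hat D V (fst k) (snd k)) z $ i)"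
  have V: "V \<in> Hspace D 2" "L0_eq D V F" using s by (auto simp: solves_def)
  have b: "basic V" by (rule Hspace_basic[OF V(1)])
  have r: "rep 2 V W" unfolding W_def by (rule Hspace_rep[OF V(1)])
  obtain F0 F1 where FF: "!!i k. AC h (F0 i k) (F1 i k)" "!!i k. AC h (F1 i k) (W i 2 k)"
   "!!i k. AE z in HM. F0 i k z = W i 0 k z" "!!i k. AE z in HM. F1 i k z = W i 1 k z"
   "!!i k a. a \<in> {-h..h} ==> tr D V a (fst k) (snd k) $ i = F0 i k a"
   "!!i k a. a \<in> {-h..h} ==> tr_dz D V a (fst k) (snd k) $ i = F1 i k a"
   using mode_traces[OF V(1) W_def] by blast
  have p2: "jet 2 (ph i)" for i by (rule jet_mono[OF srcD(2)[OF src]]) simp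
  have ode: "AE z in HM. W i 2 k z = of_real (\<nu> k) * W i 0 k z - GG ph i 0 k z" for i k
   by (rule ode_GG[OF kk b r V(2) srcD(1)[OF src] p2 srcD(4)[OF src]])
  have G: "jet s (GG ph i)" for i by (rule GG_jet[OF srcD(2)[OF src]])
  then have Gm: "mmeas (GG ph i 0)" for i by (simp add: jet_def)
  \<comment> \<open>The bound serves only to see that \<open>g\<close> is square integrable in each
    mode; its constant is discarded.\<close>
  obtain C2 where "!!ph i. (!!i. jet (s + 2) (ph i)) ==> Nj s (GG ph i) <= ennreal C2 * (\<Sum>r\<in>UNIV. Nj (s + 2) (ph r))"
   using GG_bound by blast
  then have "Nj s (GG ph i) <= ennreal C2 * (\<Sum>r\<in>UNIV. Nj (s + 2) (ph r))" for i using srcD(2)[OF src] by blast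
  then have "Nj s (GG ph i) < \<infinity>" for i
   by (rule order.strict_trans1) (use srcD(3)[OF src] in \<open>simp add: sum_3 ennreal_mult_less_top\<close>)
  then have GL: "L2 HM (GG ph i 0 k)" for i k by (rule Nj_L2[OF G _ le0])
  have j: "jet 2 (W i)" for i using r by (auto simp: rep_def)
  have w: "wd h (W i 0 k) (W i 1 k)" "wd h (W i 1 k) (W i 2 k)" for i k
   using jetD[OF j[of i], of 0 k] jetD[OF j[of i], of 1 k] by (simp_all add: numeral_2_eq_2)
  have "jet (s + 2) (ext (W i 0) (W i 1) (GG ph i))" for i
   by (rule ext_jet[OF w(1) wd_cong_AE[OF w(2) _ ode] G]) (use wd_meas[OF w(1)] mmeasD[OF Gm] in auto)
  moreover have "est C k (W i 0 k) (W i 1 k) (GG ph i 0 k)" if Q: "fcoeff D Q (fst k) (snd k) = 0" for i k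
  proof -
   \<comment> \<open>The trace conditions hold for the continuous representatives, so the two-point
     problem is stated for these, and the estimate is transferred back almost everywhere.\<close>
   have "AE z in HM. W i 2 k z = of_real (\<nu> k) * F0 i k z - GG ph i 0 k z"
    using ode[of i k] FF(3)[of i k] by eventually_elim simp
   then have "bvp k (F0 i k) (F1 i k) (W i 2 k) (GG ph i 0 k)"
    using FF(1,2) GL solves_bc[OF s FF(5,6), where i = i and k = k] Q unfolding bvp_def by simp
   then show ?thesis using C(2) sqn_cong_AE[OF FF(3)[of i k]] sqn_cong_AE[OF FF(4)[of i k]] unfolding est_def by fastforce
  qed
  ultimately show "\<exists>W. modal C s Q V ph W" unfolding modal_def using b r by blast
 qed
qed

lemma ext_rep:
 assumes b: "basic V" and r: "rep 2 V W" and j: "!!i. jet m (ext (W i 0) (W i 1) (G i))" and f: "!!i. Nj m (ext (W i 0) (W i 1) (G i)) < \<infinity>"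
 shows "rep m V (%i. ext (W i 0) (W i 1) (G i))"
 using assms unfolding rep_def by simp

lemma modalD:
 assumes "modal C s Q V ph W"
 shows "basic V" "rep 2 V W" "jet (s + 2) (ext (W i 0) (W i 1) (GG ph i))" "mmeas (W i 0)" "mmeas (W i 1)"
  "fcoeff D Q (fst k) (snd k) = 0 ==> est C k (W i 0 k) (W i 1 k) (GG ph i 0 k)"
proof -
 show "basic V" "rep 2 V W" "jet (s + 2) (ext (W i 0) (W i 1) (GG ph i))"
  "fcoeff D Q (fst k) (snd k) = 0 ==> est C k (W i 0 k) (W i 1 k) (GG ph i 0 k)"
  using assms unfolding modal_def by blast+
 then show "mmeas (W i 0)" "mmeas (W i 1)" by (auto simp: rep_def jet_def)
qed

text \<open>The homogeneous boundary datum puts every mode under the modal estimate. Its gain of two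
  derivatives makes up for the two lost in passing from the source to \<open>GG\<close>.\<close>

lemma regular_step:
 assumes kk: "kk > 0" and u: unique_modes
 obtains C where "C >= 0" "!!F V ph. solves D F (%_. 0) V ==> src (s + 2) F ph ==>
   V \<in> Hspace D (s + 2) \<and> Hnorm_sq D (s + 2) V <= ennreal C * (\<Sum>i\<in>UNIV. Nj (s + 2) (ph i))"
proof -
 obtain C1 where C1: "C1 >= 0" "!!s F Q V ph. solves D F Q V ==> src (s + 2) F ph ==> \<exists>W. modal C1 s Q V ph W"
  using solves_modal[OF kk u] by blast
 obtain C2 where C2: "C2 >= 0" "!!ph i. (!!i. jet (s + 2) (ph i)) ==> Nj s (GG ph i) <= ennreal C2 * (\<Sum>r\<in>UNIV. Nj (s + 2) (ph r))"
  using GG_bound by blast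
 obtain C3 where C3: "C3 >= 0" "!!a b G M. mmeas a ==> mmeas b ==> jet s G ==> NN (s + 2) a <= M ==> NN (s + 1) b <= M ==> Nj s G <= M
   ==> Nj (s + 2) (ext a b G) <= ennreal C3 * M" using ext_bound by blast
 define C4 where "C4 = C3 * ((C1 + 1) * C2)"
 have C4: "C4 >= 0" using C1 C2 C3 by (simp add: C4_def)
 show ?thesis
 proof (rule that[of "3 * C4"])
  show "0 <= 3 * C4" using C4 by simp
  fix F V ph assume s: "solves D F (%_. 0) V" and src: "src (s + 2) F ph"
  obtain W where W: "modal C1 s (%_. 0) V ph W" using C1(2)[OF s src] by blast
  note p = srcD(2)[OF src] and M' = modalD[OF W]
  define X where "X = (\<Sum>i\<in>UNIV. Nj (s + 2) (ph i))"
  have Xf: "X < \<infinity>" unfolding X_def using srcD(3)[OF src] by (simp add: sum_3)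
  have f0: "fcoeff D (%_. 0) p q = 0" for p q unfolding fcoeff_def set_lebesgue_integral_def by (simp add: case_prod_beta)
  have G: "jet s (GG ph i)" for i by (rule GG_jet[OF p])
  have GX: "Nj s (GG ph i) <= ennreal C2 * X" for i unfolding X_def by (rule C2(2)[OF p])
  have Gm: "mmeas (GG ph i 0)" for i using G[of i] by (simp add: jet_def)
  have G0: "NN s (GG ph i 0) <= ennreal C2 * X" for i
   using NN_le_Nj[of 0 s "GG ph i"] GX[of i] by (auto intro: order_trans)
  have est: "ennreal ((jw k)\<^sup>2) * sqn HM (W i 0 k) <= ennreal C1 * sqn HM (GG ph i 0 k)"
    "ennreal (jw k) * sqn HM (W i 1 k) <= ennreal C1 * sqn HM (GG ph i 0 k)" for i k
   using M'(6)[OF f0] unfolding est_def by blast+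
  have jw: "jw k >= 0" for k using jw_ge_1[of k] by simp
  \<comment> \<open>The modal estimate multiplied by \<open>jw k ^ s\<close> and summed over the
    modes; \<open>d\<close> is 2 for the coefficient and 1 for its derivative.\<close>
  have shift: "NN (s + d) v <= ennreal (C1 * C2) * X"
   if v: "mmeas v" and e: "!!k. ennreal (jw k ^ d) * sqn HM (v k) <= ennreal C1 * sqn HM (GG ph i 0 k)" for v d i
  proof -
   have "NN (s + d) v <= (\<integral>\<^sup>+ k. ennreal C1 * (ennreal (jw k ^ s) * sqn HM (GG ph i 0 k)) \<partial>modes)"
    unfolding NN_swap[OF v]
   proof (intro nn_integral_mono)
    fix k
    have "ennreal (jw k ^ (s + d)) * sqn HM (v k) = ennreal (jw k ^ s) * (ennreal (jw k ^ d) * sqn HM (v k))"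
     using jw[of k] by (simp add: power_add ennreal_mult mult.assoc)
    also have "... <= ennreal (jw k ^ s) * (ennreal C1 * sqn HM (GG ph i 0 k))" by (intro mult_left_mono e) simp
    finally show "ennreal (jw k ^ (s + d)) * sqn HM (v k) <= ennreal C1 * (ennreal (jw k ^ s) * sqn HM (GG ph i 0 k))"
     by (simp only: mult.left_commute)
   qed
   also have "... = ennreal C1 * NN s (GG ph i 0)" unfolding NN_swap[OF Gm] by (subst nn_integral_cmult) auto
   also have "... <= ennreal C1 * (ennreal C2 * X)" by (intro mult_left_mono G0) simp
   finally show ?thesis using C1(1) C2(1) by (simp add: ennreal_mult mult.assoc)
  qed
  \<comment> \<open>A common bound for the three inputs of \<open>ext_bound\<close>:
    \<open>C1 + 1\<close> covers both \<open>C1\<close> and 1.\<close>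
  define M where "M = ennreal ((C1 + 1) * C2) * X"
  have M: "ennreal (C1 * C2) * X <= M" "ennreal C2 * X <= M" unfolding M_def
   using C1(1) C2(1) by (intro mult_right_mono ennreal_leI; simp add: algebra_simps)+
  have Nb: "Nj (s + 2) (ext (W i 0) (W i 1) (GG ph i)) <= ennreal C4 * X" for i
  proof -
   have "NN (s + 2) (W i 0) <= M" by (rule order_trans[OF shift[OF M'(4) est(1)[where i = i]] M(1)])
   moreover have "NN (s + 1) (W i 1) <= M" by (rule order_trans[OF shift[OF M'(5), where d = 1 and i = i] M(1)]) (use est(2) in simp)
   ultimately have "Nj (s + 2) (ext (W i 0) (W i 1) (GG ph i)) <= ennreal C3 * M"
    by (rule C3(2)[OF M'(4,5) G _ _ order_trans[OF GX M(2)]])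
   also have "... = ennreal C4 * X" using C1(1) C2(1) C3(1) unfolding M_def C4_def by (simp add: ennreal_mult mult.assoc)
   finally show ?thesis .
  qed
  have r: "rep (s + 2) V (%i. ext (W i 0) (W i 1) (GG ph i))"
   by (rule ext_rep[OF M'(1,2,3)]) (rule order.strict_trans1[OF Nb], use Xf in \<open>simp add: ennreal_mult_less_top\<close>)
  show "V \<in> Hspace D (s + 2) \<and> Hnorm_sq D (s + 2) V <= ennreal (3 * C4) * (\<Sum>i\<in>UNIV. Nj (s + 2) (ph i))"
  proof
   show "V \<in> Hspace D (s + 2)" by (rule rep_Hspace[OF M'(1) r])
   have "Hnorm_sq D (s + 2) V <= (\<Sum>i\<in>(UNIV::3 set). ennreal C4 * X)" unfolding Hnorm_sq_rep[OF M'(1) r] by (intro sum_mono Nb)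
   also have "... = ennreal (3 * C4) * X" using C4 by (simp add: ennreal_mult mult.assoc)
   finally show "Hnorm_sq D (s + 2) V <= ennreal (3 * C4) * (\<Sum>i\<in>UNIV. Nj (s + 2) (ph i))" unfolding X_def .
  qed
 qed
qed

section \<open>The zeroth term and the source of the recursion\<close>

lemma NN_one_mode:
 assumes v: "mmeas v" and 0: "!!k. k \<noteq> m0 ==> sqn HM (v k) = 0"
 shows "NN n v = ennreal (jw m0 ^ n) * sqn HM (v m0)"
proof -
 have "NN n v = (\<integral>\<^sup>+ k. (ennreal (jw m0 ^ n) * sqn HM (v m0)) * indicator {m0} k \<partial>modes)"
  unfolding NN_swap[OF v] by (intro nn_integral_cong) (auto simp: indicator_def 0)
 also have "... = ennreal (jw m0 ^ n) * sqn HM (v m0)" by (subst nn_integral_cmult_indicator) auto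
 finally show ?thesis .
qed

text \<open>The incident datum is a multiple of the exponential of mode (0, 0). It is viewed as a
  field at height 0 so that \<open>hat_fc\<close> and orthogonality apply.\<close>

lemma fcoeff_phi_inc:
 assumes "k \<noteq> (0, 0)" shows "fcoeff D (phi_inc D A) (fst k) (snd k) = 0"
proof -
 define c where "c = 2 * \<i> * of_real (gamma_u D) * exp (- \<i> * of_real (gamma_u D * h))"
 define u :: "space => complex^3" where "u x = phi_inc D A (fst x, fst (snd x))" for x
 have s: "slice (%x. u x $ i) 0 = (%p. c * A $ i * ex (0, 0) p)" for i
  by (auto simp: slice_def u_def phi_inc_def c_def ex_def alpha_p_def beta_q_def fun_eq_iff)
 have "hat D u (fst k) (snd k) 0 $ i = 0" for i
 proof -
  have "L2 GM (slice (%x. u x $ i) 0)" for i unfolding s by (intro L2_cmult L2_ex)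
  then have "hat D u (fst k) (snd k) 0 $ i = fc (slice (%x. u x $ i) 0) k" by (rule hat_fc)
  also have "... = 0" unfolding s fc_cmult fc_ex using assms by simp
  finally show ?thesis .
 qed
 then have "hat D u (fst k) (snd k) 0 = 0" by (simp add: vec_eq_iff)
 moreover have "(%(x, y). u (x, y, 0)) = phi_inc D A" by (auto simp: u_def)
 ultimately show ?thesis by (simp add: hat_def)
qed

text \<open>With zero source the modal estimate forces every mode except (0, 0) to vanish almost
  everywhere. A single square integrable mode has finite norm for every weight, and the differential
  equation supplies the higher derivatives.\<close>

lemma regular_base:
 assumes kk: "kk > 0" and u: unique_modes and s: "solves D (%_. 0) (phi_inc D A) V"
 shows "V \<in> Hspace D (s + 2)"
proof -
 obtain C1 where C1: "C1 >= 0" "!!s F Q V ph. solves D F Q V ==> src (s + 2) F ph ==> \<exists>W. modal C1 s Q V ph W"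
  using solves_modal[OF kk u] by blast
 obtain C3 where C3: "C3 >= 0" "!!a b G M. mmeas a ==> mmeas b ==> jet s G ==> NN (s + 2) a <= M ==> NN (s + 1) b <= M ==> Nj s G <= M
   ==> Nj (s + 2) (ext a b G) <= ennreal C3 * M" using ext_bound by blast
 define ph :: "3 => nat => mode => real => complex" where "ph = (%i j k z. 0)"
 have wd0: "wd h (%z. 0) (%z. 0)" by (rule AC_imp_wd[OF AC_const hgt])
 have p: "jet (s + 2) (ph i)" for i unfolding jet_def ph_def using wd0 by (auto intro!: mmeasI)
 have N0: "Nj m (%j k z. 0) = 0" for m by (simp add: Nj_def NN_def wn_def)
 have "src (s + 2) (%_. 0) ph" using p unfolding src_def by (simp add: ph_def N0 L2_0 fc_def slice_def)
 from C1(2)[OF s this] obtain W where "modal C1 s (phi_inc D A) V ph W" by blast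
 note M' = modalD[OF this]
 have GG0: "GG ph i j k z = 0" for i j k z by (simp add: GG_def ph_def)
 have z: "sqn HM (W i 0 k) = 0" "sqn HM (W i 1 k) = 0" if k: "k \<noteq> (0, 0)" for i k
 proof -
  have "est C1 k (W i 0 k) (W i 1 k) (GG ph i 0 k)" by (rule M'(6)[OF fcoeff_phi_inc[OF k]])
  moreover have "sqn HM (GG ph i 0 k) = 0" by (simp add: GG0 sqn_def)
  moreover have "jw k > 0" using jw_ge_1[of k] by linarith
  ultimately show "sqn HM (W i 0 k) = 0" "sqn HM (W i 1 k) = 0" unfolding est_def by auto
 qed
 have Wf: "sqn HM (W i 0 k) < \<infinity>" "sqn HM (W i 1 k) < \<infinity>" for i k
 proof -
  have j: "jet 2 (W i)" "Nj 2 (W i) < \<infinity>" using M'(2) unfolding rep_def by blast+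
  show "sqn HM (W i 0 k) < \<infinity>" "sqn HM (W i 1 k) < \<infinity>"
   using Nj_L2[OF j, of 0 k] Nj_L2[OF j, of 1 k] by (simp_all add: L2_sqn)
 qed
 have N: "NN (s + 2) (W i 0) < \<infinity>" "NN (s + 1) (W i 1) < \<infinity>" for i
 proof -
  have "NN (s + 2) (W i 0) = ennreal (jw (0, 0) ^ (s + 2)) * sqn HM (W i 0 (0, 0))"
   by (rule NN_one_mode[OF M'(4) z(1)])
  then show "NN (s + 2) (W i 0) < \<infinity>" using Wf(1)[of i "(0, 0)"] by (simp add: ennreal_mult_less_top)
  have "NN (s + 1) (W i 1) = ennreal (jw (0, 0) ^ (s + 1)) * sqn HM (W i 1 (0, 0))"
   by (rule NN_one_mode[OF M'(5) z(2)])
  then show "NN (s + 1) (W i 1) < \<infinity>" using Wf(2)[of i "(0, 0)"] by (simp add: ennreal_mult_less_top)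
 qed
 have Nf: "Nj (s + 2) (ext (W i 0) (W i 1) (GG ph i)) < \<infinity>" for i
 proof -
  define M where "M = NN (s + 2) (W i 0) + NN (s + 1) (W i 1)"
  have "Nj s (GG ph i) = 0" using N0[of s] by (simp add: GG0[abs_def])
  then have "Nj (s + 2) (ext (W i 0) (W i 1) (GG ph i)) <= ennreal C3 * M"
   by (intro C3(2) M'(4,5) GG_jet p) (auto simp: M_def)
  also have "... < \<infinity>" using N[of i] by (simp add: M_def ennreal_mult_less_top)
  finally show ?thesis .
 qed
 show ?thesis by (rule rep_Hspace[OF M'(1) ext_rep[OF M'(1,2,3) Nf]])
qed

text \<open>In coefficients the source is \<open>c\<close> times the convolution
  \<open>TE E\<close>; \<open>product_jet\<close> gives its jet, and \<open>fc_mult\<close> on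
  almost every slice identifies the two.\<close>

lemma source_jets:
 assumes g: "good m E"
 obtains C where "C >= 0" "!!V. V \<in> Hspace D m ==> \<exists>ph. src m (%x. (c * E x) *s V x) ph \<and>
   (\<Sum>i\<in>UNIV. Nj m (ph i)) <= ennreal C * Hnorm_sq D m V"
proof -
 obtain C where C: "C >= 0" "!!w. jet m w ==> Nj m w < \<infinity> ==>
   (\<exists>w'. jet m w' \<and> w' 0 = TE E (w 0) \<and> Nj m w' <= ennreal C * Nj m w)" using product_jet[OF g] by blast
 obtain M where M: "!!p. p \<in> slab D ==> norm (E p) <= M" "M >= 0" using good_bound[OF g] by blast
 have Em: "E \<in> borel_measurable SM"
 proof -
  have "continuous_on (S_v D) E" by (rule continuous_on_subset[OF good_cont[OF g] S_v_slab])
  then have "E \<in> borel_measurable (restrict_space borel (S_v D))" by (rule borel_measurable_continuous_on_restrict)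
  then show ?thesis by (simp add: measurable_def space_restrict_space sets_restrict_space)
 qed
 show ?thesis
 proof (rule that[of "(norm c)\<^sup>2 * C"])
  show "0 <= (norm c)\<^sup>2 * C" using C by simp
  fix V assume V: "V \<in> Hspace D m"
  define W where "W = (%i j k z. wderiv h j (hat D V (fst k) (snd k)) z $ i)"
  have b: "basic V" by (rule Hspace_basic[OF V])
  have r: "rep m V W" unfolding W_def by (rule Hspace_rep[OF V])
  have Wj: "jet m (W i)" "Nj m (W i) < \<infinity>" "!!k. AE z in HM. W i 0 k z = hat D V (fst k) (snd k) z $ i" for i
   using r unfolding rep_def by blast+
  have "\<forall>i. \<exists>w'. jet m w' \<and> w' 0 = TE E (W i 0) \<and> Nj m w' <= ennreal C * Nj m (W i)" using C(2) Wj by blast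
  then obtain w' where w': "!!i. jet m (w' i)" "!!i. w' i 0 = TE E (W i 0)" "!!i. Nj m (w' i) <= ennreal C * Nj m (W i)" by metis
  define ph where "ph i j k z = c * w' i j k z" for i j k z
  have L: "L2 SM (%x. ((c * E x) *s V x) $ i)" for i
  proof -
   have "L2 SM (%x. E x * (V x $ i))" by (rule L2_bounded_mult(1)[OF basic_L2[OF b] Em]) (use M S_v_slab in auto)
   then have "L2 SM (%x. c * (E x * (V x $ i)))" by (rule L2_cmult)
   then show ?thesis by (simp add: mult.assoc)
  qed
  have j: "jet m (ph i)" for i unfolding ph_def[abs_def] by (rule jet_coeff[OF w'(1)])
  have e: "AE z in HM. ph i 0 k z = fc (slice (%x. ((c * E x) *s V x) $ i) z) k" for i k
  proof -
   have "AE z in HM. \<forall>k. W i 0 k z = hat D V (fst k) (snd k) z $ i" unfolding AE_all_countable using Wj(3) by blast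
   moreover have "AE z in HM. z \<in> space HM" by (rule AE_space)
   ultimately show ?thesis using hat_AE[OF b] L2_slices[OF basic_L2[OF b, of i]]
   proof eventually_elim
    case (elim z)
    then have z: "\<bar>z\<bar> < h" by auto
    have W0: "(%k. W i 0 k z) = fc (slice (%x. V x $ i) z)" using elim by auto
    have "slice (%x. ((c * E x) *s V x) $ i) z = (%p. c * (slice E z p * slice (%x. V x $ i) z p))" by (auto simp: slice_def mult.assoc)
    then have "fc (slice (%x. ((c * E x) *s V x) $ i) z) k = c * T (slice E z) (fc (slice (%x. V x $ i) z)) k"
     using fc_mult[OF good_slice_bddm[OF g M(1) z] elim(4)] by (simp add: fc_cmult)
    then show ?case by (simp add: ph_def w'(2) TE_def W0)
   qed
  qed
  have N: "Nj m (ph i) <= ennreal ((norm c)\<^sup>2 * C) * Nj m (W i)" for i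
  proof -
   have "Nj m (ph i) <= ennreal ((norm c)\<^sup>2) * Nj (m + 0) (w' i)" unfolding ph_def[abs_def]
    by (rule Nj_coeff) (use w'(1)[of i] in \<open>auto simp: jet_def\<close>)
   also have "... <= ennreal ((norm c)\<^sup>2) * (ennreal C * Nj m (W i))" using w'(3)[of i] by (intro mult_left_mono) auto
   finally show ?thesis using C(1) by (simp add: ennreal_mult mult.assoc)
  qed
  have f: "Nj m (ph i) < \<infinity>" for i by (rule order.strict_trans1[OF N]) (use Wj(2)[of i] in \<open>simp add: ennreal_mult_less_top\<close>)
  have "(\<Sum>i\<in>UNIV. Nj m (ph i)) <= ennreal ((norm c)\<^sup>2 * C) * Hnorm_sq D m V"
   unfolding Hnorm_sq_rep[OF b r] sum_distrib_left by (intro sum_mono N)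
  then show "\<exists>ph. src m (%x. (c * E x) *s V x) ph \<and>
   (\<Sum>i\<in>UNIV. Nj m (ph i)) <= ennreal ((norm c)\<^sup>2 * C) * Hnorm_sq D m V"
   using L j e f unfolding src_def by blast
 qed
qed

lemma iterate_bound:
 assumes kk: "kk > 0" and u: unique_modes and g: "good (s + 2) E"
 obtains C where "C >= 0" "!!V V'. V \<in> Hspace D (s + 2) ==> solves D (%x. (c * E x) *s V x) (%_. 0) V' ==>
   V' \<in> Hspace D (s + 2) \<and> Hnorm_sq D (s + 2) V' <= ennreal C * Hnorm_sq D (s + 2) V"
proof -
 obtain C1 where C1: "C1 >= 0" "!!F V ph. solves D F (%_. 0) V ==> src (s + 2) F ph ==>
   V \<in> Hspace D (s + 2) \<and> Hnorm_sq D (s + 2) V <= ennreal C1 * (\<Sum>i\<in>UNIV. Nj (s + 2) (ph i))"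
  using regular_step[OF kk u] by blast
 obtain C2 where C2: "C2 >= 0" "!!V. V \<in> Hspace D (s + 2) ==> \<exists>ph. src (s + 2) (%x. (c * E x) *s V x) ph \<and>
   (\<Sum>i\<in>UNIV. Nj (s + 2) (ph i)) <= ennreal C2 * Hnorm_sq D (s + 2) V"
  using source_jets[OF g] by blast
 show ?thesis
 proof (rule that[of "C1 * C2"])
  show "0 <= C1 * C2" using C1 C2 by simp
  fix V V' assume V: "V \<in> Hspace D (s + 2)" and s: "solves D (%x. (c * E x) *s V x) (%_. 0) V'"
  obtain ph where p: "src (s + 2) (%x. (c * E x) *s V x) ph"
   "(\<Sum>i\<in>UNIV. Nj (s + 2) (ph i)) <= ennreal C2 * Hnorm_sq D (s + 2) V" using C2(2)[OF V] by blast
  from C1(2)[OF s p(1)]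
  have 1: "V' \<in> Hspace D (s + 2)" "Hnorm_sq D (s + 2) V' <= ennreal C1 * (\<Sum>i\<in>UNIV. Nj (s + 2) (ph i))" by blast+
  note 1(2)
  also have "ennreal C1 * (\<Sum>i\<in>UNIV. Nj (s + 2) (ph i)) <= ennreal C1 * (ennreal C2 * Hnorm_sq D (s + 2) V)"
   by (intro mult_left_mono p(2)) simp
  finally show "V' \<in> Hspace D (s + 2) \<and> Hnorm_sq D (s + 2) V' <= ennreal (C1 * C2) * Hnorm_sq D (s + 2) V"
   using 1(1) C1(1) C2(1) by (simp add: ennreal_mult mult.assoc)
 qed
qed

end

section \<open>Convergence of the series\<close>

abbreviation ct :: "nat measure" where "ct \<equiv> count_space UNIV"

lemma geometric_nn: "(\<integral>\<^sup>+ l. ennreal ((1 / 2) ^ l) \<partial>ct) = 2"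
proof -
 have "(\<integral>\<^sup>+ l. ennreal ((1 / 2) ^ l) \<partial>ct) = (\<Sum>l. ennreal ((1 / 2) ^ l))" by (rule nn_integral_count_space_nat)
 also have "... = ennreal (\<Sum>l. (1 / 2) ^ l)" by (intro suminf_ennreal2) (auto simp: summable_geometric)
 also have "(\<Sum>l. (1 / 2) ^ l) = (2 :: real)" by (simp add: suminf_geometric)
 finally show ?thesis by simp
qed

text \<open>Cauchy-Schwarz with weights \<open>(1 / 2) ^ l\<close> and \<open>2 ^ l\<close>; the
  factor 2 is the sum of the geometric series. Convergence can thus be discussed in squared norms
  and by Tonelli, without completeness of \<open>Hspace\<close>.\<close>

lemma weighted_sum_sq:
 fixes a :: "nat => complex"
 shows "(\<integral>\<^sup>+ l. ennreal (norm (a l)) \<partial>ct)\<^sup>2 <= 2 * (\<integral>\<^sup>+ l. ennreal (2 ^ l) * ennreal ((norm (a l))\<^sup>2) \<partial>ct)"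
proof -
 have s: "sqrt ((1 / 2) ^ l) * sqrt (2 ^ l) = (1 :: real)" for l
  by (simp add: real_sqrt_mult[symmetric] power_mult_distrib[symmetric])
 have "(\<integral>\<^sup>+ l. ennreal (norm (a l)) \<partial>ct) = (\<integral>\<^sup>+ l. ennreal (sqrt ((1 / 2) ^ l)) * ennreal (sqrt (2 ^ l) * norm (a l)) \<partial>ct)"
 proof (intro nn_integral_cong)
  fix l
  have "norm (a l) = sqrt ((1 / 2) ^ l) * (sqrt (2 ^ l) * norm (a l))" using s[of l] by (metis mult.assoc mult_1)
  then show "ennreal (norm (a l)) = ennreal (sqrt ((1 / 2) ^ l)) * ennreal (sqrt (2 ^ l) * norm (a l))"
   by (metis ennreal_mult real_sqrt_ge_zero mult_nonneg_nonneg norm_ge_zero zero_le_power zero_le_numeral zero_le_divide_1_iff)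
 qed
 then have "(\<integral>\<^sup>+ l. ennreal (norm (a l)) \<partial>ct)\<^sup>2 \<le>
   (\<integral>\<^sup>+ l. (ennreal (sqrt ((1 / 2) ^ l)))\<^sup>2 \<partial>ct) * (\<integral>\<^sup>+ l. (ennreal (sqrt (2 ^ l) * norm (a l)))\<^sup>2 \<partial>ct)"
  by (simp only:) (rule Cauchy_Schwarz_nn_integral; simp)
 also have "(\<integral>\<^sup>+ l. (ennreal (sqrt ((1 / 2) ^ l)))\<^sup>2 \<partial>ct) = (\<integral>\<^sup>+ l. ennreal ((1 / 2) ^ l) \<partial>ct)"
 proof (intro nn_integral_cong)
  fix l :: nat
  show "(ennreal (sqrt ((1 / 2) ^ l)))\<^sup>2 = ennreal ((1 / 2) ^ l)"
   using real_sqrt_pow2[of "(1 / 2) ^ l"] by (simp add: ennreal_power)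
 qed
 also have "... = 2" by (rule geometric_nn)
 also have "(\<integral>\<^sup>+ l. (ennreal (sqrt (2 ^ l) * norm (a l)))\<^sup>2 \<partial>ct) = (\<integral>\<^sup>+ l. ennreal (2 ^ l) * ennreal ((norm (a l))\<^sup>2) \<partial>ct)"
  by (intro nn_integral_cong) (simp add: ennreal_power power_mult_distrib ennreal_mult)
 finally show ?thesis .
qed

lemma sqn_series:
 fixes a :: "nat => 'a => complex"
 assumes M: "sigma_finite_measure M" and a: "!!l. a l \<in> borel_measurable M"
 shows "(\<integral>\<^sup>+ x. (\<integral>\<^sup>+ l. ennreal (norm (a l x)) \<partial>ct)\<^sup>2 \<partial>M) <= 2 * (\<integral>\<^sup>+ l. ennreal (2 ^ l) * sqn M (a l) \<partial>ct)"
  "sqn M (%x. LINT l|ct. a l x) <= 2 * (\<integral>\<^sup>+ l. ennreal (2 ^ l) * sqn M (a l) \<partial>ct)"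
proof -
 have [measurable]: "a l \<in> borel_measurable M" for l by (rule a)
 have "(\<integral>\<^sup>+ x. (\<integral>\<^sup>+ l. ennreal (norm (a l x)) \<partial>ct)\<^sup>2 \<partial>M) <= (\<integral>\<^sup>+ x. 2 * (\<integral>\<^sup>+ l. ennreal (2 ^ l) * ennreal ((norm (a l x))\<^sup>2) \<partial>ct) \<partial>M)"
  by (intro nn_integral_mono weighted_sum_sq)
 also have "... = 2 * (\<integral>\<^sup>+ x. (\<integral>\<^sup>+ l. ennreal (2 ^ l) * ennreal ((norm (a l x))\<^sup>2) \<partial>ct) \<partial>M)"
  by (intro nn_integral_cmult meas_count) measurable
 also have "(\<integral>\<^sup>+ x. (\<integral>\<^sup>+ l. ennreal (2 ^ l) * ennreal ((norm (a l x))\<^sup>2) \<partial>ct) \<partial>M) = (\<integral>\<^sup>+ l. ennreal (2 ^ l) * sqn M (a l) \<partial>ct)"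
  by (subst nn_count_swap[OF M]) (auto simp: sqn_def nn_integral_cmult intro!: nn_integral_cong)
 finally show 1: "(\<integral>\<^sup>+ x. (\<integral>\<^sup>+ l. ennreal (norm (a l x)) \<partial>ct)\<^sup>2 \<partial>M) <= 2 * (\<integral>\<^sup>+ l. ennreal (2 ^ l) * sqn M (a l) \<partial>ct)" .
 have "sqn M (%x. LINT l|ct. a l x) <= (\<integral>\<^sup>+ x. (\<integral>\<^sup>+ l. ennreal (norm (a l x)) \<partial>ct)\<^sup>2 \<partial>M)"
  unfolding sqn_def
 proof (intro nn_integral_mono)
  fix x
  \<comment> \<open>Where the series is not absolutely summable the integral is 0 by default, so the
    bound holds for every \<open>x\<close>.\<close>
  have "ennreal (norm (LINT l|ct. a l x)) <= (\<integral>\<^sup>+ l. ennreal (norm (a l x)) \<partial>ct)"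
   by (cases "integrable ct (%l. a l x)") (auto simp: integral_norm_bound_ennreal not_integrable_integral_eq)
  then have "(ennreal (norm (LINT l|ct. a l x)))\<^sup>2 <= (\<integral>\<^sup>+ l. ennreal (norm (a l x)) \<partial>ct)\<^sup>2" by (intro power_mono) auto
  then show "ennreal ((norm (LINT l|ct. a l x))\<^sup>2) <= (\<integral>\<^sup>+ l. ennreal (norm (a l x)) \<partial>ct)\<^sup>2" by (simp add: ennreal_power)
 qed
 then show "sqn M (%x. LINT l|ct. a l x) <= 2 * (\<integral>\<^sup>+ l. ennreal (2 ^ l) * sqn M (a l) \<partial>ct)" using 1 by (rule order_trans)
qed

text \<open>On a finite measure space \<open>F <= 1 + F\<^sup>2\<close> turns the bound for the
  squared sum into one for the sum.\<close>

lemma abs_series_finite: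
 fixes a :: "nat => 'a => complex"
 assumes M: "finite_measure M" and a: "!!l. a l \<in> borel_measurable M"
  and f: "(\<integral>\<^sup>+ l. ennreal (2 ^ l) * sqn M (a l) \<partial>ct) < \<infinity>"
 shows "(\<integral>\<^sup>+ x. (\<integral>\<^sup>+ l. ennreal (norm (a l x)) \<partial>ct) \<partial>M) < \<infinity>"
proof -
 interpret finite_measure M by (rule M)
 have [measurable]: "a l \<in> borel_measurable M" for l by (rule a)
 define F where "F x = (\<integral>\<^sup>+ l. ennreal (norm (a l x)) \<partial>ct)" for x
 have [measurable]: "F \<in> borel_measurable M" unfolding F_def by (intro meas_count) measurable
 have "(\<integral>\<^sup>+ x. F x \<partial>M) <= (\<integral>\<^sup>+ x. 1 + (F x)\<^sup>2 \<partial>M)"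
 proof (intro nn_integral_mono)
  fix x show "F x <= 1 + (F x)\<^sup>2"
  proof (cases "F x <= 1")
   case True then show ?thesis by (simp add: add_increasing2)
  next
   case False
   then have "F x * 1 <= F x * F x" by (intro mult_left_mono) auto
   then show ?thesis by (simp add: power2_eq_square add_increasing)
  qed
 qed
 also have "... = emeasure M (space M) + (\<integral>\<^sup>+ x. (F x)\<^sup>2 \<partial>M)" by (subst nn_integral_add) auto
 also have "... < \<infinity>"
 proof -
  have "(\<integral>\<^sup>+ x. (F x)\<^sup>2 \<partial>M) <= 2 * (\<integral>\<^sup>+ l. ennreal (2 ^ l) * sqn M (a l) \<partial>ct)"
   unfolding F_def by (rule sqn_series(1)[OF sigma_finite_measure_axioms a])
  also have "... < \<infinity>" using f by (simp add: ennreal_mult_less_top)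
  finally show ?thesis using emeasure_finite[of "space M"] by (simp add: less_top[symmetric])
 qed
 finally show ?thesis unfolding F_def .
qed

context grid
begin

lemma NN_cong_AE:
 assumes "mmeas u" "mmeas v" "!!k. AE z in HM. u k z = v k z" shows "NN n u = NN n v"
 unfolding NN_swap[OF assms(1)] NN_swap[OF assms(2)] using assms(3)[THEN sqn_cong_AE] by simp

lemma sqn_le_NN: "mmeas v ==> sqn HM (v k) <= NN n v"
proof -
 assume v: "mmeas v"
 have "1 * sqn HM (v k) <= ennreal (jw k ^ n) * sqn HM (v k)"
  using jw_ge_1[of k] by (intro mult_right_mono) (auto simp: ennreal_ge_1)
 also have "... <= NN n v" unfolding NN_swap[OF v]
  using sum_le_nn_count[of "{k}" "%k. ennreal (jw k ^ n) * sqn HM (v k)"] by simp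
 finally show ?thesis by simp
qed

lemma IM_sf: "sigma_finite_measure HM" by unfold_locales

lemma SM_fin: "finite_measure SM"
 by (rule finite_measure_restrict_bounded[OF _ S_v_borel]) (simp add: S_v_def bounded_Times)

lemma NN_series:
 assumes v: "!!l. mmeas (v l)"
 shows "NN n (%k z. LINT l|ct. v l k z) <= 2 * (\<integral>\<^sup>+ l. ennreal (2 ^ l) * NN n (v l) \<partial>ct)"
proof -
 have m: "mmeas (%k z. LINT l|ct. v l k z)" by (rule mmeasI, rule meas_count_integral, rule mmeasD, rule v)
 have "NN n (%k z. LINT l|ct. v l k z) <= (\<integral>\<^sup>+ k. ennreal (jw k ^ n) * (2 * (\<integral>\<^sup>+ l. ennreal (2 ^ l) * sqn HM (v l k) \<partial>ct)) \<partial>modes)"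
  unfolding NN_swap[OF m] by (rule nn_integral_mono, rule mult_left_mono[OF sqn_series(2)[OF IM_sf mmeasD[OF v]]], simp)
 also have "... = (\<integral>\<^sup>+ k. 2 * (\<integral>\<^sup>+ l. ennreal (2 ^ l) * (ennreal (jw k ^ n) * sqn HM (v l k)) \<partial>ct) \<partial>modes)"
 proof (intro nn_integral_cong)
  fix k
  have "(\<integral>\<^sup>+ l. ennreal (2 ^ l) * (ennreal (jw k ^ n) * sqn HM (v l k)) \<partial>ct) = (\<integral>\<^sup>+ l. ennreal (jw k ^ n) * (ennreal (2 ^ l) * sqn HM (v l k)) \<partial>ct)"
   by (intro nn_integral_cong mult.left_commute)
  also have "... = ennreal (jw k ^ n) * (\<integral>\<^sup>+ l. ennreal (2 ^ l) * sqn HM (v l k) \<partial>ct)" by (rule nn_integral_cmult) simp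
  finally show "ennreal (jw k ^ n) * (2 * (\<integral>\<^sup>+ l. ennreal (2 ^ l) * sqn HM (v l k) \<partial>ct)) = 2 * (\<integral>\<^sup>+ l. ennreal (2 ^ l) * (ennreal (jw k ^ n) * sqn HM (v l k)) \<partial>ct)"
   by (simp only: mult.left_commute)
 qed
 also have "... = 2 * (\<integral>\<^sup>+ k. (\<integral>\<^sup>+ l. ennreal (2 ^ l) * (ennreal (jw k ^ n) * sqn HM (v l k)) \<partial>ct) \<partial>modes)"
  by (rule nn_integral_cmult) simp
 also have "(\<integral>\<^sup>+ k. (\<integral>\<^sup>+ l. ennreal (2 ^ l) * (ennreal (jw k ^ n) * sqn HM (v l k)) \<partial>ct) \<partial>modes) =
   (\<integral>\<^sup>+ l. (\<integral>\<^sup>+ k. ennreal (2 ^ l) * (ennreal (jw k ^ n) * sqn HM (v l k)) \<partial>modes) \<partial>ct)"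
  by (rule nn_count_swap) (auto simp: sigma_finite_measure_count_space)
 also have "... = (\<integral>\<^sup>+ l. ennreal (2 ^ l) * NN n (v l) \<partial>ct)"
  unfolding NN_swap[OF v] by (intro nn_integral_cong nn_integral_cmult) auto
 finally show ?thesis .
qed

lemma Nj_series:
 assumes v: "!!l. jet m (W l)"
 shows "Nj m (%j k z. LINT l|ct. W l j k z) <= 2 * (\<integral>\<^sup>+ l. ennreal (2 ^ l) * Nj m (W l) \<partial>ct)"
proof -
 have "Nj m (%j k z. LINT l|ct. W l j k z) <= (\<Sum>j\<le>m. 2 * (\<integral>\<^sup>+ l. ennreal (2 ^ l) * NN (m - j) (W l j) \<partial>ct))"
  unfolding Nj_def using v by (intro sum_mono NN_series) (auto simp: jet_def)
 also have "... = 2 * (\<integral>\<^sup>+ l. ennreal (2 ^ l) * Nj m (W l) \<partial>ct)"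
  unfolding Nj_def sum_distrib_left by (subst nn_integral_sum) (auto simp: sum_distrib_left)
 finally show ?thesis .
qed

text \<open>Each order is dominated by its share of \<open>Nj\<close>, so \<open>wd_sum\<close>
  applies between consecutive orders.\<close>

lemma jet_series:
 assumes v: "!!l. jet m (W l)" and f: "(\<integral>\<^sup>+ l. ennreal (2 ^ l) * Nj m (W l) \<partial>ct) < \<infinity>"
 shows "jet m (%j k z. LINT l|ct. W l j k z)"
 unfolding jet_def
proof (intro conjI allI impI)
 have Wm: "mmeas (W l j)" if "j <= m" for l j using v[of l] that by (auto simp: jet_def)
 show "mmeas (%k z. LINT l|ct. W l j k z)" if "j <= m" for j by (rule mmeasI, rule meas_count_integral, rule mmeasD, rule Wm, rule that)
 have fin: "(\<integral>\<^sup>+ z. (\<integral>\<^sup>+ l. ennreal (norm (W l j k z)) \<partial>ct) \<partial>HM) < \<infinity>" if j: "j <= m" for j k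
 proof (rule abs_series_finite[OF finite_measure_IM mmeasD[OF Wm[OF j]]])
  have "(\<integral>\<^sup>+ l. ennreal (2 ^ l) * sqn HM (W l j k) \<partial>ct) <= (\<integral>\<^sup>+ l. ennreal (2 ^ l) * Nj m (W l) \<partial>ct)"
  proof (intro nn_integral_mono mult_left_mono)
   fix l show "sqn HM (W l j k) <= Nj m (W l)"
    using sqn_le_NN[OF Wm[OF j], of l k "m - j"] NN_le_Nj[OF j, of "W l"] by (rule order_trans)
  qed simp
  then show "(\<integral>\<^sup>+ l. ennreal (2 ^ l) * sqn HM (W l j k) \<partial>ct) < \<infinity>" using f by (rule order.strict_trans1)
 qed
 fix j k assume j: "j < m"
 show "wd h (%z. LINT l|ct. W l j k z) (%z. LINT l|ct. W l (Suc j) k z)"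
  by (rule wd_sum[OF jetD[OF v j] fin fin]) (use j in auto)
qed

lemma rep_fc:
 assumes b: "basic u" and r: "rep m u W" shows "AE z in HM. \<forall>i k. W i 0 k z = fc (slice (%x. u x $ i) z) k"
proof -
 have "AE z in HM. W i 0 k z = hat D u (fst k) (snd k) z $ i" for i k using r unfolding rep_def by blast
 then have "AE z in HM. \<forall>i k. W i 0 k z = hat D u (fst k) (snd k) z $ i" unfolding AE_all_countable by blast
 then show ?thesis using hat_AE[OF b] by eventually_elim auto
qed

lemma repI:
 assumes b: "basic u" and j: "!!i. jet m (W i)" "!!i. Nj m (W i) < \<infinity>"
  and e: "!!i k. AE z in HM. W i 0 k z = fc (slice (%x. u x $ i) z) k"
 shows "rep m u W"
 unfolding rep_def
proof (intro allI conjI j)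
 fix i k show "AE z in HM. W i 0 k z = hat D u (fst k) (snd k) z $ i"
  using e[of i k] hat_AE[OF b] by eventually_elim auto
qed

lemma rep_sqn:
 assumes b: "basic u" and r: "rep m u W" shows "sqn SM (%x. u x $ i) <= ennreal area * Nj m (W i)"
proof -
 have L: "L2 SM (%x. u x $ i)" by (rule basic_L2[OF b])
 have W: "mmeas (W i 0)" using r by (auto simp: rep_def jet_def)
 have fm: "mmeas (%k z. fc (slice (%x. u x $ i) z) k)" using L by (intro mmeasI fc_slice_meas) (simp add: L2_def)
 have "NN 0 (%k z. fc (slice (%x. u x $ i) z) k) = NN 0 (W i 0)"
  by (rule NN_cong_AE[OF fm W]) (use rep_fc[OF b r] in \<open>auto elim!: eventually_mono\<close>)
 also have "... <= Nj m (W i)" using NN_mono[of 0 m "W i 0"] NN_le_Nj[of 0 m "W i"] by (auto intro: order_trans)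
 finally show ?thesis unfolding parseval_SM[OF L] by (rule mult_left_mono) simp
qed

text \<open>Elements of \<open>Hspace\<close> are functions, so a change on a null set has to be
  justified: by Parseval the difference has coefficients that vanish almost everywhere.\<close>

lemma rep_cong_AE:
 assumes u: "basic u" and v: "basic v" and e: "AE x in SM. u x = v x" and r: "rep m u W"
 shows "rep m v W"
proof (rule repI[OF v])
 show "jet m (W i)" "Nj m (W i) < \<infinity>" for i using r by (auto simp: rep_def)
 fix i k
 define d where "d x = u x $ i - v x $ i" for x
 have L: "L2 SM d" unfolding d_def[abs_def] by (intro L2_diff basic_L2 u v)
 have "AE x in SM. d x = 0" using e by eventually_elim (simp add: d_def)
 then have "sqn SM d = sqn SM (%x. 0)" by (rule sqn_cong_AE)
 then have 0: "NN 0 (%k z. fc (slice d z) k) = 0" using parseval_SM[OF L] area by (simp add: sqn_def)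
 have dm: "mmeas (%k z. fc (slice d z) k)" using L by (intro mmeasI fc_slice_meas) (simp add: L2_def)
 have "sqn HM (%z. fc (slice d z) k) = 0" using sqn_le_NN[OF dm, of k 0] 0 by simp
 then have "AE z in HM. fc (slice d z) k = 0" using mmeasD[OF dm, of k] unfolding sqn_def
  by (subst (asm) nn_integral_0_iff_AE) auto
 then show "AE z in HM. W i 0 k z = fc (slice (%x. v x $ i) z) k"
  using rep_fc[OF u r] L2_slices[OF L] L2_slices[OF basic_L2[OF v, of i]]
 proof eventually_elim
  case (elim z)
  have "slice (%x. u x $ i) z = (%p. slice d z p + slice (%x. v x $ i) z p)" by (auto simp: slice_def d_def)
  then have "fc (slice (%x. u x $ i) z) k = fc (slice d z) k + fc (slice (%x. v x $ i) z) k" using fc_add[OF elim(3,4)] by simp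
  then show ?case using elim(1) elim(2)[rule_format, of i k] by simp
 qed
qed

lemma basicI:
 assumes q: "quasiperiodic D u" and m: "!!i. (%x. indicator (slab D) x *\<^sub>R (u x $ i)) \<in> borel_measurable lborel" and L: "!!i. sqn SM (%x. u x $ i) < \<infinity>"
 shows "basic u"
proof -
 have s: "S_v D \<in> sets lborel" using S_v_borel by simp
 have "(%x. u x $ i) \<in> borel_measurable SM" for i
  by (rule measurable_cong[THEN iffD1, rotated, OF measurable_restrict_space1[OF m]]) (use S_v_slab in auto)
 then have "integrable SM (%x. (norm (u x $ i))\<^sup>2)" for i using L[of i] L2_integrable_sq[of SM "%x. u x $ i"] by (simp add: L2_sqn)
 then have "integrable SM (%x. (norm (u x))\<^sup>2)" unfolding norm_vec_sq by (intro Bochner_Integration.integrable_sum) auto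
 then have "set_integrable lborel (S_v D) (%x. (norm (u x))\<^sup>2)" using s by (simp add: set_integrable_def integrable_restrict_space)
 moreover have "set_borel_measurable lborel (slab D) u" unfolding set_borel_measurable_def vec_meas_iff using m by simp
 ultimately show ?thesis using q by (simp add: basic_def)
qed

lemma basicD:
 assumes "basic u"
 shows "(%x. indicator (slab D) x *\<^sub>R (u x $ i)) \<in> borel_measurable lborel" "sqn SM (%x. u x $ i) < \<infinity>"
  "\<bar>z\<bar> < h ==> u (x + dx, y, z) = exp (\<i> * of_real (alpha D * dx)) *s u (x, y, z)"
  "\<bar>z\<bar> < h ==> u (x, y + dy, z) = exp (\<i> * of_real (beta D * dy)) *s u (x, y, z)"
 using assms basic_L2[OF assms, of i] by (auto simp: basic_def set_borel_measurable_def vec_meas_iff L2_sqn quasiperiodic_def)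

lemma basic_cmult: "basic u ==> basic (%x. c *s u x)"
proof (rule basicI)
 assume b: "basic u"
 show "quasiperiodic D (%x. c *s u x)" using basicD(3,4)[OF b] by (simp add: quasiperiodic_def vector_smult_assoc mult.commute)
 show "(%x. indicator (slab D) x *\<^sub>R ((c *s u x) $ i)) \<in> borel_measurable lborel" for i
  using borel_measurable_times[OF borel_measurable_const[of c] basicD(1)[OF b, of i]] by simp
 show "sqn SM (%x. (c *s u x) $ i) < \<infinity>" for i using L2_cmult[OF basic_L2[OF b, of i], of c] by (simp add: L2_sqn)
qed

lemma basic_diff: "basic u ==> basic v ==> basic (%x. u x - v x)"
proof (rule basicI)
 assume u: "basic u" and v: "basic v"
 show "quasiperiodic D (%x. u x - v x)" using basicD(3,4)[OF u] basicD(3,4)[OF v] by (simp add: quasiperiodic_def vector_sub_rdistrib vec_eq_iff algebra_simps)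
 show "(%x. indicator (slab D) x *\<^sub>R ((u x - v x) $ i)) \<in> borel_measurable lborel" for i
  using borel_measurable_diff[OF basicD(1)[OF u, of i] basicD(1)[OF v, of i]] by (simp add: scaleR_diff_right)
 show "sqn SM (%x. (u x - v x) $ i) < \<infinity>" for i using L2_diff[OF basic_L2[OF u, of i] basic_L2[OF v, of i]] by (simp add: L2_sqn)
qed

lemma rep_cmult:
 assumes b: "basic u" and r: "rep m u W"
 shows "rep m (%x. c *s u x) (%i j k z. c * W i j k z)" "Nj m (%j k z. c * W i j k z) <= ennreal ((norm c)\<^sup>2) * Nj m (W i)"
proof -
 have W: "jet m (W i)" "Nj m (W i) < \<infinity>" for i using r by (auto simp: rep_def)
 show N: "Nj m (%j k z. c * W i j k z) <= ennreal ((norm c)\<^sup>2) * Nj m (W i)" for i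
  using Nj_coeff[of m "W i" "(norm c)\<^sup>2" "%_. c" 0] W(1)[of i] by (auto simp: jet_def)
 show "rep m (%x. c *s u x) (%i j k z. c * W i j k z)"
 proof (rule repI[OF basic_cmult[OF b]])
  show "jet m (%j k z. c * W i j k z)" for i by (rule jet_coeff[OF W(1)])
  show "Nj m (%j k z. c * W i j k z) < \<infinity>" for i by (rule order.strict_trans1[OF N]) (use W(2)[of i] in \<open>simp add: ennreal_mult_less_top\<close>)
  fix i k
  show "AE z in HM. c * W i 0 k z = fc (slice (%x. (c *s u x) $ i) z) k"
   using rep_fc[OF b r]
  proof eventually_elim
   case (elim z)
   have "slice (%x. (c *s u x) $ i) z = (%p. c * slice (%x. u x $ i) z p)" by (auto simp: slice_def)
   then show ?case using elim[rule_format, of i k] by (simp add: fc_cmult)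
  qed
 qed
qed

lemma Hspace_cmult:
 assumes u: "u \<in> Hspace D m"
 shows "(%x. c *s u x) \<in> Hspace D m" "Hnorm_sq D m (%x. c *s u x) <= ennreal ((norm c)\<^sup>2) * Hnorm_sq D m u"
proof -
 note b = Hspace_basic[OF u] and r = Hspace_rep[OF u]
 show "(%x. c *s u x) \<in> Hspace D m" by (rule rep_Hspace[OF basic_cmult[OF b] rep_cmult(1)[OF b r]])
 show "Hnorm_sq D m (%x. c *s u x) <= ennreal ((norm c)\<^sup>2) * Hnorm_sq D m u"
  unfolding Hnorm_sq_rep[OF b r] Hnorm_sq_rep[OF basic_cmult[OF b] rep_cmult(1)[OF b r]] sum_distrib_left
  by (intro sum_mono rep_cmult(2)[OF b r])
qed

text \<open>A pointwise sum: a component is 0 where it does not converge absolutely. This default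
  respects the phase factors, so quasiperiodicity holds at every point of the slab.\<close>

definition ser :: "(nat => space => complex^3) => space => complex^3" where
 "ser u x = (\<chi> i. LINT l|ct. u l x $ i)"

lemma slice_nn_AE:
 fixes F :: "space => ennreal"
 assumes F: "F \<in> borel_measurable SM" "(\<integral>\<^sup>+ x. F x \<partial>SM) < \<infinity>"
 shows "AE z in HM. (\<integral>\<^sup>+ p. slice F z p \<partial>GM) < \<infinity>"
proof -
 note m = XYI_nn(1)[OF F(1)]
 have e: "(\<integral>\<^sup>+ z. \<integral>\<^sup>+ p. slice F z p \<partial>GM \<partial>HM) = (\<integral>\<^sup>+ x. F x \<partial>SM)"
  using GI.nn_integral_snd[OF m] XYI_nn(2)[OF F(1)] by (simp add: slice_def)
 have "(%z. \<integral>\<^sup>+ p. slice F z p \<partial>GM) \<in> borel_measurable HM"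
  using sigma_finite_measure.borel_measurable_nn_integral[OF sigma_finite_restrict[OF Gam_borel], of "%z p. slice F z p" "HM"]
   measurable_compose[OF measurable_pair_swap' m]
  by (simp add: slice_def case_prod_unfold)
 from nn_integral_PInf_AE[OF this] show ?thesis using F(2) unfolding e
  by (auto simp: less_top[symmetric] elim!: eventually_mono)
qed

text \<open>The weighted sum of norms gives absolute convergence almost everywhere in the cell and
  in the mean on almost every slice; Fubini then shows that coefficients of the sum are sums of
  coefficients.\<close>

lemma ser_rep:
 assumes b: "!!l. basic (u l)" and r: "!!l. rep m (u l) (W l)"
  and f: "(\<integral>\<^sup>+ l. ennreal (2 ^ l) * Hnorm_sq D m (u l) \<partial>ct) < \<infinity>"
 shows "basic (ser u)" "rep m (ser u) (%i j k z. LINT l|ct. W l i j k z)"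
  "Hnorm_sq D m (ser u) <= 2 * (\<integral>\<^sup>+ l. ennreal (2 ^ l) * Hnorm_sq D m (u l) \<partial>ct)"
  "AE x in SM. \<forall>i. integrable ct (%l. u l x $ i)"
proof -
 have W: "jet m (W l i)" "Nj m (W l i) < \<infinity>" for l i using r[of l] by (auto simp: rep_def)
 have NH: "Nj m (W l i) <= Hnorm_sq D m (u l)" for l i
  unfolding Hnorm_sq_rep[OF b r] by (rule member_le_sum) auto
 have fW: "(\<integral>\<^sup>+ l. ennreal (2 ^ l) * Nj m (W l i) \<partial>ct) < \<infinity>" for i
  by (rule order.strict_trans1[OF _ f]) (intro nn_integral_mono mult_left_mono NH; simp)
 have um: "(%x. u l x $ i) \<in> borel_measurable SM" for l i using basic_L2[OF b] by (simp add: L2_def)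
 have fS: "(\<integral>\<^sup>+ l. ennreal (2 ^ l) * sqn SM (%x. u l x $ i) \<partial>ct) < \<infinity>" for i
 proof -
  have "(\<integral>\<^sup>+ l. ennreal (2 ^ l) * sqn SM (%x. u l x $ i) \<partial>ct) <= (\<integral>\<^sup>+ l. ennreal area * (ennreal (2 ^ l) * Nj m (W l i)) \<partial>ct)"
  proof (intro nn_integral_mono)
   fix l
   have "ennreal (2 ^ l) * sqn SM (%x. u l x $ i) <= ennreal (2 ^ l) * (ennreal area * Nj m (W l i))"
    by (intro mult_left_mono rep_sqn[OF b r]) simp
   then show "ennreal (2 ^ l) * sqn SM (%x. u l x $ i) <= ennreal area * (ennreal (2 ^ l) * Nj m (W l i))" by (simp only: mult.left_commute)
  qed
  also have "... = ennreal area * (\<integral>\<^sup>+ l. ennreal (2 ^ l) * Nj m (W l i) \<partial>ct)" by (rule nn_integral_cmult) simp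
  also have "... < \<infinity>" using fW[of i] by (simp add: ennreal_mult_less_top)
  finally show ?thesis .
 qed
 have SM_sf: "sigma_finite_measure SM" by (rule sigma_finite_restrict[OF S_v_borel])
 define F where "F i x = (\<integral>\<^sup>+ l. ennreal (norm (u l x $ i)) \<partial>ct)" for i x
 have Fm: "F i \<in> borel_measurable SM" for i unfolding F_def by (intro meas_count measurable_compose[OF measurable_compose[OF um borel_measurable_norm] measurable_ennreal])
 have Ff: "(\<integral>\<^sup>+ x. F i x \<partial>SM) < \<infinity>" for i unfolding F_def by (rule abs_series_finite[OF SM_fin um fS])
 have "AE x in SM. F i x < \<infinity>" for i using nn_integral_PInf_AE[OF Fm] Ff[of i] by (auto simp: less_top[symmetric] elim!: eventually_mono)
 then have "AE x in SM. \<forall>i. F i x < \<infinity>" by (simp add: AE_all_countable)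
 then show "AE x in SM. \<forall>i. integrable ct (%l. u l x $ i)"
  by eventually_elim (auto simp: F_def integrable_iff_bounded)
 show bs: "basic (ser u)"
 proof (rule basicI)
  show "quasiperiodic D (ser u)" using basicD(3,4)[OF b] by (simp add: quasiperiodic_def ser_def vec_eq_iff)
  show "(%x. indicator (slab D) x *\<^sub>R (ser u x $ i)) \<in> borel_measurable lborel" for i
   using meas_count_integral[of "%l x. indicator (slab D) x *\<^sub>R (u l x $ i)", OF basicD(1)[OF b]] by (simp add: ser_def)
  show "sqn SM (%x. ser u x $ i) < \<infinity>" for i
   using sqn_series(2)[OF SM_sf, of "%l x. u l x $ i"] um fS[of i] by (auto simp: ser_def ennreal_mult_less_top intro: order.strict_trans1)
 qed
 show rs: "rep m (ser u) (%i j k z. LINT l|ct. W l i j k z)"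
 proof (rule repI[OF bs])
  fix i
  show "jet m (%j k z. LINT l|ct. W l i j k z)" by (rule jet_series[OF W(1) fW])
  show "Nj m (%j k z. LINT l|ct. W l i j k z) < \<infinity>"
   by (rule order.strict_trans1[OF Nj_series[OF W(1)]]) (use fW[of i] in \<open>simp add: ennreal_mult_less_top\<close>)
  fix k
  have "AE z in HM. \<forall>l. W l i 0 k z = fc (slice (%x. u l x $ i) z) k"
   unfolding AE_all_countable
  proof
   fix l show "AE z in HM. W l i 0 k z = fc (slice (%x. u l x $ i) z) k"
    using rep_fc[OF b r, of l] by eventually_elim blast
  qed
  moreover have "AE z in HM. \<forall>l. L2 GM (slice (%x. u l x $ i) z)"
   unfolding AE_all_countable using L2_slices[OF basic_L2[OF b]] by blast
  ultimately show "AE z in HM. (LINT l|ct. W l i 0 k z) = fc (slice (%x. ser u x $ i) z) k"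
   using slice_nn_AE[OF Fm Ff, of i]
  proof eventually_elim
   case (elim z)
   have "(LINT l|ct. W l i 0 k z) = (LINT l|ct. (LINT p|GM. cnj (ex k p) * slice (%x. u l x $ i) z p) / of_real area)"
    using elim(1) by (simp add: fc_def)
   also have "... = (LINT l|ct. (LINT p|GM. cnj (ex k p) * slice (%x. u l x $ i) z p)) / of_real area" by simp
   also have "(LINT l|ct. (LINT p|GM. cnj (ex k p) * slice (%x. u l x $ i) z p)) = (LINT p|GM. LINT l|ct. cnj (ex k p) * slice (%x. u l x $ i) z p)"
   proof (rule count_Fubini[symmetric])
    show "sigma_finite_measure GM" by (rule sigma_finite_restrict) simp
    show "(%p. cnj (ex k p) * slice (%x. u l x $ i) z p) \<in> borel_measurable GM" for l
     using elim(2) by (intro L2_meas L2_bounded_mult(1)[where B = 1]) (auto intro: L2_cnj L2_ex)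
    show "(\<integral>\<^sup>+ p. \<integral>\<^sup>+ l. ennreal (norm (cnj (ex k p) * slice (%x. u l x $ i) z p)) \<partial>ct \<partial>GM) < \<infinity>"
     using elim(3) by (simp add: norm_mult F_def slice_def)
   qed
   also have "... = (LINT p|GM. cnj (ex k p) * slice (%x. ser u x $ i) z p)" by (simp add: slice_def ser_def)
   finally show ?case by (simp add: fc_def)
  qed
 qed
 have "Hnorm_sq D m (ser u) <= (\<Sum>i\<in>UNIV. 2 * (\<integral>\<^sup>+ l. ennreal (2 ^ l) * Nj m (W l i) \<partial>ct))"
  unfolding Hnorm_sq_rep[OF bs rs] by (intro sum_mono Nj_series W)
 also have "... = 2 * (\<integral>\<^sup>+ l. ennreal (2 ^ l) * Hnorm_sq D m (u l) \<partial>ct)"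
  unfolding Hnorm_sq_rep[OF b r] sum_distrib_left by (subst nn_integral_sum) (auto simp: sum_distrib_left)
 finally show "Hnorm_sq D m (ser u) <= 2 * (\<integral>\<^sup>+ l. ennreal (2 ^ l) * Hnorm_sq D m (u l) \<partial>ct)" .
qed

text \<open>The decay \<open>(1 / 4) ^ l\<close> beats the weight \<open>2 ^ l\<close>. The
  remainder after \<open>n\<close> terms is the series of the shifted sequence, to which the same
  bound applies.\<close>

lemma series_limit:
 assumes u: "!!l. u l \<in> Hspace D m" and K: "K >= 0" "!!l. Hnorm_sq D m (u l) <= ennreal (K * (1 / 4) ^ l)"
 shows "ser u \<in> Hspace D m" "(%n. Hnorm D m (%x. ser u x - (\<Sum>l<n. u l x))) \<longlonglongrightarrow> 0"
proof -
 note b = Hspace_basic[OF u] and r = Hspace_rep[OF u]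
 have tail: "(\<integral>\<^sup>+ l. ennreal (2 ^ l) * Hnorm_sq D m (u (l + n)) \<partial>ct) <= ennreal (2 * K * (1 / 4) ^ n)" for n
 proof -
  have "(\<integral>\<^sup>+ l. ennreal (2 ^ l) * Hnorm_sq D m (u (l + n)) \<partial>ct) <= (\<integral>\<^sup>+ l. ennreal (K * (1 / 4) ^ n) * ennreal ((1 / 2) ^ l) \<partial>ct)"
  proof (intro nn_integral_mono)
   fix l
   have "ennreal (2 ^ l) * Hnorm_sq D m (u (l + n)) <= ennreal (2 ^ l) * ennreal (K * (1 / 4) ^ (l + n))"
    by (intro mult_left_mono K) simp
   also have "... = ennreal (K * (1 / 4) ^ n) * ennreal ((1 / 2) ^ l)"
   proof -
    have "(2 :: real) ^ l * (1 / 4) ^ l = (1 / 2) ^ l" by (simp add: power_mult_distrib[symmetric])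
    then have "2 ^ l * (K * (1 / 4) ^ (l + n)) = K * (1 / 4) ^ n * (1 / 2) ^ l" by (simp add: power_add)
    then show ?thesis using K(1) by (simp add: ennreal_mult[symmetric])
   qed
   finally show "ennreal (2 ^ l) * Hnorm_sq D m (u (l + n)) <= ennreal (K * (1 / 4) ^ n) * ennreal ((1 / 2) ^ l)" .
  qed
  also have "... = ennreal (K * (1 / 4) ^ n) * 2" by (subst nn_integral_cmult) (auto simp: geometric_nn)
  also have "... = ennreal (K * (1 / 4) ^ n * 2)" using K(1) by (subst ennreal_mult) auto
  also have "K * (1 / 4) ^ n * 2 = 2 * K * (1 / 4) ^ n" by simp
  finally show ?thesis .
 qed
 have fin: "(\<integral>\<^sup>+ l. ennreal (2 ^ l) * Hnorm_sq D m (u (l + n)) \<partial>ct) < \<infinity>" for n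
  using tail[of n] by (rule order.strict_trans1) simp
 note S = ser_rep[of "%l. u (l + n)" for n, OF b r fin]
 note S0 = S[of 0, simplified]
 show "ser u \<in> Hspace D m" by (rule rep_Hspace[OF S0(1,2)])
 have bn: "basic (%x. ser u x - (\<Sum>l<n. u l x))" for n
 proof (induction n)
  case (Suc n)
  then show ?case using basic_diff[OF Suc b[of n]] by (simp add: algebra_simps)
 qed (simp add: S0(1))
 \<comment> \<open>The identity is obtained where the series converges absolutely, that is almost
   everywhere; \<open>rep_cong_AE\<close> then carries the jets over.\<close>
 have en: "AE x in SM. ser (%l. u (l + n)) x = ser u x - (\<Sum>l<n. u l x)" for n
  using S0(4)
 proof eventually_elim
  case (elim x)
  have "(LINT l|ct. u (l + n) x $ i) = (LINT l|ct. u l x $ i) - (\<Sum>l<n. u l x $ i)" for i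
  proof -
   have i: "integrable ct (%l. u l x $ i)" using elim by blast
   then have s: "summable (%l. norm (u l x $ i))" by (simp add: integrable_count_space_nat_iff)
   then have i': "integrable ct (%l. u (l + n) x $ i)" unfolding integrable_count_space_nat_iff by (rule summable_ignore_initial_segment)
   show ?thesis unfolding integral_count_space_nat[OF i] integral_count_space_nat[OF i']
    using suminf_split_initial_segment[OF summable_norm_cancel[OF s], of n] by simp
  qed
  then show ?case by (simp add: ser_def vec_eq_iff)
 qed
 have bound: "Hnorm D m (%x. ser u x - (\<Sum>l<n. u l x)) <= sqrt (4 * K) * (1 / 2) ^ n" for n
 proof -
  note rn = rep_cong_AE[OF S(1) bn en S(2), of n]
  have "Hnorm_sq D m (%x. ser u x - (\<Sum>l<n. u l x)) = Hnorm_sq D m (ser (%l. u (l + n)))"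
   unfolding Hnorm_sq_rep[OF bn rn] Hnorm_sq_rep[OF S(1,2)] ..
  also have "... <= 2 * ennreal (2 * K * (1 / 4) ^ n)" by (rule order_trans[OF S(3)]) (intro mult_left_mono tail; simp)
  also have "... = ennreal (2 * (2 * K * (1 / 4) ^ n))" using K(1) by (subst ennreal_mult) auto
  also have "2 * (2 * K * (1 / 4) ^ n) = 4 * K * (1 / 4) ^ n" by simp
  finally have "enn2real (Hnorm_sq D m (%x. ser u x - (\<Sum>l<n. u l x))) <= 4 * K * (1 / 4) ^ n"
   using K(1) by (intro enn2real_leI) auto
  then have "Hnorm D m (%x. ser u x - (\<Sum>l<n. u l x)) <= sqrt (4 * K * (1 / 4) ^ n)" unfolding Hnorm_def by (rule real_sqrt_le_mono)
  also have "... = sqrt (4 * K) * sqrt (1 / 4) ^ n" by (simp only: real_sqrt_mult real_sqrt_power)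
  also have "sqrt (1 / 4) = (1 / 2 :: real)" by (simp add: real_sqrt_divide)
  finally show ?thesis .
 qed
 have nonneg: "Hnorm D m v >= 0" for v by (simp add: Hnorm_def)
 show "(%n. Hnorm D m (%x. ser u x - (\<Sum>l<n. u l x))) \<longlonglongrightarrow> 0"
 proof (rule Lim_null_comparison)
  show "\<forall>\<^sub>F n in sequentially. norm (Hnorm D m (%x. ser u x - (\<Sum>l<n. u l x))) <= sqrt (4 * K) * (1 / 2) ^ n"
   unfolding real_norm_def abs_of_nonneg[OF nonneg] using bound by (intro always_eventually allI)
  show "(%n. sqrt (4 * K) * (1 / 2) ^ n) \<longlonglongrightarrow> 0" by (intro tendsto_mult_right_zero LIMSEQ_realpow_zero) auto
 qed
qed

end

theorem theorem6p2:
  fixes D :: grating and A :: "complex^3" and s :: nat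
    and \<E> :: "real \<times> real \<times> real \<Rightarrow> complex"
    and E :: "nat \<Rightarrow> real \<times> real \<times> real \<Rightarrow> complex^3"
  assumes "per_x D > 0" and "per_y D > 0" and "hgt D > 0"
    and "freq D > 0" and "eps0 D > 0" and "mu0 D > 0"
    and "eps_u D > 0" and "eps_w D > 0" and "eps_bar D > 0"
    and "cdot A (kappa D) = 0" and "norm A = 1" and "norm (B0 D A) = 1"
    and "(freq D, eps_bar D) \<in> P_set D"
    and "biperiodic D \<E>" and "C_k_bounded (slab D) (s + 2) \<E>"
    and "\<And>l. solves D
           (\<lambda>x. if l = 0 then 0
                else (of_real (eps_bar D * (k0 D)\<^sup>2) * \<E> x) *s E (l - 1) x)
           (\<lambda>x. if l = 0 then phi_inc D A x else 0)
           (E l)"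
  shows "(\<exists>\<delta>0>0. \<forall>\<delta>::complex. norm \<delta> < \<delta>0 \<longrightarrow>
            (\<exists>Esum \<in> Hspace D (s + 2).
               (\<lambda>n. Hnorm D (s + 2) (\<lambda>x. Esum x - (\<Sum>l<n. \<delta> ^ l *s E l x))) \<longlonglongrightarrow> 0))
       \<and> (\<exists>K>0. \<exists>B>0. \<forall>l. E l \<in> Hspace D (s + 2) \<and> Hnorm D (s + 2) (E l) \<le> K * B ^ l)"
proof -
 interpret grid D by unfold_locales (fact assms)+
 have kk: "(k0 D)\<^sup>2 * eps_bar D > 0" using assms(4,5,6,9) by (simp add: k0_def)
 have u: unique_modes by (rule unique_modes_P) fact
 have g: "good (s + 2) \<E>" using assms(14,15) by (simp add: good_def)
 obtain C where C: "C >= 0" "!!V V'. V \<in> Hspace D (s + 2) ==> solves D (%x. (of_real (eps_bar D * (k0 D)\<^sup>2) * \<E> x) *s V x) (%_. 0) V' ==>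
   V' \<in> Hspace D (s + 2) \<and> Hnorm_sq D (s + 2) V' <= ennreal C * Hnorm_sq D (s + 2) V"
  using iterate_bound[OF kk u g] by blast
 have base: "E 0 \<in> Hspace D (s + 2)" using regular_base[OF kk u, of A "E 0" s] assms(16)[of 0] by simp
 have step: "E (Suc l) \<in> Hspace D (s + 2) \<and> Hnorm_sq D (s + 2) (E (Suc l)) <= ennreal C * Hnorm_sq D (s + 2) (E l)"
  if "E l \<in> Hspace D (s + 2)" for l
  by (rule C(2)[OF that]) (use assms(16)[of "Suc l"] in simp)
 have El: "E l \<in> Hspace D (s + 2)" for l by (induction l) (use base step in auto)
 \<comment> \<open>Membership of \<open>E 0\<close> in \<open>Hspace\<close> makes this norm finite,
   so \<open>enn2real\<close> loses nothing.\<close>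
 define K0 where "K0 = enn2real (Hnorm_sq D (s + 2) (E 0))"
 \<comment> \<open>\<open>C\<close> bounds the growth of squared norms, hence the root; adding 1
   keeps \<open>B\<close> positive.\<close>
 define B where "B = sqrt (C + 1)"
 have K0: "K0 >= 0" by (simp add: K0_def)
 have B: "B > 0" "B\<^sup>2 = C + 1" using C(1) by (simp_all add: B_def)
 have Hl: "Hnorm_sq D (s + 2) (E l) <= ennreal (K0 * (C + 1) ^ l)" for l
 proof (induction l)
  case 0
  have "Hnorm_sq D (s + 2) (E 0) < top" using base by (simp add: Hspace_def)
  then show ?case by (simp add: K0_def)
 next
  case (Suc l)
  have "Hnorm_sq D (s + 2) (E (Suc l)) <= ennreal C * Hnorm_sq D (s + 2) (E l)" using step[OF El] by blast
  also have "... <= ennreal (C + 1) * ennreal (K0 * (C + 1) ^ l)" using C(1) Suc by (intro mult_mono ennreal_leI) auto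
  also have "... = ennreal (K0 * (C + 1) ^ Suc l)" using C(1) K0 by (subst ennreal_mult[symmetric]) (auto simp: mult.left_commute)
  finally show ?case .
 qed
 have "Hnorm D (s + 2) (E l) <= (sqrt K0 + 1) * B ^ l" for l
 proof -
  have "enn2real (Hnorm_sq D (s + 2) (E l)) <= K0 * (C + 1) ^ l" using Hl K0 C(1) by (intro enn2real_leI) auto
  then have "Hnorm D (s + 2) (E l) <= sqrt (K0 * (C + 1) ^ l)" unfolding Hnorm_def by (rule real_sqrt_le_mono)
  also have "... = sqrt K0 * B ^ l" by (simp add: real_sqrt_mult real_sqrt_power B_def)
  \<comment> \<open>The 1 makes the constant positive even if \<open>E 0\<close> has norm 0.\<close>
  also have "... <= (sqrt K0 + 1) * B ^ l" using B(1) by (intro mult_right_mono) auto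
  finally show ?thesis .
 qed
 then have second: "\<exists>K>0. \<exists>B>0. \<forall>l. E l \<in> Hspace D (s + 2) \<and> Hnorm D (s + 2) (E l) <= K * B ^ l"
  using El B(1) K0 by (intro exI[of _ "sqrt K0 + 1"] conjI exI[of _ B]) (auto intro: add_nonneg_pos)
 have "\<exists>\<delta>0>0. \<forall>\<delta>::complex. norm \<delta> < \<delta>0 -->
      (\<exists>Esum \<in> Hspace D (s + 2).
        (%n. Hnorm D (s + 2) (%x. Esum x - (\<Sum>l<n. \<delta> ^ l *s E l x))) \<longlonglongrightarrow> 0)"
 \<comment> \<open>This radius gives \<open>(norm \<delta>)\<^sup>2 * (C + 1) <= 1 / 4\<close>, the
   decay rate that \<open>series_limit\<close> expects.\<close>
 proof (intro exI[of _ "1 / (2 * B)"] conjI allI impI)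
  show "1 / (2 * B) > 0" using B(1) by simp
  fix \<delta> :: complex assume d: "norm \<delta> < 1 / (2 * B)"
  have "(norm \<delta> * B)\<^sup>2 <= (1 / 2)\<^sup>2" using d B(1) by (intro power_mono) (auto simp: field_simps)
  then have r: "(norm \<delta>)\<^sup>2 * (C + 1) <= 1 / 4" by (simp add: power_mult_distrib B(2) power_divide)
  define U where "U l x = \<delta> ^ l *s E l x" for l x
  have UH: "U l \<in> Hspace D (s + 2)" for l unfolding U_def[abs_def] by (rule Hspace_cmult(1)[OF El])
  have UN: "Hnorm_sq D (s + 2) (U l) <= ennreal (K0 * (1 / 4) ^ l)" for l
  proof -
   have "Hnorm_sq D (s + 2) (U l) <= ennreal ((norm (\<delta> ^ l))\<^sup>2) * ennreal (K0 * (C + 1) ^ l)"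
    unfolding U_def[abs_def] by (rule order_trans[OF Hspace_cmult(2)[OF El]]) (intro mult_left_mono Hl; simp)
   also have "... = ennreal (K0 * ((norm \<delta>)\<^sup>2 * (C + 1)) ^ l)"
    using K0 C(1) by (simp add: ennreal_mult[symmetric] norm_power power_mult_distrib power_mult[symmetric] mult.commute mult.left_commute)
   also have "... <= ennreal (K0 * (1 / 4) ^ l)" using r K0 C(1) by (intro ennreal_leI mult_left_mono power_mono) auto
   finally show ?thesis .
  qed
  show "\<exists>Esum \<in> Hspace D (s + 2). (%n. Hnorm D (s + 2) (%x. Esum x - (\<Sum>l<n. \<delta> ^ l *s E l x))) \<longlonglongrightarrow> 0"
   using series_limit[OF UH K0 UN] unfolding U_def by blast
 qed
 with second show ?thesis by blast
qed

end
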